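(* Let $\mathcal P_1=\{3,3,3\}$, $\mathcal P_2=\{3,3,4\}$, $\mathcal P_3=\{3,3,5\}$, $\mathcal P_4=\{3,4,3\}$, $\mathcal P_5=\{4,3,3\}$, $\mathcal P_6=\{5,3,3\}$ be the regular convex $4$-polytopes, and for $I=\{i_1,\dots,i_k\}\subseteq\{1,\dots,6\}$ let $\mathcal P_I=\mathcal P_{i_1}\diamond\cdots\diamond\mathcal P_{i_k}$. Let $f_j$ be the number of $j$-faces and $g$ the number of flags of $\mathcal P_I$. For $|I|\ge 4$ the values $(f_0,f_1,f_2,f_3,g)$, and whether $\mathcal P_I$ is polytopal (Y) or not (N), are as follows. $\{1,2,3,4\}$: $(115200,398131200,7962624000,165888000,95551488000)$, Y; $\{1,2,3,5\}$: $(921600,132710400,663552000,55296000,31850496000)$, Y; $\{1,2,3,6\}$: $(34560000,4976640000,19906560000,829440000,1194393600000)$, Y; $\{1,2,4,5\}$: $(184320,53084160,53084160,184320,2548039680)$, Y; $\{1,2,4,6\}$: $(6912000,1990656000,1592524800,2764800,95551488000)$, Y; $\{1,2,5,6\}$: $(55296000,663552000,132710400,921600,31850496000)$, Y; $\{1,3,4,5\}$: $(2764800,1592524800,1990656000,6912000,95551488000)$, Y; $\{1,3,4,6\}$: $(103680000,59719680000,59719680000,103680000,3583180800000)$, Y; $\{1,3,5,6\}$: $(829440000,19906560000,4976640000,34560000,1194393600000)$, Y; $\{1,4,5,6\}$: $(165888000,7962624000,398131200,115200,95551488000)$, Y; $\{2,3,4,5\}$: $(368640,1274019840,6370099200,22118400,305764761600)$,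 N; $\{2,3,4,6\}$: $(13824000,47775744000,191102976000,331776000,11466178560000)$, N; $\{2,3,5,6\}$: $(110592000,15925248000,15925248000,110592000,3822059520000)$, N; $\{2,4,5,6\}$: $(22118400,6370099200,1274019840,368640,305764761600)$, N; $\{3,4,5,6\}$: $(331776000,191102976000,47775744000,13824000,11466178560000)$, N; $\{1,2,3,4,5\}$: $(22118400,76441190400,382205952000,1327104000,18345885696000)$, Y; $\{1,2,3,4,6\}$: $(829440000,2866544640000,11466178560000,19906560000,687970713600000)$, Y; $\{1,2,3,5,6\}$: $(6635520000,955514880000,955514880000,6635520000,229323571200000)$, Y; $\{1,2,4,5,6\}$: $(1327104000,382205952000,76441190400,22118400,18345885696000)$, Y; $\{1,3,4,5,6\}$: $(19906560000,11466178560000,2866544640000,829440000,687970713600000)$, Y; $\{2,3,4,5,6\}$: $(2654208000,9172942848000,9172942848000,2654208000,2201506283520000)$, N; $\{1,2,3,4,5,6\}$: $(159252480000,550376570880000,550376570880000,159252480000,132090377011200000)$, Y.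
   Context: Polytopes. An (abstract) $n$-polytope is a ranked poset with ranks $-1,\dots,n$ such that: there are a unique least face (rank $-1$) and a unique greatest face (rank $n$); every flag (maximal chain) has $n+2$ faces; it is strongly flag-connected (any two flags $\Phi,\Psi$ are joined by a sequence of flags, consecutive ones differing in exactly one face, all containing $\Phi\cap\Psi$); and whenever $F<G$ have ranks $j-1$ and $j+1$ there are exactly two $j$-faces strictly between them. The Schläfli symbols denote the face lattices of the corresponding regular convex polytopes, here of rank $n=4$. For such a polytope $\mathcal P$ with a fixed base flag $\Phi$, its automorphism group is $\langle\rho_0,\dots,\rho_{n-1}\rangle$, where $\rho_i$ maps $\Phi$ to the unique flag differing from $\Phi$ exactly in its $i$-face; the $i$-th entry of the symbol is the order of $\sigma_i=\rho_{i-1}\rho_i$ ($1\le i\le n-1$). The rotation group is $\Gamma^+(\mathcal P)=\langle\sigma_1,\dots,\sigma_{n-1}\rangle$. Mix. For such polytopes $\mathcal Q_1,\dots,\mathcal Q_m$ of rank $n$ with rotation-group generators $\sigma_i^{(r)}$, let $\beta_i=(\sigma_i^{(1)},\dots,\sigma_i^{(m)})$ for $1\le i\le n-1$ and let $\Gamma^+=\langle\beta_1,\dots,\beta_{n-1}\rangle\le\Gamma^+(\mathcal Q_1)\times\cdots\times\Gamma^+(\mathcal Q_m)$. For $J\subseteq\{0,\dots,n-1\}$ put $\Gamma^+_J=\langle\beta_i\beta_{i+1}\cdots\beta_j\mid 1\le i\le j\le n-1,\ i-1\in J,\ j\in J\rangle$. The mix $\mathcal Q_1\diamond\cdots\diamond\mathcal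 Q_m$ is the poset whose $j$-faces ($0\le j\le n-1$) are the right cosets of $\Gamma^+_{\{0,\dots,n-1\}\setminus\{j\}}$ in $\Gamma^+$, together with a least face of rank $-1$ and a greatest face of rank $n$, where a $j$-face is below a $k$-face ($j<k$) if and only if the two cosets intersect. The mix is called polytopal if it is a polytope; equivalently, $\Gamma^+$ satisfies the intersection property $\Gamma^+_J\cap\Gamma^+_K=\Gamma^+_{J\cap K}$ for all $J,K\subseteq\{0,\dots,n-1\}$. *)

theory Defs
  imports
    "HOL-Analysis.Analysis"
    "HOL-Algebra.Bij"
    "HOL-Algebra.Generated_Groups"
    "HOL-Algebra.Product_Groups"
    "HOL-Algebra.Multiplicative_Group"
begin

section \<open>Abstract polytopes\<close>

text \<open>\<open>below\<close> is the non-strict order, as a set of pairs.\<close>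

record 'a ranked_poset =
  faces :: "'a set"
  below :: "'a rel"
  rk :: "'a \<Rightarrow> int"

definition flags :: "'a ranked_poset \<Rightarrow> 'a set set" where
  "flags P = {C \<in> Chains (below P). \<forall>D \<in> Chains (below P). C \<subseteq> D \<longrightarrow> D = C}"

definition adjacent_flags :: "'a set \<Rightarrow> 'a set \<Rightarrow> bool" where
  "adjacent_flags A B \<longleftrightarrow> card (A - B) = 1 \<and> card (B - A) = 1"

definition strongly_flag_connected :: "'a ranked_poset \<Rightarrow> bool" where
  "strongly_flag_connected P \<longleftrightarrow>
     (\<forall>\<Phi> \<in> flags P. \<forall>\<Psi> \<in> flags P.
        (\<lambda>A B. A \<in> flags P \<and> B \<in> flags P \<and> adjacent_flags A B \<and>
               \<Phi> \<inter> \<Psi> \<subseteq> A \<and> \<Phi> \<inter> \<Psi> \<subseteq> B)\<^sup>*\<^sup>* \<Phi> \<Psi>)"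

definition abstract_polytope :: "nat \<Rightarrow> 'a ranked_poset \<Rightarrow> bool" where
  "abstract_polytope n P \<longleftrightarrow>
     partial_order_on (faces P) (below P) \<and>
     (\<forall>F \<in> faces P. -1 \<le> rk P F \<and> rk P F \<le> int n) \<and>
     (\<forall>(F, G) \<in> below P. F \<noteq> G \<longrightarrow> rk P F < rk P G) \<and>
     (\<exists>!F. F \<in> faces P \<and> (\<forall>G \<in> faces P. (F, G) \<in> below P)) \<and>
     (\<exists>!F. F \<in> faces P \<and> rk P F = -1) \<and>
     (\<exists>!F. F \<in> faces P \<and> (\<forall>G \<in> faces P. (G, F) \<in> below P)) \<and>
     (\<exists>!F. F \<in> faces P \<and> rk P F = int n) \<and>
     (\<forall>\<Phi> \<in> flags P. card \<Phi> = n + 2) \<and>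
     strongly_flag_connected P \<and>
     (\<forall>j F G. (F, G) \<in> below P \<and> rk P F = j - 1 \<and> rk P G = j + 1 \<longrightarrow>
        card {H \<in> faces P. rk P H = j \<and> (F, H) \<in> below P \<and> (H, G) \<in> below P} = 2)"

definition face_count :: "'a ranked_poset \<Rightarrow> nat \<Rightarrow> nat" where
  "face_count P j = card {F \<in> faces P. rk P F = int j}"

section \<open>Automorphisms and rotations\<close>

definition aut_group :: "'a ranked_poset \<Rightarrow> ('a \<Rightarrow> 'a) monoid" where
  "aut_group P = (BijGroup (faces P))
     \<lparr>carrier := {f \<in> Bij (faces P). \<forall>x \<in> faces P. \<forall>y \<in> faces P.
                    (x, y) \<in> below P \<longleftrightarrow> (f x, f y) \<in> below P}\<rparr>"

definition adjacent_flag :: "'a ranked_poset \<Rightarrow> nat \<Rightarrow> 'a set \<Rightarrow> 'a set" where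
  "adjacent_flag P i \<Phi> = (THE \<Psi>. \<Psi> \<in> flags P \<and> \<Psi> \<noteq> \<Phi> \<and>
     {F \<in> \<Psi>. rk P F \<noteq> int i} = {F \<in> \<Phi>. rk P F \<noteq> int i})"

definition rho :: "'a ranked_poset \<Rightarrow> 'a set \<Rightarrow> nat \<Rightarrow> ('a \<Rightarrow> 'a)" where
  "rho P \<Phi> i = (THE f. f \<in> carrier (aut_group P) \<and> f ` \<Phi> = adjacent_flag P i \<Phi>)"

text \<open>
  Products in \<open>aut_group\<close> are read as composition of functions acting on the left. Letting
  automorphisms act on the right instead replaces every group by its opposite; this turns
  \<open>\<sigma>\<^sub>i\<close> into its inverse, leaves the subgroups \<open>mix_subgroup\<close> below unchanged as sets, and gives
  an isomorphic mix (apply inversion to the cosets).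
\<close>

definition sigma :: "'a ranked_poset \<Rightarrow> 'a set \<Rightarrow> nat \<Rightarrow> ('a \<Rightarrow> 'a)" where
  "sigma P \<Phi> i = rho P \<Phi> (i - 1) \<otimes>\<^bsub>aut_group P\<^esub> rho P \<Phi> i"

definition rotation_group :: "nat \<Rightarrow> 'a ranked_poset \<Rightarrow> 'a set \<Rightarrow> ('a \<Rightarrow> 'a) monoid" where
  "rotation_group n P \<Phi> =
     (aut_group P)\<lparr>carrier := generate (aut_group P) (sigma P \<Phi> ` {1..n - 1})\<rparr>"

definition schlafli_symbol :: "nat \<Rightarrow> 'a ranked_poset \<Rightarrow> 'a set \<Rightarrow> nat list" where
  "schlafli_symbol n P \<Phi> = map (\<lambda>i. group.ord (aut_group P) (sigma P \<Phi> i)) [1..<n]"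

section \<open>Regular convex polytopes\<close>

text \<open>Both the empty face (of affine dimension \<open>-1\<close>) and \<open>S\<close> itself are faces.\<close>

definition face_lattice :: "'a::euclidean_space set \<Rightarrow> 'a set ranked_poset" where
  "face_lattice S =
     \<lparr>faces = {F. F face_of S},
      below = {(F, G). F face_of S \<and> G face_of S \<and> F \<subseteq> G},
      rk = aff_dim\<rparr>"

definition regular_convex_polytope :: "'a::euclidean_space set \<Rightarrow> bool" where
  "regular_convex_polytope S \<longleftrightarrow>
     polytope S \<and> aff_dim S = int DIM('a) \<and>
     (\<forall>\<Phi> \<in> flags (face_lattice S). \<forall>\<Psi> \<in> flags (face_lattice S).
        \<exists>f :: 'a \<Rightarrow> 'a. (\<forall>x y. dist (f x) (f y) = dist x y) \<and> f ` S = S \<and> (`) f ` \<Phi> = \<Psi>)"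

section \<open>The mix\<close>

text \<open>
  The polytopes \<open>Q r\<close> with base flags \<open>\<Phi> r\<close> are indexed by a set \<open>I\<close>; the elements of the direct
  product are functions on \<open>I\<close>.
\<close>

definition rotation_product ::
    "nat \<Rightarrow> 'i set \<Rightarrow> ('i \<Rightarrow> 'a ranked_poset) \<Rightarrow> ('i \<Rightarrow> 'a set) \<Rightarrow> ('i \<Rightarrow> 'a \<Rightarrow> 'a) monoid" where
  "rotation_product n I Q \<Phi> = product_group I (\<lambda>r. rotation_group n (Q r) (\<Phi> r))"

definition beta ::
    "'i set \<Rightarrow> ('i \<Rightarrow> 'a ranked_poset) \<Rightarrow> ('i \<Rightarrow> 'a set) \<Rightarrow> nat \<Rightarrow> ('i \<Rightarrow> 'a \<Rightarrow> 'a)" where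
  "beta I Q \<Phi> i = (\<lambda>r\<in>I. sigma (Q r) (\<Phi> r) i)"

definition beta_prod ::
    "nat \<Rightarrow> 'i set \<Rightarrow> ('i \<Rightarrow> 'a ranked_poset) \<Rightarrow> ('i \<Rightarrow> 'a set) \<Rightarrow> nat \<Rightarrow> nat \<Rightarrow> ('i \<Rightarrow> 'a \<Rightarrow> 'a)" where
  "beta_prod n I Q \<Phi> i j =
     foldr (\<lambda>k x. beta I Q \<Phi> k \<otimes>\<^bsub>rotation_product n I Q \<Phi>\<^esub> x) [i..<Suc j]
       \<one>\<^bsub>rotation_product n I Q \<Phi>\<^esub>"

definition mix_group ::
    "nat \<Rightarrow> 'i set \<Rightarrow> ('i \<Rightarrow> 'a ranked_poset) \<Rightarrow> ('i \<Rightarrow> 'a set) \<Rightarrow> ('i \<Rightarrow> 'a \<Rightarrow> 'a) monoid" where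
  "mix_group n I Q \<Phi> =
     (rotation_product n I Q \<Phi>)
       \<lparr>carrier := generate (rotation_product n I Q \<Phi>) (beta I Q \<Phi> ` {1..n - 1})\<rparr>"

definition mix_subgroup ::
    "nat \<Rightarrow> 'i set \<Rightarrow> ('i \<Rightarrow> 'a ranked_poset) \<Rightarrow> ('i \<Rightarrow> 'a set) \<Rightarrow> nat set \<Rightarrow> ('i \<Rightarrow> 'a \<Rightarrow> 'a) set" where
  "mix_subgroup n I Q \<Phi> J =
     generate (mix_group n I Q \<Phi>)
       {beta_prod n I Q \<Phi> i j | i j. 1 \<le> i \<and> i \<le> j \<and> j \<le> n - 1 \<and> i - 1 \<in> J \<and> j \<in> J}"

text \<open>Proper faces carry their rank: cosets of different subgroups might coincide as sets.\<close>

datatype 'g mix_face = Least_Face | Face nat "'g set" | Greatest_Face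

fun mix_face_rank :: "nat \<Rightarrow> 'g mix_face \<Rightarrow> int" where
  "mix_face_rank n Least_Face = -1"
| "mix_face_rank n (Face j C) = int j"
| "mix_face_rank n Greatest_Face = int n"

fun mix_face_le :: "'g mix_face \<Rightarrow> 'g mix_face \<Rightarrow> bool" where
  "mix_face_le Least_Face _ = True"
| "mix_face_le _ Greatest_Face = True"
| "mix_face_le (Face j C) (Face k D) = (j = k \<and> C = D \<or> j < k \<and> C \<inter> D \<noteq> {})"
| "mix_face_le _ _ = False"

definition mix_faces ::
    "nat \<Rightarrow> 'i set \<Rightarrow> ('i \<Rightarrow> 'a ranked_poset) \<Rightarrow> ('i \<Rightarrow> 'a set) \<Rightarrow> ('i \<Rightarrow> 'a \<Rightarrow> 'a) mix_face set" where
  "mix_faces n I Q \<Phi> =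
     {Least_Face, Greatest_Face} \<union>
     {Face j C | j C. j < n \<and>
        C \<in> rcosets\<^bsub>mix_group n I Q \<Phi>\<^esub> (mix_subgroup n I Q \<Phi> ({0..n - 1} - {j}))}"

definition mix ::
    "nat \<Rightarrow> 'i set \<Rightarrow> ('i \<Rightarrow> 'a ranked_poset) \<Rightarrow> ('i \<Rightarrow> 'a set) \<Rightarrow>
     ('i \<Rightarrow> 'a \<Rightarrow> 'a) mix_face ranked_poset" where
  "mix n I Q \<Phi> =
     \<lparr>faces = mix_faces n I Q \<Phi>,
      below = {(F, G). F \<in> mix_faces n I Q \<Phi> \<and> G \<in> mix_faces n I Q \<Phi> \<and> mix_face_le F G},
      rk = mix_face_rank n\<rparr>"

end

theory Submission imports Defs begin

text \<open>
  Faces and flags of the mix are cosets in its rotation group \<open>\<Gamma>\<^sup>+\<close>, so the table lists indices of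
  subgroups of a subdirect product. The computation has three parts.

  \<^emph>\<open>From convex polytopes to reflections.\<close> Any two flags of a convex polytope are joined by a
  sequence of adjacent flags (\<open>flags_connected\<close>), hence an automorphism of the face lattice is
  determined by the image of one flag. By regularity the generators \<open>\<rho>\<^sub>i\<close> are then induced by
  isometries. The linear part of \<open>\<rho>\<^sub>i\<close> fixes the barycentres of all faces of the base flag but the
  \<open>i\<close>-th, so it is the reflection in a hyperplane (\<open>mirror\<close>). The orders of the products
  \<open>\<rho>\<^sub>i\<^sub>-\<^sub>1 \<rho>\<^sub>i\<close> give the angles between the mirrors (\<open>mirror_angle\<close>), up to replacing the golden
  ratio by its conjugate. With suitably oriented unit normals as a basis the group acts by explicit
  matrices over \<open>\<int>[\<tau>]\<close>, where \<open>\<tau>\<^sup>2 = 2\<close> or \<open>\<tau>\<^sup>2 = \<tau> + 1\<close>, and listing cosets of parabolic subgroups by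
  machine (\<open>coset_enumeration\<close>) yields the orders of the group and of its vertex or facet
  stabiliser, and the intersection of these two stabilisers.

  \<^emph>\<open>Orders in the mix.\<close> Each symbol has at most one entry different from 3, and no entry 4 or
  5 occurs twice at the same position. So for every component except \<open>{3,3,3}\<close> some power of some
  \<open>\<beta>\<^sub>i\<close> is \<open>\<sigma>\<^sub>i\<close> in this component and trivial in all others. In the quotient by the normal subgroup
  generated by \<open>\<sigma>\<^sub>i\<close> each neighbour of order 3 dies as well (\<open>isolated_neighbour\<close>), so the component
  splits off as a direct factor (\<open>E_decompose\<close>). For \<open>\<Gamma>\<^sup>+\<close> this leaves only \<open>{3,3,3}\<close>; for the vertex
  and facet stabilisers it leaves the components whose vertex figure or facet is \<open>{3,3}\<close>, which
  together contribute one tetrahedral group of order 12 (\<open>tetrahedral_card\<close>).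

  \<^emph>\<open>Polytopality.\<close> All conditions on a polytope hold automatically except that the stabilisers of a
  vertex and of a facet meet in the group generated by \<open>\<rho>\<^sub>1\<close> and \<open>\<rho>\<^sub>2\<close> (\<open>geometry_polytope_iff\<close>). If
  \<open>{3,3,3}\<close> is a component, it ties together the tetrahedral facets and the tetrahedral vertex
  figures, and the condition is inherited from the components (\<open>stab_Int\<close>). If it is missing, while
  the components include \<open>{3,3,4}\<close> or \<open>{3,3,5}\<close> as well as \<open>{4,3,3}\<close> or \<open>{5,3,3}\<close>, the element
  that is \<open>\<sigma>\<^sub>2\<close> in the first kind of components and trivial elsewhere lies in both stabilisers
  but is not a power of \<open>\<beta>\<^sub>2\<close> (\<open>stab_Int_fails\<close>).
\<close>

section \<open>Groups generated by involutions on a string diagram\<close>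

text \<open>
  Only the relations shared by all rank-4 groups are assumed, so that products of such groups and the
  subgroups generated by tuples of generators are instances again.
\<close>
locale string_group = group G for G (structure) +
  fixes r :: "nat \<Rightarrow> 'a"
  assumes r_closed [simp]: "i \<le> 3 \<Longrightarrow> r i \<in> carrier G"
    and r_sq [simp]: "i \<le> 3 \<Longrightarrow> r i \<otimes> r i = \<one>"
    and r_comm: "\<lbrakk>j \<le> 3; i + 2 \<le> j\<rbrakk> \<Longrightarrow> r i \<otimes> r j = r j \<otimes> r i"
begin

definition W :: "nat set \<Rightarrow> 'a set" where
  "W J = generate G (r ` J)"

text \<open>This is \<open>\<Gamma>\<^sup>+\<^sub>J\<close>: for \<open>i < k\<close> the product \<open>\<sigma>\<^sub>i\<^sub>+\<^sub>1 \<cdots> \<sigma>\<^sub>k\<close> telescopes to \<open>\<rho>\<^sub>i \<rho>\<^sub>k\<close>.\<close>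
definition E :: "nat set \<Rightarrow> 'a set" where
  "E J = generate G {r i \<otimes> r k | i k. i \<in> J \<and> k \<in> J \<and> i < k}"

lemma r_inv [simp]: "i \<le> 3 \<Longrightarrow> inv r i = r i"
  by (metis inv_equality r_closed r_sq)

lemma r_cancel [simp]: "\<lbrakk>i \<le> 3; x \<in> carrier G\<rbrakk> \<Longrightarrow> r i \<otimes> (r i \<otimes> x) = x"
  by (simp flip: m_assoc)

lemma W_subgroup: "J \<subseteq> {0..3} \<Longrightarrow> subgroup (W J) G"
  unfolding W_def by (rule generate_is_subgroup) auto

lemma E_subgroup: "J \<subseteq> {0..3} \<Longrightarrow> subgroup (E J) G"
  unfolding E_def by (rule generate_is_subgroup) (auto simp: subset_iff)

lemma W_closed: "\<lbrakk>x \<in> W J; J \<subseteq> {0..3}\<rbrakk> \<Longrightarrow> x \<in> carrier G"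
  by (rule subgroup.mem_carrier[OF W_subgroup])

lemma E_closed: "\<lbrakk>x \<in> E J; J \<subseteq> {0..3}\<rbrakk> \<Longrightarrow> x \<in> carrier G"
  by (rule subgroup.mem_carrier[OF E_subgroup])

lemma W_mono: "J \<subseteq> K \<Longrightarrow> W J \<subseteq> W K"
  unfolding W_def by (simp add: image_mono mono_generate)

lemma E_mono: "J \<subseteq> K \<Longrightarrow> E J \<subseteq> E K"
  unfolding E_def by (rule mono_generate) auto

lemma W_one [simp]: "\<one> \<in> W J"
  unfolding W_def by (rule generate.one)

lemma W_gen: "i \<in> J \<Longrightarrow> r i \<in> W J"
  unfolding W_def by (rule generate.incl) simp

lemma W_mult: "\<lbrakk>x \<in> W J; y \<in> W J\<rbrakk> \<Longrightarrow> x \<otimes> y \<in> W J"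
  unfolding W_def by (rule generate.eng)

lemma W_inv: "\<lbrakk>x \<in> W J; J \<subseteq> {0..3}\<rbrakk> \<Longrightarrow> inv x \<in> W J"
  by (rule subgroup.m_inv_closed[OF W_subgroup])

lemma E_one [simp]: "\<one> \<in> E J"
  unfolding E_def by (rule generate.one)

lemma E_mult: "\<lbrakk>x \<in> E J; y \<in> E J\<rbrakk> \<Longrightarrow> x \<otimes> y \<in> E J"
  unfolding E_def by (rule generate.eng)

lemma E_inv: "\<lbrakk>x \<in> E J; J \<subseteq> {0..3}\<rbrakk> \<Longrightarrow> inv x \<in> E J"
  by (rule subgroup.m_inv_closed[OF E_subgroup])

lemma E_gen: "\<lbrakk>i \<in> J; k \<in> J; J \<subseteq> {0..3}\<rbrakk> \<Longrightarrow> r i \<otimes> r k \<in> E J"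
proof -
  assume *: "i \<in> J" "k \<in> J" "J \<subseteq> {0..3}"
  then have le: "i \<le> 3" "k \<le> 3" by auto
  have less: "r a \<otimes> r b \<in> E J" if "a \<in> J" "b \<in> J" "a < b" for a b
    unfolding E_def by (rule generate.incl) (use that in auto)
  consider "i < k" | "i = k" | "k < i" by linarith
  then show ?thesis
  proof cases
    case 3
    then have "inv (r k \<otimes> r i) \<in> E J" using less[of k i] * E_inv by blast
    then show ?thesis using le by (simp add: inv_mult_group)
  qed (use * le less in auto)
qed

text \<open>Since the generators are involutions, words in them suffice: no inverses are needed.\<close>
lemma W_induct [consumes 2, case_names one mult]:
  assumes "x \<in> W J" "J \<subseteq> {0..3}" "P \<one>" "\<And>i y. \<lbrakk>i \<in> J; y \<in> W J; P y\<rbrakk> \<Longrightarrow> P (r i \<otimes> y)"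
  shows "P x"
proof -
  have "\<forall>y \<in> W J. P y \<longrightarrow> P (x \<otimes> y)"
    using assms(1) unfolding W_def
  proof induction
    case one
    then show ?case using W_closed[OF _ assms(2)] by (auto simp: W_def)
  next
    case (incl h)
    then show ?case using assms(4) by (auto simp: W_def)
  next
    case (inv h)
    then obtain i where i: "h = r i" "i \<in> J" by auto
    then have "i \<le> 3" using assms(2) by auto
    then show ?case using i assms(4) by (auto simp: W_def)
  next
    case (eng h1 h2)
    show ?case
    proof (intro ballI impI)
      fix y assume y: "y \<in> generate G (r ` J)" "P y"
      have c: "h1 \<in> carrier G" "h2 \<in> carrier G" "y \<in> carrier G"
        using eng y W_closed[OF _ assms(2)] by (auto simp: W_def)
      have "h2 \<otimes> y \<in> generate G (r ` J)" using eng y by (simp add: generate.eng)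
      then show "P (h1 \<otimes> h2 \<otimes> y)" using eng y c by (simp add: m_assoc)
    qed
  qed
  then show ?thesis using assms(1,2,3) W_closed by (metis W_one r_one)
qed

lemma E_subset_W: "J \<subseteq> {0..3} \<Longrightarrow> E J \<subseteq> W J"
  unfolding E_def
  by (rule generate_subgroup_incl[OF _ W_subgroup]) (auto intro: W_mult W_gen)

lemma W_even_odd:
  assumes "a \<in> J" "J \<subseteq> {0..3}" "x \<in> W J"
  shows "x \<in> E J \<or> r a \<otimes> x \<in> E J"
  using assms(3,2)
proof (induction rule: W_induct)
  case (mult i y)
  have le: "a \<le> 3" "i \<le> 3" using assms mult by auto
  have y: "y \<in> carrier G" using W_closed[OF mult(2) assms(2)] .
  from mult(3) show ?case
  proof
    assume "y \<in> E J"
    then have "(r a \<otimes> r i) \<otimes> y \<in> E J" using E_gen[OF assms(1) mult(1) assms(2)] E_mult by blast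
    then show ?thesis using le y by (simp add: m_assoc)
  next
    assume "r a \<otimes> y \<in> E J"
    then have "(r i \<otimes> r a) \<otimes> (r a \<otimes> y) \<in> E J"
      using E_gen[OF mult(1) assms(1,2)] E_mult by blast
    then show ?thesis using le y by (simp add: m_assoc)
  qed
qed auto

lemma W_comm:
  assumes x: "x \<in> W A" and y: "y \<in> W B" and AB: "A \<subseteq> {0..3}" "B \<subseteq> {0..3}"
    and far: "\<And>a b. \<lbrakk>a \<in> A; b \<in> B\<rbrakk> \<Longrightarrow> a + 2 \<le> b"
  shows "x \<otimes> y = y \<otimes> x"
  using x AB(1)
proof (induction rule: W_induct)
  case one
  then show ?case using y AB W_closed by simp
next
  case (mult i z)
  have i: "i \<le> 3" "i \<in> A" using mult AB by auto
  have z: "z \<in> carrier G" using mult W_closed AB by auto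
  have "r i \<otimes> y = y \<otimes> r i" using y AB(2)
  proof (induction rule: W_induct)
    case one
    then show ?case using i by simp
  next
    case (mult j w)
    have j: "j \<le> 3" "w \<in> carrier G" using mult AB W_closed by auto
    have "r i \<otimes> (r j \<otimes> w) = r j \<otimes> (r i \<otimes> w)"
      using i j r_comm[of j i] far[OF i(2) mult(1)] by (simp flip: m_assoc)
    then show ?case using mult i j by (simp add: m_assoc)
  qed
  then show ?case using mult i z y AB W_closed[OF y AB(2)] by (metis m_assoc r_closed)
qed

text \<open>Removing one node disconnects the string, and generators from the two pieces commute.\<close>
lemma W_split:
  assumes j: "j \<le> 3" and x: "x \<in> W ({0..3} - {j})"
  obtains y z where "y \<in> W {0..<j}" "z \<in> W {j<..3}" "x = y \<otimes> z" "x = z \<otimes> y"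
proof -
  have sub: "{0..<j} \<subseteq> {0..3}" "{j<..3} \<subseteq> {0..3}" using j by auto
  have far: "a + 2 \<le> b" if "a \<in> {0..<j}" "b \<in> {j<..3}" for a b using that by auto
  note comm = W_comm[OF _ _ sub far]
  have "\<exists>y \<in> W {0..<j}. \<exists>z \<in> W {j<..3}. x = y \<otimes> z"
    using x Diff_subset
  proof (induction rule: W_induct)
    case one
    show ?case by (intro bexI[of _ "\<one>"]) auto
  next
    case (mult i w)
    then obtain y z where yz: "y \<in> W {0..<j}" "z \<in> W {j<..3}" "w = y \<otimes> z" by auto
    have c: "y \<in> carrier G" "z \<in> carrier G" "i \<le> 3" using yz sub W_closed mult by auto
    show ?case
    proof (cases "i < j")
      case True
      then have 1: "r i \<otimes> y \<in> W {0..<j}" using yz by (intro W_mult W_gen) auto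
      have "r i \<otimes> w = (r i \<otimes> y) \<otimes> z" using yz c by (simp add: m_assoc)
      then show ?thesis using 1 yz(2) by blast
    next
      case False
      then have i: "r i \<in> W {j<..3}" using mult(1) by (intro W_gen) auto
      have "r i \<otimes> (y \<otimes> z) = (r i \<otimes> y) \<otimes> z" using c by (simp add: m_assoc)
      also have "\<dots> = y \<otimes> (r i \<otimes> z)" using comm[OF yz(1) i] c by (metis m_assoc r_closed)
      finally show ?thesis using yz i W_mult by metis
    qed
  qed
  then obtain y z where yz: "y \<in> W {0..<j}" "z \<in> W {j<..3}" "x = y \<otimes> z" by auto
  then have "x = z \<otimes> y" using comm by simp
  then show ?thesis using that yz by simp
qed

abbreviation full :: "'a set" where "full \<equiv> W {0..3}"
abbreviation stab :: "nat \<Rightarrow> 'a set" where "stab j \<equiv> W ({0..3} - {j})"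
abbreviation even_part :: "'a set" where "even_part \<equiv> E {0..3}"

lemma full_closed: "x \<in> full \<Longrightarrow> x \<in> carrier G" by (rule W_closed) auto
lemma stab_full: "x \<in> stab j \<Longrightarrow> x \<in> full" using W_mono[of "{0..3} - {j}"] by auto
lemma stab_closed: "x \<in> stab j \<Longrightarrow> x \<in> carrier G" by (rule W_closed) auto
lemma even_full: "x \<in> even_part \<Longrightarrow> x \<in> full" using E_subset_W[of "{0..3}"] by auto

definition same :: "nat \<Rightarrow> 'a \<Rightarrow> 'a \<Rightarrow> bool" where
  "same j g h \<longleftrightarrow> g \<otimes> inv h \<in> stab j"

lemma sameI: "\<lbrakk>a \<in> stab j; h \<in> carrier G\<rbrakk> \<Longrightarrow> same j (a \<otimes> h) h"
  unfolding same_def using stab_closed by (simp add: m_assoc)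

lemma sameE:
  assumes "same j g h" "g \<in> carrier G" "h \<in> carrier G"
  obtains a where "a \<in> stab j" "g = a \<otimes> h"
  using assms unfolding same_def by (metis inv_solve_right inv_solve_right' m_closed inv_closed)

lemma same_refl: "g \<in> carrier G \<Longrightarrow> same j g g"
  unfolding same_def by simp

lemma same_sym: "\<lbrakk>same j g h; g \<in> carrier G; h \<in> carrier G\<rbrakk> \<Longrightarrow> same j h g"
  unfolding same_def using W_inv[of "g \<otimes> inv h"] by (simp add: inv_mult_group)

lemma same_trans:
  assumes "same j g h" "same j h k" "g \<in> carrier G" "h \<in> carrier G" "k \<in> carrier G"
  shows "same j g k"
proof -
  have "(g \<otimes> inv h) \<otimes> (h \<otimes> inv k) \<in> stab j" using assms unfolding same_def by (intro W_mult[of "g \<otimes> inv h" _ "h \<otimes> inv k"])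
  moreover have "(g \<otimes> inv h) \<otimes> (h \<otimes> inv k) = g \<otimes> inv k"
    using assms by (simp add: m_assoc) (simp flip: m_assoc)
  ultimately show ?thesis unfolding same_def by simp
qed

lemma same_gen: "\<lbrakk>i \<noteq> j; i \<le> 3; g \<in> carrier G\<rbrakk> \<Longrightarrow> same j (r i \<otimes> g) g"
  by (rule sameI) (auto intro: W_gen)

text \<open>The key to the incidence structure: a face of lower rank can be prepended to a chain.\<close>
lemma same_extend:
  assumes ij: "i < j" "j \<le> 3" and c: "x \<in> full" "h \<in> full" "y \<in> full"
    and s: "same i y x" "same j y h"
  obtains g where "g \<in> full" "same i g x" "\<And>k. \<lbrakk>j \<le> k; k \<le> 3\<rbrakk> \<Longrightarrow> same k g h"
proof -
  note cl = full_closed[OF c(1)] full_closed[OF c(2)] full_closed[OF c(3)]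
  obtain a where a: "a \<in> stab j" "y = a \<otimes> h" using sameE[OF s(2)] cl by metis
  obtain b d where bd: "b \<in> W {0..<j}" "d \<in> W {j<..3}" "a = b \<otimes> d" "a = d \<otimes> b"
    using W_split[OF ij(2) a(1)] by metis
  have sub: "{0..<j} \<subseteq> {0..3}" "{j<..3} \<subseteq> {0..3} - {i}" using ij by auto
  have b: "b \<in> full" using bd(1) W_mono[OF sub(1)] by blast
  have d: "d \<in> stab i" using bd(2) W_mono[OF sub(2)] by blast
  have g: "b \<otimes> h \<in> full" using b c W_mult by auto
  have "y = d \<otimes> (b \<otimes> h)"
    using a(2) bd(4) m_assoc[OF stab_closed[OF d] full_closed[OF b] cl(2)] by simp
  then have "same i y (b \<otimes> h)" using sameI[OF d full_closed[OF g]] by simp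
  then have 1: "same i (b \<otimes> h) x"
    using s(1) cl full_closed[OF g] same_trans same_sym by metis
  have 2: "same k (b \<otimes> h) h" if "j \<le> k" "k \<le> 3" for k
  proof (rule sameI[OF _ cl(2)])
    have "W {0..<j} \<subseteq> stab k" using that by (intro W_mono) auto
    then show "b \<in> stab k" using bd(1) by auto
  qed
  show ?thesis using that[OF g 1 2] .
qed

end

text \<open>
  These three conditions are what remains of the intersection property for the geometry to have
  adjacent flags: rotations have index two, and the only nontrivial element fixing all faces of
  the base flag except the \<open>i\<close>-th is \<open>r i\<close>.
\<close>
locale coset_geometry = string_group +
  assumes odd: "r 0 \<notin> even_part"
    and triple: "\<lbrakk>i \<le> 3; \<And>j. \<lbrakk>j \<le> 3; j \<noteq> i\<rbrakk> \<Longrightarrow> x \<in> stab j\<rbrakk> \<Longrightarrow> x = \<one> \<or> x = r i"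
    and notin: "i \<le> 3 \<Longrightarrow> r i \<notin> stab i"
begin

lemma r_not_even: assumes "i \<le> 3" shows "r i \<notin> even_part"
proof
  assume "r i \<in> even_part"
  then have "(r 0 \<otimes> r i) \<otimes> r i \<in> even_part" using E_gen[of 0 "{0..3}" i] E_mult assms by auto
  then show False using odd assms by (simp add: m_assoc)
qed

lemma even_odd: "\<lbrakk>x \<in> full; i \<le> 3\<rbrakk> \<Longrightarrow> r i \<otimes> x \<in> even_part \<longleftrightarrow> x \<notin> even_part"
proof -
  assume *: "x \<in> full" "i \<le> 3"
  have "x \<in> even_part \<or> r i \<otimes> x \<in> even_part" using W_even_odd[of i "{0..3}" x] * by auto
  moreover have False if "x \<in> even_part" "r i \<otimes> x \<in> even_part"
  proof -
    have "(r i \<otimes> x) \<otimes> inv x \<in> even_part" using that E_inv E_mult by blast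
    then show False using r_not_even * full_closed by (simp add: m_assoc)
  qed
  ultimately show ?thesis by blast
qed

lemma W_Int_even: assumes "J \<subseteq> {0..3}" shows "W J \<inter> even_part = E J"
proof (cases "J = {}")
  case True
  have "W {} = {\<one>}" unfolding W_def by (simp add: generate_empty)
  then show ?thesis using True E_one[of "{}"] E_subset_W[of "{}"] E_one[of "{0..3}"] by auto
next
  case False
  then obtain a where a: "a \<in> J" by auto
  have "x \<in> E J" if "x \<in> W J" "x \<in> even_part" for x
  proof -
    have "x \<in> full" using that even_full by auto
    then have "r a \<otimes> x \<notin> even_part" using even_odd[of x a] a assms that by auto
    then show ?thesis using W_even_odd[OF a assms that(1)] E_mono[OF assms] by auto
  qed
  then show ?thesis using E_subset_W[OF assms] E_mono[OF assms] by auto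
qed

lemma card_W: assumes "J \<subseteq> {0..3}" "J \<noteq> {}" "finite (W J)" shows "card (W J) = 2 * card (E J)"
proof -
  obtain a where a: "a \<in> J" "a \<le> 3" using assms(1,2) by (metis atLeastAtMost_iff ex_in_conv subset_iff)
  have fin: "finite (E J)" using finite_subset[OF E_subset_W[OF assms(1)] assms(3)] .
  have cl: "x \<in> carrier G" if "x \<in> E J" for x using E_closed[OF that assms(1)] .
  have eq: "W J = E J \<union> (\<lambda>x. r a \<otimes> x) ` E J"
  proof
    show "W J \<subseteq> E J \<union> (\<lambda>x. r a \<otimes> x) ` E J"
    proof
      fix x assume x: "x \<in> W J"
      then have "x = r a \<otimes> (r a \<otimes> x)" using a W_closed assms(1) by simp
      then show "x \<in> E J \<union> (\<lambda>x. r a \<otimes> x) ` E J" using W_even_odd[OF a(1) assms(1) x] by blast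
    qed
    show "E J \<union> (\<lambda>x. r a \<otimes> x) ` E J \<subseteq> W J"
      using E_subset_W[OF assms(1)] a(1) by (auto intro!: W_mult W_gen)
  qed
  have disj: "E J \<inter> (\<lambda>x. r a \<otimes> x) ` E J = {}"
    using even_odd[OF even_full a(2)] E_mono[OF assms(1)] by blast
  have "inj_on (\<lambda>x. r a \<otimes> x) (E J)" using cl a by (intro inj_onI) simp
  then show ?thesis using eq disj fin by (simp add: card_Un_disjoint card_image)
qed

text \<open>
  A coset of rotations may be named by an odd element as well. In this way the flags correspond to
  the elements of the full group, while the faces are made of rotations only.
\<close>
definition fc :: "nat \<Rightarrow> 'a \<Rightarrow> 'a set" where
  "fc j g = {x \<in> even_part. same j x g}"

abbreviation "rotations \<equiv> G\<lparr>carrier := even_part\<rparr>"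

lemma rotations_group: "group rotations"
  by (rule subgroup.subgroup_is_group[OF E_subgroup]) (auto intro: is_group)

lemma fc_even:
  assumes "g \<in> full" "j \<le> 3" obtains a where "a \<in> even_part" "same j a g"
proof (cases "g \<in> even_part")
  case True
  then show ?thesis using that same_refl full_closed assms by blast
next
  case False
  have "\<exists>i \<in> {0, 1 :: nat}. i \<noteq> j" by auto
  then obtain i where i: "i \<noteq> j" "i \<le> 3" by fastforce
  have "r i \<otimes> g \<in> even_part" using even_odd assms i False by blast
  then show ?thesis using that same_gen[OF i] full_closed assms by blast
qed

lemma fc_eq_iff: assumes "g \<in> full" "h \<in> full" "j \<le> 3" shows "fc j g = fc j h \<longleftrightarrow> same j g h"
proof
  assume eq: "fc j g = fc j h"
  obtain a where a: "a \<in> even_part" "same j a g" using fc_even[OF assms(1,3)] .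
  then have "same j a h" using eq unfolding fc_def by blast
  then show "same j g h" using a same_trans same_sym full_closed even_full assms by metis
next
  assume "same j g h"
  then have "same j x g \<longleftrightarrow> same j x h" if "x \<in> even_part" for x
    using same_trans[of j x g h] same_trans[of j x h g] same_sym[of j g h]
      full_closed even_full[OF that] assms by blast
  then show "fc j g = fc j h" unfolding fc_def by blast
qed

lemma fc_meet_iff:
  assumes "g \<in> full" "h \<in> full" "j \<le> 3" "k \<le> 3"
  shows "fc j g \<inter> fc k h \<noteq> {} \<longleftrightarrow> (\<exists>y \<in> full. same j y g \<and> same k y h)"
proof
  assume "\<exists>y \<in> full. same j y g \<and> same k y h"
  then obtain y where y: "y \<in> full" "same j y g" "same k y h" by auto
  show "fc j g \<inter> fc k h \<noteq> {}"
  proof (cases "y \<in> even_part")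
    case True
    then show ?thesis using y unfolding fc_def by blast
  next
    case False
    have "\<exists>i \<in> {0, 1, 2 :: nat}. i \<noteq> j \<and> i \<noteq> k" by auto
    then obtain i where i: "i \<noteq> j" "i \<noteq> k" "i \<le> 3" by fastforce
    have e: "r i \<otimes> y \<in> even_part" using even_odd y i False by blast
    have "same j (r i \<otimes> y) g" "same k (r i \<otimes> y) h"
      using same_gen i y same_trans full_closed assms even_full[OF e] by metis+
    then show ?thesis using e unfolding fc_def by blast
  qed
next
  assume "fc j g \<inter> fc k h \<noteq> {}"
  then show "\<exists>y \<in> full. same j y g \<and> same k y h" unfolding fc_def using even_full by blast
qed

lemma fc_rcosets:
  assumes j: "j \<le> 3"
  shows "rcosets\<^bsub>rotations\<^esub> (E ({0..3} - {j})) = fc j ` full"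
proof -
  have 1: "E ({0..3} - {j}) #>\<^bsub>rotations\<^esub> a = fc j a" if a: "a \<in> even_part" for a
  proof -
    have ac: "a \<in> carrier G" using a even_full full_closed by blast
    have "x \<in> fc j a \<longleftrightarrow> (\<exists>h \<in> E ({0..3} - {j}). x = h \<otimes> a)" for x
    proof
      assume x: "x \<in> fc j a"
      then have xe: "x \<in> even_part" "same j x a" unfolding fc_def by auto
      have xc: "x \<in> carrier G" using xe even_full full_closed by blast
      obtain h where h: "h \<in> stab j" "x = h \<otimes> a" using sameE[OF xe(2)] xc ac by metis
      have "h = x \<otimes> inv a" using h ac stab_closed[OF h(1)] by (simp add: m_assoc)
      then have "h \<in> even_part" using xe a by (simp add: E_inv E_mult)
      then have "h \<in> E ({0..3} - {j})" using W_Int_even[of "{0..3} - {j}"] h by auto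
      then show "\<exists>h \<in> E ({0..3} - {j}). x = h \<otimes> a" using h by blast
    next
      assume "\<exists>h \<in> E ({0..3} - {j}). x = h \<otimes> a"
      then obtain h where h: "h \<in> E ({0..3} - {j})" "x = h \<otimes> a" by blast
      have "h \<in> stab j" "h \<in> even_part" using h W_Int_even[of "{0..3} - {j}"] by auto
      then show "x \<in> fc j a" unfolding fc_def using h a ac sameI E_mult by auto
    qed
    then show ?thesis unfolding r_coset_def by auto
  qed
  have "fc j ` full = fc j ` even_part"
  proof
    show "fc j ` full \<subseteq> fc j ` even_part"
    proof
      fix C assume "C \<in> fc j ` full"
      then obtain g where g: "g \<in> full" "C = fc j g" by auto
      obtain a where "a \<in> even_part" "same j a g" using fc_even[OF g(1) j] .
      then show "C \<in> fc j ` even_part" using g fc_eq_iff[of a g j] even_full j by auto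
    qed
  qed (use even_full in auto)
  then show ?thesis using 1 unfolding RCOSETS_def by auto
qed

end

section \<open>Coset enumeration with matrices\<close>

text \<open>
  A pair \<open>(x, y)\<close> stands for \<open>x + y \<tau>\<close> with \<open>\<tau>\<^sup>2 = u \<tau> + v\<close>. A string diagram is given by three
  Booleans telling which of its bonds have weight \<open>\<tau>\<close> rather than 1. The matrices describe the
  action on simple roots; multiplying by a generator changes a single column or row.
\<close>
type_synonym scal = "int \<times> int"
type_synonym mtrx = "scal list list"

fun bond :: "int \<Rightarrow> int \<Rightarrow> bool \<Rightarrow> scal \<Rightarrow> scal" where
  "bond u v True (x, y) = (v * y, x + u * y)"
| "bond u v False (x, y) = (x, y)"
fun sneg :: "scal \<Rightarrow> scal" where "sneg (x, y) = (- x, - y)"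
fun sadd :: "scal \<Rightarrow> scal \<Rightarrow> scal" where "sadd (x, y) (x', y') = (x + x', y + y')"

fun row_refl :: "('b \<Rightarrow> 'b) \<Rightarrow> ('b \<Rightarrow> 'b \<Rightarrow> 'b) \<Rightarrow> (bool \<Rightarrow> 'b \<Rightarrow> 'b) \<Rightarrow> bool \<times> bool \<times> bool \<Rightarrow> nat \<Rightarrow> 'b list \<Rightarrow> 'b list" where
  "row_refl ng ad t (b0, b1, b2) 0 [x0, x1, x2, x3] = [ng x0, ad x1 (t b0 x0), x2, x3]"
| "row_refl ng ad t (b0, b1, b2) (Suc 0) [x0, x1, x2, x3] = [ad x0 (t b0 x1), ng x1, ad x2 (t b1 x1), x3]"
| "row_refl ng ad t (b0, b1, b2) (Suc (Suc 0)) [x0, x1, x2, x3] = [x0, ad x1 (t b1 x2), ng x2, ad x3 (t b2 x2)]"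
| "row_refl ng ad t (b0, b1, b2) (Suc (Suc (Suc n))) [x0, x1, x2, x3] = [x0, x1, ad x2 (t b2 x3), ng x3]"

fun col_refl :: "('b \<Rightarrow> 'b) \<Rightarrow> ('b \<Rightarrow> 'b \<Rightarrow> 'b) \<Rightarrow> (bool \<Rightarrow> 'b \<Rightarrow> 'b) \<Rightarrow> bool \<times> bool \<times> bool \<Rightarrow> nat \<Rightarrow> 'b list \<Rightarrow> 'b list" where
  "col_refl ng ad t (b0, b1, b2) 0 [x0, x1, x2, x3] = [ad (ng x0) (t b0 x1), x1, x2, x3]"
| "col_refl ng ad t (b0, b1, b2) (Suc 0) [x0, x1, x2, x3] = [x0, ad (ng x1) (ad (t b0 x0) (t b1 x2)), x2, x3]"
| "col_refl ng ad t (b0, b1, b2) (Suc (Suc 0)) [x0, x1, x2, x3] = [x0, x1, ad (ng x2) (ad (t b1 x1) (t b2 x3)), x3]"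
| "col_refl ng ad t (b0, b1, b2) (Suc (Suc (Suc n))) [x0, x1, x2, x3] = [x0, x1, x2, ad (ng x3) (t b2 x2)]"

definition rmul where "rmul u v bs s M = map (row_refl sneg sadd (bond u v) bs s) M"
definition lmul where "lmul u v bs s M = col_refl (map sneg) (map2 sadd) (\<lambda>b. map (bond u v b)) bs s M"

definition idm :: mtrx where "idm = [[(1,0),(0,0),(0,0),(0,0)],[(0,0),(1,0),(0,0),(0,0)],[(0,0),(0,0),(1,0),(0,0)],[(0,0),(0,0),(0,0),(1,0)]]"

text \<open>
  A hash of a row. Two different rows with the same key would make the final comparison of matrices
  fail, so a positive outcome does not depend on the choice of the base 32.
\<close>
fun key :: "scal list \<Rightarrow> int" where
  "key [] = 0"
| "key ((x, y) # xs) = x + 32 * (y + 32 * key xs)"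

text \<open>
  The branches of the tests are functions of their own, so that rewriting decides a test before it
  enters a branch.
\<close>
fun known :: "int \<Rightarrow> (int \<times> mtrx) list \<Rightarrow> bool" and known_if :: "bool \<Rightarrow> int \<Rightarrow> (int \<times> mtrx) list \<Rightarrow> bool" where
  "known a [] = False"
| "known a ((b, N) # T) = known_if (a = b) a T"
| "known_if True a T = True"
| "known_if False a T = known a T"

fun stored :: "int \<Rightarrow> mtrx \<Rightarrow> (int \<times> mtrx) list \<Rightarrow> bool" and stored_if :: "bool \<Rightarrow> mtrx \<Rightarrow> int \<Rightarrow> mtrx \<Rightarrow> (int \<times> mtrx) list \<Rightarrow> bool" where
  "stored a M [] = False"
| "stored a M ((b, N) # T) = stored_if (a = b) N a M T"
| "stored_if True N a M T = (M = N)"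
| "stored_if False N a M T = stored a M T"

fun bfs :: "int \<Rightarrow> int \<Rightarrow> bool \<times> bool \<times> bool \<Rightarrow> nat list \<Rightarrow> nat \<Rightarrow> nat \<Rightarrow> (int \<times> mtrx) list \<Rightarrow> (int \<times> mtrx) list \<Rightarrow> (int \<times> mtrx) list" where
  "bfs u v bs gens k 0 q T = T"
| "bfs u v bs gens k (Suc n) [] T = T"
| "bfs u v bs gens k (Suc n) ((a, M) # q) T = 
    (let new = filter (\<lambda>(b, N). \<not> known b T) (map (\<lambda>s. let N = rmul u v bs s M in (key (N ! k), N)) gens)
     in bfs u v bs gens k n (q @ new) (T @ new))"

fun good_if :: "bool \<Rightarrow> int \<Rightarrow> int \<Rightarrow> bool \<times> bool \<times> bool \<Rightarrow> nat list \<Rightarrow> (int \<times> mtrx) list \<Rightarrow> mtrx \<Rightarrow> mtrx \<Rightarrow> int \<Rightarrow> bool" where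
  "good_if True u v bs gens' T M N b = list_ex (\<lambda>s'. N = lmul u v bs s' M) gens'"
| "good_if False u v bs gens' T M N b = stored b N T"

text \<open>
  Either the new matrix lies in the coset of the old one, as witnessed by left multiplication by a
  single generator, or it is one of the listed representatives.
\<close>
fun good :: "int \<Rightarrow> int \<Rightarrow> bool \<times> bool \<times> bool \<Rightarrow> nat list \<Rightarrow> nat \<Rightarrow> (int \<times> mtrx) list \<Rightarrow> int \<times> mtrx \<Rightarrow> nat \<Rightarrow> bool" where
 "good u v bs gens' k T (a, M) s = (let N = rmul u v bs s M; b = key (N ! k) in good_if (a = b) u v bs gens' T M N b)"

definition all_good :: "int \<Rightarrow> int \<Rightarrow> bool \<times> bool \<times> bool \<Rightarrow> nat list \<Rightarrow> nat \<Rightarrow> nat list \<Rightarrow> (int \<times> mtrx) list \<Rightarrow> nat \<Rightarrow> bool" where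
 "all_good u v bs gens k gens' T n \<longleftrightarrow> length T = n \<and> distinct (map fst T) \<and>
   list_all (\<lambda>aM. list_all (good u v bs gens' k T aM) gens) T"

definition start where "start k = [(key (idm ! k), idm)]"
definition coset_check where "coset_check u v bs gens k gens' n = (let s = start k in all_good u v bs gens k gens' (bfs u v bs gens k (Suc n) s s) n)"

definition val :: "real \<Rightarrow> scal \<Rightarrow> real" where
  "val \<tau> p = of_int (fst p) + of_int (snd p) * \<tau>"

fun bond_val :: "real \<Rightarrow> bool \<Rightarrow> real" where
  "bond_val \<tau> True = \<tau>"
| "bond_val \<tau> False = 1"

fun cartan :: "real \<Rightarrow> bool \<times> bool \<times> bool \<Rightarrow> nat \<Rightarrow> nat \<Rightarrow> real" where
  "cartan \<tau> (b0, b1, b2) i j =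
     (if i = j then 2 else if {i, j} = {0, 1} then - bond_val \<tau> b0
      else if {i, j} = {1, 2} then - bond_val \<tau> b1 else if {i, j} = {2, 3} then - bond_val \<tau> b2 else 0)"

lemma val_bond:
  assumes "\<tau> * \<tau> = of_int u * \<tau> + of_int v"
  shows "val \<tau> (bond u v b p) = bond_val \<tau> b * val \<tau> p"
proof (cases b)
  case True
  have "\<tau> * (x + y * \<tau>) = of_int v * y + (x + of_int u * y) * \<tau>" for x y
  proof -
    have "\<tau> * (x + y * \<tau>) = x * \<tau> + y * (\<tau> * \<tau>)" by (simp add: algebra_simps)
    also have "\<dots> = of_int v * y + (x + of_int u * y) * \<tau>" unfolding assms by (simp add: algebra_simps)
    finally show ?thesis .
  qed
  then show ?thesis using True by (cases p) (simp add: val_def)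
qed (cases p; simp add: val_def)

lemma val_neg: "val \<tau> (sneg p) = - val \<tau> p"
  by (cases p) (simp add: val_def algebra_simps)

lemma val_add: "val \<tau> (sadd p q) = val \<tau> p + val \<tau> q"
  by (cases p; cases q) (simp add: val_def algebra_simps)

lemma length_4E:
  assumes "length xs = 4" obtains x0 x1 x2 x3 where "xs = [x0, x1, x2, x3]"
  using assms by (auto simp: length_Suc_conv eval_nat_numeral)

lemma row_refl_val:
  assumes \<tau>: "\<tau> * \<tau> = of_int u * \<tau> + of_int v" and len: "length R = 4" and s: "s \<le> 3" and j: "j \<le> 3"
  shows "val \<tau> (row_refl sneg sadd (bond u v) bs s R ! j)
    = val \<tau> (R ! j) - cartan \<tau> bs s j * val \<tau> (R ! s)"
proof -
  obtain x0 x1 x2 x3 where R: "R = [x0, x1, x2, x3]" using length_4E[OF len] .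
  obtain b0 b1 b2 where bs: "bs = (b0, b1, b2)" by (cases bs)
  have "s = 0 \<or> s = 1 \<or> s = 2 \<or> s = 3" "j = 0 \<or> j = 1 \<or> j = 2 \<or> j = 3" using s j by auto
  then show ?thesis
    by (elim disjE) (simp_all add: R bs val_bond[OF \<tau>] val_neg val_add eval_nat_numeral doubleton_eq_iff)
qed

lemma col_refl_val:
  assumes \<tau>: "\<tau> * \<tau> = of_int u * \<tau> + of_int v" and len: "length M = 4" "\<forall>R \<in> set M. length R = 4"
    and s: "s \<le> 3" and i: "i \<le> 3" and j: "j \<le> 3"
  shows "val \<tau> (col_refl (map sneg) (map2 sadd) (\<lambda>b. map (bond u v b)) bs s M ! i ! j)
    = (if i = s then val \<tau> (M ! s ! j) - (\<Sum>k\<le>3. cartan \<tau> bs s k * val \<tau> (M ! k ! j)) else val \<tau> (M ! i ! j))"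
proof -
  obtain R0 R1 R2 R3 where M: "M = [R0, R1, R2, R3]" using length_4E[OF len(1)] .
  have L: "j < length R0" "j < length R1" "j < length R2" "j < length R3" using len(2) M j by auto
  obtain b0 b1 b2 where bs: "bs = (b0, b1, b2)" by (cases bs)
  have sum: "(\<Sum>k\<le>3. f k) = f 0 + f 1 + f 2 + f 3" for f :: "nat \<Rightarrow> real"
    by (simp add: eval_nat_numeral)
  have "s = 0 \<or> s = 1 \<or> s = 2 \<or> s = 3" "i = 0 \<or> i = 1 \<or> i = 2 \<or> i = 3" using s i by auto
  then show ?thesis
    by (elim disjE) (simp_all add: sum M bs L val_bond[OF \<tau>] val_neg val_add eval_nat_numeral doubleton_eq_iff)
qed

lemma row_refl_length: assumes "length xs = 4" shows "length (row_refl ng ad t bs s xs) = 4"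
proof -
  obtain x0 x1 x2 x3 where xs: "xs = [x0, x1, x2, x3]" using length_4E[OF assms] .
  obtain b0 b1 b2 where bs: "bs = (b0, b1, b2)" by (cases bs)
  consider "s = 0" | "s = Suc 0" | "s = Suc (Suc 0)" | n where "s = Suc (Suc (Suc n))"
    by (metis not0_implies_Suc)
  then show ?thesis by cases (simp_all add: xs bs)
qed

lemma col_refl_shape:
  assumes "length M = 4" "\<forall>R \<in> set M. length R = 4"
  shows "length (col_refl (map sneg) (map2 sadd) (\<lambda>b. map (bond u v b)) bs s M) = 4 \<and>
    (\<forall>R \<in> set (col_refl (map sneg) (map2 sadd) (\<lambda>b. map (bond u v b)) bs s M). length R = 4)"
proof -
  obtain R0 R1 R2 R3 where M: "M = [R0, R1, R2, R3]" using length_4E[OF assms(1)] .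
  obtain b0 b1 b2 where bs: "bs = (b0, b1, b2)" by (cases bs)
  consider "s = 0" | "s = Suc 0" | "s = Suc (Suc 0)" | n where "s = Suc (Suc (Suc n))"
    by (metis not0_implies_Suc)
  then show ?thesis using assms(2) by cases (simp_all add: M bs)
qed

locale refl_rep = string_group +
  fixes entry :: "'a \<Rightarrow> nat \<Rightarrow> nat \<Rightarrow> real" and \<tau> :: real and u v :: int and bs :: "bool \<times> bool \<times> bool"
  assumes entry_one: "\<lbrakk>i \<le> 3; j \<le> 3\<rbrakk> \<Longrightarrow> entry \<one> i j = (if i = j then 1 else 0)"
    and entry_right: "\<lbrakk>g \<in> full; s \<le> 3; i \<le> 3; j \<le> 3\<rbrakk> \<Longrightarrow>
        entry (g \<otimes> r s) i j = entry g i j - cartan \<tau> bs s j * entry g i s"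
    and entry_left: "\<lbrakk>g \<in> full; s \<le> 3; i \<le> 3; j \<le> 3\<rbrakk> \<Longrightarrow>
        entry (r s \<otimes> g) i j = (if i = s then entry g s j - (\<Sum>k\<le>3. cartan \<tau> bs s k * entry g k j) else entry g i j)"
    and entry_inj: "\<lbrakk>g \<in> full; h \<in> full; \<And>i j. \<lbrakk>i \<le> 3; j \<le> 3\<rbrakk> \<Longrightarrow> entry g i j = entry h i j\<rbrakk> \<Longrightarrow> g = h"
    and quadratic: "\<tau> * \<tau> = of_int u * \<tau> + of_int v"
    and irrational: "of_int x + of_int y * \<tau> = 0 \<Longrightarrow> x = 0 \<and> y = 0"
begin

definition realizes :: "mtrx \<Rightarrow> 'a \<Rightarrow> bool" where
  "realizes M g \<longleftrightarrow> length M = 4 \<and> (\<forall>R \<in> set M. length R = 4) \<and> (\<forall>i \<le> 3. \<forall>j \<le> 3. entry g i j = val \<tau> (M ! i ! j))"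

lemma realizes_one: "realizes idm \<one>"
proof -
  have c: "i = 0 \<or> i = 1 \<or> i = 2 \<or> i = 3" if "i \<le> 3" for i :: nat using that by auto
  have "val \<tau> (idm ! i ! j) = (if i = j then 1 else 0)" if "i \<le> 3" "j \<le> 3" for i j
    using c[OF that(1)] c[OF that(2)] by (elim disjE) (simp_all add: idm_def val_def)
  then show ?thesis unfolding realizes_def using entry_one by (simp add: idm_def)
qed

lemma realizes_right:
  assumes "realizes M g" "g \<in> full" "s \<le> 3"
  shows "realizes (rmul u v bs s M) (g \<otimes> r s)"
  using assms row_refl_val[OF quadratic] entry_right
  unfolding realizes_def rmul_def by (auto simp: row_refl_length)

lemma realizes_left:
  assumes "realizes M g" "g \<in> full" "s \<le> 3"
  shows "realizes (lmul u v bs s M) (r s \<otimes> g)"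
  using assms col_refl_val[OF quadratic, of M s _ _ bs] entry_left[of g s] col_refl_shape[of M u v bs s]
  unfolding realizes_def lmul_def by auto

lemma realizes_inj: "\<lbrakk>realizes M g; realizes M h; g \<in> full; h \<in> full\<rbrakk> \<Longrightarrow> g = h"
  unfolding realizes_def by (intro entry_inj) auto

lemma val_inj: "val \<tau> p = val \<tau> q \<Longrightarrow> p = q"
  using irrational[of "fst p - fst q" "snd p - snd q"]
  by (cases p; cases q) (simp add: val_def algebra_simps)

lemma realizes_row:
  assumes "realizes M g" "realizes N h" "k \<le> 3" "\<And>j. j \<le> 3 \<Longrightarrow> entry g k j = entry h k j"
  shows "M ! k = N ! k"
proof (rule nth_equalityI)
  have L: "length (M ! k) = 4" "length (N ! k) = 4"
    using assms(1-3) nth_mem[of k M] nth_mem[of k N] unfolding realizes_def by auto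
  then show "length (M ! k) = length (N ! k)" by simp
  fix j assume "j < length (M ! k)"
  then have "j \<le> 3" using L by simp
  then have "val \<tau> (M ! k ! j) = val \<tau> (N ! k ! j)" using assms unfolding realizes_def by simp
  then show "M ! k ! j = N ! k ! j" by (rule val_inj)
qed

lemma entry_row_left:
  assumes "x \<in> W J" "J \<subseteq> {0..3}" "k \<le> 3" "k \<notin> J" "y \<in> full" "j \<le> 3"
  shows "entry (x \<otimes> y) k j = entry y k j"
  using assms(1,2)
proof (induction rule: W_induct)
  case one
  then show ?case using assms full_closed by simp
next
  case (mult i z)
  have z: "z \<in> full" using mult W_mono[OF assms(2)] by auto
  have i: "i \<le> 3" "i \<noteq> k" using mult assms by auto
  have "r i \<otimes> z \<otimes> y = r i \<otimes> (z \<otimes> y)" using i z assms full_closed by (simp add: m_assoc)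
  then show ?case using mult(3) entry_left[OF W_mult[OF z assms(5)] i(1) assms(3,6)] i by simp
qed

lemma W_induct_right [consumes 2, case_names one mult]:
  assumes x: "x \<in> W J" and J: "J \<subseteq> {0..3}" and 1: "P \<one>"
    and s: "\<And>i y. \<lbrakk>i \<in> J; y \<in> W J; P y\<rbrakk> \<Longrightarrow> P (y \<otimes> r i)"
  shows "P x"
proof -
  have "P (inv y)" if "y \<in> W J" for y
    using that J
  proof (induction rule: W_induct)
    case one
    then show ?case using 1 by simp
  next
    case (mult i z)
    have "i \<le> 3" "z \<in> carrier G" "inv z \<in> W J" using mult J W_closed W_inv by auto
    then show ?case using s[OF mult(1) _ mult(3)] by (simp add: inv_mult_group)
  qed
  from this[OF W_inv[OF x J]] show ?thesis using x W_closed[OF _ J] by simp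
qed

lemma stored_set: "stored a M T \<Longrightarrow> M \<in> snd ` set T" "stored_if c N a M T \<Longrightarrow> M = N \<or> M \<in> snd ` set T"
  by (induction a M T and c N a M T rule: stored_stored_if.induct) auto

lemma bfs_realized:
  assumes J: "set gens = J" "J \<subseteq> {0..3}"
    and "\<And>a M. (a, M) \<in> set q \<union> set T \<Longrightarrow> a = key (M ! k) \<and> (\<exists>g \<in> W J. realizes M g)"
    and "(a, M) \<in> set (bfs u v bs gens k n q T)"
  shows "a = key (M ! k) \<and> (\<exists>g \<in> W J. realizes M g)"
  using assms(3,4)
proof (induction n arbitrary: q T a M)
  case 0
  then show ?case by auto
next
  case (Suc n)
  show ?case
  proof (cases q)
    case Nil
    then show ?thesis using Suc.prems by simp
  next
    case (Cons aM q')
    obtain a0 M0 where aM: "aM = (a0, M0)" by (cases aM)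
    obtain g where g: "g \<in> W J" "realizes M0 g" using Suc.prems(1)[of a0 M0] unfolding Cons aM by auto
    define new where "new = filter (\<lambda>(b, N). \<not> known b T)
      (map (\<lambda>s. let N = rmul u v bs s M0 in (key (N ! k), N)) gens)"
    have new: "b = key (N ! k) \<and> (\<exists>g \<in> W J. realizes N g)" if bN: "(b, N) \<in> set new" for b N
    proof -
      obtain s where s: "s \<in> J" "N = rmul u v bs s M0" "b = key (N ! k)"
        using bN J(1) unfolding new_def Let_def by auto
      have "g \<in> full" using g(1) W_mono[OF J(2)] by blast
      then have "realizes N (g \<otimes> r s)" using realizes_right[OF g(2)] s J(2) by auto
      moreover have "g \<otimes> r s \<in> W J" using W_mult[OF g(1) W_gen[OF s(1)]] .
      ultimately show ?thesis using s by blast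
    qed
    have eq: "bfs u v bs gens k (Suc n) q T = bfs u v bs gens k n (q' @ new) (T @ new)"
      unfolding Cons aM new_def by (simp add: Let_def)
    have "b = key (N ! k) \<and> (\<exists>g \<in> W J. realizes N g)"
      if bN: "(b, N) \<in> set (q' @ new) \<union> set (T @ new)" for b N
    proof -
      consider "(b, N) \<in> set q \<union> set T" | "(b, N) \<in> set new" using bN Cons by auto
      then show ?thesis by cases (rule Suc.prems(1) new, assumption)+
    qed
    then show ?thesis
      using Suc.IH[of "q' @ new" "T @ new" a M] Suc.prems(2) unfolding eq by simp
  qed
qed

text \<open>
  The computed matrices represent the right cosets of the parabolic subgroup \<open>W (J - {k})\<close>: left
  multiplication by its generators does not change row \<open>k\<close>, the rows \<open>k\<close> of the matrices are distinct,
  and the union of the cosets is closed under right multiplication by generators.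
\<close>
lemma coset_enumeration:
  assumes J: "set gens = J" "J \<subseteq> {0..3}" "set gens' = J - {k}" "k \<in> J"
    and ok: "coset_check u v bs gens k gens' n"
  shows "card (W J) = n * card (W (J - {k}))"
    and "\<And>x. \<lbrakk>x \<in> W J; \<And>j. j \<le> 3 \<Longrightarrow> entry x k j = (if k = j then 1 else 0)\<rbrakk> \<Longrightarrow> x \<in> W (J - {k})"
proof -
  define T where "T = bfs u v bs gens k (Suc n) (start k) (start k)"
  have k3: "k \<le> 3" using J by auto
  have T: "length T = n" "distinct (map fst T)"
    "\<And>a M s. \<lbrakk>(a, M) \<in> set T; s \<in> J\<rbrakk> \<Longrightarrow> good u v bs gens' k T (a, M) s"
    using ok J(1) unfolding coset_check_def Let_def all_good_def T_def list_all_iff by auto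
  have real: "a = key (M ! k) \<and> (\<exists>g \<in> W J. realizes M g)" if "(a, M) \<in> set T" for a M
  proof (rule bfs_realized[OF J(1,2) _ that[unfolded T_def]])
    fix a M assume "(a, M) \<in> set (start k) \<union> set (start k)"
    then have "M = idm" "a = key (M ! k)" by (auto simp: start_def)
    then show "a = key (M ! k) \<and> (\<exists>g \<in> W J. realizes M g)" using realizes_one W_one by blast
  qed
  have keyed: "(key (M ! k), M) \<in> set T" if kM: "M \<in> snd ` set T" for M
  proof -
    obtain a where "(a, M) \<in> set T" using kM by force
    then show ?thesis using real by metis
  qed
  have startT: "set (start k) \<subseteq> set T"
  proof -
    have "set T0 \<subseteq> set (bfs u v bs gens k m q T0)" for m q T0
    proof (induction m arbitrary: q T0)
      case (Suc m)
      show ?case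
      proof (cases q)
        case (Cons aM q')
        obtain a0 M0 where aM: "aM = (a0, M0)" by (cases aM)
        define new where "new = filter (\<lambda>(b, N). \<not> known b T0)
          (map (\<lambda>s. let N = rmul u v bs s M0 in (key (N ! k), N)) gens)"
        have "bfs u v bs gens k (Suc m) q T0 = bfs u v bs gens k m (q' @ new) (T0 @ new)"
          unfolding Cons aM new_def by (simp add: Let_def)
        then show ?thesis using Suc[of "T0 @ new" "q' @ new"] by simp
      qed simp
    qed simp
    then show ?thesis unfolding T_def by blast
  qed
  define t where "t M = (SOME g. g \<in> W J \<and> realizes M g)" for M
  have t: "t M \<in> W J" "realizes M (t M)" if "M \<in> snd ` set T" for M
  proof -
    obtain a where "(a, M) \<in> set T" using \<open>M \<in> snd ` set T\<close> by force
    then have "\<exists>g. g \<in> W J \<and> realizes M g" using real by blast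
    from someI_ex[OF this] show "t M \<in> W J" "realizes M (t M)" unfolding t_def by simp_all
  qed
  have full: "x \<in> full" if "x \<in> W J" for x using that W_mono[OF J(2)] by blast
  have sub: "J - {k} \<subseteq> {0..3}" using J by auto
  have WJk: "x \<in> W J" if "x \<in> W (J - {k})" for x using that W_mono[of "J - {k}" J] by blast
  have idT: "idm \<in> snd ` set T" using startT by (force simp: start_def)
  have t1: "t idm = \<one>"
    using realizes_inj[OF t(2)[OF idT] realizes_one full[OF t(1)[OF idT]]] by simp
  have cover: "\<exists>w \<in> W (J - {k}). \<exists>M \<in> snd ` set T. x = w \<otimes> t M" if "x \<in> W J" for x
    using that J(2)
  proof (induction rule: W_induct_right)
    case one
    show ?case by (intro bexI[of _ "\<one>"] bexI[of _ idm]) (simp_all add: t1 idT)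
  next
    case (mult s y)
    then obtain w M where wM: "w \<in> W (J - {k})" "M \<in> snd ` set T" "y = w \<otimes> t M" by blast
    have s: "s \<le> 3" using mult J by auto
    have cl: "w \<in> carrier G" "t M \<in> carrier G" using wM(1) W_closed[OF _ sub] t(1)[OF wM(2)] full full_closed by auto
    then have y: "y \<otimes> r s = w \<otimes> (t M \<otimes> r s)" using wM s by (simp add: m_assoc)
    define N where "N = rmul u v bs s M"
    have N: "realizes N (t M \<otimes> r s)"
      unfolding N_def using realizes_right[OF t(2)[OF wM(2)] full[OF t(1)[OF wM(2)]] s] .
    have tr: "t M \<otimes> r s \<in> full" using W_mult[OF full[OF t(1)[OF wM(2)]] W_gen[of s "{0..3}"]] s by simp
    have "(key (M ! k), M) \<in> set T" using keyed[OF wM(2)] .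
    then have "good u v bs gens' k T (key (M ! k), M) s" using T(3) mult(1) by blast
    then have "(\<exists>s' \<in> set gens'. N = lmul u v bs s' M) \<or> N \<in> snd ` set T"
      using stored_set(1) by (cases "key (M ! k) = key (N ! k)") (auto simp: N_def Let_def list_ex_iff)
    then show ?case
    proof
      assume "N \<in> snd ` set T"
      moreover have "t N = t M \<otimes> r s" if "N \<in> snd ` set T"
        using realizes_inj[OF t(2)[OF that] N full[OF t(1)[OF that]] tr] .
      ultimately show ?thesis using y wM(1) by metis
    next
      assume "\<exists>s' \<in> set gens'. N = lmul u v bs s' M"
      then obtain s' where s': "s' \<in> J - {k}" "N = lmul u v bs s' M" using J(3) by blast
      have s'3: "s' \<le> 3" using s'(1) J(2) by auto
      have "r s' \<otimes> t M \<in> full" using W_mult[OF W_gen[of s' "{0..3}"] full[OF t(1)[OF wM(2)]]] s'3 by simp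
      then have "t M \<otimes> r s = r s' \<otimes> t M"
        using realizes_inj[OF N _ tr] realizes_left[OF t(2)[OF wM(2)] full[OF t(1)[OF wM(2)]] s'3] s'(2) by simp
      then have "y \<otimes> r s = (w \<otimes> r s') \<otimes> t M" using y cl s'3 by (simp add: m_assoc)
      moreover have "w \<otimes> r s' \<in> W (J - {k})" using W_mult[OF wM(1) W_gen[OF s'(1)]] .
      ultimately show ?thesis using wM(2) by blast
    qed
  qed
  have row: "entry (w \<otimes> t M) k j = val \<tau> (M ! k ! j)"
    if "w \<in> W (J - {k})" "M \<in> snd ` set T" "j \<le> 3" for w M j
    using entry_row_left[OF that(1) sub k3 _ full[OF t(1)[OF that(2)]] that(3)] t(2)[OF that(2)] k3 that(3)
    unfolding realizes_def by simp
  have rows: "M = N" if "M \<in> snd ` set T" "N \<in> snd ` set T" "\<And>j. j \<le> 3 \<Longrightarrow> val \<tau> (M ! k ! j) = val \<tau> (N ! k ! j)" for M N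
  proof -
    have "M ! k = N ! k"
      using realizes_row[OF t(2)[OF that(1)] t(2)[OF that(2)] k3] that(3) t(2)[OF that(1)] t(2)[OF that(2)] k3
      unfolding realizes_def by simp
    moreover have "(key (M ! k), M) \<in> set T" "(key (N ! k), N) \<in> set T" 
      using keyed[OF that(1)] keyed[OF that(2)] .
    ultimately show ?thesis using T(2) eq_key_imp_eq_value by metis
  qed
  have "bij_betw (\<lambda>(w, M). w \<otimes> t M) (W (J - {k}) \<times> snd ` set T) (W J)"
  proof (rule bij_betw_imageI)
    show "inj_on (\<lambda>(w, M). w \<otimes> t M) (W (J - {k}) \<times> snd ` set T)"
    proof (rule inj_onI, clarsimp simp del: mem_Collect_eq)
      fix w a M w' a' M'
      assume w: "w \<in> W (J - {k})" "w' \<in> W (J - {k})" and M: "(a, M) \<in> set T" "(a', M') \<in> set T"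
        and eq: "w \<otimes> t M = w' \<otimes> t M'"
      have MM: "M \<in> snd ` set T" "M' \<in> snd ` set T" using M by (simp_all add: rev_image_eqI)
      have "M = M'" using rows[OF MM] row[OF w(1) MM(1)] row[OF w(2) MM(2)] eq by simp
      moreover have "w = w'"
        using eq \<open>M = M'\<close> W_closed[OF w(1) sub] W_closed[OF w(2) sub] full_closed[OF full[OF t(1)[OF MM(1)]]] by simp
      ultimately show "w = w' \<and> M = M'" by simp
    qed
    show "(\<lambda>(w, M). w \<otimes> t M) ` (W (J - {k}) \<times> snd ` set T) = W J"
    proof
      show "(\<lambda>(w, M). w \<otimes> t M) ` (W (J - {k}) \<times> snd ` set T) \<subseteq> W J"
      proof (rule image_subsetI)
        fix p assume p: "p \<in> W (J - {k}) \<times> snd ` set T"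
        obtain w M where wM: "p = (w, M)" by (cases p)
        have "w \<in> W J" "t M \<in> W J" using p wM WJk t(1) by simp_all
        then show "(case p of (w, M) \<Rightarrow> w \<otimes> t M) \<in> W J" unfolding wM by (simp add: W_mult)
      qed
      show "W J \<subseteq> (\<lambda>(w, M). w \<otimes> t M) ` (W (J - {k}) \<times> snd ` set T)"
      proof
        fix x assume "x \<in> W J"
        then obtain w M where "w \<in> W (J - {k})" "M \<in> snd ` set T" "x = w \<otimes> t M" using cover by blast
        then show "x \<in> (\<lambda>(w, M). w \<otimes> t M) ` (W (J - {k}) \<times> snd ` set T)"
          by (intro image_eqI[of _ _ "(w, M)"]) simp_all
      qed
    qed
  qed
  then have "card (W J) = card (W (J - {k})) * card (snd ` set T)"
    using bij_betw_same_card card_cartesian_product by metis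
  moreover have "card (snd ` set T) = n"
  proof -
    have "inj_on snd (set T)"
    proof (rule inj_onI)
      fix p q assume pq: "p \<in> set T" "q \<in> set T" "snd p = snd q"
      have "fst p = key (snd p ! k)" "fst q = key (snd q ! k)"
        using real[of "fst p" "snd p"] real[of "fst q" "snd q"] pq(1,2) unfolding prod.collapse by blast+
      then show "p = q" using pq(3) by (simp add: prod_eq_iff)
    qed
    moreover have "card (set T) = n" using T(1,2) distinct_card distinct_map by metis
    ultimately show ?thesis by (simp add: card_image)
  qed
  ultimately show "card (W J) = n * card (W (J - {k}))" by simp
  show "x \<in> W (J - {k})" if x: "x \<in> W J" "\<And>j. j \<le> 3 \<Longrightarrow> entry x k j = (if k = j then 1 else 0)" for x
  proof -
    obtain w M where wM: "w \<in> W (J - {k})" "M \<in> snd ` set T" "x = w \<otimes> t M" using cover[OF x(1)] by blast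
    have "val \<tau> (M ! k ! j) = val \<tau> (idm ! k ! j)" if "j \<le> 3" for j
      using row[OF wM(1,2) that] x(2)[OF that] wM(3) realizes_one entry_one[OF k3 that] k3 that
      unfolding realizes_def by simp
    then have "M = idm" using rows[OF wM(2) idT] by blast
    then show ?thesis using wM t1 W_closed[OF wM(1) sub] by simp
  qed
qed

end

section \<open>The coset geometry\<close>

context coset_geometry
begin

definition geometry :: "'a mix_face ranked_poset" where
  "geometry = (let Fs = {Least_Face, Greatest_Face} \<union>
       {Face j C | j C. j < 4 \<and> C \<in> rcosets\<^bsub>rotations\<^esub> (E ({0..3} - {j}))}
     in \<lparr>faces = Fs, below = {(F, G). F \<in> Fs \<and> G \<in> Fs \<and> mix_face_le F G}, rk = mix_face_rank 4\<rparr>)"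

definition fl :: "'a \<Rightarrow> 'a mix_face set" where
  "fl g = {Least_Face, Greatest_Face} \<union> {Face j (fc j g) | j. j \<le> 3}"

lemma faces_geometry:
  "faces geometry = {Least_Face, Greatest_Face} \<union> {Face j (fc j g) | j g. j \<le> 3 \<and> g \<in> full}"
proof -
  have 1: "j < 4 \<and> C \<in> rcosets\<^bsub>rotations\<^esub> (E ({0..3} - {j})) \<longleftrightarrow> j \<le> 3 \<and> (\<exists>g. g \<in> full \<and> C = fc j g)" for j C
    using fc_rcosets[of j] by (cases "j \<le> 3") (simp_all add: image_iff Bex_def)
  show ?thesis unfolding geometry_def Let_def by (simp only: 1 ranked_poset.select_convs) fast
qed

lemma below_geometry:
  "(F, H) \<in> below geometry \<longleftrightarrow> F \<in> faces geometry \<and> H \<in> faces geometry \<and> mix_face_le F H"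
  unfolding geometry_def Let_def by simp

lemma rk_geometry: "rk geometry = mix_face_rank 4"
  unfolding geometry_def Let_def by simp

lemma face_in_geometry: "\<lbrakk>j \<le> 3; g \<in> full\<rbrakk> \<Longrightarrow> Face j (fc j g) \<in> faces geometry"
  unfolding faces_geometry by blast

lemma face_geometryE:
  assumes "Face j C \<in> faces geometry"
  obtains g where "j \<le> 3" "g \<in> full" "C = fc j g"
  using assms unfolding faces_geometry by blast

lemma fl_faces: "g \<in> full \<Longrightarrow> fl g \<subseteq> faces geometry"
  unfolding fl_def faces_geometry by blast

lemma Face_in_fl: "Face j C \<in> fl g \<longleftrightarrow> j \<le> 3 \<and> C = fc j g"
  unfolding fl_def by blast

lemma fc_meet_self: "\<lbrakk>g \<in> full; j \<le> 3; k \<le> 3\<rbrakk> \<Longrightarrow> fc j g \<inter> fc k g \<noteq> {}"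
  using fc_meet_iff[of g g j k] same_refl[of g] full_closed[of g] by blast

lemma mix_face_le_refl: "mix_face_le F F"
  by (cases F) auto

lemma fl_le:
  assumes "g \<in> full" "F \<in> fl g" "H \<in> fl g" "mix_face_rank 4 F \<le> mix_face_rank 4 H"
  shows "(F, H) \<in> below geometry"
proof -
  have "mix_face_le F H"
    using assms(2-4) fc_meet_self[OF assms(1)] unfolding fl_def by (auto simp: le_less)
  then show ?thesis using assms fl_faces below_geometry by blast
qed

lemma fl_chain: assumes "g \<in> full" shows "fl g \<in> Chains (below geometry)"
proof -
  have "(F, H) \<in> below geometry \<or> (H, F) \<in> below geometry" if "F \<in> fl g" "H \<in> fl g" for F H
    using fl_le[OF assms that] fl_le[OF assms that(2,1)]
    by (cases "mix_face_rank 4 F \<le> mix_face_rank 4 H") simp_all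
  then show ?thesis unfolding Chains_def by simp
qed

text \<open>
  The common representative is built from the face of highest rank downwards; \<open>same_extend\<close> absorbs
  one further face in each step.
\<close>
lemma chain_in_fl:
  assumes C: "C \<in> Chains (below geometry)"
  obtains g where "g \<in> full" "C \<subseteq> fl g"
proof -
  have Cf: "F \<in> faces geometry" if "F \<in> C" for F
    using C that below_geometry unfolding Chains_def by blast
  have "\<exists>g \<in> full. \<forall>j D. Face j D \<in> C \<longrightarrow> 4 - n \<le> j \<longrightarrow> D = fc j g" if "n \<le> 4" for n :: nat
    using that
  proof (induction n)
    case 0
    have False if "Face j D \<in> C" "4 \<le> j" for j D using face_geometryE[OF Cf[OF that(1)]] that(2) by fastforce
    then show ?case using W_one by fastforce
  next
    case (Suc n)
    define m where "m = 3 - n"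
    have m: "4 - Suc n = m" "4 - n = Suc m" "m \<le> 3" using Suc.prems by (auto simp: m_def)
    obtain g where g: "g \<in> full" "\<And>j D. \<lbrakk>Face j D \<in> C; m < j\<rbrakk> \<Longrightarrow> D = fc j g"
      using Suc m by (metis Suc_leD Suc_leI)
    show ?case
    proof (cases "\<exists>D. Face m D \<in> C")
      case False
      then show ?thesis using g m by (metis le_neq_implies_less)
    next
      case True
      then obtain D where D: "Face m D \<in> C" by blast
      then obtain x where x: "x \<in> full" "D = fc m x" using face_geometryE[OF Cf[OF D]] by metis
      have uniq: "D' = D" if "Face m D' \<in> C" for D'
      proof -
        have "mix_face_le (Face m D) (Face m D') \<or> mix_face_le (Face m D') (Face m D)"
          using C D that below_geometry unfolding Chains_def by blast
        then show ?thesis by auto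
      qed
      show ?thesis
      proof (cases "\<exists>j E. Face j E \<in> C \<and> m < j")
        case False
        then have "\<forall>j D. Face j D \<in> C \<longrightarrow> m \<le> j \<longrightarrow> D = fc j x"
          using uniq x by (metis le_neq_implies_less)
        then show ?thesis using x m by auto
      next
        case True
        define j where "j = (LEAST j. m < j \<and> (\<exists>E. Face j E \<in> C))"
        have "m < j \<and> (\<exists>E. Face j E \<in> C)" unfolding j_def by (rule LeastI_ex) (use True in blast)
        then obtain B where j: "m < j" "Face j B \<in> C" by blast
        have least: "j \<le> k" if "m < k" "Face k B' \<in> C" for k B'
          unfolding j_def by (rule Least_le) (use that in blast)
        have j3: "j \<le> 3" using face_geometryE[OF Cf[OF j(2)]] by metis
        have B: "B = fc j g" using g(2) j by blast
        have "mix_face_le (Face m D) (Face j B) \<or> mix_face_le (Face j B) (Face m D)"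
          using C D j below_geometry unfolding Chains_def by blast
        then have "fc m x \<inter> fc j g \<noteq> {}" using j B x by auto
        then obtain y where y: "y \<in> full" "same m y x" "same j y g"
          using iffD1[OF fc_meet_iff[OF x(1) g(1) m(3) j3]] by blast
        obtain h where h: "h \<in> full" "same m h x" "\<And>k. \<lbrakk>j \<le> k; k \<le> 3\<rbrakk> \<Longrightarrow> same k h g"
          using same_extend[OF j(1) j3 x(1) g(1) y] by blast
        have "D' = fc k h" if k: "Face k D' \<in> C" "m \<le> k" for k D'
        proof (cases "k = m")
          case True
          then show ?thesis using uniq k x h fc_eq_iff m by metis
        next
          case False
          then have "m < k" using k by auto
          then have "j \<le> k" "D' = fc k g" using least k g by auto
          moreover have "k \<le> 3" using face_geometryE[OF Cf[OF k(1)]] by metis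
          ultimately show ?thesis using h g fc_eq_iff by metis
        qed
        then show ?thesis using h m by auto
      qed
    qed
  qed
  from this[of 4] obtain g where g: "g \<in> full" "\<And>j D. Face j D \<in> C \<Longrightarrow> D = fc j g" by auto
  have "C \<subseteq> fl g"
  proof
    fix F assume F: "F \<in> C"
    show "F \<in> fl g"
    proof (cases F)
      case (Face j D)
      then show ?thesis using g F face_geometryE[OF Cf[of "Face j D"]] Face_in_fl by metis
    qed (auto simp: fl_def)
  qed
  then show ?thesis using that g by blast
qed

lemma all_stab: assumes "\<And>j. j \<le> 3 \<Longrightarrow> x \<in> stab j" shows "x = \<one>"
proof -
  have "x = \<one> \<or> x = r 0" using triple[of 0 x] assms by simp
  moreover have "x \<noteq> r 0" using notin[of 0] assms[of 0] by auto
  ultimately show ?thesis by simp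
qed

lemma fl_inj: assumes "g \<in> full" "h \<in> full" "fl g \<subseteq> fl h" shows "g = h"
proof -
  have "same j g h" if "j \<le> 3" for j
    using fc_eq_iff assms that Face_in_fl by (metis subsetD)
  then have "g \<otimes> inv h = \<one>" using all_stab unfolding same_def by blast
  then show ?thesis using assms full_closed by (metis inv_equality inv_closed inv_inv)
qed

lemma flags_geometry: "flags geometry = fl ` full"
proof
  show "flags geometry \<subseteq> fl ` full"
  proof
    fix C assume C: "C \<in> flags geometry"
    then obtain g where g: "g \<in> full" "C \<subseteq> fl g" unfolding flags_def using chain_in_fl by blast
    then have "fl g = C" using C fl_chain unfolding flags_def by blast
    then show "C \<in> fl ` full" using g by blast
  qed
  show "fl ` full \<subseteq> flags geometry"
  proof
    fix C assume "C \<in> fl ` full"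
    then obtain g where g: "g \<in> full" "C = fl g" by blast
    have "D = C" if D: "D \<in> Chains (below geometry)" "C \<subseteq> D" for D
    proof -
      obtain h where h: "h \<in> full" "D \<subseteq> fl h" using chain_in_fl[OF D(1)] .
      then have "g = h" using fl_inj g D by blast
      then show ?thesis using g h D by blast
    qed
    then show "C \<in> flags geometry" unfolding flags_def using g fl_chain by blast
  qed
qed

lemma card_flags_geometry:
  assumes "finite full" shows "card (flags geometry) = 2 * card even_part"
proof -
  have "inj_on fl full" using fl_inj by (intro inj_onI) blast
  then show ?thesis using flags_geometry card_W[of "{0..3}"] assms by (simp add: card_image)
qed

lemma face_count_geometry:
  assumes "finite full" "j \<le> 3"
  shows "face_count geometry j * card (E ({0..3} - {j})) = card even_part"
proof -
  have mem: "Face i C \<in> faces geometry \<longleftrightarrow> i \<le> 3 \<and> C \<in> rcosets\<^bsub>rotations\<^esub> (E ({0..3} - {i}))" for i C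
    unfolding faces_geometry using fc_rcosets[of i] by (cases "i \<le> 3") (auto simp: image_iff)
  have "{F \<in> faces geometry. rk geometry F = int j} = Face j ` (rcosets\<^bsub>rotations\<^esub> (E ({0..3} - {j})))"
  proof (rule Set.set_eqI)
    fix F
    show "F \<in> {F \<in> faces geometry. rk geometry F = int j} \<longleftrightarrow>
        F \<in> Face j ` (rcosets\<^bsub>rotations\<^esub> (E ({0..3} - {j})))"
      using assms(2) by (cases F) (simp_all add: mem image_iff rk_geometry, auto)
  qed
  then have "face_count geometry j = card (rcosets\<^bsub>rotations\<^esub> (E ({0..3} - {j})))"
    unfolding face_count_def by (simp add: card_image inj_on_def)
  moreover have "subgroup (E ({0..3} - {j})) rotations"
    by (rule subgroup_incl[OF E_subgroup E_subgroup E_mono]) auto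
  ultimately show ?thesis
    using group.lagrange[OF rotations_group] by (simp add: order_def)
qed

lemma le_3_iff: "j \<le> 3 \<longleftrightarrow> j = 0 \<or> j = 1 \<or> j = 2 \<or> j = (3::nat)"
  by linarith

lemma W_single: assumes "i \<le> 3" "x \<in> W {i}" shows "x = \<one> \<or> x = r i"
proof -
  have "{i} \<subseteq> {0..3}" using assms by auto
  with assms(2) show ?thesis
    by (induction rule: W_induct) (use assms(1) in auto)
qed

lemma stab_sub: "\<lbrakk>x \<in> W J; J \<subseteq> {0..3}; j \<notin> J\<rbrakk> \<Longrightarrow> x \<in> stab j"
  using W_mono[of J "{0..3} - {j}"] by blast

lemma stab_cancel:
  assumes "y \<in> stab j" "y \<otimes> z \<in> stab j" "z \<in> carrier G" shows "z \<in> stab j"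
proof -
  have "inv y \<otimes> (y \<otimes> z) \<in> stab j" using assms W_inv[of y "{0..3} - {j}"] by (intro W_mult[of "inv y" _ "y \<otimes> z"]) auto
  moreover have "inv y \<otimes> (y \<otimes> z) = z" using assms stab_closed[OF assms(1)] by (simp flip: m_assoc)
  ultimately show ?thesis by simp
qed

text \<open>
  An element of one stabiliser is a commuting product by \<open>W_split\<close>. Cancelling the factor that
  lies in the other stabiliser leaves an element to which \<open>W_single\<close> or \<open>triple\<close> applies. This
  settles all pairs of ranks except 0 and 3.
\<close>
lemma stab_0_1: assumes "x \<in> stab 0" "x \<in> stab 1" shows "x \<in> W {2, 3}"
proof -
  obtain y z where yz: "y \<in> W {0..<1}" "z \<in> W {1<..3}" "x = y \<otimes> z" "x = z \<otimes> y"
    using W_split[OF _ assms(2)] by auto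
  have eq: "{0..<1} = {0::nat}" "{1<..3} = {2, 3::nat}" by auto
  have z: "z \<in> stab 0" using yz eq by (intro stab_sub[of _ "{2,3}"]) auto
  have "y \<in> carrier G" using yz eq by (intro W_closed[of _ "{0}"]) auto
  then have "y \<in> stab 0" using stab_cancel[OF z] assms yz by metis
  then have "y = \<one>" using W_single[of 0 y] yz eq notin[of 0] by auto
  then show ?thesis using yz eq stab_closed[OF z] by simp
qed

lemma stab_2_3: assumes "x \<in> stab 2" "x \<in> stab 3" shows "x \<in> W {0, 1}"
proof -
  obtain y z where yz: "y \<in> W {0..<2}" "z \<in> W {2<..3}" "x = y \<otimes> z" "x = z \<otimes> y"
    using W_split[OF _ assms(1)] by auto
  have eq: "{0..<2} = {0,1::nat}" "{2<..3} = {3::nat}" by auto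
  have y: "y \<in> stab 3" using yz eq by (intro stab_sub[of _ "{0,1}"]) auto
  have "z \<in> carrier G" using yz eq by (intro W_closed[of _ "{3}"]) auto
  then have "z \<in> stab 3" using stab_cancel[OF y] assms yz by metis
  then have "z = \<one>" using W_single[of 3 z] yz eq notin[of 3] by auto
  then show ?thesis using yz eq stab_closed[OF y] by simp
qed

lemma stab_0_2:
  assumes "x \<in> stab 0" "x \<in> stab 2"
  obtains z where "z \<in> W {3}" "x = z \<or> x = z \<otimes> r 1"
proof -
  obtain y z where yz: "y \<in> W {0..<2}" "z \<in> W {2<..3}" "x = y \<otimes> z" "x = z \<otimes> y"
    using W_split[OF _ assms(2)] by auto
  have eq: "{0..<2} = {0,1::nat}" "{2<..3} = {3::nat}" by auto
  have z: "z \<in> stab 0" using yz eq by (intro stab_sub[of _ "{3}"]) auto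
  have yc: "y \<in> carrier G" using yz eq by (intro W_closed[of _ "{0,1}"]) auto
  have "y \<in> stab 0" using stab_cancel[OF z] assms yz yc by metis
  moreover have "y \<in> stab 2" "y \<in> stab 3"
    using stab_sub[of y "{0,1}"] yz eq by simp_all
  ultimately have "y = \<one> \<or> y = r 1" by (intro triple) (auto simp: le_3_iff)
  then show ?thesis using that yz eq stab_closed[OF z] by auto
qed

lemma stab_1_3:
  assumes "x \<in> stab 1" "x \<in> stab 3"
  obtains y where "y \<in> W {0}" "x = y \<or> x = y \<otimes> r 2"
proof -
  obtain y z where yz: "y \<in> W {0..<1}" "z \<in> W {1<..3}" "x = y \<otimes> z" "x = z \<otimes> y"
    using W_split[OF _ assms(1)] by auto
  have eq: "{0..<1} = {0::nat}" "{1<..3} = {2,3::nat}" by auto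
  have y: "y \<in> stab 3" using yz eq by (intro stab_sub[of _ "{0}"]) auto
  have zc: "z \<in> carrier G" using yz eq by (intro W_closed[of _ "{2,3}"]) auto
  have "z \<in> stab 3" using stab_cancel[OF y] assms yz zc by metis
  moreover have "z \<in> stab 0" "z \<in> stab 1"
    using stab_sub[of z "{2,3}"] yz eq by simp_all
  ultimately have "z = \<one> \<or> z = r 2" by (intro triple) (auto simp: le_3_iff)
  then show ?thesis using that yz eq stab_closed[OF y] by auto
qed

lemma stab_1_2: assumes "x \<in> stab 1" "x \<in> stab 2" shows "x \<in> W {0, 3}"
proof -
  obtain y z where yz: "y \<in> W {0..<1}" "z \<in> W {1<..3}" "x = y \<otimes> z" "x = z \<otimes> y"
    using W_split[OF _ assms(1)] by auto
  have eq: "{0..<1} = {0::nat}" "{1<..3} = {2,3::nat}" by auto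
  have y: "y \<in> stab 2" using yz eq by (intro stab_sub[of _ "{0}"]) auto
  have zc: "z \<in> carrier G" using yz eq by (intro W_closed[of _ "{2,3}"]) auto
  have "z \<in> stab 2" using stab_cancel[OF y] assms yz zc by metis
  moreover have "z \<in> stab 0" "z \<in> stab 1"
    using stab_sub[of z "{2,3}"] yz eq by simp_all
  ultimately have "z = \<one> \<or> z = r 3" by (intro triple) (auto simp: le_3_iff)
  then have "z \<in> W {0, 3}" using W_gen[of 3 "{0,3}"] by auto
  moreover have "y \<in> W {0, 3}" using yz eq W_mono[of "{0}" "{0,3}"] by auto
  ultimately show ?thesis using yz W_mult by metis
qed

lemma diamond_group:
  assumes "j \<le> 3" "a \<in> full" "1 \<le> j \<Longrightarrow> a \<in> stab (j - 1)" "j \<le> 2 \<Longrightarrow> a \<in> stab (j + 1)"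
  shows "\<exists>b \<in> stab j. a = b \<or> a = b \<otimes> r j"
proof -
  consider "j = 0" | "j = 1" | "j = 2" | "j = 3" using assms(1) by linarith
  then show ?thesis
  proof cases
    case 1
    then have a: "a \<in> stab 1" using assms by auto
    obtain y z where yz: "y \<in> W {0..<1}" "z \<in> W {1<..3}" "a = y \<otimes> z" "a = z \<otimes> y"
      using W_split[OF _ a] by auto
    have eq: "{0..<1} = {0::nat}" "{1<..3} = {2, 3::nat}" by auto
    have z: "z \<in> stab 0" using yz eq by (intro stab_sub[of _ "{2,3}"]) auto
    have "y = \<one> \<or> y = r 0" using W_single[of 0 y] yz eq by auto
    then have "a = z \<or> a = z \<otimes> r 0" using yz(4) stab_closed[OF z] by auto
    then show ?thesis using 1 z by blast
  next
    case 2
    then obtain z where "z \<in> W {3}" "a = z \<or> a = z \<otimes> r 1" using stab_0_2 assms by (metis diff_self_eq_0 one_add_one one_le_numeral order_refl)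
    then show ?thesis using 2 stab_sub[of z "{3}" 1] by auto
  next
    case 3
    have "a \<in> stab 1" "a \<in> stab 3" using 3 assms(3,4) by (auto simp: numeral_3_eq_3 numeral_2_eq_2)
    then obtain y where "y \<in> W {0}" "a = y \<or> a = y \<otimes> r 2" using stab_1_3 by metis
    then show ?thesis using 3 stab_sub[of y "{0}" 2] by auto
  next
    case 4
    then have a: "a \<in> stab 2" using assms by auto
    obtain y z where yz: "y \<in> W {0..<2}" "z \<in> W {2<..3}" "a = y \<otimes> z" "a = z \<otimes> y"
      using W_split[OF _ a] by auto
    have eq: "{0..<2} = {0,1::nat}" "{2<..3} = {3::nat}" by auto
    have y: "y \<in> stab 3" using yz eq by (intro stab_sub[of _ "{0,1}"]) auto
    have "z = \<one> \<or> z = r 3" using W_single[of 3 z] yz eq by auto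
    then have "a = y \<or> a = y \<otimes> r 3" using yz(3) stab_closed[OF y] by auto
    then show ?thesis using 4 y by blast
  qed
qed

lemma intersection_property:
  assumes ip: "stab 0 \<inter> stab 3 \<subseteq> W {1, 2}"
    and x: "x \<in> full" "\<And>j. j \<in> A \<Longrightarrow> x \<in> stab j" and A: "A \<subseteq> {0..3}"
  shows "x \<in> W ({0..3} - A)"
proof -
  have key: ?thesis if "x \<in> W K" "K \<subseteq> {0..3}" "K \<inter> A = {}" for K
    using that W_mono[of K "{0..3} - A"] by blast
  have f02: "x \<in> W {1, 3}" if h: "x \<in> stab 0" "x \<in> stab 2"
  proof -
    obtain z where "z \<in> W {3}" "x = z \<or> x = z \<otimes> r 1" using stab_0_2[OF h] .
    moreover have "W {3} \<subseteq> W {1, 3}" by (rule W_mono) simp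
    ultimately show ?thesis using W_gen[of 1 "{1,3}"] W_mult[of z "{1,3}" "r 1"] by auto
  qed
  have f13: "x \<in> W {0, 2}" if h: "x \<in> stab 1" "x \<in> stab 3"
  proof -
    obtain z where "z \<in> W {0}" "x = z \<or> x = z \<otimes> r 2" using stab_1_3[OF h] .
    moreover have "W {0} \<subseteq> W {0, 2}" by (rule W_mono) simp
    ultimately show ?thesis using W_gen[of 2 "{0,2}"] W_mult[of z "{0,2}" "r 2"] by auto
  qed
  have tr: "x \<in> W {i}" if "i \<le> 3" "\<And>j. \<lbrakk>j \<le> 3; j \<noteq> i\<rbrakk> \<Longrightarrow> x \<in> stab j" for i
    using triple[OF that] W_gen[of i "{i}"] by auto
  note le3 = le_3_iff
  have eqs: "{0..3} - {0::nat} = {1, 2, 3}" "{0..3} - {1::nat} = {0, 2, 3}"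
    "{0..3} - {2::nat} = {0, 1, 3}" "{0..3} - {3::nat} = {0, 1, 2}" by auto
  show ?thesis
  proof (cases "0 \<in> A"; cases "1 \<in> A"; cases "2 \<in> A"; cases "3 \<in> A")
    assume "0 \<in> A" "1 \<in> A" "2 \<in> A" "3 \<in> A"
    then have "x = \<one>" using x le3 by (intro all_stab) auto
    then show ?thesis by simp
  next
    assume *: "0 \<in> A" "1 \<in> A" "2 \<in> A" "3 \<notin> A"
    show ?thesis using x * le3 by (intro key[OF tr[of 3]]) auto
  next
    assume *: "0 \<in> A" "1 \<in> A" "2 \<notin> A" "3 \<in> A"
    show ?thesis using x * le3 by (intro key[OF tr[of 2]]) auto
  next
    assume *: "0 \<in> A" "1 \<in> A" "2 \<notin> A" "3 \<notin> A"
    show ?thesis using x * by (intro key[OF stab_0_1]) auto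
  next
    assume *: "0 \<in> A" "1 \<notin> A" "2 \<in> A" "3 \<in> A"
    show ?thesis using x * le3 by (intro key[OF tr[of 1]]) auto
  next
    assume *: "0 \<in> A" "1 \<notin> A" "2 \<in> A" "3 \<notin> A"
    show ?thesis using x * by (intro key[OF f02]) auto
  next
    assume *: "0 \<in> A" "1 \<notin> A" "2 \<notin> A" "3 \<in> A"
    show ?thesis using x * ip by (intro key[of "{1,2}"]) auto
  next
    assume *: "0 \<in> A" "1 \<notin> A" "2 \<notin> A" "3 \<notin> A"
    show ?thesis using x(2)[of 0] * eqs by (intro key[of "{1,2,3}"]) simp_all
  next
    assume *: "0 \<notin> A" "1 \<in> A" "2 \<in> A" "3 \<in> A"
    show ?thesis using x * le3 by (intro key[OF tr[of 0]]) auto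
  next
    assume *: "0 \<notin> A" "1 \<in> A" "2 \<in> A" "3 \<notin> A"
    show ?thesis using x * by (intro key[OF stab_1_2]) auto
  next
    assume *: "0 \<notin> A" "1 \<in> A" "2 \<notin> A" "3 \<in> A"
    show ?thesis using x * by (intro key[OF f13]) auto
  next
    assume *: "0 \<notin> A" "1 \<in> A" "2 \<notin> A" "3 \<notin> A"
    show ?thesis using x(2)[of 1] * eqs by (intro key[of "{0,2,3}"]) simp_all
  next
    assume *: "0 \<notin> A" "1 \<notin> A" "2 \<in> A" "3 \<in> A"
    show ?thesis using x * by (intro key[OF stab_2_3]) auto
  next
    assume *: "0 \<notin> A" "1 \<notin> A" "2 \<in> A" "3 \<notin> A"
    show ?thesis using x(2)[of 2] * eqs by (intro key[of "{0,1,3}"]) simp_all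
  next
    assume *: "0 \<notin> A" "1 \<notin> A" "2 \<notin> A" "3 \<in> A"
    show ?thesis using x(2)[of 3] * eqs by (intro key[of "{0,1,2}"]) simp_all
  next
    assume *: "0 \<notin> A" "1 \<notin> A" "2 \<notin> A" "3 \<notin> A"
    have "j \<notin> A" for j using A * le3[of j] by (cases "j \<le> 3") auto
    then have "A = {}" by blast
    then show ?thesis using x by simp
  qed
qed

end

section \<open>When the coset geometry is a polytope\<close>

context coset_geometry
begin

lemma below_chain: "(F, H) \<in> below geometry \<Longrightarrow> {F, H} \<in> Chains (below geometry)"
  unfolding Chains_def by (auto simp: below_geometry mix_face_le_refl)

lemma below_fl:
  assumes "(F, H) \<in> below geometry"
  obtains g where "g \<in> full" "F \<in> fl g" "H \<in> fl g"
  using chain_in_fl[OF below_chain[OF assms]] by auto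

lemma below_rank: "\<lbrakk>(F, H) \<in> below geometry; F \<noteq> H\<rbrakk> \<Longrightarrow> rk geometry F < rk geometry H"
  unfolding rk_geometry using below_geometry[of F H] face_geometryE
  by (cases F; cases H) (auto elim!: face_geometryE)

lemma below_trans:
  assumes FG: "(F, G') \<in> below geometry" and GH: "(G', H) \<in> below geometry"
  shows "(F, H) \<in> below geometry"
proof -
  have F: "F \<in> faces geometry" and H: "H \<in> faces geometry" using assms below_geometry by auto
  show ?thesis
  proof (cases "F = G' \<or> G' = H \<or> F = Least_Face \<or> H = Greatest_Face")
    case True
    have "mix_face_le F Greatest_Face" by (cases F) auto
    then show ?thesis using True assms F H below_geometry by auto
  next
    case False
    have less: "mix_face_rank 4 F < mix_face_rank 4 G'" "mix_face_rank 4 G' < mix_face_rank 4 H"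
      using below_rank[OF FG] below_rank[OF GH] False by (auto simp: rk_geometry)
    obtain i A where i: "F = Face i A"
      using False FG less by (cases F; cases G') (auto simp: below_geometry)
    obtain j B where j: "G' = Face j B"
      using i less FG GH False by (cases G'; cases H) (auto simp: below_geometry)
    obtain k D where k: "H = Face k D"
      using j less GH False by (cases H) (auto simp: below_geometry)
    have ijk: "i < j" "j < k" using less i j k by auto
    obtain x where x: "i \<le> 3" "x \<in> full" "A = fc i x" using F i face_geometryE by metis
    obtain h where h: "h \<in> full" "G' \<in> fl h" "H \<in> fl h" using below_fl[OF GH] .
    have B: "j \<le> 3" "B = fc j h" and D: "k \<le> 3" "D = fc k h" using h j k Face_in_fl by auto
    have "fc i x \<inter> fc j h \<noteq> {}" using FG i j ijk x B by (auto simp: below_geometry)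
    then obtain y where y: "y \<in> full" "same i y x" "same j y h"
      using iffD1[OF fc_meet_iff[OF x(2) h(1) x(1) B(1)]] by blast
    obtain g where g: "g \<in> full" "same i g x" "\<And>k. \<lbrakk>j \<le> k; k \<le> 3\<rbrakk> \<Longrightarrow> same k g h"
      using same_extend[OF ijk(1) B(1) x(2) h(1) y] by blast
    have "fc i x \<inter> fc k h \<noteq> {}"
      using fc_meet_iff[OF x(2) h(1) x(1) D(1)] g ijk D by auto
    then show ?thesis using F H i k x D ijk by (simp add: below_geometry)
  qed
qed

lemma geometry_order: "partial_order_on (faces geometry) (below geometry)"
  unfolding partial_order_on_def preorder_on_def
proof (intro conjI)
  show "below geometry \<subseteq> faces geometry \<times> faces geometry" using below_geometry by auto
  show "refl_on (faces geometry) (below geometry)"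
    unfolding refl_on_def by (simp add: below_geometry mix_face_le_refl)
  show "trans (below geometry)" using below_trans unfolding trans_def by blast
  show "antisym (below geometry)"
    using below_rank unfolding antisym_def by (metis less_asym)
qed

lemma r_full: "i \<le> 3 \<Longrightarrow> r i \<in> full" by (rule W_gen) simp

lemma r_mult_full: "\<lbrakk>i \<le> 3; g \<in> full\<rbrakk> \<Longrightarrow> r i \<otimes> g \<in> full" using r_full W_mult by blast

lemma fc_gen_iff: "\<lbrakk>i \<le> 3; j \<le> 3; g \<in> full\<rbrakk> \<Longrightarrow> fc j (r i \<otimes> g) = fc j g \<longleftrightarrow> i \<noteq> j"
proof -
  assume *: "i \<le> 3" "j \<le> 3" "g \<in> full"
  have g: "g \<in> carrier G" using * full_closed by blast
  have "same i (r i \<otimes> g) g \<longleftrightarrow> r i \<in> stab i" unfolding same_def using * g by (simp add: m_assoc)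
  then show ?thesis using fc_eq_iff[OF r_mult_full[OF *(1,3)] *(3,2)] same_gen[of i j g] * g notin by auto
qed

lemma fl_adjacent:
  assumes "i \<le> 3" "g \<in> full"
  shows "fl g - fl (r i \<otimes> g) = {Face i (fc i g)}" "fl (r i \<otimes> g) - fl g = {Face i (fc i (r i \<otimes> g))}"
proof -
  have "Face j C \<in> fl g - fl (r i \<otimes> g) \<longleftrightarrow> Face j C = Face i (fc i g)"
    "Face j C \<in> fl (r i \<otimes> g) - fl g \<longleftrightarrow> Face j C = Face i (fc i (r i \<otimes> g))" for j C
    using fc_gen_iff[OF assms(1) _ assms(2), of j] assms(1) unfolding Diff_iff Face_in_fl by auto
  moreover have "Least_Face \<in> fl h" "Greatest_Face \<in> fl h" for h by (simp_all add: fl_def)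
  ultimately have "F \<in> fl g - fl (r i \<otimes> g) \<longleftrightarrow> F = Face i (fc i g)"
    "F \<in> fl (r i \<otimes> g) - fl g \<longleftrightarrow> F = Face i (fc i (r i \<otimes> g))" for F
    by (cases F; simp)+
  then show "fl g - fl (r i \<otimes> g) = {Face i (fc i g)}" "fl (r i \<otimes> g) - fl g = {Face i (fc i (r i \<otimes> g))}"
    by blast+
qed

lemma card_fl: "card (fl g) = 6"
proof -
  have "{Face j (fc j g) | j. j \<le> 3} = {Face 0 (fc 0 g), Face 1 (fc 1 g), Face 2 (fc 2 g), Face 3 (fc 3 g)}"
    unfolding le_3_iff by blast
  then show ?thesis unfolding fl_def by simp
qed

lemma diamond:
  assumes FH: "(F, H) \<in> below geometry" and rF: "mix_face_rank 4 F = int j - 1"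
    and rH: "mix_face_rank 4 H = int j + 1" and j: "j \<le> 3"
  shows "card {K \<in> faces geometry. mix_face_rank 4 K = int j \<and> (F, K) \<in> below geometry \<and> (K, H) \<in> below geometry} = 2"
proof -
  obtain g where g: "g \<in> full" "F \<in> fl g" "H \<in> fl g" using below_fl[OF FH] .
  let ?S = "{K \<in> faces geometry. mix_face_rank 4 K = int j \<and> (F, K) \<in> below geometry \<and> (K, H) \<in> below geometry}"
  have gc: "g \<in> carrier G" using g full_closed by blast
  have rg: "r j \<otimes> g \<in> full" using r_mult_full[OF j g(1)] .
  have other: "K \<in> fl (r j \<otimes> g)" if "K \<in> fl g" "mix_face_rank 4 K \<noteq> int j" for K
  proof (rule ccontr)
    assume "K \<notin> fl (r j \<otimes> g)"
    then have "K \<in> {Face j (fc j g)}" using that(1) fl_adjacent(1)[OF j g(1)] by blast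
    then show False using that(2) by simp
  qed
  have mem: "Face j (fc j h) \<in> ?S" if h: "h \<in> full" "F \<in> fl h" "H \<in> fl h" for h
  proof -
    have K: "Face j (fc j h) \<in> fl h" using Face_in_fl j by simp
    have "(F, Face j (fc j h)) \<in> below geometry" by (rule fl_le[OF h(1,2) K]) (simp add: rF)
    moreover have "(Face j (fc j h), H) \<in> below geometry" by (rule fl_le[OF h(1) K h(3)]) (simp add: rH)
    ultimately show ?thesis using face_in_geometry[OF j h(1)] by simp
  qed
  have "?S = {Face j (fc j g), Face j (fc j (r j \<otimes> g))}"
  proof
    show "{Face j (fc j g), Face j (fc j (r j \<otimes> g))} \<subseteq> ?S"
      using mem[OF g] mem[OF rg other[OF g(2)] other[OF g(3)]] rF rH by simp
    show "?S \<subseteq> {Face j (fc j g), Face j (fc j (r j \<otimes> g))}"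
    proof
      fix K assume K: "K \<in> ?S"
      then have "{F, K, H} \<in> Chains (below geometry)"
        using FH unfolding Chains_def by (auto simp: below_geometry mix_face_le_refl)
      then obtain h where h: "h \<in> full" "{F, K, H} \<subseteq> fl h" using chain_in_fl by blast
      have hc: "h \<in> carrier G" using h full_closed by blast
      obtain C where "K = Face j C" using K j by (cases K) auto
      then have KC: "K = Face j (fc j h)" using h Face_in_fl by auto
      let ?a = "h \<otimes> inv g"
      have "?a \<in> stab (j - 1)" if h1: "1 \<le> j"
      proof -
        obtain C where "F = Face (j - 1) C" using rF h1 j by (cases F) auto
        then have "fc (j - 1) h = fc (j - 1) g" using g h Face_in_fl by auto
        then show ?thesis using fc_eq_iff[OF h(1) g(1)] j unfolding same_def by simp
      qed
      moreover have "?a \<in> stab (j + 1)" if h2: "j \<le> 2"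
      proof -
        obtain C where "H = Face (j + 1) C" using rH h2 by (cases H) auto
        then have "fc (j + 1) h = fc (j + 1) g" using g h Face_in_fl by auto
        then show ?thesis using fc_eq_iff[OF h(1) g(1), of "j + 1"] h2 unfolding same_def by simp
      qed
      moreover have "?a \<in> full" using h g W_mult W_inv by simp
      ultimately obtain b where b: "b \<in> stab j" "?a = b \<or> ?a = b \<otimes> r j"
        using diamond_group[OF j] by blast
      have bc: "b \<in> carrier G" using b stab_closed by blast
      have "h = ?a \<otimes> g" using hc gc by (simp add: m_assoc)
      then have "h = b \<otimes> g \<or> h = b \<otimes> (r j \<otimes> g)" using b(2) bc gc j m_assoc r_closed by metis
      then have "same j h g \<or> same j h (r j \<otimes> g)"
        using sameI[OF b(1) gc] sameI[OF b(1), of "r j \<otimes> g"] gc j by auto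
      then show "K \<in> {Face j (fc j g), Face j (fc j (r j \<otimes> g))}"
        using fc_eq_iff[OF h(1) g(1) j] fc_eq_iff[OF h(1) rg j] KC by auto
    qed
  qed
  moreover have "fc j g \<noteq> fc j (r j \<otimes> g)" using fc_gen_iff[OF j j g(1)] by simp
  ultimately show ?thesis by simp
qed

text \<open>
  A word in the generators of the parabolic subgroup fixing the common faces is a path between the
  two flags.
\<close>
lemma connected_if:
  assumes ip: "stab 0 \<inter> stab 3 \<subseteq> W {1, 2}"
  shows "strongly_flag_connected geometry"
  unfolding strongly_flag_connected_def flags_geometry
proof (intro ballI)
  fix A B assume "A \<in> fl ` full" "B \<in> fl ` full"
  then obtain g h where g: "g \<in> full" "A = fl g" and h: "h \<in> full" "B = fl h" by blast
  have c: "g \<in> carrier G" "h \<in> carrier G" using g h full_closed by auto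
  define J where "J = {j. j \<le> 3 \<and> fc j h = fc j g}"
  let ?R = "\<lambda>X Y. X \<in> fl ` full \<and> Y \<in> fl ` full \<and> adjacent_flags X Y \<and> A \<inter> B \<subseteq> X \<and> A \<inter> B \<subseteq> Y"
  have AB: "A \<inter> B \<subseteq> {Least_Face, Greatest_Face} \<union> {Face j (fc j g) | j. j \<in> J}"
    unfolding J_def g h fl_def by auto
  have x: "h \<otimes> inv g \<in> W ({0..3} - J)"
  proof (rule intersection_property[OF ip])
    show "h \<otimes> inv g \<in> full" using h g W_mult W_inv by simp
    show "h \<otimes> inv g \<in> stab j" if "j \<in> J" for j
      using that fc_eq_iff[OF h(1) g(1)] unfolding J_def same_def by auto
  qed (auto simp: J_def)
  have "x \<otimes> g \<in> full \<and> (\<forall>j \<in> J. fc j (x \<otimes> g) = fc j g) \<and> ?R\<^sup>*\<^sup>* A (fl (x \<otimes> g))"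
    if "x \<in> W ({0..3} - J)" for x
    using that Diff_subset
  proof (induction rule: W_induct)
    case one
    then show ?case using g c by simp
  next
    case (mult i y)
    have yc: "y \<in> carrier G" using mult(2) by (rule W_closed) auto
    have i: "i \<le> 3" "i \<notin> J" using mult by auto
    let ?y = "y \<otimes> g"
    have eq: "(r i \<otimes> y) \<otimes> g = r i \<otimes> ?y" using i yc c by (simp add: m_assoc)
    have full: "?y \<in> full" "r i \<otimes> ?y \<in> full" using mult r_mult_full i by auto
    have fcJ: "fc j (r i \<otimes> ?y) = fc j g" if "j \<in> J" for j
      using fc_gen_iff[OF i(1) _ full(1), of j] that i mult unfolding J_def by auto
    have sub: "{Least_Face, Greatest_Face} \<union> {Face j (fc j g) | j. j \<in> J} \<subseteq> fl z"
      if "\<forall>j \<in> J. fc j z = fc j g" for z using that unfolding fl_def J_def by auto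
    have "adjacent_flags (fl ?y) (fl (r i \<otimes> ?y))"
      unfolding adjacent_flags_def using fl_adjacent[OF i(1) full(1)] by simp
    moreover have "A \<inter> B \<subseteq> fl ?y" "A \<inter> B \<subseteq> fl (r i \<otimes> ?y)"
      using order_trans[OF AB sub[of ?y]] order_trans[OF AB sub[of "r i \<otimes> ?y"]] mult(3) fcJ by simp_all
    ultimately have step: "?R (fl ?y) (fl (r i \<otimes> ?y))" using full by simp
    have base: "?R\<^sup>*\<^sup>* A (fl ?y)" using mult(3) by simp
    have "?R\<^sup>*\<^sup>* A (fl (r i \<otimes> ?y))" 
      by (rule rtranclp.rtrancl_into_rtrancl, rule base, rule step)
    then show ?case using eq full fcJ by simp
  qed
  note conjunct2[OF conjunct2[OF this[OF x]]]
  moreover have "(h \<otimes> inv g) \<otimes> g = h" using c by (simp add: m_assoc)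
  ultimately show "?R\<^sup>*\<^sup>* A B" using h by simp
qed

text \<open>
  The flags of \<open>1\<close> and of \<open>x\<close> share their vertex and their facet, so a path between them inside
  that section uses only the generators 1 and 2.
\<close>
lemma connected_only_if:
  assumes conn: "strongly_flag_connected geometry"
  shows "stab 0 \<inter> stab 3 \<subseteq> W {1, 2}"
proof
  fix x assume x: "x \<in> stab 0 \<inter> stab 3"
  have xf: "x \<in> full" using x stab_full by blast
  have of: "\<one> \<in> full" by simp
  let ?A = "fl \<one>" and ?B = "fl x"
  have "fc j x = fc j \<one>" if "x \<in> stab j" "j \<le> 3" for j
    using fc_eq_iff[OF xf of that(2)] that stab_closed unfolding same_def by simp
  then have common: "Face 0 (fc 0 \<one>) \<in> ?A \<inter> ?B" "Face 3 (fc 3 \<one>) \<in> ?A \<inter> ?B"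
    using x Face_in_fl by auto
  let ?R = "\<lambda>X Y. X \<in> flags geometry \<and> Y \<in> flags geometry \<and> adjacent_flags X Y \<and> ?A \<inter> ?B \<subseteq> X \<and> ?A \<inter> ?B \<subseteq> Y"
  have "?R\<^sup>*\<^sup>* ?A ?B" using conn xf of unfolding strongly_flag_connected_def flags_geometry by blast
  then have "\<exists>y \<in> W {1, 2}. ?B = fl y"
  proof (induction rule: rtranclp_induct)
    case base
    show ?case by (rule bexI[of _ "\<one>"]) auto
  next
    case (step X Y)
    then obtain y where y: "y \<in> W {1, 2}" "X = fl y" by blast
    obtain z where z: "z \<in> full" "Y = fl z" using step(2) unfolding flags_geometry by blast
    have yf: "y \<in> full" using y W_mono[of "{1,2}" "{0..3}"] by auto
    have c: "y \<in> carrier G" "z \<in> carrier G" using yf z full_closed by auto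
    have 03: "fc 0 z = fc 0 y" "fc 3 z = fc 3 y"
    proof -
      have "Face 0 (fc 0 \<one>) \<in> fl y" "Face 0 (fc 0 \<one>) \<in> fl z"
        "Face 3 (fc 3 \<one>) \<in> fl y" "Face 3 (fc 3 \<one>) \<in> fl z"
        using step(2) common unfolding y(2) z(2) by blast+
      then show "fc 0 z = fc 0 y" "fc 3 z = fc 3 y" unfolding Face_in_fl by simp_all
    qed
    have "fc 1 z = fc 1 y \<or> fc 2 z = fc 2 y"
    proof (rule ccontr)
      assume "\<not> ?thesis"
      then have "{Face 1 (fc 1 y), Face 2 (fc 2 y)} \<subseteq> X - Y" using y z Face_in_fl by auto
      moreover have "finite (X - Y)" using y card_fl[of y] by (metis card.infinite finite_Diff zero_neq_numeral)
      ultimately have "card {Face 1 (fc 1 y), Face 2 (fc 2 y)} \<le> card (X - Y)" using card_mono by blast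
      then show False using step(2) unfolding adjacent_flags_def by simp
    qed
    then obtain i where i: "i \<in> {1, 2}" "\<And>j. \<lbrakk>j \<le> 3; j \<noteq> i\<rbrakk> \<Longrightarrow> fc j z = fc j y"
      using 03 unfolding le_3_iff by (metis insertI1 insertI2 singletonI)
    have "z \<otimes> inv y \<in> stab j" if "j \<le> 3" "j \<noteq> i" for j
      using fc_eq_iff[OF z(1) yf that(1)] i(2)[OF that] unfolding same_def by simp
    then have "z \<otimes> inv y = \<one> \<or> z \<otimes> inv y = r i" using triple[of i "z \<otimes> inv y"] i by auto
    moreover have "z = (z \<otimes> inv y) \<otimes> y" using c by (simp add: m_assoc)
    ultimately have "z = y \<or> z = r i \<otimes> y" using c by (metis l_one)
    then have "z \<in> W {1, 2}" using y W_gen[OF i(1)] W_mult by auto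
    then show ?case using z by blast
  qed
  then obtain y where "y \<in> W {1, 2}" "?B = fl y" by blast
  moreover have "y \<in> full" using \<open>y \<in> W {1, 2}\<close> W_mono[of "{1,2}" "{0..3}"] by auto
  ultimately show "x \<in> W {1, 2}" using fl_inj[OF xf, of y] by auto
qed

theorem geometry_polytope_iff:
  "abstract_polytope 4 geometry \<longleftrightarrow> stab 0 \<inter> stab 3 \<subseteq> W {1, 2}"
proof
  assume "abstract_polytope 4 geometry"
  then show "stab 0 \<inter> stab 3 \<subseteq> W {1, 2}" unfolding abstract_polytope_def using connected_only_if by blast
next
  assume ip: "stab 0 \<inter> stab 3 \<subseteq> W {1, 2}"
  have ranks: "-1 \<le> mix_face_rank 4 F \<and> mix_face_rank 4 F \<le> 4" if "F \<in> faces geometry" for F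
    using that by (cases F) (auto elim!: face_geometryE)
  have least: "F = Least_Face" if "F \<in> faces geometry" "mix_face_rank 4 F = -1" for F
    using that by (cases F) auto
  have greatest: "F = Greatest_Face" if "F \<in> faces geometry" "mix_face_rank 4 F = 4" for F
    using that by (cases F) (auto elim!: face_geometryE)
  have LG: "Least_Face \<in> faces geometry" "Greatest_Face \<in> faces geometry"
    unfolding faces_geometry by auto
  have le: "mix_face_le Least_Face F" "mix_face_le F Greatest_Face" for F by (cases F; simp)+
  have anti: "F = H" if "(F, H) \<in> below geometry" "(H, F) \<in> below geometry" for F H
    using below_rank[OF that(1)] below_rank[OF that(2)] by force
  show "abstract_polytope 4 geometry"
    unfolding abstract_polytope_def rk_geometry
  proof (intro conjI)
    show "partial_order_on (faces geometry) (below geometry)" by (rule geometry_order)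
    show "\<forall>F \<in> faces geometry. -1 \<le> mix_face_rank 4 F \<and> mix_face_rank 4 F \<le> int 4" using ranks by simp
    show "\<forall>(F, H) \<in> below geometry. F \<noteq> H \<longrightarrow> mix_face_rank 4 F < mix_face_rank 4 H"
      using below_rank by (auto simp: rk_geometry)
    show "\<exists>!F. F \<in> faces geometry \<and> (\<forall>H \<in> faces geometry. (F, H) \<in> below geometry)"
      by (rule ex1I[of _ Least_Face]) (use LG le anti in \<open>auto simp: below_geometry\<close>)
    show "\<exists>!F. F \<in> faces geometry \<and> mix_face_rank 4 F = -1"
      by (rule ex1I[of _ Least_Face]) (use LG least in auto)
    show "\<exists>!F. F \<in> faces geometry \<and> (\<forall>H \<in> faces geometry. (H, F) \<in> below geometry)"
      by (rule ex1I[of _ Greatest_Face]) (use LG le anti in \<open>auto simp: below_geometry\<close>)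
    show "\<exists>!F. F \<in> faces geometry \<and> mix_face_rank 4 F = int 4"
      by (rule ex1I[of _ Greatest_Face]) (use LG greatest in auto)
    show "\<forall>\<Phi> \<in> flags geometry. card \<Phi> = 4 + 2" using card_fl by (auto simp: flags_geometry)
    show "strongly_flag_connected geometry" by (rule connected_if[OF ip])
    show "\<forall>j F H. (F, H) \<in> below geometry \<and> mix_face_rank 4 F = j - 1 \<and> mix_face_rank 4 H = j + 1 \<longrightarrow>
        card {K \<in> faces geometry. mix_face_rank 4 K = j \<and> (F, K) \<in> below geometry \<and> (K, H) \<in> below geometry} = 2"
    proof (intro allI impI)
      fix j F H
      assume *: "(F, H) \<in> below geometry \<and> mix_face_rank 4 F = j - 1 \<and> mix_face_rank 4 H = j + 1"
      then have "F \<in> faces geometry" "H \<in> faces geometry" using below_geometry by auto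
      then have "0 \<le> j" "j \<le> 3" using ranks[of F] ranks[of H] * by auto
      then obtain n where "j = int n" "n \<le> 3" by (metis nat_0_le nat_le_iff of_nat_numeral)
      then show "card {K \<in> faces geometry. mix_face_rank 4 K = j \<and> (F, K) \<in> below geometry \<and> (K, H) \<in> below geometry} = 2"
        using diamond[of F H n] * by simp
    qed
  qed
qed

end

section \<open>Generating rotations\<close>

text \<open>
  The relations rewrite every word to one of the twelve forms \<open>b\<^sup>i\<close>, \<open>b\<^sup>i a b\<^sup>j\<close>; conversely the order
  is divisible by \<open>6\<close> and exceeds \<open>6\<close>, since three cosets of \<open>\<langle>b\<rangle>\<close> are distinct.
\<close>
lemma (in group) tetrahedral_card:
  assumes c: "a \<in> carrier G" "b \<in> carrier G"
    and a3: "a \<otimes> (a \<otimes> a) = \<one>" and b3: "b \<otimes> (b \<otimes> b) = \<one>"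
    and ab2: "a \<otimes> (b \<otimes> (a \<otimes> b)) = \<one>" and ab: "a \<otimes> b \<noteq> \<one>"
  shows "card (generate G {a, b}) = 12"
proof -
  let ?H = "generate G {a, b}"
  have ext: "u \<otimes> (v \<otimes> x) = w \<otimes> x" if "u \<otimes> v = w" "u \<in> carrier G" "v \<in> carrier G" "x \<in> carrier G" for u v w x
    using that by (simp flip: m_assoc)
  have bbb: "b \<otimes> (b \<otimes> (b \<otimes> x)) = x" if "x \<in> carrier G" for x
  proof -
    have "b \<otimes> (b \<otimes> (b \<otimes> x)) = (b \<otimes> (b \<otimes> b)) \<otimes> x" using c that by (simp add: m_assoc)
    then show ?thesis using b3 that by simp
  qed
  have inva: "inv a = a \<otimes> a" by (rule inv_equality) (use c a3 in \<open>simp_all add: m_assoc\<close>)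
  have inva': "inv a = b \<otimes> (a \<otimes> b)"
    by (rule inv_equality) (use inv_comm[OF ab2] c in \<open>simp_all add: m_assoc\<close>)
  have aa: "a \<otimes> a = b \<otimes> (a \<otimes> b)" using inva inva' by simp
  have aax: "a \<otimes> (a \<otimes> x) = b \<otimes> (a \<otimes> (b \<otimes> x))" if "x \<in> carrier G" for x
    using ext[OF aa c(1) c(1) that] c that by (simp add: m_assoc)
  have invb: "inv b = b \<otimes> b" by (rule inv_equality) (use c b3 in \<open>simp_all add: m_assoc\<close>)
  have invb': "inv b = a \<otimes> (b \<otimes> a)" by (rule inv_equality) (use ab2 c in \<open>simp_all add: m_assoc\<close>)
  have aba: "a \<otimes> (b \<otimes> a) = b \<otimes> b" using invb invb' by simp
  have abax: "a \<otimes> (b \<otimes> (a \<otimes> x)) = b \<otimes> (b \<otimes> x)" if "x \<in> carrier G" for x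
  proof -
    have "(a \<otimes> (b \<otimes> a)) \<otimes> x = (b \<otimes> b) \<otimes> x" unfolding aba ..
    then show ?thesis using c that by (simp add: m_assoc)
  qed
  have abba: "a \<otimes> (b \<otimes> (b \<otimes> a)) = b \<otimes> (b \<otimes> (a \<otimes> (b \<otimes> b)))"
  proof -
    have "a \<otimes> (b \<otimes> (b \<otimes> a)) = a \<otimes> ((b \<otimes> b) \<otimes> a)" using c by (simp add: m_assoc)
    also have "\<dots> = a \<otimes> (a \<otimes> (b \<otimes> (a \<otimes> a)))" unfolding aba[symmetric] using c by (simp add: m_assoc)
    also have "\<dots> = b \<otimes> (a \<otimes> (b \<otimes> (b \<otimes> (b \<otimes> (a \<otimes> b)))))" unfolding aa using c by (simp add: aax)
    also have "\<dots> = b \<otimes> (b \<otimes> (a \<otimes> (b \<otimes> b)))" using c by (simp add: bbb aax)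
    finally show ?thesis .
  qed
  define xs where "xs = [\<one>, b, b \<otimes> b, a, a \<otimes> b, a \<otimes> (b \<otimes> b), b \<otimes> a, b \<otimes> (a \<otimes> b), b \<otimes> (a \<otimes> (b \<otimes> b)),
    b \<otimes> (b \<otimes> a), b \<otimes> (b \<otimes> (a \<otimes> b)), b \<otimes> (b \<otimes> (a \<otimes> (b \<otimes> b)))]"
  have xs_c: "y \<in> carrier G" if "y \<in> set xs" for y using that c by (auto simp: xs_def)
  have ya: "y \<otimes> a \<in> set xs" and yb: "y \<otimes> b \<in> set xs" if "y \<in> set xs" for y
    using that c unfolding xs_def by (auto simp: m_assoc aa aax aba abax abba bbb b3)
  have step: "\<forall>y \<in> set xs. y \<otimes> x \<in> set xs" if "x \<in> ?H" for x
    using that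
  proof induction
    case one
    then show ?case using xs_c by simp
  next
    case (incl h)
    then show ?case using ya yb by auto
  next
    case (inv h)
    have "y \<otimes> inv h = (y \<otimes> h) \<otimes> h" if "y \<in> set xs" for y
      using inv xs_c[OF that] c inva invb by (auto simp: m_assoc)
    then show ?case using inv ya yb by auto
  next
    case (eng h1 h2)
    have "h1 \<in> carrier G" "h2 \<in> carrier G" using eng c generate_in_carrier[of "{a, b}"] by auto
    then show ?case using eng xs_c by (simp flip: m_assoc)
  qed
  have HS: "?H \<subseteq> set xs"
  proof
    fix x assume x: "x \<in> ?H"
    then have "x \<in> carrier G" using c generate_in_carrier[of "{a, b}"] by auto
    then show "x \<in> set xs" using step[OF x] by (force simp: xs_def)
  qed
  then have fin: "finite ?H" and le: "card ?H \<le> 12"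
    using finite_subset[OF HS] card_mono[OF _ HS] card_length[of xs] by (simp_all add: xs_def)
  have sub: "subgroup ?H G" using c by (intro generate_is_subgroup) auto
  interpret H: group "G\<lparr>carrier := ?H\<rparr>" by (rule subgroup_imp_group[OF sub])
  have aH: "a \<in> ?H" "b \<in> ?H" by (auto intro: generate.incl)
  have b1: "b \<noteq> \<one>"
  proof
    assume "b = \<one>"
    then have "a \<otimes> a = \<one>" using ab2 c by simp
    then show False using a3 ab c \<open>b = \<one>\<close> by simp
  qed
  let ?B = "{\<one>, b, b \<otimes> b}"
  have Bsub: "subgroup ?B (G\<lparr>carrier := ?H\<rparr>)"
  proof (rule H.subgroupI)
    show "?B \<subseteq> carrier (G\<lparr>carrier := ?H\<rparr>)" using aH by (auto intro: generate.one generate.eng)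
    show "inv\<^bsub>G\<lparr>carrier := ?H\<rparr>\<^esub> x \<in> ?B" if x: "x \<in> ?B" for x
    proof -
      have "x \<in> ?H" using x aH by (auto intro: generate.one generate.eng)
      then have "inv\<^bsub>G\<lparr>carrier := ?H\<rparr>\<^esub> x = inv x" using m_inv_consistent[OF sub] by simp
      moreover have "inv (b \<otimes> b) = b" using invb c by (metis inv_inv)
      ultimately show ?thesis using x invb by auto
    qed
    show "x \<otimes>\<^bsub>G\<lparr>carrier := ?H\<rparr>\<^esub> y \<in> ?B" if "x \<in> ?B" "y \<in> ?B" for x y
      using that c by (auto simp: m_assoc b3 bbb)
  qed auto
  have cardB: "card ?B = 3"
  proof -
    have "b \<otimes> b \<noteq> \<one>" using b3 b1 c by (metis r_one)
    moreover have "b \<otimes> b \<noteq> b" using b1 c by simp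
    ultimately show ?thesis using b1 by simp
  qed
  have a_notin: "a \<notin> ?B"
  proof
    assume "a \<in> ?B"
    then consider "a = \<one>" | "a = b" | "a = b \<otimes> b" by auto
    then show False
    proof cases
      case 1
      then have "b \<otimes> b = \<one>" using ab2 c by simp
      then show False using b3 b1 c by simp
    next
      case 2
      then show False using ab2 b1 c by (simp add: bbb b3)
    next
      case 3
      then show False using ab b3 c by (simp add: m_assoc)
    qed
  qed
  let ?C = "\<lambda>x. ?B #>\<^bsub>G\<lparr>carrier := ?H\<rparr>\<^esub> x"
  have C: "?C x = {x, b \<otimes> x, b \<otimes> (b \<otimes> x)}" if "x \<in> ?H" for x
  proof -
    have "x \<in> carrier G" using that c generate_in_carrier[of "{a, b}"] by auto
    then show ?thesis using c unfolding r_coset_def by (auto simp: m_assoc)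
  qed
  have aaH: "a \<otimes> a \<in> ?H" "\<one> \<in> ?H" using aH by (auto intro: generate.one generate.eng)
  have C1: "?C \<one> = ?B" using C[OF aaH(2)] c by simp
  have in_C: "x \<in> ?C x" if "x \<in> ?H" for x using C[OF that] by blast
  have n1: "?C a \<noteq> ?C \<one>" using in_C[OF aH(1)] a_notin C1 by blast
  have n2: "?C (a \<otimes> a) \<noteq> ?C \<one>"
  proof
    assume "?C (a \<otimes> a) = ?C \<one>"
    then have *: "a \<otimes> a \<in> ?B" using in_C[OF aaH(1)] C1 by blast
    have "a = (a \<otimes> a) \<otimes> (a \<otimes> a)" using a3 c by (simp add: m_assoc)
    also have "\<dots> \<in> ?B" using subgroup.m_closed[OF Bsub * *] by simp
    finally show False using a_notin by blast
  qed
  have n3: "?C (a \<otimes> a) \<noteq> ?C a"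
  proof
    assume "?C (a \<otimes> a) = ?C a"
    then have "a \<otimes> a \<in> {a, b \<otimes> a, b \<otimes> (b \<otimes> a)}" using in_C[OF aaH(1)] C[OF aH(1)] by blast
    then have "a \<in> ?B" using c by (auto simp flip: m_assoc)
    then show False using a_notin by blast
  qed
  have "{?C \<one>, ?C a, ?C (a \<otimes> a)} \<subseteq> rcosets\<^bsub>G\<lparr>carrier := ?H\<rparr>\<^esub> ?B"
    using aH aaH unfolding RCOSETS_def by auto
  moreover have "finite (rcosets\<^bsub>G\<lparr>carrier := ?H\<rparr>\<^esub> ?B)"
    using fin unfolding RCOSETS_def by simp
  ultimately have "card {?C \<one>, ?C a, ?C (a \<otimes> a)} \<le> card (rcosets\<^bsub>G\<lparr>carrier := ?H\<rparr>\<^esub> ?B)" by (rule card_mono[rotated])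
  then have m3: "3 \<le> card (rcosets\<^bsub>G\<lparr>carrier := ?H\<rparr>\<^esub> ?B)" using n1 n2 n3 by simp
  have lag: "card (rcosets\<^bsub>G\<lparr>carrier := ?H\<rparr>\<^esub> ?B) * 3 = card ?H"
    using H.lagrange[OF Bsub] cardB by (simp add: order_def)
  have "even (card ?H)"
  proof -
    let ?D = "{\<one>, a \<otimes> b}"
    have abH: "a \<otimes> b \<in> ?H" using aH by (rule generate.eng)
    have inv_ab: "inv (a \<otimes> b) = a \<otimes> b" by (rule inv_equality) (use ab2 c in \<open>simp_all add: m_assoc\<close>)
    have "subgroup ?D (G\<lparr>carrier := ?H\<rparr>)"
    proof (rule H.subgroupI)
      show "?D \<subseteq> carrier (G\<lparr>carrier := ?H\<rparr>)" using abH aaH by auto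
      show "inv\<^bsub>G\<lparr>carrier := ?H\<rparr>\<^esub> x \<in> ?D" if "x \<in> ?D" for x
        using that abH aaH m_inv_consistent[OF sub, of x] inv_ab by auto
      show "x \<otimes>\<^bsub>G\<lparr>carrier := ?H\<rparr>\<^esub> y \<in> ?D" if "x \<in> ?D" "y \<in> ?D" for x y
        using that c ab2 by (auto simp: m_assoc)
    qed auto
    from H.lagrange[OF this] have "card (rcosets\<^bsub>G\<lparr>carrier := ?H\<rparr>\<^esub> ?D) * card ?D = card ?H" by (simp add: order_def)
    moreover have "card ?D = 2" using ab by simp
    ultimately show ?thesis by (metis even_mult_iff even_numeral)
  qed
  then show ?thesis using lag m3 le by presburger
qed

context string_group
begin

definition s :: "nat \<Rightarrow> 'a" where "s i = r (i - 1) \<otimes> r i"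

lemma s_closed [simp]: "i \<le> 3 \<Longrightarrow> s i \<in> carrier G"
  unfolding s_def by simp

lemma E_interval:
  assumes "b \<le> 3"
  shows "E {a..b} = generate G (s ` {a<..b})"
proof
  have sub: "{a..b} \<subseteq> {0..3}" using assms by auto
  have sc: "s ` {a<..b} \<subseteq> carrier G" using assms by auto
  have gen: "s ` {a<..b} \<subseteq> E {a..b}"
  proof (rule image_subsetI)
    fix i assume "i \<in> {a<..b}"
    then have "i - 1 \<in> {a..b}" "i \<in> {a..b}" by auto
    then show "s i \<in> E {a..b}" unfolding s_def by (rule E_gen[OF _ _ sub])
  qed
  show "generate G (s ` {a<..b}) \<subseteq> E {a..b}" using generate_subgroup_incl[OF gen E_subgroup[OF sub]] .
  have "r i \<otimes> r k \<in> generate G (s ` {a<..b})" if "i < k" "a \<le> i" "k \<le> b" for i k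
    using that
  proof (induction k)
    case (Suc k)
    have sk: "s (Suc k) \<in> generate G (s ` {a<..b})" using Suc.prems by (intro generate.incl) auto
    show ?case
    proof (cases "i = k")
      case True
      then show ?thesis using sk by (simp add: s_def)
    next
      case False
      then have ik: "r i \<otimes> r k \<in> generate G (s ` {a<..b})" using Suc by simp
      have "i \<le> 3" "k \<le> 3" "Suc k \<le> 3" using Suc.prems assms by auto
      then have "r i \<otimes> r (Suc k) = (r i \<otimes> r k) \<otimes> s (Suc k)" by (simp add: s_def m_assoc)
      then show ?thesis using generate.eng[OF ik sk] by simp
    qed
  qed simp
  then have "{r i \<otimes> r k | i k. i \<in> {a..b} \<and> k \<in> {a..b} \<and> i < k} \<subseteq> generate G (s ` {a<..b})" by auto
  then show "E {a..b} \<subseteq> generate G (s ` {a<..b})"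
    unfolding E_def by (rule generate_subgroup_incl) (rule generate_is_subgroup[OF sc])
qed

text \<open>The product of consecutive rotations is a product of two commuting involutions.\<close>
lemma s_square:
  assumes "1 \<le> i" "i < 3"
  shows "s i \<otimes> (s (Suc i) \<otimes> (s i \<otimes> s (Suc i))) = \<one>"
proof -
  have i: "i - 1 \<le> 3" "i \<le> 3" "Suc i \<le> 3" "i - 1 + 2 \<le> Suc i" using assms by auto
  have ss: "s i \<otimes> (s (Suc i) \<otimes> x) = r (i - 1) \<otimes> (r (Suc i) \<otimes> x)" if "x \<in> carrier G" for x
    unfolding s_def using i that by (simp add: m_assoc)
  have "s i \<otimes> s (Suc i) = r (i - 1) \<otimes> r (Suc i)"
    unfolding s_def using i by (simp add: m_assoc)
  then have "s i \<otimes> (s (Suc i) \<otimes> (s i \<otimes> s (Suc i))) = r (i - 1) \<otimes> (r (Suc i) \<otimes> (r (i - 1) \<otimes> r (Suc i)))"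
    using ss[of "s i \<otimes> s (Suc i)"] i by simp
  also have "\<dots> = r (i - 1) \<otimes> (r (Suc i) \<otimes> (r (Suc i) \<otimes> r (i - 1)))" using r_comm[OF i(3,4)] by simp
  finally show ?thesis using i by simp
qed

end

lemma (in coset_geometry) s_prod_neq_one:
  assumes "1 \<le> i" "i < 3" shows "s i \<otimes> s (Suc i) \<noteq> \<one>"
proof
  assume "s i \<otimes> s (Suc i) = \<one>"
  moreover have i: "i - 1 \<le> 3" "i \<le> 3" "Suc i \<le> 3" "i - 1 \<noteq> Suc i" using assms by auto
  moreover have "s i \<otimes> s (Suc i) = r (i - 1) \<otimes> r (Suc i)" unfolding s_def using i by (simp add: m_assoc)
  ultimately have "r (i - 1) = r (Suc i)" by (metis inv_equality r_closed r_inv)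
  moreover have "r (i - 1) \<in> stab (Suc i)" using i by (intro W_gen) auto
  ultimately show False using notin[OF i(3)] by simp
qed

text \<open>The cyclic case of the edge stabilisers: the group of order \<open>2 ord s\<^sub>3\<close> is dihedral.\<close>
lemma (in coset_geometry) card_E_023:
  assumes fin: "finite full"
  shows "card (E ({0..3} - {1})) = 2 * ord (s 3)" "card (E ({0..3} - {2})) = 2 * ord (s 1)"
proof -
  have finJ: "finite (W J)" if "J \<subseteq> {0..3}" for J using W_mono[OF that] fin finite_subset by blast
  have cyc: "card (E {i..Suc i}) = ord (s (Suc i))" if "Suc i \<le> 3" for i
  proof -
    have "{i<..Suc i} = {Suc i}" by auto
    then have "E {i..Suc i} = generate G {s (Suc i)}" using E_interval[OF that, of i] by simp
    then show ?thesis using generate_pow_card[of "s (Suc i)"] that by simp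
  qed
  have double: "card (W J) = 2 * card (W K)"
    if JK: "J \<subseteq> {0..3}" "K \<subseteq> J" "i \<in> J" "r i \<notin> W K" "\<And>x. x \<in> W J \<Longrightarrow> x \<in> W K \<or> r i \<otimes> x \<in> W K" for i J K
  proof -
    have K: "K \<subseteq> {0..3}" using JK by blast
    have i: "i \<le> 3" using JK by auto
    have kc: "x \<in> carrier G" if "x \<in> W K" for x using W_closed[OF that K] .
    have "W J = W K \<union> (\<lambda>x. r i \<otimes> x) ` W K"
    proof
      show "W J \<subseteq> W K \<union> (\<lambda>x. r i \<otimes> x) ` W K"
      proof
        fix x assume x: "x \<in> W J"
        then have "x = r i \<otimes> (r i \<otimes> x)" using i W_closed[OF x JK(1)] by simp
        then show "x \<in> W K \<union> (\<lambda>x. r i \<otimes> x) ` W K" using JK(5)[OF x] by blast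
      qed
      show "W K \<union> (\<lambda>x. r i \<otimes> x) ` W K \<subseteq> W J"
        using W_mono[OF JK(2)] W_mult[OF W_gen[OF JK(3)]] by blast
    qed
    moreover have "W K \<inter> (\<lambda>x. r i \<otimes> x) ` W K = {}"
    proof -
      have False if x: "x \<in> W K" "r i \<otimes> x \<in> W K" for x
      proof -
        have "(r i \<otimes> x) \<otimes> inv x \<in> W K" using W_mult[OF x(2) W_inv[OF x(1) K]] .
        then show False using JK(4) i kc[OF x(1)] by (simp add: m_assoc)
      qed
      then show ?thesis by blast
    qed
    moreover have "inj_on (\<lambda>x. r i \<otimes> x) (W K)" using kc i by (intro inj_onI) simp
    ultimately show ?thesis using finJ[OF K] by (simp add: card_Un_disjoint card_image)
  qed
  have e1: "{0..<1} = {0::nat}" "{1<..3} = {2::nat..3}" "{0..<2} = {0::nat..1}" "{2<..3} = {3::nat}" by auto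
  have "card (W ({0..3} - {1})) = 2 * card (W {2..3})"
  proof (rule double[of _ _ 0])
    have "{2..3} \<subseteq> {0..3} - {0::nat}" by auto
    then show "r 0 \<notin> W {2..3}" using notin[of 0] W_mono by blast
    fix x assume x: "x \<in> W ({0..3} - {1})"
    obtain y z where "y \<in> W {0..<1}" "z \<in> W {1<..3}" "x = y \<otimes> z" by (rule W_split[OF _ x], simp, rule that; assumption)
    note yz = this[unfolded e1]
    have z: "z \<in> carrier G" using W_closed[OF yz(2)] by simp
    have "y = \<one> \<or> y = r 0" using W_single[OF _ yz(1)] by simp
    then show "x \<in> W {2..3} \<or> r 0 \<otimes> x \<in> W {2..3}" using yz z by auto
  qed auto
  moreover have "card (W {2..3}) = 2 * card (E {2..3})" by (rule card_W) (auto intro: finJ)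
  moreover have "card (W ({0..3} - {1})) = 2 * card (E ({0..3} - {1}))" by (rule card_W) (auto intro: finJ)
  ultimately show "card (E ({0..3} - {1})) = 2 * ord (s 3)" using cyc[of 2] by (simp add: eval_nat_numeral)
  have "card (W ({0..3} - {2})) = 2 * card (W {0..1})"
  proof (rule double[of _ _ 3])
    have "{0..1} \<subseteq> {0..3} - {3::nat}" by auto
    then show "r 3 \<notin> W {0..1}" using notin[of 3] W_mono by blast
    fix x assume x: "x \<in> W ({0..3} - {2})"
    obtain y z where "y \<in> W {0..<2}" "z \<in> W {2<..3}" "x = z \<otimes> y" by (rule W_split[OF _ x], simp, rule that; assumption)
    note yz = this[unfolded e1]
    have y: "y \<in> carrier G" using W_closed[OF yz(1)] by simp
    have "z = \<one> \<or> z = r 3" using W_single[OF _ yz(2)] by simp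
    then show "x \<in> W {0..1} \<or> r 3 \<otimes> x \<in> W {0..1}" using yz y by auto
  qed auto
  moreover have "card (W {0..1}) = 2 * card (E {0..1})" by (rule card_W) (auto intro: finJ)
  moreover have "card (W ({0..3} - {2})) = 2 * card (E ({0..3} - {2}))" by (rule card_W) (auto intro: finJ)
  ultimately show "card (E ({0..3} - {2})) = 2 * ord (s 1)" using cyc[of 0] by simp
qed

section \<open>Products of string groups\<close>

lemma (in string_group) hom_W_E:
  assumes h: "group_hom G H h" and H: "string_group H r'" and hr: "\<And>i. i \<le> 3 \<Longrightarrow> h (r i) = r' i"
    and J: "J \<subseteq> {0..3}"
  shows "h ` W J = string_group.W H r' J" "h ` E J = string_group.E H r' J"
proof -
  interpret h: group_hom G H h by (rule h)
  interpret H: string_group H r' by (rule H)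
  have "h ` (r ` J) = r' ` J" unfolding image_image by (rule image_cong) (use hr J in auto)
  moreover have "r ` J \<subseteq> carrier G" using J by auto
  ultimately show "h ` W J = H.W J" unfolding W_def H.W_def using h.generate_img[of "r ` J"] by simp
  have le: "i \<le> 3" if "i \<in> J" for i using that J by auto
  let ?K = "{r i \<otimes> r k | i k. i \<in> J \<and> k \<in> J \<and> i < k}"
  have "?K \<subseteq> carrier G" using le by auto
  moreover have "h ` ?K = {r' i \<otimes>\<^bsub>H\<^esub> r' k | i k. i \<in> J \<and> k \<in> J \<and> i < k}"
  proof -
    have e: "h (r i \<otimes> r k) = r' i \<otimes>\<^bsub>H\<^esub> r' k" if "i \<in> J" "k \<in> J" for i k
      using le[OF that(1)] le[OF that(2)] hr by simp
    have eqK: "?K = (\<lambda>(i, k). r i \<otimes> r k) ` {(i, k). i \<in> J \<and> k \<in> J \<and> i < k}" by auto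
    have "h ` ?K = (\<lambda>(i, k). r' i \<otimes>\<^bsub>H\<^esub> r' k) ` {(i, k). i \<in> J \<and> k \<in> J \<and> i < k}"
      unfolding eqK image_image by (intro image_cong) (auto simp: e)
    then show ?thesis by auto
  qed
  ultimately show "h ` E J = H.E J" unfolding E_def H.E_def using h.generate_img[of ?K] by simp
qed

locale mix_family =
  fixes I :: "'i set" and A :: "'i \<Rightarrow> 'b monoid" and \<rho> :: "'i \<Rightarrow> nat \<Rightarrow> 'b"
  assumes finI: "finite I" and neI: "I \<noteq> {}"
    and comp: "t \<in> I \<Longrightarrow> coset_geometry (A t) (\<rho> t)"
begin

abbreviation "PG \<equiv> product_group I A"
definition "rr i = (\<lambda>t\<in>I. \<rho> t i)"

lemma comp_string: "t \<in> I \<Longrightarrow> string_group (A t) (\<rho> t)"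
  by (rule coset_geometry.axioms(1)[OF comp])

lemma comp_group: "t \<in> I \<Longrightarrow> group (A t)"
  by (rule string_group.axioms(1)[OF comp_string])

lemma PG_group: "group PG"
  using comp_group by simp

lemma PG_eqI: "\<lbrakk>x \<in> carrier PG; y \<in> carrier PG; \<And>t. t \<in> I \<Longrightarrow> x t = y t\<rbrakk> \<Longrightarrow> x = y"
  by (auto intro: PiE_ext)

sublocale P: string_group PG rr
proof -
  interpret group PG by (rule PG_group)
  show "string_group PG rr"
  proof
    show "rr i \<in> carrier PG" if "i \<le> 3" for i
      using string_group.r_closed[OF comp_string that] by (auto simp: rr_def)
    show "rr i \<otimes>\<^bsub>PG\<^esub> rr i = \<one>\<^bsub>PG\<^esub>" if "i \<le> 3" for i
      using string_group.r_sq[OF comp_string that] by (auto simp: rr_def)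
    show "rr i \<otimes>\<^bsub>PG\<^esub> rr j = rr j \<otimes>\<^bsub>PG\<^esub> rr i" if "j \<le> 3" "i + 2 \<le> j" for i j
      using string_group.r_comm[OF comp_string that] by (auto simp: rr_def)
  qed
qed

lemma hom_component: assumes "t \<in> I" shows "group_hom PG (A t) (\<lambda>x. x t)"
proof -
  have "(\<lambda>x. x t) \<in> hom PG (A t)" using assms by (auto simp: hom_def)
  then show ?thesis using PG_group comp_group[OF assms] by (simp add: group_hom_def group_hom_axioms_def)
qed

abbreviation "Wc t \<equiv> string_group.W (A t) (\<rho> t)"
abbreviation "Ec t \<equiv> string_group.E (A t) (\<rho> t)"
abbreviation "sc t \<equiv> string_group.s (A t) (\<rho> t)"

lemma component_image:
  assumes "t \<in> I" "J \<subseteq> {0..3}"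
  shows "(\<lambda>x. x t) ` P.W J = Wc t J" "(\<lambda>x. x t) ` P.E J = Ec t J"
proof -
  have "(\<lambda>x. x t) (rr i) = \<rho> t i" for i using assms(1) by (simp add: rr_def)
  then show "(\<lambda>x. x t) ` P.W J = Wc t J" "(\<lambda>x. x t) ` P.E J = Ec t J"
    using P.hom_W_E[OF hom_component[OF assms(1)] comp_string[OF assms(1)] _ assms(2)] by blast+
qed

lemma component_W: "\<lbrakk>x \<in> P.W J; t \<in> I; J \<subseteq> {0..3}\<rbrakk> \<Longrightarrow> x t \<in> Wc t J"
  using component_image(1)[of t J] by (metis image_eqI)

lemma component_E: "\<lbrakk>x \<in> P.E J; t \<in> I; J \<subseteq> {0..3}\<rbrakk> \<Longrightarrow> x t \<in> Ec t J"
  using component_image(2)[of t J] by (metis image_eqI)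

lemma PG_mult: "t \<in> I \<Longrightarrow> (x \<otimes>\<^bsub>PG\<^esub> y) t = x t \<otimes>\<^bsub>A t\<^esub> y t"
  by simp

lemma PG_inv: "\<lbrakk>t \<in> I; x \<in> carrier PG\<rbrakk> \<Longrightarrow> (inv\<^bsub>PG\<^esub> x) t = inv\<^bsub>A t\<^esub> x t"
  using inv_product_group[of x I A] comp_group by simp

lemma PG_comp: "\<lbrakk>t \<in> I; x \<in> carrier PG\<rbrakk> \<Longrightarrow> x t \<in> carrier (A t)"
  by auto

sublocale P: coset_geometry PG rr
proof
  obtain t where t: "t \<in> I" using neI by blast
  interpret t: coset_geometry "A t" "\<rho> t" by (rule comp[OF t])
  show "rr 0 \<notin> P.even_part"
  proof
    assume "rr 0 \<in> P.even_part"
    then show False using component_E[OF _ t, of "rr 0"] t.odd t by (simp add: rr_def)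
  qed
  show "rr i \<notin> P.stab i" if "i \<le> 3" for i
  proof
    assume "rr i \<in> P.stab i"
    then show False using component_W[OF _ t, of "rr i" "{0..3} - {i}"] t.notin[OF that] t by (auto simp: rr_def)
  qed
  fix i x assume i: "i \<le> 3" and x: "\<And>j. \<lbrakk>j \<le> 3; j \<noteq> i\<rbrakk> \<Longrightarrow> x \<in> P.stab j"
  have ev: "y = \<one>\<^bsub>PG\<^esub>" if y: "y \<in> P.even_part" "\<And>j. \<lbrakk>j \<le> 3; j \<noteq> i\<rbrakk> \<Longrightarrow> y \<in> P.stab j" for y
  proof (rule PG_eqI)
    show "y \<in> carrier PG" using y(1) P.E_closed by blast
    show "\<one>\<^bsub>PG\<^esub> \<in> carrier PG" by (rule P.one_closed)
    fix u assume u: "u \<in> I"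
    interpret u: coset_geometry "A u" "\<rho> u" by (rule comp[OF u])
    have "y u \<in> u.stab j" if "j \<le> 3" "j \<noteq> i" for j using component_W[OF y(2)[OF that] u] by blast
    then have "y u = \<one>\<^bsub>A u\<^esub> \<or> y u = \<rho> u i" using u.triple[OF i] by blast
    moreover have "y u \<in> u.even_part" using component_E[OF y(1) u] by blast
    ultimately have "y u = \<one>\<^bsub>A u\<^esub>" using u.r_not_even[OF i] by metis
    then show "y u = \<one>\<^bsub>PG\<^esub> u" using u by simp
  qed
  obtain j :: nat where j: "j \<le> 3" "j \<noteq> i"
  proof (cases "i = 0")
    case True
    then show ?thesis using that[of 1] by simp
  qed (use that[of 0] in simp)
  have xf: "x \<in> P.full" using P.stab_full x[OF j] by blast
  have "x \<in> P.even_part \<or> rr i \<otimes>\<^bsub>PG\<^esub> x \<in> P.even_part"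
    using P.W_even_odd[of i "{0..3}" x] xf i by auto
  then show "x = \<one>\<^bsub>PG\<^esub> \<or> x = rr i"
  proof
    assume "x \<in> P.even_part"
    then show ?thesis using ev x by blast
  next
    assume e: "rr i \<otimes>\<^bsub>PG\<^esub> x \<in> P.even_part"
    have "rr i \<otimes>\<^bsub>PG\<^esub> x \<in> P.stab k" if "k \<le> 3" "k \<noteq> i" for k
      using P.W_mult[OF P.W_gen[of i "{0..3} - {k}"] x[OF that]] that i by auto
    then have "rr i \<otimes>\<^bsub>PG\<^esub> x = \<one>\<^bsub>PG\<^esub>" using ev[OF e] by blast
    moreover have "x \<in> carrier PG" using P.full_closed[OF xf] .
    ultimately have "x = rr i" using P.r_cancel[OF i, of x] P.r_closed[OF i] P.r_one by metis
    then show ?thesis by blast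
  qed
qed

lemma subfamily: assumes D: "D \<subseteq> I" "D \<noteq> {}" shows "mix_family D A \<rho>"
proof (rule mix_family.intro)
  show "finite D" using finite_subset[OF D(1) finI] .
  show "D \<noteq> {}" by (rule D(2))
  show "coset_geometry (A t) (\<rho> t)" if "t \<in> D" for t using comp D(1) that by (simp add: subset_iff)
qed

lemma P_s: "t \<in> I \<Longrightarrow> P.s i t = sc t i"
  using string_group.s_def[OF comp_string, of t i] by (simp add: P.s_def rr_def)

lemma restrict_image:
  assumes D: "D \<subseteq> I" "D \<noteq> {}" and J: "J \<subseteq> {0..3}"
  shows "(\<lambda>x. restrict x D) ` P.E J = string_group.E (product_group D A) (mix_family.rr D \<rho>) J"
proof -
  interpret D: mix_family D A \<rho> by (rule subfamily[OF D])
  have "(\<lambda>x. restrict x D) \<in> hom PG D.PG"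
  proof (rule homI)
    show "restrict x D \<in> carrier D.PG" if "x \<in> carrier PG" for x using that D(1) by auto
    show "restrict (x \<otimes>\<^bsub>PG\<^esub> y) D = restrict x D \<otimes>\<^bsub>D.PG\<^esub> restrict y D" for x y
      by (rule ext) (use D(1) in \<open>auto simp: restrict_def\<close>)
  qed
  then have gh: "group_hom PG D.PG (\<lambda>x. restrict x D)"
    using PG_group D.PG_group by (simp add: group_hom_def group_hom_axioms_def)
  have hr: "restrict (rr i) D = D.rr i" for i
    by (rule ext) (use D(1) in \<open>auto simp: rr_def D.rr_def restrict_def\<close>)
  show ?thesis by (rule P.hom_W_E(2)[OF gh D.P.string_group_axioms hr J])
qed

lemma PG_pow: "t \<in> I \<Longrightarrow> x \<in> carrier PG \<Longrightarrow> (x [^]\<^bsub>PG\<^esub> (m::nat)) t = x t [^]\<^bsub>A t\<^esub> m"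
  by (induction m) simp_all

definition embed :: "'i \<Rightarrow> 'b \<Rightarrow> 'i \<Rightarrow> 'b" where
  "embed t x = (\<lambda>u\<in>I. if u = t then x else \<one>\<^bsub>A u\<^esub>)"

lemma embed_carrier: "\<lbrakk>t \<in> I; x \<in> carrier (A t)\<rbrakk> \<Longrightarrow> embed t x \<in> carrier PG"
  by (auto simp: embed_def comp_group group.is_monoid monoid.one_closed)

lemma embed_mult: "\<lbrakk>t \<in> I; x \<in> carrier (A t); y \<in> carrier (A t)\<rbrakk> \<Longrightarrow>
    embed t (x \<otimes>\<^bsub>A t\<^esub> y) = embed t x \<otimes>\<^bsub>PG\<^esub> embed t y"
proof -
  have "\<one>\<^bsub>A u\<^esub> \<otimes>\<^bsub>A u\<^esub> \<one>\<^bsub>A u\<^esub> = \<one>\<^bsub>A u\<^esub>" if "u \<in> I" for u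
    using comp_group[OF that] by (simp add: group.is_monoid monoid.l_one monoid.one_closed)
  then show ?thesis by (auto simp: embed_def fun_eq_iff restrict_def)
qed

lemma embed_one: "t \<in> I \<Longrightarrow> embed t \<one>\<^bsub>A t\<^esub> = \<one>\<^bsub>PG\<^esub>"
  by (auto simp: embed_def)

end

section \<open>Direct factors of the mix\<close>

context mix_family
begin

lemma embed_inv:
  assumes t: "t \<in> I" and x: "x \<in> carrier (A t)"
  shows "embed t (inv\<^bsub>A t\<^esub> x) = inv\<^bsub>PG\<^esub> embed t x"
proof -
  interpret t: group "A t" by (rule comp_group[OF t])
  have "embed t (inv\<^bsub>A t\<^esub> x) \<otimes>\<^bsub>PG\<^esub> embed t x = \<one>\<^bsub>PG\<^esub>"
    using embed_mult[OF t t.inv_closed[OF x] x] embed_one[OF t] x by simp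
  then show ?thesis using P.inv_equality embed_carrier[OF t] x by simp
qed

lemma s_component_closed: "\<lbrakk>t \<in> I; k \<le> 3\<rbrakk> \<Longrightarrow> sc t k \<in> carrier (A t)"
  by (rule string_group.s_closed[OF comp_string])

lemma embed_conj:
  assumes t: "t \<in> I" and x: "x \<in> carrier (A t)" and y: "y \<in> carrier PG"
  shows "embed t (y t \<otimes>\<^bsub>A t\<^esub> x \<otimes>\<^bsub>A t\<^esub> inv\<^bsub>A t\<^esub> y t) = y \<otimes>\<^bsub>PG\<^esub> embed t x \<otimes>\<^bsub>PG\<^esub> inv\<^bsub>PG\<^esub> y"
proof (rule PG_eqI)
  interpret t: group "A t" by (rule comp_group[OF t])
  have yt: "y t \<in> carrier (A t)" using PG_comp[OF t y] .
  show "embed t (y t \<otimes>\<^bsub>A t\<^esub> x \<otimes>\<^bsub>A t\<^esub> inv\<^bsub>A t\<^esub> y t) \<in> carrier PG"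
    by (rule embed_carrier[OF t]) (use x yt in simp)
  show "y \<otimes>\<^bsub>PG\<^esub> embed t x \<otimes>\<^bsub>PG\<^esub> inv\<^bsub>PG\<^esub> y \<in> carrier PG"
    using P.m_closed[OF P.m_closed[OF y embed_carrier[OF t x]] P.inv_closed[OF y]] .
  fix u assume u: "u \<in> I"
  interpret u: group "A u" by (rule comp_group[OF u])
  have "y u \<in> carrier (A u)" using PG_comp[OF u y] .
  then show "embed t (y t \<otimes>\<^bsub>A t\<^esub> x \<otimes>\<^bsub>A t\<^esub> inv\<^bsub>A t\<^esub> y t) u = (y \<otimes>\<^bsub>PG\<^esub> embed t x \<otimes>\<^bsub>PG\<^esub> inv\<^bsub>PG\<^esub> y) u"
    unfolding PG_mult[OF u] PG_inv[OF u y] using u by (simp add: embed_def)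
qed

text \<open>Elements that the mix contains concentrated in the single component \<open>t\<close>.\<close>
definition isolated :: "nat \<Rightarrow> nat \<Rightarrow> 'i \<Rightarrow> 'b \<Rightarrow> bool" where
  "isolated a b t x \<longleftrightarrow> x \<in> carrier (A t) \<and> embed t x \<in> P.E {a..b}"

lemma isolated_mult: "\<lbrakk>t \<in> I; isolated a b t x; isolated a b t y\<rbrakk> \<Longrightarrow> isolated a b t (x \<otimes>\<^bsub>A t\<^esub> y)"
  unfolding isolated_def
  by (simp add: embed_mult P.E_mult comp_group group.is_monoid monoid.m_closed del: mult_product_group)

lemma isolated_inv: "\<lbrakk>t \<in> I; isolated a b t x; b \<le> 3\<rbrakk> \<Longrightarrow> isolated a b t (inv\<^bsub>A t\<^esub> x)"
  unfolding isolated_def by (simp add: embed_inv P.E_inv comp_group group.inv_closed)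

lemma isolated_power:
  assumes t: "t \<in> I" and i: "i \<in> {a<..b}" "b \<le> 3"
    and e: "sc t i [^]\<^bsub>A t\<^esub> (m::nat) = sc t i" "\<And>u. \<lbrakk>u \<in> I; u \<noteq> t\<rbrakk> \<Longrightarrow> sc u i [^]\<^bsub>A u\<^esub> m = \<one>\<^bsub>A u\<^esub>"
  shows "isolated a b t (sc t i)"
proof -
  have i3: "i \<le> 3" using i by auto
  have sE: "P.s i \<in> P.E {a..b}" unfolding P.E_interval[OF i(2)] by (rule generate.incl) (use i in auto)
  have c: "P.s i \<in> carrier PG" by (rule P.s_closed[OF i3])
  have "P.s i [^]\<^bsub>PG\<^esub> m \<in> P.E {a..b}" by (induction m) (simp_all add: P.E_mult sE del: mult_product_group one_product_group)
  moreover have "P.s i [^]\<^bsub>PG\<^esub> m = embed t (sc t i)"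
  proof (rule PG_eqI)
    show "P.s i [^]\<^bsub>PG\<^esub> m \<in> carrier PG" using P.nat_pow_closed[OF c] .
    show "embed t (sc t i) \<in> carrier PG" by (rule embed_carrier[OF t s_component_closed[OF t i3]])
    fix u assume u: "u \<in> I"
    show "(P.s i [^]\<^bsub>PG\<^esub> m) u = embed t (sc t i) u"
      unfolding PG_pow[OF u c] P_s[OF u] using e u by (simp add: embed_def)
  qed
  ultimately show ?thesis unfolding isolated_def using s_component_closed[OF t i3] by simp
qed

text \<open>
  In the quotient by a normal subgroup containing \<open>s\<^sub>i\<close>, the relation \<open>(s\<^sub>i s\<^sub>k)\<^sup>2 = 1\<close> becomes
  \<open>s\<^sub>k\<^sup>2 = 1\<close>, and \<open>s\<^sub>k\<^sup>3 = 1\<close> then kills \<open>s\<^sub>k\<close> as well.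
\<close>
lemma isolated_neighbour:
  assumes t: "t \<in> I" and b: "b \<le> 3" and i: "i \<in> {a<..b}" and k: "k \<in> {a<..b}" "k = Suc i \<or> i = Suc k"
    and iso: "isolated a b t (sc t i)" and cube: "sc t k [^]\<^bsub>A t\<^esub> (3::nat) = \<one>\<^bsub>A t\<^esub>"
  shows "isolated a b t (sc t k)"
proof -
  interpret t: coset_geometry "A t" "\<rho> t" by (rule comp[OF t])
  let ?x = "sc t i" and ?y = "sc t k"
  have k3: "k \<le> 3" "i \<le> 3" using i k b by auto
  have c: "?x \<in> carrier (A t)" "?y \<in> carrier (A t)" using k3 by auto
  have y3: "?y \<otimes>\<^bsub>A t\<^esub> (?y \<otimes>\<^bsub>A t\<^esub> ?y) = \<one>\<^bsub>A t\<^esub>" using cube c by (simp add: numeral_3_eq_3 t.m_assoc)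
  have "?y \<otimes>\<^bsub>A t\<^esub> (?x \<otimes>\<^bsub>A t\<^esub> ?y) \<otimes>\<^bsub>A t\<^esub> ?x = \<one>\<^bsub>A t\<^esub>"
  proof (cases "k = Suc i")
    case True
    have "?x \<otimes>\<^bsub>A t\<^esub> (?y \<otimes>\<^bsub>A t\<^esub> (?x \<otimes>\<^bsub>A t\<^esub> ?y)) = \<one>\<^bsub>A t\<^esub>" using t.s_square[of i] i k True b by simp
    then show ?thesis using t.inv_comm c by simp
  next
    case False
    then have "?y \<otimes>\<^bsub>A t\<^esub> (?x \<otimes>\<^bsub>A t\<^esub> (?y \<otimes>\<^bsub>A t\<^esub> ?x)) = \<one>\<^bsub>A t\<^esub>" using t.s_square[of k] i k b by simp
    then show ?thesis using c by (simp add: t.m_assoc)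
  qed
  then have inv_x: "inv\<^bsub>A t\<^esub> ?x = ?y \<otimes>\<^bsub>A t\<^esub> (?x \<otimes>\<^bsub>A t\<^esub> ?y)" using t.inv_equality c by simp
  have sE: "P.s k \<in> P.E {a..b}" unfolding P.E_interval[OF b] by (rule generate.incl) (use k in auto)
  have sP: "P.s k \<in> carrier PG" by (rule P.s_closed[OF k3(1)])
  let ?z = "?y \<otimes>\<^bsub>A t\<^esub> ?x \<otimes>\<^bsub>A t\<^esub> inv\<^bsub>A t\<^esub> ?y"
  have "embed t ?z \<in> P.E {a..b}"
    using embed_conj[OF t c(1) sP] iso P.E_mult[OF P.E_mult[OF sE] P.E_inv[OF sE]] b
    unfolding isolated_def P_s[OF t] by auto
  then have z: "isolated a b t ?z" unfolding isolated_def using c by simp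
  have "?z \<otimes>\<^bsub>A t\<^esub> (?y \<otimes>\<^bsub>A t\<^esub> ?y) = inv\<^bsub>A t\<^esub> ?x"
    unfolding inv_x using c t.r_cancel_one by (simp add: t.m_assoc) (simp flip: t.m_assoc)
  then have "?y \<otimes>\<^bsub>A t\<^esub> ?y = inv\<^bsub>A t\<^esub> ?z \<otimes>\<^bsub>A t\<^esub> inv\<^bsub>A t\<^esub> ?x"
    using c by (metis t.inv_closed t.inv_solve_left t.m_closed)
  then have yy: "isolated a b t (?y \<otimes>\<^bsub>A t\<^esub> ?y)"
    using isolated_mult[OF t isolated_inv[OF t z b] isolated_inv[OF t iso b]] by simp
  have "(?y \<otimes>\<^bsub>A t\<^esub> ?y) \<otimes>\<^bsub>A t\<^esub> (?y \<otimes>\<^bsub>A t\<^esub> ?y) = ?y" using y3 c by (simp add: t.m_assoc)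
  then show ?thesis using isolated_mult[OF t yy yy] by simp
qed

lemma isolated_all:
  assumes t: "t \<in> I" and b: "b \<le> 3" and gen: "\<And>k. k \<in> {a<..b} \<Longrightarrow> isolated a b t (sc t k)"
    and x: "x \<in> Ec t {a..b}"
  shows "isolated a b t x"
proof -
  interpret t: coset_geometry "A t" "\<rho> t" by (rule comp[OF t])
  show ?thesis
    using x unfolding t.E_interval[OF b]
  proof induction
    case one
    then show ?case unfolding isolated_def using embed_one[OF t] P.E_one by simp
  next
    case (inv h)
    then show ?case using isolated_inv[OF t _ b] gen by auto
  qed (use gen isolated_mult[OF t] in auto)
qed

text \<open>
  Dividing a tuple by an element of the subgroup with the same restriction to \<open>D\<close> leaves a tuple
  supported on \<open>Q\<close>, which is a product of isolated elements.
\<close>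
lemma E_decompose:
  assumes b: "b \<le> 3" and Q: "Q \<subseteq> I" and D: "D = I - Q"
    and gen: "\<And>t k. \<lbrakk>t \<in> Q; k \<in> {a<..b}\<rbrakk> \<Longrightarrow> isolated a b t (sc t k)"
  shows "x \<in> P.E {a..b} \<longleftrightarrow> x \<in> carrier PG \<and> (\<forall>t \<in> Q. x t \<in> Ec t {a..b}) \<and>
      restrict x D \<in> (\<lambda>x. restrict x D) ` P.E {a..b}" (is "?L x \<longleftrightarrow> ?R x")
    and "card (P.E {a..b}) = (\<Prod>t\<in>Q. card (Ec t {a..b})) * card ((\<lambda>x. restrict x D) ` P.E {a..b})"
proof -
  have J: "{a..b} \<subseteq> {0..3}" using b by auto
  have finQ: "finite Q" using finite_subset[OF Q finI] .
  have small: "w \<in> P.E {a..b}"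
    if "finite T" "T \<subseteq> Q" "w \<in> carrier PG" "\<forall>t \<in> T. w t \<in> Ec t {a..b}" "\<forall>t \<in> I - T. w t = \<one>\<^bsub>A t\<^esub>" for T w
    using that
  proof (induction T arbitrary: w rule: finite_induct)
    case empty
    have wone: "w = \<one>\<^bsub>PG\<^esub>" using empty by (intro PG_eqI[OF _ P.one_closed]) simp_all
    show ?case unfolding wone by (rule P.E_one)
  next
    case (insert t T)
    have t: "t \<in> I" "t \<in> Q" using insert.prems Q by auto
    interpret t: coset_geometry "A t" "\<rho> t" by (rule comp[OF t(1)])
    have wt: "w t \<in> Ec t {a..b}" using insert.prems by simp
    then have wc: "w t \<in> carrier (A t)" using t.E_closed J by blast
    define w' where "w' = (\<lambda>u\<in>I. if u = t then \<one>\<^bsub>A t\<^esub> else w u)"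
    have w'c: "w' \<in> carrier PG" using insert.prems(2) t unfolding w'_def by auto
    have "w' \<in> P.E {a..b}"
    proof (rule insert.IH)
      show "T \<subseteq> Q" using insert.prems(1) by simp
      show "w' \<in> carrier PG" by (rule w'c)
      show "\<forall>u \<in> T. w' u \<in> Ec u {a..b}" using insert.prems(1,3) insert.hyps(2) Q unfolding w'_def by auto
      show "\<forall>u \<in> I - T. w' u = \<one>\<^bsub>A u\<^esub>" using insert.prems(4) unfolding w'_def by auto
    qed
    moreover have "embed t (w t) \<in> P.E {a..b}"
      using isolated_all[OF t(1) b gen[OF t(2)] wt] unfolding isolated_def by blast
    moreover have "w = embed t (w t) \<otimes>\<^bsub>PG\<^esub> w'"
    proof (rule PG_eqI[OF insert.prems(2) P.m_closed[OF embed_carrier[OF t(1) wc] w'c]])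
      fix u assume u: "u \<in> I"
      interpret u: group "A u" by (rule comp_group[OF u])
      show "w u = (embed t (w t) \<otimes>\<^bsub>PG\<^esub> w') u"
        using u wc PG_comp[OF u insert.prems(2)] by (simp add: embed_def w'_def)
    qed
    ultimately show ?case using P.E_mult by metis
  qed
  have ifR: "?L x" if x: "?R x" for x
  proof -
    have xc: "x \<in> carrier PG" using x by blast
    obtain y where y: "y \<in> P.E {a..b}" "restrict x D = restrict y D" using x by blast
    have yc: "y \<in> carrier PG" using P.E_closed[OF y(1) J] .
    have iy: "inv\<^bsub>PG\<^esub> y \<in> P.E {a..b}" using P.E_inv[OF y(1) J] .
    have iyc: "inv\<^bsub>PG\<^esub> y \<in> carrier PG" by (rule P.inv_closed[OF yc])
    let ?w = "x \<otimes>\<^bsub>PG\<^esub> inv\<^bsub>PG\<^esub> y"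
    have "?w \<in> P.E {a..b}"
    proof (rule small[OF finQ order_refl])
      show "?w \<in> carrier PG" by (rule P.m_closed[OF xc iyc])
      show "\<forall>t \<in> Q. ?w t \<in> Ec t {a..b}"
      proof
        fix t assume t: "t \<in> Q"
        then have tI: "t \<in> I" using Q by blast
        interpret t: coset_geometry "A t" "\<rho> t" by (rule comp[OF tI])
        have "x t \<in> Ec t {a..b}" using x t by blast
        then show "?w t \<in> Ec t {a..b}"
          unfolding PG_mult[OF tI] using t.E_mult component_E[OF iy tI J] by blast
      qed
      show "\<forall>t \<in> I - Q. ?w t = \<one>\<^bsub>A t\<^esub>"
      proof
        fix t assume t: "t \<in> I - Q"
        then have tI: "t \<in> I" and tD: "t \<in> D" using D by auto
        interpret t: group "A t" by (rule comp_group[OF tI])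
        have "x t = y t" using fun_cong[OF y(2), of t] tD by simp
        then show "?w t = \<one>\<^bsub>A t\<^esub>"
          unfolding PG_mult[OF tI] PG_inv[OF tI yc] using PG_comp[OF tI yc] by simp
      qed
    qed
    then have "?w \<otimes>\<^bsub>PG\<^esub> y \<in> P.E {a..b}" using P.E_mult[OF _ y(1)] by blast
    moreover have "?w \<otimes>\<^bsub>PG\<^esub> y = x" using P.inv_solve_right[OF xc _ yc] P.m_assoc[OF xc iyc yc] P.l_inv[OF yc] P.r_one[OF xc] by metis
    ultimately show ?thesis by simp
  qed
  have onlyR: "?R x" if "?L x" for x
    using P.E_closed[OF that J] component_E[OF that _ J] Q that by blast
  show iff: "?L x \<longleftrightarrow> ?R x" for x using ifR onlyR by blast
  let ?V = "(\<lambda>x. restrict x D) ` P.E {a..b}"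
  let ?f = "\<lambda>x. (restrict x Q, restrict x D)"
  have "bij_betw ?f (P.E {a..b}) (PiE Q (\<lambda>t. Ec t {a..b}) \<times> ?V)"
  proof (rule bij_betw_imageI)
    show "inj_on ?f (P.E {a..b})"
    proof (rule inj_onI)
      fix x y assume h: "x \<in> P.E {a..b}" "y \<in> P.E {a..b}" "?f x = ?f y"
      have r: "restrict x Q = restrict y Q" "restrict x D = restrict y D" using h(3) by auto
      show "x = y"
      proof (rule PG_eqI)
        show "x \<in> carrier PG" "y \<in> carrier PG" using P.E_closed[OF _ J] h by blast+
        fix t assume "t \<in> I"
        then show "x t = y t" using fun_cong[OF r(1), of t] fun_cong[OF r(2), of t] D by (cases "t \<in> Q") auto
      qed
    qed
    show "?f ` P.E {a..b} = PiE Q (\<lambda>t. Ec t {a..b}) \<times> ?V"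
    proof
      show "?f ` P.E {a..b} \<subseteq> PiE Q (\<lambda>t. Ec t {a..b}) \<times> ?V" using component_E[OF _ _ J] Q by auto
      show "PiE Q (\<lambda>t. Ec t {a..b}) \<times> ?V \<subseteq> ?f ` P.E {a..b}"
      proof
        fix p assume p: "p \<in> PiE Q (\<lambda>t. Ec t {a..b}) \<times> ?V"
        obtain f y where fy: "p = (f, restrict y D)" "f \<in> PiE Q (\<lambda>t. Ec t {a..b})" "y \<in> P.E {a..b}" using p by auto
        define x where "x = (\<lambda>t\<in>I. if t \<in> Q then f t else y t)"
        have yc: "y \<in> carrier PG" using P.E_closed[OF fy(3) J] .
        have rQ: "restrict x Q = f" using fy(2) Q unfolding x_def by (auto simp: fun_eq_iff PiE_def extensional_def)
        have rD: "restrict x D = restrict y D" unfolding x_def D by (auto simp: fun_eq_iff)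
        have "x t \<in> carrier (A t)" if t: "t \<in> I" for t
        proof (cases "t \<in> Q")
          case True
          interpret t: coset_geometry "A t" "\<rho> t" by (rule comp[OF t])
          show ?thesis using True t fy(2) t.E_closed[OF _ J] unfolding x_def by auto
        next
          case False
          then show ?thesis using t PG_comp[OF t yc] unfolding x_def by simp
        qed
        then have "x \<in> carrier PG" unfolding x_def by auto
        moreover have "\<forall>t \<in> Q. x t \<in> Ec t {a..b}" using fy(2) Q unfolding x_def by auto
        ultimately have "x \<in> P.E {a..b}" using ifR[of x] rD fy(3) by auto
        then show "p \<in> ?f ` P.E {a..b}" using fy(1) rQ rD by (intro image_eqI[of _ _ x]) auto
      qed
    qed
  qed
  from bij_betw_same_card[OF this]
  show "card (P.E {a..b}) = (\<Prod>t\<in>Q. card (Ec t {a..b})) * card ?V"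
    by (simp only: card_cartesian_product card_PiE[OF finQ])
qed

lemma card_restrict_empty: "card ((\<lambda>x. restrict x {}) ` P.E J) = 1"
proof -
  have "(\<lambda>x. restrict x {}) ` P.E J = {\<lambda>_. undefined}"
    using image_constant[OF P.E_one[of J], of "\<lambda>_. undefined"] by (simp add: restrict_def)
  then show ?thesis by simp
qed

lemma card_restrict_single:
  assumes t: "t \<in> I" and J: "J \<subseteq> {0..3}"
  shows "card ((\<lambda>x. restrict x {t}) ` P.E J) = card (Ec t J)"
proof -
  have "(\<lambda>x. x t) ` ((\<lambda>x. restrict x {t}) ` P.E J) = Ec t J"
    using component_image(2)[OF t J] by (simp add: image_image)
  moreover have "inj_on (\<lambda>x. x t) ((\<lambda>x. restrict x {t}) ` P.E J)"
    by (rule inj_onI) (auto simp: fun_eq_iff)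
  ultimately show ?thesis by (metis card_image)
qed

lemma card_restrict_tetrahedral:
  assumes D: "D \<subseteq> I" "D \<noteq> {}" and a: "a \<le> 1"
    and cubes: "\<And>t k. \<lbrakk>t \<in> D; k \<in> {Suc a, Suc (Suc a)}\<rbrakk> \<Longrightarrow> sc t k [^]\<^bsub>A t\<^esub> (3::nat) = \<one>\<^bsub>A t\<^esub>"
  shows "card ((\<lambda>x. restrict x D) ` P.E {a..a + 2}) = 12"
proof -
  interpret D: mix_family D A \<rho> by (rule subfamily[OF D])
  have J: "{a..a + 2} \<subseteq> {0..3}" using a by auto
  have a3: "a + 2 \<le> 3" using a by simp
  let ?x = "D.P.s (Suc a)" and ?y = "D.P.s (Suc (Suc a))"
  have c: "?x \<in> carrier D.PG" "?y \<in> carrier D.PG" using a by (auto intro!: D.P.s_closed simp del: carrier_product_group)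
  have "s \<otimes>\<^bsub>D.PG\<^esub> (s \<otimes>\<^bsub>D.PG\<^esub> s) = \<one>\<^bsub>D.PG\<^esub>" if k: "k \<in> {Suc a, Suc (Suc a)}" "s = D.P.s k" for k s
  proof -
    have k3: "k \<le> 3" using k a by auto
    have sc: "s \<in> carrier D.PG" unfolding k(2) by (rule D.P.s_closed[OF k3])
    show ?thesis
    proof (rule D.PG_eqI)
      show "s \<otimes>\<^bsub>D.PG\<^esub> (s \<otimes>\<^bsub>D.PG\<^esub> s) \<in> carrier D.PG" using D.P.m_closed[OF sc D.P.m_closed[OF sc sc]] .
      show "\<one>\<^bsub>D.PG\<^esub> \<in> carrier D.PG" by (rule D.P.one_closed)
      fix t assume t: "t \<in> D"
      interpret t: group "A t" by (rule D.comp_group[OF t])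
      have st: "s t = sc t k" unfolding k(2) using D.P_s[OF t] by simp
      have "sc t k \<in> carrier (A t)" using s_component_closed t D(1) k3 by blast
      then show "(s \<otimes>\<^bsub>D.PG\<^esub> (s \<otimes>\<^bsub>D.PG\<^esub> s)) t = \<one>\<^bsub>D.PG\<^esub> t"
        unfolding D.PG_mult[OF t] st using cubes[OF t k(1)] t by (simp add: numeral_3_eq_3 t.m_assoc)
    qed
  qed
  then have "card (generate D.PG {?x, ?y}) = 12"
    using a D.P.s_square[of "Suc a"] D.P.s_prod_neq_one[of "Suc a"] by (intro D.P.tetrahedral_card[OF c]) simp_all
  moreover have "{?x, ?y} = D.P.s ` {a<..a + 2}"
  proof -
    have "{a<..a + 2} = {Suc a, Suc (Suc a)}" by auto
    then show ?thesis by simp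
  qed
  ultimately show ?thesis using restrict_image[OF D J] D.P.E_interval[OF a3, of a] by simp
qed

end

section \<open>Flags of convex polytopes\<close>

lemma below_face_lattice [simp]:
  "(F, G) \<in> below (face_lattice S) \<longleftrightarrow> F face_of S \<and> G face_of S \<and> F \<subseteq> G"
  by (simp add: face_lattice_def)

lemma faces_face_lattice [simp]: "F \<in> faces (face_lattice S) \<longleftrightarrow> F face_of S"
  by (simp add: face_lattice_def)

lemma rk_face_lattice [simp]: "rk (face_lattice S) = aff_dim"
  by (simp add: face_lattice_def)

lemma face_chain_iff:
  "C \<in> Chains (below (face_lattice S)) \<longleftrightarrow> (\<forall>F \<in> C. F face_of S) \<and> (\<forall>F \<in> C. \<forall>G \<in> C. F \<subseteq> G \<or> G \<subseteq> F)"
  unfolding Chains_def by auto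

lemma face_dim_mono:
  assumes "convex S" "F face_of S" "G face_of S" "F \<subseteq> G" "F \<noteq> G"
  shows "aff_dim F < aff_dim G"
proof -
  have "F face_of G" using assms face_of_face by blast
  then show ?thesis using face_of_aff_dim_lt face_of_imp_convex assms by metis
qed

lemma face_dim_eq:
  assumes "convex S" "F face_of S" "G face_of S" "F \<subseteq> G \<or> G \<subseteq> F" "aff_dim F = aff_dim G"
  shows "F = G"
  using face_dim_mono[of S F G] face_dim_mono[of S G F] assms by auto

lemma next_face:
  fixes S :: "'a::euclidean_space set"
  assumes S: "polytope S" and F: "F face_of S" "F \<noteq> S"
  obtains G where "G face_of S" "F \<subseteq> G" "aff_dim G = aff_dim S - 1"
proof (cases "F = {}")
  case False
  obtain G where "G facet_of S" "F \<subseteq> G"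
    using face_of_polyhedron_subset_facet[OF polytope_imp_polyhedron[OF S] F(1) False F(2)] .
  then show ?thesis using that unfolding facet_of_def by blast
next
  case True
  show ?thesis
  proof (cases "0 < aff_dim S")
    case 1: True
    obtain G where "G facet_of S" using polytope_facet_exists[OF S 1] .
    then show ?thesis using that True unfolding facet_of_def by blast
  next
    case False
    have "aff_dim S \<noteq> -1" using F True by (metis aff_dim_empty)
    then have "aff_dim S = 0" using False aff_dim_geq[of S] by linarith
    then show ?thesis using that[of "{}"] True F by simp
  qed
qed

text \<open>Maximality of a flag, together with the existence of facets, fills every gap in dimension.\<close>
lemma flag_has_dim:
  fixes S :: "'a::euclidean_space set"
  assumes S: "polytope S" and \<Phi>: "\<Phi> \<in> flags (face_lattice S)" and k: "-1 \<le> k" "k \<le> aff_dim S"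
  shows "\<exists>F \<in> \<Phi>. aff_dim F = k"
proof -
  note cvx = polytope_imp_convex[OF S]
  have chain: "\<And>F. F \<in> \<Phi> \<Longrightarrow> F face_of S" "\<And>F G. \<lbrakk>F \<in> \<Phi>; G \<in> \<Phi>\<rbrakk> \<Longrightarrow> F \<subseteq> G \<or> G \<subseteq> F"
    using \<Phi> unfolding flags_def face_chain_iff by blast+
  have maxi: "X \<in> \<Phi>" if X: "X face_of S" "\<And>F. F \<in> \<Phi> \<Longrightarrow> F \<subseteq> X \<or> X \<subseteq> F" for X
  proof -
    have "insert X \<Phi> \<in> Chains (below (face_lattice S))"
      unfolding face_chain_iff using chain X by blast
    then have "insert X \<Phi> = \<Phi>" using \<Phi> unfolding flags_def by blast
    then show ?thesis by blast
  qed
  have SP: "S \<in> \<Phi>" using maxi[of S] chain(1) face_of_imp_subset face_of_refl[OF cvx] by blast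
  have EP: "{} \<in> \<Phi>" using maxi[of "{}"] by simp
  have fin: "finite \<Phi>" using finite_polytope_faces[OF S] chain(1) by (metis finite_subset mem_Collect_eq subsetI)
  show ?thesis
  proof (cases "k = -1")
    case True
    then show ?thesis using EP by (intro bexI[of _ "{}"]) auto
  next
    case k1: False
    obtain G where G: "G \<in> \<Phi>" "k \<le> aff_dim G" "\<And>H. \<lbrakk>H \<in> \<Phi>; k \<le> aff_dim H\<rbrakk> \<Longrightarrow> aff_dim G \<le> aff_dim H"
      using ex_min_if_finite[of "aff_dim ` {H \<in> \<Phi>. k \<le> aff_dim H}"] fin SP k(2)
      by (force simp: not_less)
    have "\<exists>F \<in> {H \<in> \<Phi>. aff_dim H < k}. \<forall>H \<in> {H \<in> \<Phi>. aff_dim H < k}. aff_dim H \<le> aff_dim F"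
    proof -
      let ?A = "{H \<in> \<Phi>. aff_dim H < k}"
      have fA: "finite (aff_dim ` ?A)" using fin by simp
      have "{} \<in> ?A" using EP k1 k(1) by simp
      then have "aff_dim ` ?A \<noteq> {}" by blast
      then have "Max (aff_dim ` ?A) \<in> aff_dim ` ?A" using fA Max_in by blast
      then obtain F where F: "F \<in> ?A" "aff_dim F = Max (aff_dim ` ?A)" by force
      show ?thesis by (rule bexI[OF _ F(1)]) (simp add: F(2) fA)
    qed
    then obtain F where F: "F \<in> \<Phi>" "aff_dim F < k" "\<And>H. \<lbrakk>H \<in> \<Phi>; aff_dim H < k\<rbrakk> \<Longrightarrow> aff_dim H \<le> aff_dim F"
      by blast
    have le: "H \<subseteq> H'" if "H \<in> \<Phi>" "H' \<in> \<Phi>" "aff_dim H \<le> aff_dim H'" for H H'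
      using chain(2)[OF that(1,2)] face_dim_mono[OF cvx chain(1)[OF that(2)] chain(1)[OF that(1)]] that(3)
      by fastforce
    show ?thesis
    proof (rule ccontr)
      assume "\<not> ?thesis"
      then have Gk: "k < aff_dim G" using G by force
      have "F \<subseteq> G" using le[OF F(1) G(1)] F(2) G(2) by simp
      then have FG: "F face_of G" "F \<noteq> G"
        using face_of_face[OF chain(1)[OF G(1)], of F] chain(1)[OF F(1)] F(2) G(2) by auto
      obtain X where X: "X face_of G" "F \<subseteq> X" "aff_dim X = aff_dim G - 1"
        using next_face[OF face_of_polytope_polytope[OF S chain(1)[OF G(1)]] FG] .
      have "X \<in> \<Phi>"
      proof (rule maxi)
        show "X face_of S" using X(1) chain(1)[OF G(1)] by (rule face_of_trans)
        fix H assume H: "H \<in> \<Phi>"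
        show "H \<subseteq> X \<or> X \<subseteq> H"
        proof (cases "k \<le> aff_dim H")
          case True
          then have "G \<subseteq> H" using le G H by blast
          then show ?thesis using face_of_imp_subset[OF X(1)] by blast
        next
          case False
          then have "H \<subseteq> F" using le F H by auto
          then show ?thesis using X by blast
        qed
      qed
      then show False using G(3)[of X] X Gk by auto
    qed
  qed
qed

lemma flag_dim_unique:
  assumes "convex S" "\<Phi> \<in> flags (face_lattice S)" "F \<in> \<Phi>" "G \<in> \<Phi>" "aff_dim F = aff_dim G"
  shows "F = G"
  using assms face_dim_eq[of S F G] unfolding flags_def face_chain_iff by blast

lemma flag_face: "\<lbrakk>\<Phi> \<in> flags (face_lattice S); F \<in> \<Phi>\<rbrakk> \<Longrightarrow> F face_of S"
  unfolding flags_def face_chain_iff by blast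

lemma flag_compare: "\<lbrakk>\<Phi> \<in> flags (face_lattice S); F \<in> \<Phi>; G \<in> \<Phi>\<rbrakk> \<Longrightarrow> F \<subseteq> G \<or> G \<subseteq> F"
  unfolding flags_def face_chain_iff by blast

lemma face_dim_range:
  fixes S :: "'a::euclidean_space set"
  assumes "F face_of S" shows "-1 \<le> aff_dim F" "aff_dim F \<le> aff_dim S"
  using aff_dim_geq aff_dim_subset[OF face_of_imp_subset[OF assms]] by auto

lemma flagI:
  fixes S :: "'a::euclidean_space set"
  assumes cvx: "convex S" and C: "C \<in> Chains (below (face_lattice S))"
    and dims: "\<And>k. \<lbrakk>-1 \<le> k; k \<le> aff_dim S\<rbrakk> \<Longrightarrow> \<exists>F \<in> C. aff_dim F = k"
  shows "C \<in> flags (face_lattice S)"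
proof -
  have "D = C" if D: "D \<in> Chains (below (face_lattice S))" "C \<subseteq> D" for D
  proof
    show "D \<subseteq> C"
    proof
      fix X assume X: "X \<in> D"
      have DD: "\<And>F. F \<in> D \<Longrightarrow> F face_of S" "\<And>F G. \<lbrakk>F \<in> D; G \<in> D\<rbrakk> \<Longrightarrow> F \<subseteq> G \<or> G \<subseteq> F"
        using D(1) unfolding face_chain_iff by blast+
      obtain F where F: "F \<in> C" "aff_dim F = aff_dim X" using dims face_dim_range[OF DD(1)[OF X]] by metis
      have "F = X" using face_dim_eq[OF cvx] DD F X D(2) by blast
      then show "X \<in> C" using F by simp
    qed
  qed (rule D(2))
  then show ?thesis unfolding flags_def using C by blast
qed

lemma chain_extends:
  fixes S :: "'a::euclidean_space set"
  assumes S: "polytope S" and C: "C \<in> Chains (below (face_lattice S))"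
  obtains \<Phi> where "\<Phi> \<in> flags (face_lattice S)" "C \<subseteq> \<Phi>"
proof -
  let ?X = "{D \<in> Chains (below (face_lattice S)). C \<subseteq> D}"
  have "?X \<subseteq> Pow {F. F face_of S}" unfolding face_chain_iff by blast
  then have "finite ?X" using finite_polytope_faces[OF S] finite_subset by blast
  moreover have "?X \<noteq> {}" using C by blast
  ultimately obtain M where M: "M \<in> ?X" "\<forall>D \<in> ?X. M \<subseteq> D \<longrightarrow> M = D"
    using finite_has_maximal[of ?X] by blast
  have "D = M" if "D \<in> Chains (below (face_lattice S))" "M \<subseteq> D" for D
    using M that by auto
  then have "M \<in> flags (face_lattice S)" using M(1) unfolding flags_def by simp
  then show ?thesis using that M by blast
qed

text \<open>
  The facets through a ridge correspond to affine functions that vanish on the ridge and agree at an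
  interior point; they are determined by one further value, and the one with a middle value is a
  proper convex combination of two others, which is absurd.
\<close>
lemma ridge_card_le_2:
  fixes S :: "'a::euclidean_space set"
  assumes S: "polytope S" and R: "R face_of S" "aff_dim R = aff_dim S - 2"
    and F: "F1 face_of S" "F2 face_of S" "F3 face_of S"
      "aff_dim F1 = aff_dim S - 1" "aff_dim F2 = aff_dim S - 1" "aff_dim F3 = aff_dim S - 1"
      "R \<subseteq> F1" "R \<subseteq> F2" "R \<subseteq> F3"
  shows "F1 = F2 \<or> F1 = F3 \<or> F2 = F3"
proof (rule ccontr)
  assume neq: "\<not> ?thesis"
  note cvx = polytope_imp_convex[OF S]
  have dS: "aff_dim S \<ge> 1" using R aff_dim_geq[of R] by linarith
  then have "S \<noteq> {}" by auto
  then obtain p where p: "p \<in> rel_interior S" using cvx rel_interior_eq_empty by blast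
  have pS: "p \<in> S" using p rel_interior_subset by blast
  have expose: "\<exists>a b. (\<forall>x \<in> S. a \<bullet> x \<le> b) \<and> X = {x \<in> S. a \<bullet> x = b} \<and> a \<bullet> p = b - 1"
    if X: "X face_of S" "aff_dim X = aff_dim S - 1" for X
  proof -
    have "X exposed_face_of S" using X exposed_face_of_polyhedron polytope_imp_polyhedron[OF S] by blast
    then obtain a b where ab: "S \<subseteq> {x. a \<bullet> x \<le> b}" "X = S \<inter> {x. a \<bullet> x = b}"
      unfolding exposed_face_of_def by blast
    have "X \<noteq> S" using X by auto
    then have "p \<notin> X" using face_of_disjoint_rel_interior[OF X(1)] p by blast
    then have less: "a \<bullet> p < b" using ab pS by force
    define t where "t = 1 / (b - a \<bullet> p)"
    have t: "t > 0" "t * (b - a \<bullet> p) = 1" using less by (auto simp: t_def)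
    have h: "(t *\<^sub>R a) \<bullet> x \<le> t * b \<longleftrightarrow> a \<bullet> x \<le> b" "(t *\<^sub>R a) \<bullet> x = t * b \<longleftrightarrow> a \<bullet> x = b" for x using t by auto
    have "(t *\<^sub>R a) \<bullet> p = t * b - 1" using t(2) by (simp add: algebra_simps)
    moreover have "X = {x \<in> S. (t *\<^sub>R a) \<bullet> x = t * b}" unfolding h using ab(2) by blast
    moreover have "\<forall>x \<in> S. (t *\<^sub>R a) \<bullet> x \<le> t * b" unfolding h using ab(1) by blast
    ultimately show ?thesis by blast
  qed
  obtain a1 b1 where 1: "\<forall>x \<in> S. a1 \<bullet> x \<le> b1" "F1 = {x \<in> S. a1 \<bullet> x = b1}" "a1 \<bullet> p = b1 - 1"
    using expose[OF F(1,4)] by blast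
  obtain a2 b2 where 2: "\<forall>x \<in> S. a2 \<bullet> x \<le> b2" "F2 = {x \<in> S. a2 \<bullet> x = b2}" "a2 \<bullet> p = b2 - 1"
    using expose[OF F(2,5)] by blast
  obtain a3 b3 where 3: "\<forall>x \<in> S. a3 \<bullet> x \<le> b3" "F3 = {x \<in> S. a3 \<bullet> x = b3}" "a3 \<bullet> p = b3 - 1"
    using expose[OF F(3,6)] by blast
  have "R \<noteq> F1" using R F by auto
  then obtain q where q: "q \<in> F1" "q \<notin> R" using F by blast
  have qS: "q \<in> S" using q 1 by blast
  have hull: "S \<subseteq> affine hull (insert p (insert q R))"
  proof -
    have "q \<notin> affine hull R"
      using face_of_imp_eq_affine_Int[OF cvx R(1)] q qS by blast
    then have d1: "aff_dim (insert q R) = aff_dim S - 1" using R(2) aff_dim_insert[of q R] by simp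
    have "p \<notin> affine hull F1"
      using affine_hull_face_of_disjoint_rel_interior[OF cvx F(1)] F(4) p by fastforce
    moreover have "affine hull (insert q R) \<subseteq> affine hull F1" using q F by (intro hull_mono) blast
    ultimately have "p \<notin> affine hull (insert q R)" by blast
    then have d2: "aff_dim (insert p (insert q R)) = aff_dim S" using d1 aff_dim_insert[of p "insert q R"] by simp
    have sub: "insert p (insert q R) \<subseteq> S" using pS qS face_of_imp_subset[OF R(1)] by blast
    have "affine hull (insert p (insert q R)) = affine hull S"
      using aff_dim_eq_full_gen[OF sub] d2 by blast
    then show ?thesis using hull_subset[of S affine] by simp
  qed
  have agree: "a \<bullet> x = b" if v: "\<forall>y \<in> insert p (insert q R). a \<bullet> y = b" and x: "x \<in> S" for a b x
  proof -
    have "affine hull (insert p (insert q R)) \<subseteq> {x. a \<bullet> x = b}"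
      by (rule hull_minimal) (use v affine_hyperplane in auto)
    then show ?thesis using hull x by blast
  qed
  have eq: "X = Y" if X: "X face_of S" "Y face_of S" "aff_dim X = aff_dim S - 1" "aff_dim Y = aff_dim S - 1" "X \<subseteq> Y" for X Y
    using face_dim_eq[OF cvx X(1,2)] X by auto
  let ?u = "b2 - a2 \<bullet> q" and ?v = "b3 - a3 \<bullet> q"
  have Rv: "a1 \<bullet> y = b1" "a2 \<bullet> y = b2" "a3 \<bullet> y = b3" if "y \<in> R" for y
    using that F(7-9) 1 2 3 by blast+
  have q1: "a1 \<bullet> q = b1" using q 1 by blast
  have u0: "?u > 0"
  proof (rule ccontr)
    assume "\<not> ?thesis"
    then have "?u = 0" using 2 qS by force
    then have "\<forall>z \<in> insert p (insert q R). (a1 - a2) \<bullet> z = b1 - b2"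
      using Rv q1 1(3) 2(3) by (auto simp: inner_diff_left)
    from agree[OF this] have "b1 - a1 \<bullet> y = b2 - a2 \<bullet> y" if "y \<in> S" for y
      using that by (simp add: inner_diff_left algebra_simps)
    then have "a1 \<bullet> y = b1 \<longleftrightarrow> a2 \<bullet> y = b2" if "y \<in> S" for y using that by fastforce
    then have "F1 = F2" unfolding 1(2) 2(2) by blast
    then show False using neq by blast
  qed
  have v0: "?v > 0"
  proof (rule ccontr)
    assume "\<not> ?thesis"
    then have "?v = 0" using 3 qS by force
    then have "\<forall>z \<in> insert p (insert q R). (a1 - a3) \<bullet> z = b1 - b3"
      using Rv q1 1(3) 3(3) by (auto simp: inner_diff_left)
    from agree[OF this] have "b1 - a1 \<bullet> y = b3 - a3 \<bullet> y" if "y \<in> S" for y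
      using that by (simp add: inner_diff_left algebra_simps)
    then have "a1 \<bullet> y = b1 \<longleftrightarrow> a3 \<bullet> y = b3" if "y \<in> S" for y using that by fastforce
    then have "F1 = F3" unfolding 1(2) 3(2) by blast
    then show False using neq by blast
  qed
  \<comment> \<open>\<open>v f\<^sub>2 = u f\<^sub>3 + (v - u) f\<^sub>1\<close> for the three affine functions \<open>f\<^sub>i = a\<^sub>i - b\<^sub>i\<close>.\<close>
  have comb: "?v * (b2 - a2 \<bullet> y) = ?u * (b3 - a3 \<bullet> y) + (?v - ?u) * (b1 - a1 \<bullet> y)" if y: "y \<in> S" for y
  proof -
    let ?a = "?v *\<^sub>R a2 - ?u *\<^sub>R a3 - (?v - ?u) *\<^sub>R a1"
    let ?b = "?v * b2 - ?u * b3 - (?v - ?u) * b1"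
    have "?a \<bullet> y = ?b"
    proof (rule agree[OF _ y], intro ballI)
      fix z assume "z \<in> insert p (insert q R)"
      then consider "z = p" | "z = q" | "z \<in> R" by blast
      then show "?a \<bullet> z = ?b"
      proof cases
        case 1
        have "?v * (a2 \<bullet> p) - ?u * (a3 \<bullet> p) - (?v - ?u) * (a1 \<bullet> p) = ?b"
          unfolding \<open>a1 \<bullet> p = b1 - 1\<close> \<open>a2 \<bullet> p = b2 - 1\<close> \<open>a3 \<bullet> p = b3 - 1\<close> by (simp add: algebra_simps)
        then show ?thesis unfolding 1 by (simp add: inner_diff_left)
      next
        case 2
        have "?v * (a2 \<bullet> q) - ?u * (a3 \<bullet> q) - (?v - ?u) * (a1 \<bullet> q) = ?b"
          unfolding q1 by (simp add: algebra_simps)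
        then show ?thesis unfolding 2 by (simp add: inner_diff_left)
      next
        case 3
        then show ?thesis using Rv[OF 3] by (simp add: inner_diff_left)
      qed
    qed
    then show ?thesis by (simp add: inner_diff_left algebra_simps)
  qed
  show False
  proof (cases "?u \<le> ?v")
    case True
    have "F2 \<subseteq> F3"
    proof
      fix y assume y: "y \<in> F2"
      then have yS: "y \<in> S" and y2: "b2 - a2 \<bullet> y = 0" using 2 by auto
      have "?u * (b3 - a3 \<bullet> y) \<ge> 0" "(?v - ?u) * (b1 - a1 \<bullet> y) \<ge> 0"
        using u0 True 1 3 yS by (auto intro!: mult_nonneg_nonneg)
      moreover have "?u * (b3 - a3 \<bullet> y) + (?v - ?u) * (b1 - a1 \<bullet> y) = 0"
        using comb[OF yS] unfolding y2 by simp
      ultimately have "?u * (b3 - a3 \<bullet> y) = 0" by linarith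
      then show "y \<in> F3" using u0 3 yS by auto
    qed
    then show False using eq[OF F(2,3,5,6)] neq by blast
  next
    case False
    have "F3 \<subseteq> F2"
    proof
      fix y assume y: "y \<in> F3"
      then have yS: "y \<in> S" and y3: "b3 - a3 \<bullet> y = 0" using 3 by auto
      have "?v * (b2 - a2 \<bullet> y) \<ge> 0" "(?u - ?v) * (b1 - a1 \<bullet> y) \<ge> 0"
        using v0 False 1 2 yS by (auto intro!: mult_nonneg_nonneg)
      moreover have "?v * (b2 - a2 \<bullet> y) = - ((?u - ?v) * (b1 - a1 \<bullet> y))"
        using comb[OF yS] y3 by (simp add: algebra_simps)
      ultimately have "?v * (b2 - a2 \<bullet> y) = 0" by linarith
      then show "y \<in> F2" using v0 2 yS by auto
    qed
    then show False using eq[OF F(3,2,6,5)] neq by blast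
  qed
qed

lemma ridge_card_ge_2:
  fixes S :: "'a::euclidean_space set"
  assumes S: "polytope S" and R: "R face_of S" "aff_dim R = aff_dim S - 2"
  obtains F1 F2 where "F1 face_of S" "F2 face_of S" "F1 \<noteq> F2" "R \<subseteq> F1" "R \<subseteq> F2"
    "aff_dim F1 = aff_dim S - 1" "aff_dim F2 = aff_dim S - 1"
proof -
  note cvx = polytope_imp_convex[OF S]
  have RS: "R \<noteq> S" using R by auto
  obtain F1 where F1: "F1 face_of S" "R \<subseteq> F1" "aff_dim F1 = aff_dim S - 1" using next_face[OF S R(1) RS] .
  have "\<exists>F2. F2 face_of S \<and> F2 \<noteq> F1 \<and> R \<subseteq> F2 \<and> aff_dim F2 = aff_dim S - 1"
  proof (cases "R = {}")
    case True
    then have d: "aff_dim S = 1" using R by simp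
    show ?thesis
    proof (rule ccontr)
      assume no: "\<not> ?thesis"
      have "{x. x extreme_point_of S} \<subseteq> F1"
      proof
        fix x assume "x \<in> {x. x extreme_point_of S}"
        then have "{x} face_of S" by (simp add: face_of_singleton)
        then have "{x} = F1" using no True d by (metis aff_dim_sing diff_self empty_subsetI)
        then show "x \<in> F1" by blast
      qed
      then have "convex hull {x. x extreme_point_of S} \<subseteq> F1"
        using face_of_imp_convex[OF F1(1)] by (simp add: hull_minimal)
      then have "S \<subseteq> F1" using Krein_Milman_Minkowski[OF polytope_imp_compact[OF S] cvx] by simp
      then show False using F1 face_of_imp_subset[OF F1(1)] by auto
    qed
  next
    case False
    show ?thesis
    proof (rule ccontr)
      assume no: "\<not> ?thesis"
      have "{F. F facet_of S \<and> R \<subseteq> F} \<subseteq> {F1}" using no unfolding facet_of_def by blast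
      then have "F1 \<subseteq> \<Inter> {F. F facet_of S \<and> R \<subseteq> F}" by blast
      then have "F1 \<subseteq> R" using face_of_polyhedron[OF polytope_imp_polyhedron[OF S] R(1) False RS] by blast
      then show False using F1 R by auto
    qed
  qed
  then show ?thesis using that F1 by blast
qed

definition adj :: "'a::euclidean_space set \<Rightarrow> int \<Rightarrow> 'a set set \<Rightarrow> 'a set set \<Rightarrow> bool" where
  "adj S i \<Phi> \<Psi> \<longleftrightarrow> \<Phi> \<in> flags (face_lattice S) \<and> \<Psi> \<in> flags (face_lattice S) \<and>
     {F \<in> \<Psi>. aff_dim F \<noteq> i} = {F \<in> \<Phi>. aff_dim F \<noteq> i}"

lemma adj_exists:
  fixes S :: "'a::euclidean_space set"
  assumes S: "polytope S" and \<Phi>: "\<Phi> \<in> flags (face_lattice S)" and i: "0 \<le> i" "i < aff_dim S"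
  shows "\<exists>\<Psi>. adj S i \<Phi> \<Psi> \<and> \<Psi> \<noteq> \<Phi>"
proof -
  note cvx = polytope_imp_convex[OF S]
  obtain A where A: "A \<in> \<Phi>" "aff_dim A = i - 1" using flag_has_dim[OF S \<Phi>, of "i - 1"] i by auto
  obtain B where B: "B \<in> \<Phi>" "aff_dim B = i" using flag_has_dim[OF S \<Phi>, of i] i by auto
  obtain C where C: "C \<in> \<Phi>" "aff_dim C = i + 1" using flag_has_dim[OF S \<Phi>, of "i + 1"] i by auto
  have le: "H \<subseteq> H'" if "H \<in> \<Phi>" "H' \<in> \<Phi>" "aff_dim H \<le> aff_dim H'" for H H'
    using flag_compare[OF \<Phi> that(1,2)] that(3)
      face_dim_mono[OF cvx flag_face[OF \<Phi> that(2)] flag_face[OF \<Phi> that(1)]] by fastforce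
  have Cf: "C face_of S" using flag_face[OF \<Phi> C(1)] .
  have Cp: "polytope C" using face_of_polytope_polytope[OF S Cf] .
  have AC: "A face_of C" using le[OF A(1) C(1)] A(2) C(2) flag_face[OF \<Phi> A(1)] face_of_face[OF Cf, of A] by auto
  obtain X where X: "X face_of C" "X \<noteq> B" "A \<subseteq> X" "aff_dim X = i"
    using ridge_card_ge_2[OF Cp AC] A C by (metis add_diff_cancel_right' diff_diff_eq2 diff_add_eq one_add_one)
  let ?\<Psi> = "insert X (\<Phi> - {B})"
  have XS: "X face_of S" "X \<subseteq> C" using X Cf face_of_trans face_of_imp_subset by blast+
  have cmp: "H \<subseteq> X \<or> X \<subseteq> H" if H: "H \<in> \<Phi>" "H \<noteq> B" for H
  proof -
    have "aff_dim H \<noteq> i" using flag_dim_unique[OF cvx \<Phi> H(1) B(1)] B H by auto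
    then consider "aff_dim H \<le> aff_dim A" | "aff_dim C \<le> aff_dim H" using A C by linarith
    then show ?thesis using le[OF H(1) A(1)] le[OF C(1) H(1)] X XS by cases blast+
  qed
  have "?\<Psi> \<in> flags (face_lattice S)"
  proof (rule flagI[OF cvx])
    show "?\<Psi> \<in> Chains (below (face_lattice S))"
      unfolding face_chain_iff using XS(1) flag_face[OF \<Phi>] flag_compare[OF \<Phi>] cmp by blast
    fix k :: int assume k: "-1 \<le> k" "k \<le> aff_dim S"
    obtain F where F: "F \<in> \<Phi>" "aff_dim F = k" using flag_has_dim[OF S \<Phi> k] by blast
    then show "\<exists>F \<in> ?\<Psi>. aff_dim F = k" using X B by (cases "F = B") auto
  qed
  moreover have "{F \<in> ?\<Psi>. aff_dim F \<noteq> i} = {F \<in> \<Phi>. aff_dim F \<noteq> i}" using X B by auto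
  moreover have "X \<notin> \<Phi>" using flag_dim_unique[OF cvx \<Phi> _ B(1), of X] X(2,4) B(2) by auto
  ultimately show ?thesis using \<Phi> unfolding adj_def by blast
qed

lemma adj_unique:
  fixes S :: "'a::euclidean_space set"
  assumes S: "polytope S" and i: "0 \<le> i" "i < aff_dim S"
    and a: "adj S i \<Phi> \<Psi>" "\<Psi> \<noteq> \<Phi>" "adj S i \<Phi> \<Psi>'" "\<Psi>' \<noteq> \<Phi>"
  shows "\<Psi> = \<Psi>'"
proof -
  note cvx = polytope_imp_convex[OF S]
  have fl: "\<Phi> \<in> flags (face_lattice S)" "\<Psi> \<in> flags (face_lattice S)" "\<Psi>' \<in> flags (face_lattice S)"
    using a unfolding adj_def by blast+
  have same: "F \<in> \<Psi> \<longleftrightarrow> F \<in> \<Phi>" "F \<in> \<Psi>' \<longleftrightarrow> F \<in> \<Phi>" if "aff_dim F \<noteq> i" for F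
    using a that unfolding adj_def by blast+
  obtain A where A: "A \<in> \<Phi>" "aff_dim A = i - 1" using flag_has_dim[OF S fl(1), of "i - 1"] i by auto
  obtain C where C: "C \<in> \<Phi>" "aff_dim C = i + 1" using flag_has_dim[OF S fl(1), of "i + 1"] i by auto
  have A': "A \<in> \<Psi>" "A \<in> \<Psi>'" and C': "C \<in> \<Psi>" "C \<in> \<Psi>'" using same A C by auto
  have le: "H \<subseteq> H'" if "X \<in> flags (face_lattice S)" "H \<in> X" "H' \<in> X" "aff_dim H < aff_dim H'" for X H H'
    using flag_compare[OF that(1,2,3)] that
      face_dim_mono[OF cvx flag_face[OF that(1,3)] flag_face[OF that(1,2)]] by fastforce
  have Cf: "C face_of S" using flag_face[OF fl(1) C(1)] .
  have Cp: "polytope C" using face_of_polytope_polytope[OF S Cf] .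
  have AC: "A face_of C" "aff_dim A = aff_dim C - 2"
    using le[OF fl(1) A(1) C(1)] A(2) C(2) flag_face[OF fl(1) A(1)] face_of_face[OF Cf, of A] by auto
  have mid: "B face_of C \<and> A \<subseteq> B" if X: "X \<in> flags (face_lattice S)" "B \<in> X" "A \<in> X" "C \<in> X" "aff_dim B = i" for X B
    using le[OF X(1,2,4)] le[OF X(1,3,2)] X(5) A(2) C(2) flag_face[OF X(1,2)] face_of_face[OF Cf, of B] by auto
  obtain B where B: "B \<in> \<Phi>" "aff_dim B = i" using flag_has_dim[OF S fl(1), of i] i by auto
  obtain B1 where B1: "B1 \<in> \<Psi>" "aff_dim B1 = i" using flag_has_dim[OF S fl(2), of i] i by auto
  obtain B2 where B2: "B2 \<in> \<Psi>'" "aff_dim B2 = i" using flag_has_dim[OF S fl(3), of i] i by auto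
  have flag_eq: "X = Y"
    if XY: "X \<in> flags (face_lattice S)" "Y \<in> flags (face_lattice S)" "\<And>F. aff_dim F \<noteq> i \<Longrightarrow> F \<in> X \<longleftrightarrow> F \<in> Y"
      "H \<in> X" "H \<in> Y" "aff_dim H = i" for X Y H
  proof (rule Set.set_eqI)
    fix F
    show "F \<in> X \<longleftrightarrow> F \<in> Y"
    proof (cases "aff_dim F = i")
      case True
      then show ?thesis
        using flag_dim_unique[OF cvx XY(1) _ XY(4), of F] flag_dim_unique[OF cvx XY(2) _ XY(5), of F] XY(4-6)
        by auto
    qed (rule XY(3))
  qed
  have "B1 \<noteq> B" using flag_eq[OF fl(2,1) same(1), of B] B B1 a by metis
  moreover have "B2 \<noteq> B" using flag_eq[OF fl(3,1) same(2), of B] B B2 a by metis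
  ultimately have "B1 = B2"
    using ridge_card_le_2[OF Cp AC, of B B1 B2] mid[OF fl(1) B(1) A(1) C(1) B(2)]
      mid[OF fl(2) B1(1) A'(1) C'(1) B1(2)] mid[OF fl(3) B2(1) A'(2) C'(2) B2(2)] B B1 B2 C by auto
  then show ?thesis using flag_eq[OF fl(2,3), of B1] same B1 B2 by metis
qed

section \<open>Connectedness of the flags\<close>

lemma affine_line:
  fixes x y :: "'a::real_vector"
  assumes A: "affine A" and t: "s \<noteq> t" "(1 - s) *\<^sub>R x + s *\<^sub>R y \<in> A" "(1 - t) *\<^sub>R x + t *\<^sub>R y \<in> A"
  shows "x \<in> A" "y \<in> A"
proof -
  have ts: "t - s \<noteq> 0" using t by simp
  have "(1 - w) *\<^sub>R x + w *\<^sub>R y \<in> A" for w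
  proof -
    obtain c where c: "c * (t - s) = w - s" using ts by (metis nonzero_eq_divide_eq)
    have "(1 - c) *\<^sub>R ((1 - s) *\<^sub>R x + s *\<^sub>R y) + c *\<^sub>R ((1 - t) *\<^sub>R x + t *\<^sub>R y) \<in> A"
      by (rule mem_affine[OF A t(2,3)]) simp
    moreover have "(1 - c) *\<^sub>R ((1 - s) *\<^sub>R x + s *\<^sub>R y) + c *\<^sub>R ((1 - t) *\<^sub>R x + t *\<^sub>R y)
      = ((1 - c) * (1 - s) + c * (1 - t)) *\<^sub>R x + ((1 - c) * s + c * t) *\<^sub>R y"
      by (simp add: algebra_simps)
    moreover have "(1 - c) * s + c * t = s + c * (t - s)" by (simp add: algebra_simps)
    moreover have "(1 - c) * (1 - s) + c * (1 - t) = (1 - s) - c * (t - s)" by (simp add: algebra_simps)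
    ultimately show ?thesis unfolding c by simp
  qed
  from this[of 0] this[of 1] show "x \<in> A" "y \<in> A" by simp_all
qed

text \<open>A segment meets an affine set in at most one point unless it lies inside it.\<close>
lemma convex_subset_Union_affine:
  fixes C :: "'a::real_vector set"
  assumes "finite \<A>" "\<And>A. A \<in> \<A> \<Longrightarrow> affine A" "convex C" "C \<noteq> {}" "C \<subseteq> \<Union>\<A>"
  shows "\<exists>A \<in> \<A>. C \<subseteq> A"
  using assms(1,2,5)
proof (induction \<A> rule: finite_induct)
  case empty
  then show ?case using assms(4) by simp
next
  case (insert A \<A>)
  show ?case
  proof (cases "C \<subseteq> A \<or> C \<subseteq> \<Union>\<A>")
    case True
    then show ?thesis using insert by auto
  next
    case False
    then obtain x y where x: "x \<in> C" "x \<notin> A" and y: "y \<in> C" "y \<notin> \<Union>\<A>" by blast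
    let ?f = "\<lambda>t. (1 - t) *\<^sub>R x + t *\<^sub>R y"
    have fin: "finite {t. ?f t \<in> B}" if B: "B \<in> insert A \<A>" for B
    proof -
      have "s = t" if "?f s \<in> B" "?f t \<in> B" for s t
        using affine_line[of B s t x y] insert.prems(1)[OF B] that x y B by blast
      then have "{t. ?f t \<in> B} \<subseteq> {SOME t. ?f t \<in> B}" by (auto intro: someI2)
      then show ?thesis using finite_subset by blast
    qed
    have "{0..1} \<subseteq> (\<Union>B \<in> insert A \<A>. {t. ?f t \<in> B})"
    proof
      fix t :: real assume "t \<in> {0..1}"
      then have "?f t \<in> C" using assms(3) x y by (simp add: convexD_alt)
      then show "t \<in> (\<Union>B \<in> insert A \<A>. {t. ?f t \<in> B})" using insert.prems(2) by blast
    qed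
    moreover have "finite (\<Union>B \<in> insert A \<A>. {t. ?f t \<in> B})" using fin insert.hyps by blast
    ultimately have "finite {0..1::real}" using finite_subset by blast
    then show ?thesis using infinite_Icc[of "0::real" 1] by simp
  qed
qed

lemma cone_point:
  fixes S :: "'a::euclidean_space set"
  assumes "convex F" "F \<noteq> {}" "z \<in> convex hull (insert p F)"
  obtains s w where "0 \<le> s" "s \<le> 1" "w \<in> F" "z = p + s *\<^sub>R (w - p)"
proof -
  obtain u v b where "0 \<le> u" "0 \<le> v" "b \<in> convex hull F" "u + v = 1" "z = u *\<^sub>R p + v *\<^sub>R b"
    using assms(3) unfolding convex_hull_insert[OF assms(2)] by blast
  moreover have "u = 1 - v" using \<open>u + v = 1\<close> by simp
  moreover have "convex hull F = F" using assms(1) by (simp add: convex_hull_eq)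
  ultimately show ?thesis using that[of v b] by (simp add: algebra_simps)
qed

text \<open>
  The cones with an interior apex over the facets cover the polytope, and a generic segment avoids the cones over faces of codimension three,
  so it can leave the union of the cones of a class of facets only through a ridge.
\<close>
lemma facets_connected:
  fixes S :: "'a::euclidean_space set"
  assumes S: "polytope S" and d: "1 \<le> aff_dim S"
    and G: "F0 \<in> \<G>" "\<And>F. F \<in> \<G> \<Longrightarrow> F face_of S \<and> aff_dim F = aff_dim S - 1"
    and closed: "\<And>F F'. \<lbrakk>F \<in> \<G>; F' face_of S; aff_dim F' = aff_dim S - 1; aff_dim (F \<inter> F') = aff_dim S - 2\<rbrakk> \<Longrightarrow> F' \<in> \<G>"
    and B: "B face_of S" "aff_dim B = aff_dim S - 1"
  shows "B \<in> \<G>"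
proof (rule ccontr)
  assume notB: "B \<notin> \<G>"
  note cvx = polytope_imp_convex[OF S]
  define facets where "facets = {F. F face_of S \<and> aff_dim F = aff_dim S - 1}"
  have finf: "finite facets" unfolding facets_def using finite_polytope_faces[OF S] by simp
  have Gf: "\<G> \<subseteq> facets" using G(2) unfolding facets_def by blast
  have Bf: "B \<in> facets" using B unfolding facets_def by blast
  have small: "aff_dim (F \<inter> F') \<le> aff_dim S - 3" if F: "F \<in> \<G>" "F' \<in> facets - \<G>" for F F'
  proof -
    have f: "F face_of S" "F' face_of S" "aff_dim F = aff_dim S - 1" "aff_dim F' = aff_dim S - 1"
      using F Gf unfolding facets_def by auto
    have "F \<inter> F' face_of S" using f face_of_Int by blast
    moreover have "F \<inter> F' \<noteq> F"
    proof
      assume "F \<inter> F' = F"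
      then have "F \<subseteq> F'" by blast
      then have "F = F'" using face_dim_eq[OF cvx f(1,2)] f(3,4) by simp
      then show False using F(1,2) by simp
    qed
    ultimately have "aff_dim (F \<inter> F') < aff_dim F" using face_dim_mono[OF cvx _ f(1), of "F \<inter> F'"] by simp
    moreover have "aff_dim (F \<inter> F') \<noteq> aff_dim S - 2" using closed[OF F(1) f(2,4)] F(2) by blast
    ultimately show ?thesis using f(3) by linarith
  qed
  have d2: "2 \<le> aff_dim S" using small[OF G(1), of B] notB Bf aff_dim_geq[of "F0 \<inter> B"] by auto
  define bad where "bad = {E. \<exists>F \<in> facets. \<exists>F' \<in> facets. E = F \<inter> F' \<and> aff_dim E \<le> aff_dim S - 3} \<union> {{}}"
  have badd: "aff_dim E \<le> aff_dim S - 3" if "E \<in> bad" for E using that d2 unfolding bad_def by auto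
  have "bad \<subseteq> (\<lambda>(F, F'). F \<inter> F') ` (facets \<times> facets) \<union> {{}}" unfolding bad_def by auto
  then have finb: "finite bad" using finf finite_subset by (meson finite.emptyI finite.insertI finite_SigmaI finite_UnI finite_imageI)
  have "S \<noteq> {}" using d by auto
  then obtain p where p: "p \<in> rel_interior S" using cvx rel_interior_eq_empty by blast
  have pS: "p \<in> S" using p rel_interior_subset by blast
  have phull: "p \<notin> affine hull F" and nonempty: "F \<noteq> {}" and Fcvx: "convex F" and dis: "F \<inter> rel_interior S = {}"
    and FS: "F \<subseteq> S"
    if "F \<in> facets" for F
  proof -
    have F: "F face_of S" "aff_dim F = aff_dim S - 1" using that unfolding facets_def by auto
    then have "F \<noteq> S" by auto
    then show "p \<notin> affine hull F" "F \<inter> rel_interior S = {}"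
      using affine_hull_face_of_disjoint_rel_interior[OF cvx F(1)] face_of_disjoint_rel_interior[OF F(1)] p by blast+
    show "F \<noteq> {}" using F d2 by auto
    show "convex F" "F \<subseteq> S" using F(1) face_of_imp_convex face_of_imp_subset by blast+
  qed
  have ins: "aff_dim (insert a E) \<le> aff_dim E + 1" for a and E :: "'a set" by (simp add: aff_dim_insert)
  have F0: "F0 \<in> facets" using G(1) Gf by blast
  obtain q where q: "q \<in> F0" "\<And>E. E \<in> bad \<Longrightarrow> q \<notin> affine hull (insert p E)"
  proof -
    let ?A = "(\<lambda>E. affine hull (insert p E)) ` bad"
    have "\<not> F0 \<subseteq> affine hull (insert p E)" if "E \<in> bad" for E
    proof
      assume "F0 \<subseteq> affine hull (insert p E)"
      then have "aff_dim F0 \<le> aff_dim (insert p E)" using aff_dim_subset aff_dim_affine_hull by metis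
      then show False using ins[of p E] badd[OF that] F0 unfolding facets_def by auto
    qed
    moreover have "affine A" if "A \<in> ?A" for A using that affine_affine_hull by blast
    ultimately have "\<not> F0 \<subseteq> \<Union>?A"
      using convex_subset_Union_affine[of ?A F0] finb Fcvx[OF F0] nonempty[OF F0] by blast
    then show thesis using that by blast
  qed
  obtain q' where q': "q' \<in> B" "\<And>E. E \<in> bad \<Longrightarrow> q' \<notin> affine hull (insert p (insert q E))"
  proof -
    let ?A = "(\<lambda>E. affine hull (insert p (insert q E))) ` bad"
    have "\<not> B \<subseteq> affine hull (insert p (insert q E))" if "E \<in> bad" for E
    proof
      assume "B \<subseteq> affine hull (insert p (insert q E))"
      then have sub: "affine hull B \<subseteq> affine hull (insert p (insert q E))" by (simp add: hull_minimal)
      have "p \<in> affine hull (insert p (insert q E))" by (simp add: hull_inc)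
      then have "affine hull B \<subset> affine hull (insert p (insert q E))" using sub phull[OF Bf] by blast
      then have "aff_dim B < aff_dim (insert p (insert q E))"
        using aff_dim_psubset[of B "insert p (insert q E)"] by simp
      then show False using ins[of p "insert q E"] ins[of q E] badd[OF that] B by linarith
    qed
    moreover have "affine A" if "A \<in> ?A" for A using that affine_affine_hull by blast
    ultimately have "\<not> B \<subseteq> \<Union>?A"
      using convex_subset_Union_affine[of ?A B] finb Fcvx[OF Bf] nonempty[OF Bf] by blast
    then show thesis using that by blast
  qed
  have on_seg: "q' \<in> affine hull (insert p (insert q E))"
    if z: "z \<in> closed_segment q q'" "z \<noteq> q" "z \<in> affine hull (insert p E)" for z E
  proof -
    obtain t where t: "z = (1 - t) *\<^sub>R q + t *\<^sub>R q'" using z(1) unfolding closed_segment_def by blast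
    then have t0: "t \<noteq> 0" using z(2) by auto
    let ?A = "affine hull (insert p (insert q E))"
    have "q \<in> ?A" by (simp add: hull_inc)
    moreover have "z \<in> ?A" using z(3) hull_mono[of "insert p E" "insert p (insert q E)" affine] by blast
    ultimately have "(1 - inverse t) *\<^sub>R q + inverse t *\<^sub>R z \<in> ?A" by (intro mem_affine) auto
    moreover have "(1 - inverse t) *\<^sub>R q + inverse t *\<^sub>R z = q'"
      unfolding t using t0 by (simp add: algebra_simps)
    ultimately show ?thesis by simp
  qed
  have pq: "p \<noteq> q" using q(1) dis[OF F0] p by blast
  have p_seg: "p \<notin> closed_segment q q'"
  proof
    assume "p \<in> closed_segment q q'"
    then have "q' \<in> affine hull (insert p (insert q {}))" using on_seg[of p "{}"] pq by (simp add: hull_inc)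
    then show False using q'(2)[of "{}"] by (simp add: bad_def)
  qed
  let ?cone = "\<lambda>F. convex hull (insert p F)"
  have seg_S: "closed_segment q q' \<subseteq> S"
    using q(1) q'(1) FS[OF F0] FS[OF Bf] by (intro closed_segment_subset cvx) auto
  have cover: "\<exists>F \<in> facets. z \<in> ?cone F" if z: "z \<in> S" "z \<noteq> p" for z
  proof -
    have bS: "bounded S" using S polytope_imp_bounded by blast
    have aff: "p + (z - p) \<in> affine hull S" using z by (simp add: hull_inc)
    obtain c where c: "0 < c" "p + c *\<^sub>R (z - p) \<in> rel_frontier S"
      using ray_to_rel_frontier[OF bS p aff] z(2) by auto
    let ?w = "p + c *\<^sub>R (z - p)"
    have wc: "?w \<in> S" "?w \<notin> rel_interior S"
      using c(2) polytope_imp_closed[OF S] unfolding rel_frontier_def by auto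
    have c1: "1 \<le> c"
    proof (rule ccontr)
      assume "\<not> 1 \<le> c"
      then have "?w \<in> open_segment p z"
        unfolding in_segment using c(1) z(2) by (intro conjI exI[of _ c]) (auto simp: algebra_simps)
      then show False
        using rel_interior_closure_convex_segment[OF cvx p] closure_subset z(1) wc by blast
    qed
    have "?w \<in> \<Union>{F. F facet_of S}"
      using c(2) rel_frontier_of_polyhedron[OF polytope_imp_polyhedron[OF S]] by simp
    then obtain F where F: "F facet_of S" "?w \<in> F" by blast
    have "z = (1 - inverse c) *\<^sub>R p + inverse c *\<^sub>R ?w" using c(1) by (simp add: algebra_simps)
    moreover have "(1 - inverse c) *\<^sub>R p + inverse c *\<^sub>R ?w \<in> ?cone F"
    proof (rule convexD_alt[OF convex_convex_hull])
      show "p \<in> ?cone F" "?w \<in> ?cone F" using F(2) by (auto intro: hull_inc)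
      show "0 \<le> inverse c" "inverse c \<le> 1" using c1 by (auto simp: inverse_le_1_iff)
    qed
    ultimately have "z \<in> ?cone F" by simp
    then show ?thesis using F(1) unfolding facets_def facet_of_def by blast
  qed
  have cone_closed: "closed (?cone F)" if "F \<in> facets" for F
  proof -
    have "polytope F" using that face_of_polytope_polytope[OF S] unfolding facets_def by blast
    then show ?thesis by (intro compact_imp_closed compact_convex_hull compact_insert polytope_imp_compact)
  qed
  let ?U = "\<Union>F \<in> \<G>. ?cone F" and ?V = "\<Union>F \<in> facets - \<G>. ?cone F"
  have "closed ?U" "closed ?V"
    using cone_closed Gf finf finite_subset[OF Gf finf] by (auto intro!: closed_UN)
  moreover have "closed_segment q q' \<subseteq> ?U \<union> ?V"
  proof
    fix z assume z: "z \<in> closed_segment q q'"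
    then have "z \<in> S" "z \<noteq> p" using seg_S p_seg by blast+
    then show "z \<in> ?U \<union> ?V" using cover by blast
  qed
  moreover have "q \<in> ?U" using q(1) G(1) by (blast intro: hull_inc)
  moreover have "q' \<in> ?V" using q'(1) Bf notB by (blast intro: hull_inc)
  ultimately have "?U \<inter> ?V \<inter> closed_segment q q' \<noteq> {}"
    using connected_segment(1)[of q q'] unfolding connected_closed
    by (metis IntI disjoint_iff ends_in_segment(1) ends_in_segment(2))
  then obtain z F1 F2 where z: "z \<in> closed_segment q q'" "F1 \<in> \<G>" "z \<in> ?cone F1" "F2 \<in> facets - \<G>" "z \<in> ?cone F2"
    by blast
  have F12: "F1 \<in> facets" "F2 \<in> facets" using z Gf by auto
  have zp: "z \<noteq> p" using z(1) p_seg by blast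
  obtain s1 w1 where 1: "0 \<le> s1" "s1 \<le> 1" "w1 \<in> F1" "z = p + s1 *\<^sub>R (w1 - p)"
    using cone_point[OF Fcvx nonempty z(3)] F12 by blast
  obtain s2 w2 where 2: "0 \<le> s2" "s2 \<le> 1" "w2 \<in> F2" "z = p + s2 *\<^sub>R (w2 - p)"
    using cone_point[OF Fcvx nonempty z(5)] F12 by blast
  have pos: "0 < s1" "0 < s2" using 1 2 zp by (auto simp: less_le)
  have not_less: "\<not> s < s'"
    if h: "0 < s" "0 < s'" "w \<in> F" "w' \<in> F'" "F \<in> facets" "F' \<in> facets" "s *\<^sub>R (w - p) = s' *\<^sub>R (w' - p)" for s s' w w' F F'
  proof
    assume less: "s < s'"
    have "w' = p + inverse s' *\<^sub>R (s' *\<^sub>R (w' - p))" using h by simp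
    also have "\<dots> = p + (s / s') *\<^sub>R (w - p)" unfolding h(7)[symmetric] using h by (simp add: field_simps)
    finally have w': "w' = (1 - s / s') *\<^sub>R p + (s / s') *\<^sub>R w" by (simp add: algebra_simps)
    have "w \<noteq> p" using h(3) dis[OF h(5)] p by blast
    then have "w' \<in> open_segment p w" unfolding in_segment using w' h less by (intro conjI exI[of _ "s / s'"]) auto
    then have "w' \<in> rel_interior S"
      using rel_interior_closure_convex_segment[OF cvx p, of w] closure_subset FS[OF h(5)] h(3) by blast
    then show False using dis[OF h(6)] h(4) by blast
  qed
  have eqv: "s1 *\<^sub>R (w1 - p) = s2 *\<^sub>R (w2 - p)" using 1 2 by simp
  have "s1 = s2"
    using not_less[OF pos 1(3) 2(3) F12 eqv] not_less[OF pos(2,1) 2(3) 1(3) F12(2,1) eqv[symmetric]] by simp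
  then have "w1 = w2" using eqv pos by simp
  then have w: "w1 \<in> F1 \<inter> F2" using 1 2 by blast
  have E: "F1 \<inter> F2 \<in> bad" using small[OF z(2,4)] F12 unfolding bad_def by blast
  have "z \<in> affine hull (insert p (F1 \<inter> F2))"
  proof -
    have "(1 - s1) *\<^sub>R p + s1 *\<^sub>R w1 \<in> affine hull (insert p (F1 \<inter> F2))"
      using w by (intro mem_affine affine_affine_hull hull_inc) auto
    moreover have "z = (1 - s1) *\<^sub>R p + s1 *\<^sub>R w1" unfolding 1(4) by (simp add: algebra_simps)
    ultimately show ?thesis by simp
  qed
  then show False using on_seg[OF z(1)] q(2)[OF E] q'(2)[OF E] by blast
qed

lemma flag_insert:
  fixes S :: "'a::euclidean_space set"
  assumes S: "polytope S" and F: "F face_of S" "aff_dim F = aff_dim S - 1" and \<Psi>: "\<Psi> \<in> flags (face_lattice F)"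
  shows "insert S \<Psi> \<in> flags (face_lattice S)"
proof (rule flagI[OF polytope_imp_convex[OF S]])
  have P: "polytope F" using face_of_polytope_polytope[OF S F(1)] .
  show "insert S \<Psi> \<in> Chains (below (face_lattice S))"
    unfolding face_chain_iff
    using flag_face[OF \<Psi>] flag_compare[OF \<Psi>] face_of_trans[OF _ F(1)] face_of_refl[OF polytope_imp_convex[OF S]]
      face_of_imp_subset[OF face_of_trans[OF _ F(1)]] by blast
  fix k :: int assume k: "-1 \<le> k" "k \<le> aff_dim S"
  show "\<exists>X \<in> insert S \<Psi>. aff_dim X = k"
    using flag_has_dim[OF P \<Psi>, of k] k F(2) by (cases "k = aff_dim S") auto
qed

lemma flag_remove:
  fixes S :: "'a::euclidean_space set"
  assumes S: "polytope S" and \<Phi>: "\<Phi> \<in> flags (face_lattice S)" and F: "F \<in> \<Phi>" "aff_dim F = aff_dim S - 1"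
  shows "S \<in> \<Phi>" "\<Phi> - {S} \<in> flags (face_lattice F)"
proof -
  note cvx = polytope_imp_convex[OF S]
  have Ff: "F face_of S" using flag_face[OF \<Phi> F(1)] .
  have P: "polytope F" using face_of_polytope_polytope[OF S Ff] .
  obtain X where X: "X \<in> \<Phi>" "aff_dim X = aff_dim S" using flag_has_dim[OF S \<Phi>, of "aff_dim S"] aff_dim_geq by auto
  have "X = S" using face_of_aff_dim_lt[OF cvx flag_face[OF \<Phi> X(1)]] X by auto
  then show "S \<in> \<Phi>" using X by simp
  have sub: "H face_of F" if H: "H \<in> \<Phi> - {S}" for H
  proof -
    have Hf: "H face_of S" using flag_face[OF \<Phi>] H by blast
    then have less: "aff_dim H < aff_dim S" using face_of_aff_dim_lt[OF cvx] H by blast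
    have "H \<subseteq> F" using flag_compare[OF \<Phi>, of H F] face_dim_mono[OF cvx Ff Hf] H F less by auto
    then show ?thesis using Hf face_of_face[OF Ff] by blast
  qed
  show "\<Phi> - {S} \<in> flags (face_lattice F)"
  proof (rule flagI[OF polytope_imp_convex[OF P]])
    show "\<Phi> - {S} \<in> Chains (below (face_lattice F))"
      unfolding face_chain_iff using sub flag_compare[OF \<Phi>] by blast
    fix k :: int assume k: "-1 \<le> k" "k \<le> aff_dim F"
    obtain Y where "Y \<in> \<Phi>" "aff_dim Y = k" using flag_has_dim[OF S \<Phi> k(1)] k F by auto
    then show "\<exists>Y \<in> \<Phi> - {S}. aff_dim Y = k" using k F by (intro bexI[of _ Y]) auto
  qed
qed

theorem flags_connected:
  fixes S :: "'a::euclidean_space set"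
  assumes "polytope S" "\<S> \<subseteq> flags (face_lattice S)" "\<S> \<noteq> {}"
    and "\<And>i \<Phi> \<Psi>. \<lbrakk>\<Phi> \<in> \<S>; adj S i \<Phi> \<Psi>; 0 \<le> i; i < aff_dim S\<rbrakk> \<Longrightarrow> \<Psi> \<in> \<S>"
  shows "flags (face_lattice S) \<subseteq> \<S>"
proof -
  have "flags (face_lattice S) \<subseteq> \<S>"
    if "polytope S" "aff_dim S = int n - 1" "\<S> \<subseteq> flags (face_lattice S)" "\<S> \<noteq> {}"
      "\<And>i \<Phi> \<Psi>. \<lbrakk>\<Phi> \<in> \<S>; adj S i \<Phi> \<Psi>; 0 \<le> i; i < aff_dim S\<rbrakk> \<Longrightarrow> \<Psi> \<in> \<S>" for n and S :: "'a set" and \<S>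
    using that
  proof (induction n arbitrary: S \<S>)
    case 0
    then have "S = {}" using aff_dim_empty[of S] by simp
    have "\<Phi> = {{}}" if "\<Phi> \<in> flags (face_lattice S)" for \<Phi>
    proof -
      have "F = {}" if "F \<in> \<Phi>" for F using flag_face[OF \<open>\<Phi> \<in> _\<close> that] \<open>S = {}\<close> by simp
      moreover have "\<exists>F \<in> \<Phi>. aff_dim F = -1" using flag_has_dim[OF 0(1) that] 0(2) by simp
      ultimately show ?thesis by blast
    qed
    then show ?case using 0(3,4) by blast
  next
    case (Suc n)
    note S = Suc.prems(1) and dS = Suc.prems(2) and cl = Suc.prems(5)
    have cvx: "convex S" using polytope_imp_convex[OF S] .
    let ?X = "\<lambda>F. {\<Psi> \<in> flags (face_lattice F). insert S \<Psi> \<in> \<S>}"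
    define facets where "facets = {F. F face_of S \<and> aff_dim F = aff_dim S - 1}"
    have all: "flags (face_lattice F) \<subseteq> ?X F" if F: "F \<in> facets" "?X F \<noteq> {}" for F
    proof (rule Suc.IH[OF _ _ _ F(2)])
      have f: "F face_of S" "aff_dim F = aff_dim S - 1" using F unfolding facets_def by auto
      show "polytope F" "aff_dim F = int n - 1" "?X F \<subseteq> flags (face_lattice F)"
        using face_of_polytope_polytope[OF S f(1)] f(2) dS by auto
      fix i \<Phi> \<Psi> assume h: "\<Phi> \<in> ?X F" "adj F i \<Phi> \<Psi>" "0 \<le> i" "i < aff_dim F"
      have "insert S \<Phi> \<in> flags (face_lattice S)" "insert S \<Psi> \<in> flags (face_lattice S)"
        using flag_insert[OF S f] h unfolding adj_def by auto
      moreover have "{X \<in> insert S \<Psi>. aff_dim X \<noteq> i} = {X \<in> insert S \<Phi>. aff_dim X \<noteq> i}"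
        using h(2) unfolding adj_def by blast
      ultimately have "adj S i (insert S \<Phi>) (insert S \<Psi>)" unfolding adj_def by blast
      then have "insert S \<Psi> \<in> \<S>" using cl[of "insert S \<Phi>" i "insert S \<Psi>"] h f by auto
      then show "\<Psi> \<in> ?X F" using h(2) unfolding adj_def by blast
    qed
    define \<G> where "\<G> = {F \<in> facets. ?X F \<noteq> {}}"
    obtain \<Phi>0 where \<Phi>0: "\<Phi>0 \<in> \<S>" using Suc.prems(4) by blast
    have split: "\<exists>F \<in> facets. \<Phi> - {S} \<in> flags (face_lattice F) \<and> insert S (\<Phi> - {S}) = \<Phi>"
      if \<Phi>: "\<Phi> \<in> flags (face_lattice S)" for \<Phi>
    proof -
      obtain F where F: "F \<in> \<Phi>" "aff_dim F = aff_dim S - 1"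
        using flag_has_dim[OF S \<Phi>, of "aff_dim S - 1"] dS by auto
      then show ?thesis using flag_remove[OF S \<Phi> F] flag_face[OF \<Phi> F(1)] unfolding facets_def by blast
    qed
    have "\<Phi>0 \<in> flags (face_lattice S)" using \<Phi>0 Suc.prems(3) by blast
    then obtain F0 where F0: "F0 \<in> \<G>" using split[of \<Phi>0] \<Phi>0 unfolding \<G>_def by fastforce
    have good: "F \<in> \<G>" if F: "F \<in> facets" for F
    proof (cases "1 \<le> aff_dim S")
      case True
      have FS: "F face_of S" "aff_dim F = aff_dim S - 1" using F unfolding facets_def by auto
      show ?thesis
      proof (rule facets_connected[OF S True F0 _ _ FS])
        show "H face_of S \<and> aff_dim H = aff_dim S - 1" if "H \<in> \<G>" for H using that unfolding \<G>_def facets_def by blast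
        fix H H' assume h: "H \<in> \<G>" "H' face_of S" "aff_dim H' = aff_dim S - 1" "aff_dim (H \<inter> H') = aff_dim S - 2"
        have Hf: "H face_of S" "aff_dim H = aff_dim S - 1" "H \<in> facets" "?X H \<noteq> {}"
          using h(1) unfolding \<G>_def facets_def by auto
        let ?R = "H \<inter> H'"
        have R: "?R face_of H" "?R face_of H'"
          using face_of_Int[OF Hf(1) h(2)] face_of_face[OF Hf(1)] face_of_face[OF h(2)] by blast+
        have PH: "polytope H" "polytope H'" using face_of_polytope_polytope[OF S] Hf h by auto
        have "polytope ?R" using face_of_polytope_polytope[OF PH(1) R(1)] .
        moreover have "{} \<in> Chains (below (face_lattice ?R))" unfolding Chains_def by simp
        ultimately obtain \<Psi> where \<Psi>: "\<Psi> \<in> flags (face_lattice ?R)" using chain_extends by metis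
        have ins: "insert H \<Psi> \<in> flags (face_lattice H)" "insert H' \<Psi> \<in> flags (face_lattice H')"
          using flag_insert[OF PH(1) R(1) _ \<Psi>] flag_insert[OF PH(2) R(2) _ \<Psi>] Hf h by auto
        then have 1: "insert S (insert H \<Psi>) \<in> \<S>" using all[OF Hf(3,4)] by blast
        have "adj S (aff_dim S - 1) (insert S (insert H \<Psi>)) (insert S (insert H' \<Psi>))"
          unfolding adj_def using flag_insert[OF S Hf(1,2) ins(1)] flag_insert[OF S h(2,3) ins(2)] Hf(2) h(3) by auto
        then have "insert S (insert H' \<Psi>) \<in> \<S>" using cl[OF 1] True by auto
        then show "H' \<in> \<G>" unfolding \<G>_def facets_def using h(2,3) ins(2) by blast
      qed
    next
      case False
      have "F = {}" if "F \<in> facets" for F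
        using that False aff_dim_geq[of F] aff_dim_empty[of F] unfolding facets_def by auto
      then show ?thesis using F F0 unfolding \<G>_def by blast
    qed
    show ?case
    proof
      fix \<Phi> assume \<Phi>: "\<Phi> \<in> flags (face_lattice S)"
      then obtain F where F: "F \<in> facets" "\<Phi> - {S} \<in> flags (face_lattice F)" "insert S (\<Phi> - {S}) = \<Phi>"
        using split by blast
      then have "\<Phi> - {S} \<in> ?X F" using all[OF F(1)] good[OF F(1)] unfolding \<G>_def by blast
      then show "\<Phi> \<in> \<S>" using F(3) by simp
    qed
  qed
  from this[of S "nat (aff_dim S + 1)" \<S>] show ?thesis using assms aff_dim_geq[of S] by simp
qed

section \<open>Automorphisms of a ranked poset\<close>

abbreviation auts :: "'a ranked_poset \<Rightarrow> ('a \<Rightarrow> 'a) set" where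
  "auts P \<equiv> carrier (aut_group P)"

lemma auts_iff:
  "f \<in> auts P \<longleftrightarrow> f \<in> Bij (faces P) \<and>
     (\<forall>x \<in> faces P. \<forall>y \<in> faces P. (x, y) \<in> below P \<longleftrightarrow> (f x, f y) \<in> below P)"
  by (simp add: aut_group_def)

lemma aut_face: "\<lbrakk>f \<in> auts P; x \<in> faces P\<rbrakk> \<Longrightarrow> f x \<in> faces P"
  unfolding auts_iff Bij_def bij_betw_def by blast

lemma aut_below: "\<lbrakk>f \<in> auts P; x \<in> faces P; y \<in> faces P\<rbrakk> \<Longrightarrow> (f x, f y) \<in> below P \<longleftrightarrow> (x, y) \<in> below P"
  unfolding auts_iff by blast

lemma aut_inj: "\<lbrakk>f \<in> auts P; x \<in> faces P; y \<in> faces P; f x = f y\<rbrakk> \<Longrightarrow> x = y"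
  unfolding auts_iff Bij_def bij_betw_def inj_on_def by blast

lemma aut_mult: "\<lbrakk>f \<in> auts P; g \<in> auts P\<rbrakk> \<Longrightarrow> f \<otimes>\<^bsub>aut_group P\<^esub> g = compose (faces P) f g"
  unfolding auts_iff by (simp add: aut_group_def BijGroup_def)

lemma aut_mult_apply:
  "\<lbrakk>f \<in> auts P; g \<in> auts P; x \<in> faces P\<rbrakk> \<Longrightarrow> (f \<otimes>\<^bsub>aut_group P\<^esub> g) x = f (g x)"
  by (simp add: aut_mult compose_def)

lemma aut_one: "\<one>\<^bsub>aut_group P\<^esub> = (\<lambda>x \<in> faces P. x)"
  by (simp add: aut_group_def BijGroup_def)

lemma aut_eqI: "\<lbrakk>f \<in> auts P; g \<in> auts P; \<And>x. x \<in> faces P \<Longrightarrow> f x = g x\<rbrakk> \<Longrightarrow> f = g"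
  by (rule extensionalityI[of f "faces P"]) (simp_all add: auts_iff Bij_def)

lemma group_aut_group: "group (aut_group P)"
proof -
  interpret B: group "BijGroup (faces P)" by (rule group_BijGroup)
  have car: "f \<in> carrier (BijGroup (faces P)) \<longleftrightarrow> f \<in> Bij (faces P)" for f by (simp add: BijGroup_def)
  have "subgroup (auts P) (BijGroup (faces P))"
  proof (rule B.subgroupI)
    show "auts P \<subseteq> carrier (BijGroup (faces P))" unfolding subset_iff car auts_iff by simp
    have "(\<lambda>x \<in> faces P. x) \<in> auts P" unfolding auts_iff using id_Bij by simp
    then show "auts P \<noteq> {}" by blast
    fix f assume f: "f \<in> auts P"
    then have fB: "f \<in> Bij (faces P)" by (simp add: auts_iff)
    let ?g = "\<lambda>x \<in> faces P. inv_into (faces P) f x"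
    have inv: "inv\<^bsub>BijGroup (faces P)\<^esub> f = ?g" using inv_BijGroup[OF fB] .
    have gB: "?g \<in> Bij (faces P)" using B.inv_closed[of f] fB car inv by simp
    have surj: "f ` faces P = faces P" using fB unfolding Bij_def bij_betw_def by blast
    have g: "?g x \<in> faces P" "f (?g x) = x" if "x \<in> faces P" for x
      using that surj inv_into_into[of x f "faces P"] f_inv_into_f[of x f "faces P"] by auto
    have "(x, y) \<in> below P \<longleftrightarrow> (?g x, ?g y) \<in> below P" if "x \<in> faces P" "y \<in> faces P" for x y
      using aut_below[OF f g(1)[OF that(1)] g(1)[OF that(2)]] g(2) that by simp
    then show "inv\<^bsub>BijGroup (faces P)\<^esub> f \<in> auts P" unfolding inv auts_iff using gB by blast
  next
    fix f g assume fg: "f \<in> auts P" "g \<in> auts P"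
    then have "f \<in> Bij (faces P)" "g \<in> Bij (faces P)" by (simp_all add: auts_iff)
    then have mult: "f \<otimes>\<^bsub>BijGroup (faces P)\<^esub> g = compose (faces P) f g" by (simp add: BijGroup_def)
    have "f \<otimes>\<^bsub>BijGroup (faces P)\<^esub> g \<in> Bij (faces P)"
      using B.m_closed[of f g] \<open>f \<in> Bij _\<close> \<open>g \<in> Bij _\<close> car by simp
    moreover have "(x, y) \<in> below P \<longleftrightarrow> (compose (faces P) f g x, compose (faces P) f g y) \<in> below P"
      if "x \<in> faces P" "y \<in> faces P" for x y
      using that aut_below[OF fg(2) that] aut_below[OF fg(1) aut_face[OF fg(2) that(1)] aut_face[OF fg(2) that(2)]]
      by (simp add: compose_def)
    ultimately show "f \<otimes>\<^bsub>BijGroup (faces P)\<^esub> g \<in> auts P" unfolding auts_iff mult by blast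
  qed
  moreover have "aut_group P = (BijGroup (faces P))\<lparr>carrier := auts P\<rparr>"
    by (simp add: aut_group_def)
  ultimately show ?thesis using B.subgroup_imp_group by metis
qed

section \<open>Automorphisms of the face lattice of a convex polytope\<close>

lemma aut_subset_iff:
  assumes "f \<in> auts (face_lattice S)" "F face_of S" "G face_of S"
  shows "f F \<subseteq> f G \<longleftrightarrow> F \<subseteq> G"
  using aut_below[OF assms(1), of F G] aut_face[OF assms(1)] assms(2,3) by simp

lemma aut_face_of: "\<lbrakk>f \<in> auts (face_lattice S); F face_of S\<rbrakk> \<Longrightarrow> f F face_of S"
  using aut_face[of f "face_lattice S" F] by simp

lemma aut_dim:
  fixes S :: "'a::euclidean_space set"
  assumes S: "polytope S" and f: "f \<in> auts (face_lattice S)" and F: "F face_of S"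
  shows "aff_dim (f F) = aff_dim F"
proof -
  note cvx = polytope_imp_convex[OF S]
  interpret group "aut_group (face_lattice S)" by (rule group_aut_group)
  have ge: "aff_dim F \<le> aff_dim (g F)"
    if "g \<in> auts (face_lattice S)" "F face_of S" "aff_dim F = int n - 1" for g F n
    using that
  proof (induction n arbitrary: F)
    case 0
    then show ?case using aff_dim_geq[of "g F"] by simp
  next
    case (Suc n)
    have "F \<noteq> {}" using Suc by auto
    then obtain G where G: "G face_of F" "aff_dim G = aff_dim F - 1"
      using next_face[OF face_of_polytope_polytope[OF S Suc.prems(2)], of "{}"] by auto
    then have GS: "G face_of S" using Suc face_of_trans by blast
    have "G \<subseteq> F" "G \<noteq> F" using G face_of_imp_subset by auto
    then have "g G \<subseteq> g F" "\<not> g F \<subseteq> g G"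
      using aut_subset_iff[OF Suc.prems(1) GS Suc.prems(2)] aut_subset_iff[OF Suc.prems(1,2) GS] by simp_all
    then have "aff_dim (g G) < aff_dim (g F)"
      using face_dim_mono[OF cvx aut_face_of[OF Suc.prems(1) GS] aut_face_of[OF Suc.prems(1,2)]] by blast
    moreover have "aff_dim G \<le> aff_dim (g G)" using Suc.IH[OF Suc.prems(1) GS] G Suc.prems(3) by simp
    ultimately show ?case using G by linarith
  qed
  have n: "\<exists>n. aff_dim G = int n - 1" for G :: "'a set"
    using aff_dim_geq[of G] by (intro exI[of _ "nat (aff_dim G + 1)"]) simp
  let ?i = "inv\<^bsub>aut_group (face_lattice S)\<^esub> f"
  have "?i (f F) = (?i \<otimes>\<^bsub>aut_group (face_lattice S)\<^esub> f) F"
    using aut_mult_apply[OF inv_closed[OF f] f, of F] F unfolding faces_face_lattice by simp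
  also have "\<dots> = F" unfolding l_inv[OF f] aut_one using F by simp
  finally have "?i (f F) = F" .
  moreover have "aff_dim (f F) \<le> aff_dim (?i (f F))" 
    using n[of "f F"] ge[OF inv_closed[OF f] aut_face_of[OF f F]] by blast
  moreover have "aff_dim F \<le> aff_dim (f F)" using n[of F] ge[OF f F] by blast
  ultimately show ?thesis by simp
qed

lemma aut_flag:
  fixes S :: "'a::euclidean_space set"
  assumes S: "polytope S" and f: "f \<in> auts (face_lattice S)" and \<Phi>: "\<Phi> \<in> flags (face_lattice S)"
  shows "f ` \<Phi> \<in> flags (face_lattice S)"
proof (rule flagI[OF polytope_imp_convex[OF S]])
  show "f ` \<Phi> \<in> Chains (below (face_lattice S))"
    unfolding face_chain_iff
    using flag_face[OF \<Phi>] flag_compare[OF \<Phi>] aut_face_of[OF f] aut_subset_iff[OF f] by (auto 4 3)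
  fix k :: int assume k: "-1 \<le> k" "k \<le> aff_dim S"
  obtain F where "F \<in> \<Phi>" "aff_dim F = k" using flag_has_dim[OF S \<Phi> k] by blast
  then show "\<exists>F \<in> f ` \<Phi>. aff_dim F = k" using aut_dim[OF S f flag_face[OF \<Phi>]] by blast
qed

lemma aut_adj:
  fixes S :: "'a::euclidean_space set"
  assumes S: "polytope S" and f: "f \<in> auts (face_lattice S)" and a: "adj S i \<Phi> \<Psi>"
  shows "adj S i (f ` \<Phi>) (f ` \<Psi>)"
proof -
  have fl: "\<Phi> \<in> flags (face_lattice S)" "\<Psi> \<in> flags (face_lattice S)"
    and eq: "{F \<in> \<Psi>. aff_dim F \<noteq> i} = {F \<in> \<Phi>. aff_dim F \<noteq> i}"
    using a unfolding adj_def by auto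
  have "{F \<in> f ` X. aff_dim F \<noteq> i} = f ` {F \<in> X. aff_dim F \<noteq> i}" if "X \<in> flags (face_lattice S)" for X
    using aut_dim[OF S f flag_face[OF that]] by auto
  then show ?thesis unfolding adj_def using aut_flag[OF S f] fl eq by simp
qed

lemma aut_image_inj:
  assumes f: "f \<in> auts (face_lattice S)" and fl: "\<Phi> \<in> flags (face_lattice S)" "\<Psi> \<in> flags (face_lattice S)"
    and eq: "f ` \<Phi> = f ` \<Psi>"
  shows "\<Phi> = \<Psi>"
proof -
  have "inj_on f {F. F face_of S}" using aut_inj[OF f] by (intro inj_onI) simp
  moreover have "\<Phi> \<subseteq> {F. F face_of S}" "\<Psi> \<subseteq> {F. F face_of S}" using fl flag_face by blast+
  ultimately show ?thesis using eq inj_on_image_eq_iff by metis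
qed

lemma aut_eq_on_flag:
  fixes S :: "'a::euclidean_space set"
  assumes S: "polytope S" and f: "f \<in> auts (face_lattice S)" and g: "g \<in> auts (face_lattice S)"
    and \<Phi>: "\<Phi> \<in> flags (face_lattice S)" and eq: "f ` \<Phi> = g ` \<Phi>" and F: "F \<in> \<Phi>"
  shows "f F = g F"
proof -
  obtain F' where F': "F' \<in> \<Phi>" "f F = g F'" using eq F by blast
  have "aff_dim F' = aff_dim F"
    using aut_dim[OF S f flag_face[OF \<Phi> F]] aut_dim[OF S g flag_face[OF \<Phi> F'(1)]] F' by simp
  then have "F' = F" using flag_dim_unique[OF polytope_imp_convex[OF S] \<Phi> F'(1) F] by simp
  then show ?thesis using F' by simp
qed

text \<open>
  Agreement on a flag propagates to adjacent flags, since an adjacent flag is unique, and the flags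
  are connected.
\<close>
theorem aut_determined_by_flag:
  fixes S :: "'a::euclidean_space set"
  assumes S: "polytope S" and f: "f \<in> auts (face_lattice S)" and g: "g \<in> auts (face_lattice S)"
    and \<Phi>: "\<Phi> \<in> flags (face_lattice S)" and eq: "f ` \<Phi> = g ` \<Phi>"
  shows "f = g"
proof -
  let ?S = "{\<Psi> \<in> flags (face_lattice S). f ` \<Psi> = g ` \<Psi>}"
  have sub: "flags (face_lattice S) \<subseteq> ?S"
  proof (rule flags_connected[OF S])
    show "?S \<noteq> {}" using \<Phi> eq by blast
    fix i \<Psi> \<Psi>' assume h: "\<Psi> \<in> ?S" "adj S i \<Psi> \<Psi>'" "0 \<le> i" "i < aff_dim S"
    have fl: "\<Psi> \<in> flags (face_lattice S)" "\<Psi>' \<in> flags (face_lattice S)" using h unfolding adj_def by auto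
    have "f ` \<Psi>' = g ` \<Psi>'" if "\<Psi>' \<noteq> \<Psi>"
    proof (rule adj_unique[OF S h(3,4)])
      show "adj S i (f ` \<Psi>) (f ` \<Psi>')" using aut_adj[OF S f h(2)] .
      show "f ` \<Psi>' \<noteq> f ` \<Psi>" using aut_image_inj[OF f fl(2,1)] that by blast
      have "f ` \<Psi> = g ` \<Psi>" using h(1) by simp
      then show "adj S i (f ` \<Psi>) (g ` \<Psi>')" "g ` \<Psi>' \<noteq> f ` \<Psi>"
        using aut_adj[OF S g h(2)] aut_image_inj[OF g fl(2,1)] that by auto
    qed
    then show "\<Psi>' \<in> ?S" using h(1) fl by (cases "\<Psi>' = \<Psi>") auto
  qed simp
  show ?thesis
  proof (rule aut_eqI[OF f g])
    fix F assume "F \<in> faces (face_lattice S)"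
    then have "{F} \<in> Chains (below (face_lattice S))" unfolding face_chain_iff by simp
    then obtain \<Psi> where \<Psi>: "\<Psi> \<in> flags (face_lattice S)" "{F} \<subseteq> \<Psi>" using chain_extends[OF S] by blast
    then show "f F = g F" using aut_eq_on_flag[OF S f g \<Psi>(1)] sub by auto
  qed
qed

lemma aut_one_if_fixes_flag:
  fixes S :: "'a::euclidean_space set"
  assumes S: "polytope S" and f: "f \<in> auts (face_lattice S)"
    and \<Phi>: "\<Phi> \<in> flags (face_lattice S)" and eq: "f ` \<Phi> = \<Phi>"
  shows "f = \<one>\<^bsub>aut_group (face_lattice S)\<^esub>"
proof (rule aut_determined_by_flag[OF S f _ \<Phi>])
  interpret group "aut_group (face_lattice S)" by (rule group_aut_group)
  show "\<one>\<^bsub>aut_group (face_lattice S)\<^esub> \<in> auts (face_lattice S)" by simp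
  have "\<one>\<^bsub>aut_group (face_lattice S)\<^esub> ` \<Phi> = \<Phi>"
    using flag_face[OF \<Phi>] by (force simp: aut_one)
  then show "f ` \<Phi> = \<one>\<^bsub>aut_group (face_lattice S)\<^esub> ` \<Phi>" using eq by simp
qed

section \<open>Symmetries\<close>

definition symmetry :: "'a::euclidean_space set \<Rightarrow> ('a \<Rightarrow> 'a) \<Rightarrow> bool" where
  "symmetry S g \<longleftrightarrow> (\<forall>x y. dist (g x) (g y) = dist x y) \<and> g ` S = S"

definition on_faces :: "'a::euclidean_space set \<Rightarrow> ('a \<Rightarrow> 'a) \<Rightarrow> 'a set \<Rightarrow> 'a set" where
  "on_faces S g = (\<lambda>F \<in> faces (face_lattice S). g ` F)"

definition lin_part :: "('a::euclidean_space \<Rightarrow> 'a) \<Rightarrow> 'a \<Rightarrow> 'a" where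
  "lin_part g x = g x - g 0"

lemma lin_part_orthogonal: "symmetry S g \<Longrightarrow> orthogonal_transformation (lin_part g)"
  unfolding orthogonal_transformation_isometry lin_part_def symmetry_def by (simp add: dist_norm)

lemma symmetry_face_iff:
  assumes g: "symmetry S g" shows "g ` F face_of S \<longleftrightarrow> F face_of S"
proof -
  have lin: "linear (lin_part g)" "inj (lin_part g)"
    using lin_part_orthogonal[OF g] orthogonal_transformation_linear orthogonal_transformation_inj by blast+
  have im: "g ` X = (+) (g 0) ` (lin_part g ` X)" for X
    unfolding image_image by (simp add: lin_part_def)
  have "g ` F face_of g ` S \<longleftrightarrow> F face_of S"
    unfolding im face_of_translation_eq using face_of_linear_image[OF lin] by blast
  then show ?thesis using g unfolding symmetry_def by simp
qed

lemma symmetry_inj: "symmetry S g \<Longrightarrow> inj g"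
  unfolding symmetry_def by (metis dist_eq_0_iff injI)

lemma on_faces_aut:
  assumes g: "symmetry S g" shows "on_faces S g \<in> auts (face_lattice S)"
proof -
  have inj: "inj g" using symmetry_inj[OF g] .
  have "G \<in> (\<lambda>F. g ` F) ` {F. F face_of S}" if G: "G face_of S" for G
  proof -
    let ?F = "{x \<in> S. g x \<in> G}"
    have "G \<subseteq> g ` S" using face_of_imp_subset[OF G] g unfolding symmetry_def by simp
    then have "g ` ?F = G" by blast
    then have "G = (\<lambda>F. g ` F) ?F" "?F face_of S" using symmetry_face_iff[OF g, of ?F] G by simp_all
    then show ?thesis by blast
  qed
  moreover have "inj_on (\<lambda>F. g ` F) {F. F face_of S}"
    using inj by (intro inj_onI) (simp add: inj_image_eq_iff)
  ultimately have "bij_betw (\<lambda>F. g ` F) {F. F face_of S} {F. F face_of S}"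
    using symmetry_face_iff[OF g] unfolding bij_betw_def by blast
  then have "bij_betw (on_faces S g) (faces (face_lattice S)) (faces (face_lattice S))"
  proof -
    assume b: "bij_betw (\<lambda>F. g ` F) {F. F face_of S} {F. F face_of S}"
    have eq: "faces (face_lattice S) = {F. F face_of S}" by (simp add: face_lattice_def)
    show ?thesis unfolding on_faces_def eq using b by (subst bij_betw_cong[where g = "\<lambda>F. g ` F"]) auto
  qed
  then show ?thesis
    unfolding auts_iff Bij_def on_faces_def
    using symmetry_face_iff[OF g] inj_image_subset_iff[OF inj] by auto
qed

lemma on_faces_apply: "F face_of S \<Longrightarrow> on_faces S g F = g ` F"
  by (simp add: on_faces_def)

lemma symmetry_comp: "\<lbrakk>symmetry S g; symmetry S h\<rbrakk> \<Longrightarrow> symmetry S (g \<circ> h)"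
  unfolding symmetry_def by (metis comp_apply image_comp)

lemma on_faces_comp:
  assumes "symmetry S g" "symmetry S h"
  shows "on_faces S (g \<circ> h) = on_faces S g \<otimes>\<^bsub>aut_group (face_lattice S)\<^esub> on_faces S h"
proof (rule aut_eqI)
  interpret group "aut_group (face_lattice S)" by (rule group_aut_group)
  show "on_faces S (g \<circ> h) \<in> auts (face_lattice S)" using on_faces_aut symmetry_comp assms by blast
  show "on_faces S g \<otimes>\<^bsub>aut_group (face_lattice S)\<^esub> on_faces S h \<in> auts (face_lattice S)"
    using on_faces_aut assms by blast
  fix F assume "F \<in> faces (face_lattice S)"
  then show "on_faces S (g \<circ> h) F = (on_faces S g \<otimes>\<^bsub>aut_group (face_lattice S)\<^esub> on_faces S h) F"
    using aut_mult_apply[OF on_faces_aut[OF assms(1)] on_faces_aut[OF assms(2)]] symmetry_face_iff[OF assms(2)]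
    by (simp add: on_faces_apply image_comp)
qed

section \<open>The generators of a regular convex polytope\<close>

locale regular_flag =
  fixes S :: "'a::euclidean_space set" and \<Phi> :: "'a set set"
  assumes regular: "regular_convex_polytope S" and flag: "\<Phi> \<in> flags (face_lattice S)"
begin

abbreviation "L \<equiv> face_lattice S"
abbreviation "\<rho> \<equiv> rho L \<Phi>"

lemma poly: "polytope S" and full_dim: "aff_dim S = int DIM('a)"
  using regular unfolding regular_convex_polytope_def by auto

lemma cvx: "convex S"
  using poly polytope_imp_convex by blast

lemma top_flag: "S \<in> \<Phi>"
proof -
  obtain F where "F \<in> \<Phi>" "aff_dim F = aff_dim S" using flag_has_dim[OF poly flag, of "aff_dim S"] full_dim by auto
  then show ?thesis using face_of_aff_dim_lt[OF cvx flag_face[OF flag]] by fastforce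
qed

definition fa :: "nat \<Rightarrow> 'a set" where
  "fa i = (THE F. F \<in> \<Phi> \<and> aff_dim F = int i)"

lemma fa: assumes "i \<le> DIM('a)" shows "fa i \<in> \<Phi>" "aff_dim (fa i) = int i" "fa i face_of S"
proof -
  obtain F where F: "F \<in> \<Phi>" "aff_dim F = int i" using flag_has_dim[OF poly flag, of "int i"] assms full_dim by auto
  have "fa i = F" unfolding fa_def
  proof (rule the_equality)
    show "F \<in> \<Phi> \<and> aff_dim F = int i" using F by simp
    fix X assume "X \<in> \<Phi> \<and> aff_dim X = int i"
    then show "X = F" using flag_dim_unique[OF cvx flag _ F(1), of X] F(2) by simp
  qed
  then have "fa i \<in> \<Phi> \<and> aff_dim (fa i) = int i" using F by simp
  then show "fa i \<in> \<Phi>" "aff_dim (fa i) = int i" "fa i face_of S" using flag_face[OF flag] by auto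
qed

lemma fa_eq: "\<lbrakk>F \<in> \<Phi>; aff_dim F = int i; i \<le> DIM('a)\<rbrakk> \<Longrightarrow> F = fa i"
  using flag_dim_unique[OF cvx flag, of F "fa i"] fa by simp

lemma fa_top: "fa (DIM('a)) = S"
  using fa_eq[OF top_flag full_dim] by simp

lemma flag_cases:
  assumes "F \<in> \<Phi>" obtains "F = {}" | i where "i \<le> DIM('a)" "F = fa i"
proof (cases "aff_dim F = -1")
  case True
  then have "F = {}" using aff_dim_empty by metis
  then show ?thesis using that by simp
next
  case False
  then have "aff_dim F = int (nat (aff_dim F))" "nat (aff_dim F) \<le> DIM('a)"
    using face_dim_range[OF flag_face[OF flag assms]] full_dim by auto
  then show ?thesis using that(2)[of "nat (aff_dim F)"] fa_eq[OF assms] by blast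
qed

lemma fa_mono: assumes "i \<le> j" "j \<le> DIM('a)" shows "fa i \<subseteq> fa j"
proof -
  have le: "i \<le> DIM('a)" using assms by simp
  have "fa i \<subseteq> fa j \<or> fa j \<subseteq> fa i" using flag_compare[OF flag fa(1)[OF le] fa(1)[OF assms(2)]] .
  moreover have "fa i = fa j" if "fa j \<subseteq> fa i"
    using face_dim_mono[OF cvx fa(3)[OF assms(2)] fa(3)[OF le] that] fa(2)[OF le] fa(2)[OF assms(2)] assms(1)
    by (cases "fa j = fa i") auto
  ultimately show ?thesis by blast
qed

lemma adjacent_flag:
  assumes i: "i < DIM('a)"
  shows "adj S (int i) \<Phi> (adjacent_flag L i \<Phi>)" "adjacent_flag L i \<Phi> \<noteq> \<Phi>"
proof -
  have i': "0 \<le> int i" "int i < aff_dim S" using i full_dim by auto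
  obtain \<Psi> where \<Psi>: "adj S (int i) \<Phi> \<Psi>" "\<Psi> \<noteq> \<Phi>" using adj_exists[OF poly flag i'] by blast
  have eq: "adjacent_flag L i \<Phi> = (THE \<Psi>. adj S (int i) \<Phi> \<Psi> \<and> \<Psi> \<noteq> \<Phi>)"
    unfolding adjacent_flag_def adj_def by (rule arg_cong[of _ _ The]) (use flag in auto)
  have "adj S (int i) \<Phi> (adjacent_flag L i \<Phi>) \<and> adjacent_flag L i \<Phi> \<noteq> \<Phi>"
    unfolding eq
  proof (rule theI[of _ \<Psi>])
    show "adj S (int i) \<Phi> \<Psi> \<and> \<Psi> \<noteq> \<Phi>" using \<Psi> by simp
    fix X assume "adj S (int i) \<Phi> X \<and> X \<noteq> \<Phi>"
    then show "X = \<Psi>" using adj_unique[OF poly i', of \<Phi> X \<Psi>] \<Psi> by simp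
  qed
  then show "adj S (int i) \<Phi> (adjacent_flag L i \<Phi>)" "adjacent_flag L i \<Phi> \<noteq> \<Phi>" by blast+
qed

lemma rho:
  assumes i: "i < DIM('a)"
  shows "\<rho> i \<in> auts L" "\<rho> i ` \<Phi> = adjacent_flag L i \<Phi>" "\<exists>g. symmetry S g \<and> \<rho> i = on_faces S g"
proof -
  have "adjacent_flag L i \<Phi> \<in> flags L" using adjacent_flag[OF i] unfolding adj_def by blast
  then have fl: "adjacent_flag L i \<Phi> \<in> flags L" .
  obtain g where g: "\<forall>x y. dist (g x) (g y) = dist x y" "g ` S = S" "(`) g ` \<Phi> = adjacent_flag L i \<Phi>"
  proof -
    have "\<forall>\<Phi> \<in> flags L. \<forall>\<Psi> \<in> flags L.
        \<exists>f :: 'a \<Rightarrow> 'a. (\<forall>x y. dist (f x) (f y) = dist x y) \<and> f ` S = S \<and> (`) f ` \<Phi> = \<Psi>"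
      using regular unfolding regular_convex_polytope_def by (elim conjE)
    from bspec[OF bspec[OF this flag] fl] show thesis using that by (elim exE conjE)
  qed
  then have sym: "symmetry S g" unfolding symmetry_def by blast
  have im: "on_faces S g ` \<Phi> = adjacent_flag L i \<Phi>"
    using g(3) on_faces_apply[OF flag_face[OF flag]] by (simp cong: image_cong)
  have "\<rho> i = on_faces S g"
    unfolding rho_def
  proof (rule the_equality)
    show "on_faces S g \<in> auts L \<and> on_faces S g ` \<Phi> = adjacent_flag L i \<Phi>" using on_faces_aut[OF sym] im by blast
    fix f assume "f \<in> auts L \<and> f ` \<Phi> = adjacent_flag L i \<Phi>"
    then show "f = on_faces S g" using aut_determined_by_flag[OF poly _ on_faces_aut[OF sym] flag] im by metis
  qed
  then show "\<rho> i \<in> auts L" "\<rho> i ` \<Phi> = adjacent_flag L i \<Phi>" "\<exists>g. symmetry S g \<and> \<rho> i = on_faces S g"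
    using on_faces_aut[OF sym] im sym by auto
qed

lemma aut_fixes_ends: assumes "f \<in> auts L" shows "f {} = {}" "f S = S"
proof -
  have "aff_dim (f {}) = -1" using aut_dim[OF poly assms, of "{}"] by simp
  then show "f {} = {}" using aff_dim_empty by metis
  have "S face_of S" using cvx by (simp add: face_of_refl)
  then have "f S face_of S" "aff_dim (f S) = aff_dim S" using aut_dim[OF poly assms] aut_face_of[OF assms] by auto
  then show "f S = S" using face_of_aff_dim_lt[OF cvx] by fastforce
qed

lemma rho_fix:
  assumes i: "i < DIM('a)" and j: "j \<le> DIM('a)" "j \<noteq> i"
  shows "\<rho> i (fa j) = fa j"
proof -
  have "\<rho> i (fa j) \<in> adjacent_flag L i \<Phi>" using rho(2)[OF i] fa[OF j(1)] by blast
  moreover have d: "aff_dim (\<rho> i (fa j)) = int j" using aut_dim[OF poly rho(1)[OF i]] fa[OF j(1)] by simp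
  ultimately have "\<rho> i (fa j) \<in> {F \<in> adjacent_flag L i \<Phi>. aff_dim F \<noteq> int i}" using j(2) by simp
  also have "\<dots> = {F \<in> \<Phi>. aff_dim F \<noteq> int i}" using adjacent_flag(1)[OF i] unfolding adj_def by (elim conjE)
  finally have "\<rho> i (fa j) \<in> \<Phi>" by simp
  then show ?thesis using fa_eq[OF _ d j(1)] by blast
qed

lemma flag_image_eq:
  assumes f: "f \<in> auts L" and fx: "\<And>j. j < DIM('a) \<Longrightarrow> f (fa j) = fa j"
  shows "f ` \<Phi> = \<Phi>"
proof -
  have "f F = F" if F: "F \<in> \<Phi>" for F
    using F
  proof (cases rule: flag_cases)
    case (2 i)
    then show ?thesis using fx[of i] aut_fixes_ends[OF f] fa_top by (cases "i = DIM('a)") auto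
  qed (use aut_fixes_ends[OF f] in simp)
  then show ?thesis by simp
qed

lemma rho_move: assumes i: "i < DIM('a)" shows "\<rho> i (fa i) \<noteq> fa i"
proof
  assume "\<rho> i (fa i) = fa i"
  then have "\<rho> i (fa j) = fa j" if "j < DIM('a)" for j using rho_fix[OF i, of j] that by (cases "j = i") auto
  then have "\<rho> i ` \<Phi> = \<Phi>" using flag_image_eq[OF rho(1)[OF i]] by blast
  then show False using rho(2)[OF i] adjacent_flag(2)[OF i] by simp
qed

lemma aut_fixing_all_but_one:
  assumes f: "f \<in> auts L" and i: "i < DIM('a)" and fx: "\<And>j. \<lbrakk>j < DIM('a); j \<noteq> i\<rbrakk> \<Longrightarrow> f (fa j) = fa j"
  shows "f = \<one>\<^bsub>aut_group L\<^esub> \<or> f = \<rho> i"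
proof (cases "f (fa i) = fa i")
  case True
  then have "f (fa j) = fa j" if "j < DIM('a)" for j using fx[OF that] by (cases "j = i") auto
  then have "f ` \<Phi> = \<Phi>" using flag_image_eq[OF f] by blast
  then show ?thesis using aut_one_if_fixes_flag[OF poly f flag] by blast
next
  case False
  have "{F \<in> f ` \<Phi>. aff_dim F \<noteq> int i} = {F \<in> \<Phi>. aff_dim F \<noteq> int i}"
  proof -
    have same: "f F = F" if F: "F \<in> \<Phi>" "aff_dim F \<noteq> int i" for F
      using F(1)
    proof (cases rule: flag_cases)
      case (2 j)
      then have "j \<noteq> i" using F fa(2)[of j] by auto
      then show ?thesis using 2 fx[of j] aut_fixes_ends[OF f] fa_top by (cases "j = DIM('a)") auto
    qed (use aut_fixes_ends[OF f] in simp)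
    have "aff_dim (f F) = aff_dim F" if "F \<in> \<Phi>" for F using aut_dim[OF poly f flag_face[OF flag that]] .
    then show ?thesis using same by force
  qed
  then have "adj S (int i) \<Phi> (f ` \<Phi>)" unfolding adj_def using flag aut_flag[OF poly f flag] by blast
  moreover have "f ` \<Phi> \<noteq> \<Phi>"
  proof
    assume "f ` \<Phi> = \<Phi>"
    then have "f (fa i) \<in> \<Phi>" using fa(1)[of i] i by auto
    moreover have "aff_dim (f (fa i)) = int i" using aut_dim[OF poly f fa(3)] fa(2) i by simp
    ultimately show False using False fa_eq[of "f (fa i)" i] i by simp
  qed
  ultimately have "f ` \<Phi> = \<rho> i ` \<Phi>"
    using adj_unique[OF poly, of "int i" \<Phi> "f ` \<Phi>" "adjacent_flag L i \<Phi>"] adjacent_flag[OF i] rho(2)[OF i] i full_dim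
    by simp
  then show ?thesis using aut_determined_by_flag[OF poly f rho(1)[OF i] flag] by blast
qed

sublocale A: group "aut_group L"
  by (rule group_aut_group)

lemma aut_app: "\<lbrakk>f \<in> auts L; g \<in> auts L; F face_of S\<rbrakk> \<Longrightarrow> (f \<otimes>\<^bsub>aut_group L\<^esub> g) F = f (g F)"
  by (simp add: aut_mult_apply)

lemma rho_sq: assumes i: "i < DIM('a)" shows "\<rho> i \<otimes>\<^bsub>aut_group L\<^esub> \<rho> i = \<one>\<^bsub>aut_group L\<^esub>"
proof -
  note r = rho(1)[OF i]
  have "(\<rho> i \<otimes>\<^bsub>aut_group L\<^esub> \<rho> i) (fa j) = fa j" if "j < DIM('a)" "j \<noteq> i" for j
    using aut_app[OF r r fa(3)] rho_fix[OF i, of j] that by simp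
  then have "\<rho> i \<otimes>\<^bsub>aut_group L\<^esub> \<rho> i = \<one>\<^bsub>aut_group L\<^esub> \<or> \<rho> i \<otimes>\<^bsub>aut_group L\<^esub> \<rho> i = \<rho> i"
    using aut_fixing_all_but_one[OF A.m_closed[OF r r] i] by blast
  moreover have "\<rho> i \<noteq> \<one>\<^bsub>aut_group L\<^esub>" using rho_move[OF i] fa(3)[of i] i by (auto simp: aut_one)
  ultimately show ?thesis using A.l_cancel_one[OF r r] by simp
qed

lemma rho_comm:
  assumes ij: "i < DIM('a)" "j < DIM('a)" "i + 2 \<le> j"
  shows "\<rho> i \<otimes>\<^bsub>aut_group L\<^esub> \<rho> j = \<rho> j \<otimes>\<^bsub>aut_group L\<^esub> \<rho> i"
proof -
  note ri = rho(1)[OF ij(1)] and rj = rho(1)[OF ij(2)]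
  have jm: "j - 1 \<le> DIM('a)" "j + 1 \<le> DIM('a)" "j - 1 \<noteq> i" "j + 1 \<noteq> i" "j - 1 \<noteq> j" "j \<noteq> i" "j + 1 \<noteq> j"
    "int (j - 1) = int j - 1"
    using ij by auto
  let ?A = "fa (j - 1)" and ?B = "fa j" and ?C = "fa (j + 1)"
  let ?G = "\<rho> j ?B"
  note jD = less_imp_le[OF ij(2)]
  have C: "polytope ?C" using face_of_polytope_polytope[OF poly fa(3)[OF jm(2)]] .
  have inC: "X face_of ?C" if "X face_of S" "X \<subseteq> ?C" for X
    using that face_of_face[OF fa(3)[OF jm(2)]] by blast
  have A: "?A face_of ?C" "aff_dim ?A = aff_dim ?C - 2"
    using inC[OF fa(3)[OF jm(1)] fa_mono] jm fa(2) by auto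
  have between: "f X face_of ?C \<and> ?A \<subseteq> f X \<and> aff_dim (f X) = int j"
    if h: "f \<in> auts L" "f ?A = ?A" "f ?C = ?C" "X face_of S" "?A \<subseteq> X" "X \<subseteq> ?C" "aff_dim X = int j" for f X
    using aut_subset_iff[OF h(1) fa(3)[OF jm(1)] h(4)] aut_subset_iff[OF h(1,4) fa(3)[OF jm(2)]] h
      aut_dim[OF poly h(1,4)] inC[OF aut_face_of[OF h(1,4)]] by simp
  have B: "?A \<subseteq> ?B" "?B \<subseteq> ?C" "?B face_of S" "aff_dim ?B = int j"
    using fa_mono[of "j - 1" j] fa_mono[of j "j + 1"] jm jD fa[OF jD] by auto
  have G: "?G face_of ?C \<and> ?A \<subseteq> ?G \<and> aff_dim ?G = int j"
    by (rule between[OF rj rho_fix[OF ij(2) jm(1,5)] rho_fix[OF ij(2) jm(2,7)] B(3,1,2,4)])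
  have GS: "?G face_of S" using aut_face_of[OF rj B(3)] .
  have H: "\<rho> i ?G face_of ?C \<and> ?A \<subseteq> \<rho> i ?G \<and> aff_dim (\<rho> i ?G) = int j"
    using between[OF ri rho_fix[OF ij(1) jm(1,3)] rho_fix[OF ij(1) jm(2,4)] GS] G face_of_imp_subset by blast
  have iB: "\<rho> i ?B = ?B" using rho_fix[OF ij(1) jD] jm by simp
  have "\<rho> i ?G \<noteq> ?B" using aut_inj[OF ri, of ?G ?B] iB rho_move[OF ij(2)] GS B(3) by auto
  then have iG: "\<rho> i ?G = ?G"
    using ridge_card_le_2[OF C A, of ?B ?G "\<rho> i ?G"] inC[OF B(3,2)] B G H rho_move[OF ij(2)] fa(2)[OF jm(2)] by auto
  let ?f = "\<rho> j \<otimes>\<^bsub>aut_group L\<^esub> (\<rho> i \<otimes>\<^bsub>aut_group L\<^esub> \<rho> j)"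
  have f: "?f \<in> auts L" using ri rj by simp
  have app: "?f F = \<rho> j (\<rho> i (\<rho> j F))" if "F face_of S" for F
    using aut_app[OF rj A.m_closed[OF ri rj] that] aut_app[OF ri rj that] by simp
  have jG: "\<rho> j ?G = ?B"
    using rho_sq[OF ij(2)] aut_app[OF rj rj B(3)] B(3) by (simp add: aut_one)
  have "?f (fa k) = fa k" if k: "k < DIM('a)" "k \<noteq> i" for k
  proof (cases "k = j")
    case True
    then show ?thesis using app[OF B(3)] iG jG by simp
  next
    case False
    then show ?thesis using app[OF fa(3)] rho_fix[OF ij(1), of k] rho_fix[OF ij(2), of k] k by simp
  qed
  then have "?f = \<one>\<^bsub>aut_group L\<^esub> \<or> ?f = \<rho> i" using aut_fixing_all_but_one[OF f ij(1)] by blast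
  moreover have jf: "\<rho> j \<otimes>\<^bsub>aut_group L\<^esub> ?f = \<rho> i \<otimes>\<^bsub>aut_group L\<^esub> \<rho> j"
    using rho_sq[OF ij(2)] ri rj by (simp flip: A.m_assoc)
  moreover have False if "?f = \<one>\<^bsub>aut_group L\<^esub>"
  proof -
    have "\<rho> i \<otimes>\<^bsub>aut_group L\<^esub> \<rho> j = \<rho> j" using jf that rj by simp
    then have "\<rho> i = \<one>\<^bsub>aut_group L\<^esub>" using A.r_cancel_one[OF rj ri] by simp
    then show False using rho_move[OF ij(1)] fa(3)[of i] ij by (auto simp: aut_one)
  qed
  ultimately show ?thesis by metis
qed

end

section \<open>Mirrors\<close>

text \<open>A point of the relative interior whose choice is respected by every symmetry.\<close>
definition bary :: "'a::euclidean_space set \<Rightarrow> 'a" where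
  "bary F = (\<Sum>x | x extreme_point_of F. x) /\<^sub>R real (card {x. x extreme_point_of F})"

lemma bary_rel_interior:
  fixes F :: "'a::euclidean_space set"
  assumes F: "polytope F" "F \<noteq> {}"
  shows "bary F \<in> rel_interior F"
proof -
  let ?E = "{x. x extreme_point_of F}"
  have fin: "finite ?E" using finite_polyhedron_extreme_points polytope_imp_polyhedron F(1) by blast
  have hull: "F = convex hull ?E"
    using Krein_Milman_Minkowski[OF polytope_imp_compact[OF F(1)] polytope_imp_convex[OF F(1)]] .
  then have ne: "?E \<noteq> {}" using F(2) by (metis convex_hull_empty)
  then have card: "0 < card ?E" using fin by (simp add: card_gt_0_iff)
  have "bary F = (\<Sum>x\<in>?E. inverse (real (card ?E)) *\<^sub>R x)" unfolding bary_def by (simp add: scaleR_sum_right)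
  moreover have "(\<Sum>x\<in>?E. inverse (real (card ?E))) = 1" using card by simp
  ultimately have "bary F \<in> rel_interior (convex hull ?E)"
    using card by (intro subsetD[OF explicit_subset_rel_interior_convex_hull_minimal[OF fin]] CollectI
        exI[of _ "\<lambda>x. inverse (real (card ?E))"]) simp
  then show ?thesis using hull by simp
qed

lemma bary_symmetry:
  fixes S :: "'a::euclidean_space set"
  assumes S: "polytope S" and g: "symmetry S g" and F: "F face_of S" "F \<noteq> {}"
  shows "bary (g ` F) = g (bary F)"
proof -
  let ?E = "{x. x extreme_point_of F}"
  have PF: "polytope F" using face_of_polytope_polytope[OF S F(1)] .
  have fin: "finite ?E" using finite_polyhedron_extreme_points polytope_imp_polyhedron PF by blast
  have "F = convex hull ?E"
    using Krein_Milman_Minkowski[OF polytope_imp_compact[OF PF] polytope_imp_convex[OF PF]] .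
  then have ne: "?E \<noteq> {}" using F(2) by (metis convex_hull_empty)
  have inj: "inj g" using symmetry_inj[OF g] .
  have ext: "x extreme_point_of G \<longleftrightarrow> x \<in> G \<and> {x} face_of S" if "G face_of S" for x G
    unfolding face_of_singleton[symmetric] using face_of_face[OF that] by blast
  have gF: "g ` F face_of S" using symmetry_face_iff[OF g] F(1) by blast
  have sing: "{g x} face_of S \<longleftrightarrow> {x} face_of S" for x using symmetry_face_iff[OF g, of "{x}"] by simp
  have E: "{y. y extreme_point_of g ` F} = g ` ?E"
    unfolding ext[OF gF] ext[OF F(1)] using sing by blast
  have card: "card (g ` ?E) = card ?E" using inj by (intro card_image inj_on_subset[OF inj]) simp
  have lin: "linear (lin_part g)" using lin_part_orthogonal[OF g] orthogonal_transformation_linear by blast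
  let ?n = "real (card ?E)"
  have n: "?n \<noteq> 0" using fin ne by simp
  have "(\<Sum>y\<in>g ` ?E. y) = (\<Sum>x\<in>?E. g x)" using inj by (subst sum.reindex) (auto intro: inj_on_subset)
  also have "\<dots> = (\<Sum>x\<in>?E. g 0 + lin_part g x)" by (simp add: lin_part_def)
  also have "\<dots> = ?n *\<^sub>R g 0 + lin_part g (\<Sum>x\<in>?E. x)"
    using linear_sum[OF lin, of "\<lambda>x. x" ?E] by (simp add: sum.distrib scaleR_conv_of_real sum_constant_scaleR)
  finally have "bary (g ` F) = g 0 + lin_part g (\<Sum>x\<in>?E. x) /\<^sub>R ?n"
    unfolding bary_def E card using n by (simp add: scaleR_add_right)
  also have "\<dots> = g 0 + lin_part g (bary F)"
    unfolding bary_def using linear_scale[OF lin] by simp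
  finally show ?thesis by (simp add: lin_part_def)
qed

definition reflection :: "'a::real_inner \<Rightarrow> 'a \<Rightarrow> 'a" where
  "reflection a x = x - (2 * (a \<bullet> x)) *\<^sub>R a"

lemma linear_reflection: "linear (reflection a)"
  unfolding reflection_def by (intro linearI) (simp_all add: inner_add_right algebra_simps)

lemma reflection_reflection: "norm a = 1 \<Longrightarrow> reflection a (reflection a x) = x"
  unfolding reflection_def by (simp add: algebra_simps inner_diff_right dot_square_norm)

lemma reflection_uminus: "reflection (- a) = reflection a"
  unfolding reflection_def by (simp add: fun_eq_iff)

lemma reflection_plane:
  assumes "norm a = 1" "norm b = 1"
  shows "reflection a (x *\<^sub>R a + y *\<^sub>R b) = (- x - 2 * (a \<bullet> b) * y) *\<^sub>R a + y *\<^sub>R b"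
    and "reflection b (x *\<^sub>R a + y *\<^sub>R b) = x *\<^sub>R a + (- y - 2 * (a \<bullet> b) * x) *\<^sub>R b"
proof -
  have aa: "a \<bullet> a = 1" "b \<bullet> b = 1" using assms by (simp_all add: dot_square_norm)
  have 1: "a \<bullet> (x *\<^sub>R a + y *\<^sub>R b) = x + y * (a \<bullet> b)" using aa by (simp add: inner_add_right)
  have 2: "b \<bullet> (x *\<^sub>R a + y *\<^sub>R b) = y + x * (a \<bullet> b)" using aa by (simp add: inner_add_right inner_commute)
  have "x *\<^sub>R a + y *\<^sub>R b - k *\<^sub>R a = (x - k) *\<^sub>R a + y *\<^sub>R b" for k by (simp add: scaleR_diff_left)
  moreover have "x - 2 * (x + y * (a \<bullet> b)) = - x - 2 * (a \<bullet> b) * y" by simp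
  ultimately show "reflection a (x *\<^sub>R a + y *\<^sub>R b) = (- x - 2 * (a \<bullet> b) * y) *\<^sub>R a + y *\<^sub>R b"
    unfolding reflection_def 1 by metis
  have "x *\<^sub>R a + y *\<^sub>R b - k *\<^sub>R b = x *\<^sub>R a + (y - k) *\<^sub>R b" for k by (simp add: scaleR_diff_left)
  moreover have "y - 2 * (y + x * (a \<bullet> b)) = - y - 2 * (a \<bullet> b) * x" by simp
  ultimately show "reflection b (x *\<^sub>R a + y *\<^sub>R b) = x *\<^sub>R a + (- y - 2 * (a \<bullet> b) * x) *\<^sub>R b"
    unfolding reflection_def 2 by metis
qed

text \<open>
  The order of the product of two reflections determines the angle between the mirrors up to a
  Galois conjugation, which for order five may interchange the two roots of \<open>s\<^sup>2 = s + 1\<close>.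
\<close>
lemma mirror_angle:
  fixes a b :: "'a::real_inner"
  assumes ab: "norm a = 1" "norm b = 1" and indep: "\<And>x y. x *\<^sub>R a + y *\<^sub>R b = 0 \<Longrightarrow> x = 0 \<and> y = 0"
  defines "B \<equiv> reflection a \<circ> reflection b" and "t \<equiv> 2 * (a \<bullet> b)"
  shows "B ^^ 3 = id \<Longrightarrow> t * t = 1"
    and "\<lbrakk>B ^^ 4 = id; B ^^ 2 \<noteq> id\<rbrakk> \<Longrightarrow> t * t = 2"
    and "B ^^ 5 = id \<Longrightarrow> (t * t = t + 1) \<or> (t * t = - t + 1)"
proof -
  let ?v = "\<lambda>x y. x *\<^sub>R a + y *\<^sub>R b"
  have eq: "x = x' \<and> y = y'" if "?v x y = ?v x' y'" for x y x' y'
    using indep[of "x - x'" "y - y'"] that by (simp add: algebra_simps)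
  have B: "B (?v x y) = ?v x' y'" if "x' = - x - t * (- y - t * x)" "y' = - y - t * x" for x y x' y'
    unfolding that B_def comp_apply reflection_plane[OF ab] t_def by simp
  define B' where "B' = reflection b \<circ> reflection a"
  have B': "B' (?v x y) = ?v x' y'" if "x' = - x - t * y" "y' = - y - t * (- x - t * y)" for x y x' y'
    unfolding that B'_def comp_apply reflection_plane[OF ab] t_def by simp
  have inv: "B' (B x) = x" for x unfolding B_def B'_def
    by (simp add: reflection_reflection[OF ab(1)] reflection_reflection[OF ab(2)])
  have b: "b = ?v 0 1" by simp
  have B1: "B b = ?v t (-1)" using B[of t 0 1 "-1"] by simp
  have B2: "B (B b) = ?v (t * t * t - 2 * t) (1 - t * t)"
    unfolding B1 by (rule B) (simp_all add: algebra_simps)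
  have B3: "B (B (B b)) = ?v (t * t * t * t * t - 4 * t * t * t + 3 * t) (- t * t * t * t + 3 * t * t - 1)"
    unfolding B2 by (rule B) (simp_all add: algebra_simps)
  have B'1: "B' b = ?v (- t) (t * t - 1)" using B'[of "- t" 0 1 "t * t - 1"] by simp
  have B'2: "B' (B' b) = ?v (2 * t - t * t * t) (t * t * t * t - 3 * t * t + 1)"
    unfolding B'1 by (rule B') (simp_all add: algebra_simps)
  {
    assume "B ^^ 3 = id"
    then have "(B ^^ 3) b = b" by simp
    then have "B (B (B b)) = ?v 0 1" by (simp add: eval_nat_numeral)
    from eq[OF this[unfolded B3]]
    have "t * t * t * t * t - 4 * t * t * t + 3 * t = 0" "- t * t * t * t + 3 * t * t - 1 = 1" by simp_all
    moreover have "t * ((t * t - 1) * (t * t - 3)) = t * t * t * t * t - 4 * t * t * t + 3 * t"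
      "(t * t - 1) * (t * t - 2) = 1 - (- t * t * t * t + 3 * t * t - 1)" by (simp_all add: algebra_simps)
    ultimately have "(t * t - 1) * (t * t - 2) = 0" "t * ((t * t - 1) * (t * t - 3)) = 0" by simp_all
    then show "t * t = 1" by auto
  next
    assume 4: "B ^^ 4 = id" "B ^^ 2 \<noteq> id"
    have "B (B (B (B b))) = b" using fun_cong[OF 4(1), of b] by (simp add: eval_nat_numeral)
    then have "B' (B' b) = B (B b)" using inv by metis
    from eq[OF this[unfolded B2 B'2]] have "2 * t - t * t * t = t * t * t - 2 * t" by simp
    moreover have "2 * (t * (t * t - 2)) = (t * t * t - 2 * t) - (2 * t - t * t * t)" by (simp add: algebra_simps)
    ultimately have "t * (t * t - 2) = 0" by simp
    moreover have "t \<noteq> 0"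
    proof
      assume "t = 0"
      then have "a \<bullet> b = 0" by (simp add: t_def)
      then have "reflection a (reflection b x) = reflection b (reflection a x)" for x
        unfolding reflection_def by (simp add: algebra_simps inner_diff_right inner_commute)
      then have "B (B x) = x" for x unfolding B_def comp_apply using reflection_reflection ab by metis
      then show False using 4(2) by (auto simp: eval_nat_numeral fun_eq_iff)
    qed
    ultimately show "t * t = 2" by simp
  next
    assume 5: "B ^^ 5 = id"
    have "B (B (B (B (B b)))) = b" using fun_cong[OF 5, of b] by (simp add: eval_nat_numeral)
    then have "B' (B' b) = B (B (B b))" using inv by metis
    from eq[OF this[unfolded B3 B'2]]
    have e: "t * t * t * t - 3 * t * t + 1 = - t * t * t * t + 3 * t * t - 1" by simp
    have "2 * ((t * t - t - 1) * (t * t + t - 1))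
      = (t * t * t * t - 3 * t * t + 1) - (- t * t * t * t + 3 * t * t - 1)" by (simp add: algebra_simps)
    then have "2 * ((t * t - t - 1) * (t * t + t - 1)) = 0" unfolding e by simp
    then have "t * t - t - 1 = 0 \<or> t * t + t - 1 = 0" by (simp only: mult_eq_0_iff) simp
    then show "(t * t = t + 1) \<or> (t * t = - t + 1)" by auto
  }
qed

context regular_flag
begin

definition "c \<equiv> bary S"
definition "v i \<equiv> bary (fa i) - c"

lemma fa_nonempty: "i \<le> DIM('a) \<Longrightarrow> fa i \<noteq> {}"
  using fa(2)[of i] by auto

lemma fa_polytope: "i \<le> DIM('a) \<Longrightarrow> polytope (fa i)"
  using face_of_polytope_polytope[OF poly fa(3)] .

lemma bary_fa: "i \<le> DIM('a) \<Longrightarrow> bary (fa i) \<in> fa i"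
  using bary_rel_interior[OF fa_polytope fa_nonempty] rel_interior_subset by blast

lemma bary_fa_notin:
  assumes "i < DIM('a)" shows "bary (fa (Suc i)) \<notin> affine hull (fa i)"
proof -
  have le: "i \<le> DIM('a)" "Suc i \<le> DIM('a)" using assms by auto
  have "fa i face_of fa (Suc i)"
    using fa_mono[of i "Suc i"] le fa(3)[OF le(1)] face_of_face[OF fa(3)[OF le(2)]] by simp
  moreover have "fa i \<noteq> fa (Suc i)" using fa(2)[OF le(1)] fa(2)[OF le(2)] by auto
  ultimately have "affine hull (fa i) \<inter> rel_interior (fa (Suc i)) = {}"
    using affine_hull_face_of_disjoint_rel_interior face_of_imp_convex[OF fa(3)[OF le(2)]] by blast
  then show ?thesis using bary_rel_interior[OF fa_polytope[OF le(2)] fa_nonempty[OF le(2)]] by blast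
qed

text \<open>
  The barycentres of the faces of a flag are the vertices of a simplex: each lies in the relative
  interior of its face, hence off the affine hull of the smaller faces.
\<close>
lemma affine_hull_barycentres: "affine hull ((\<lambda>i. bary (fa i)) ` {..DIM('a)}) = UNIV"
proof -
  have "aff_dim ((\<lambda>i. bary (fa i)) ` {..k}) = int k" if "k \<le> DIM('a)" for k
    using that
  proof (induction k)
    case 0
    then show ?case by simp
  next
    case (Suc k)
    let ?A = "(\<lambda>i. bary (fa i)) ` {..k}"
    have "?A \<subseteq> fa k"
    proof (rule image_subsetI)
      fix i assume "i \<in> {..k}"
      then show "bary (fa i) \<in> fa k" using bary_fa[of i] fa_mono[of i k] Suc.prems by auto
    qed
    then have "affine hull ?A \<subseteq> affine hull (fa k)" by (rule hull_mono)
    then have "bary (fa (Suc k)) \<notin> affine hull ?A" using bary_fa_notin[of k] Suc.prems by auto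
    moreover have "(\<lambda>i. bary (fa i)) ` {..Suc k} = insert (bary (fa (Suc k))) ?A"
      by (simp add: atMost_Suc)
    ultimately show ?case using Suc.IH Suc.prems by (simp add: aff_dim_insert)
  qed
  then have "aff_dim ((\<lambda>i. bary (fa i)) ` {..DIM('a)}) = int DIM('a)" by blast
  then show ?thesis using aff_dim_eq_full by blast
qed

lemma orthogonal_v: assumes x: "\<And>i. i < DIM('a) \<Longrightarrow> x \<bullet> v i = 0" shows "x = 0"
proof -
  have "(\<lambda>i. bary (fa i)) ` {..DIM('a)} \<subseteq> {y. x \<bullet> y = x \<bullet> c}"
  proof (rule image_subsetI)
    fix i assume i: "i \<in> {..DIM('a)}"
    show "bary (fa i) \<in> {y. x \<bullet> y = x \<bullet> c}"
    proof (cases "i = DIM('a)")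
      case True
      then show ?thesis using fa_top by (simp add: c_def)
    next
      case False
      then show ?thesis using x[of i] i by (simp add: v_def inner_diff_right)
    qed
  qed
  then have "affine hull ((\<lambda>i. bary (fa i)) ` {..DIM('a)}) \<subseteq> {y. x \<bullet> y = x \<bullet> c}"
    by (rule hull_minimal) (rule affine_hyperplane)
  then have "x \<bullet> (c + x) = x \<bullet> c" using affine_hull_barycentres by blast
  then show ?thesis by (simp add: inner_add_right)
qed

lemma span_v: "span (v ` {..<DIM('a)}) = UNIV"
proof (rule ccontr)
  assume "\<not> ?thesis"
  then obtain a where a: "a \<noteq> 0" "\<forall>x \<in> span (v ` {..<DIM('a)}). a \<bullet> x = 0" using span_not_UNIV_orthogonal by blast
  have "a \<bullet> v i = 0" if "i < DIM('a)" for i using a(2) span_base[of "v i" "v ` {..<DIM('a)}"] that by auto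
  then show False using orthogonal_v a(1) by blast
qed

lemma linear_eqI:
  assumes "linear f" "linear g" "\<And>i. i < DIM('a) \<Longrightarrow> f (v i) = g (v i)" shows "f = g"
proof
  fix x
  show "f x = g x" by (rule linear_eq_on[OF assms(1,2), of x "v ` {..<DIM('a)}"]) (use span_v assms(3) in auto)
qed

lemma symmetry_centre: assumes g: "symmetry S g" shows "g c = c"
proof -
  have "S \<noteq> {}" using fa_nonempty[of "DIM('a)"] fa_top by simp
  moreover have "g ` S = S" using g unfolding symmetry_def by blast
  ultimately show ?thesis using bary_symmetry[OF poly g face_of_refl[OF cvx]] unfolding c_def by simp
qed

lemma symmetry_lin: "symmetry S g \<Longrightarrow> g x = c + lin_part g (x - c)"
proof -
  assume g: "symmetry S g"
  have lin: "linear (lin_part g)" using lin_part_orthogonal[OF g] orthogonal_transformation_linear by blast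
  have "lin_part g (x - c) = lin_part g x - lin_part g c" using linear_diff[OF lin] .
  then show ?thesis using symmetry_centre[OF g] by (simp add: lin_part_def)
qed

lemma lin_part_v:
  assumes g: "symmetry S g" and i: "i \<le> DIM('a)"
  shows "lin_part g (v i) = bary (on_faces S g (fa i)) - c"
proof -
  have "bary (g ` fa i) = g (bary (fa i))" using bary_symmetry[OF poly g fa(3)[OF i] fa_nonempty[OF i]] .
  then show ?thesis using symmetry_lin[OF g, of "bary (fa i)"] on_faces_apply[OF fa(3)[OF i]] by (simp add: v_def)
qed

definition realized :: "('a set \<Rightarrow> 'a set) \<Rightarrow> bool" where
  "realized f \<longleftrightarrow> (\<exists>g. symmetry S g \<and> f = on_faces S g)"

definition linf :: "('a set \<Rightarrow> 'a set) \<Rightarrow> 'a \<Rightarrow> 'a" where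
  "linf f = lin_part (SOME g. symmetry S g \<and> f = on_faces S g)"

lemma linf_on_faces: assumes g: "symmetry S g" shows "linf (on_faces S g) = lin_part g"
proof -
  let ?h = "SOME h. symmetry S h \<and> on_faces S g = on_faces S h"
  have h: "symmetry S ?h \<and> on_faces S g = on_faces S ?h" by (rule someI[of _ g]) (use g in simp)
  have "lin_part ?h = lin_part g"
  proof (rule linear_eqI)
    show "linear (lin_part ?h)" "linear (lin_part g)"
      using lin_part_orthogonal h g orthogonal_transformation_linear by blast+
    show "lin_part ?h (v i) = lin_part g (v i)" if "i < DIM('a)" for i
      using lin_part_v[OF conjunct1[OF h], of i] lin_part_v[OF g, of i] h that by simp
  qed
  then show ?thesis unfolding linf_def .
qed

lemma linf_linear: assumes "realized f" shows "orthogonal_transformation (linf f)"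
proof -
  obtain g where g: "symmetry S g" "f = on_faces S g" using assms unfolding realized_def by blast
  show ?thesis unfolding g(2) linf_on_faces[OF g(1)] by (rule lin_part_orthogonal[OF g(1)])
qed

lemma realized_mult:
  assumes "realized f" "realized f'"
  shows "realized (f \<otimes>\<^bsub>aut_group L\<^esub> f')" "linf (f \<otimes>\<^bsub>aut_group L\<^esub> f') = linf f \<circ> linf f'"
proof -
  obtain g g' where g: "symmetry S g" "f = on_faces S g" "symmetry S g'" "f' = on_faces S g'"
    using assms unfolding realized_def by blast
  have eq: "f \<otimes>\<^bsub>aut_group L\<^esub> f' = on_faces S (g \<circ> g')" using on_faces_comp[OF g(1,3)] g by simp
  then show "realized (f \<otimes>\<^bsub>aut_group L\<^esub> f')" unfolding realized_def using symmetry_comp[OF g(1,3)] by blast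
  have lin: "linear (lin_part g)" using lin_part_orthogonal[OF g(1)] orthogonal_transformation_linear by blast
  have "lin_part (g \<circ> g') = lin_part g \<circ> lin_part g'"
  proof
    fix x
    have "lin_part g (g' x - g' 0) = lin_part g (g' x) - lin_part g (g' 0)" using linear_diff[OF lin] .
    then show "lin_part (g \<circ> g') x = (lin_part g \<circ> lin_part g') x" by (simp add: lin_part_def)
  qed
  then show "linf (f \<otimes>\<^bsub>aut_group L\<^esub> f') = linf f \<circ> linf f'"
    unfolding eq linf_on_faces[OF symmetry_comp[OF g(1,3)]] unfolding g linf_on_faces[OF g(1)] linf_on_faces[OF g(3)] .
qed

lemma realized_one: "realized \<one>\<^bsub>aut_group L\<^esub>" "linf \<one>\<^bsub>aut_group L\<^esub> = id"
proof -
  have id: "symmetry S id" unfolding symmetry_def by simp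
  have eq: "\<one>\<^bsub>aut_group L\<^esub> = on_faces S id" unfolding aut_one on_faces_def by (simp add: restrict_def fun_eq_iff)
  show "realized \<one>\<^bsub>aut_group L\<^esub>" unfolding realized_def eq using id by blast
  show "linf \<one>\<^bsub>aut_group L\<^esub> = id" unfolding eq linf_on_faces[OF id] by (auto simp: lin_part_def)
qed

lemma linf_inj:
  assumes "realized f" "realized f'" "linf f = linf f'" shows "f = f'"
proof -
  obtain g g' where g: "symmetry S g" "f = on_faces S g" "symmetry S g'" "f' = on_faces S g'"
    using assms unfolding realized_def by blast
  have "lin_part g = lin_part g'" using assms(3) g linf_on_faces by metis
  then have "g = g'" using symmetry_lin[OF g(1)] symmetry_lin[OF g(3)] by (intro ext) metis
  then show ?thesis using g by simp
qed

lemma realized_rho: assumes "i < DIM('a)" shows "realized (\<rho> i)"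
  using rho(3)[OF assms] unfolding realized_def .

lemma linf_v: assumes "realized f" "i \<le> DIM('a)" shows "linf f (v i) = bary (f (fa i)) - c"
proof -
  obtain g where g: "symmetry S g" "f = on_faces S g" using assms(1) unfolding realized_def by blast
  show ?thesis unfolding g(2) linf_on_faces[OF g(1)] by (rule lin_part_v[OF g(1) assms(2)])
qed

definition "mirror i \<equiv> (linf (\<rho> i) (v i) - v i) /\<^sub>R norm (linf (\<rho> i) (v i) - v i)"

text \<open>
  The symmetry is an involution fixing all vectors \<open>v j\<close> with \<open>j\<close> different from \<open>i\<close>; these span a
  hyperplane, so an orthogonal map fixing them that is not the identity is the reflection in it.
\<close>
lemma mirror:
  assumes i: "i < DIM('a)"
  shows "norm (mirror i) = 1" "\<And>j. \<lbrakk>j < DIM('a); j \<noteq> i\<rbrakk> \<Longrightarrow> mirror i \<bullet> v j = 0"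
    "mirror i \<bullet> v i \<noteq> 0" "linf (\<rho> i) = reflection (mirror i)"
proof -
  let ?h = "linf (\<rho> i)"
  note r = realized_rho[OF i]
  have orth: "orthogonal_transformation ?h" using linf_linear[OF r] .
  then have lin: "linear ?h" using orthogonal_transformation_linear by blast
  have fixed: "?h (v j) = v j" if "j < DIM('a)" "j \<noteq> i" for j
    using linf_v[OF r, of j] rho_fix[OF i, of j] that by (simp add: v_def)
  let ?u = "?h (v i) - v i"
  have u0: "?u \<noteq> 0"
  proof
    assume "?u = 0"
    have "?h = id"
    proof (rule linear_eqI[OF lin linear_id])
      fix j assume "j < DIM('a)"
      then show "?h (v j) = id (v j)" using fixed[of j] \<open>?u = 0\<close> by (cases "j = i") simp_all
    qed
    then have "\<rho> i = \<one>\<^bsub>aut_group L\<^esub>" using linf_inj[OF r realized_one(1)] realized_one(2) by simp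
    then show False using rho_move[OF i] fa(3)[of i] i by (auto simp: aut_one)
  qed
  then show n1: "norm (mirror i) = 1" unfolding mirror_def by simp
  have inner: "?h x \<bullet> ?h y = x \<bullet> y" for x y using orth unfolding orthogonal_transformation_def by blast
  have uj: "?u \<bullet> v j = 0" if "j < DIM('a)" "j \<noteq> i" for j
    using inner[of "v i" "v j"] fixed[OF that] by (simp add: inner_diff_left)
  then show nj: "mirror i \<bullet> v j = 0" if "j < DIM('a)" "j \<noteq> i" for j
    using that unfolding mirror_def by simp
  have uu: "?u \<bullet> ?u = - 2 * (?u \<bullet> v i)"
    using inner[of "v i" "v i"] by (simp add: inner_diff_left inner_diff_right inner_commute)
  moreover have "?u \<bullet> ?u \<noteq> 0" using u0 by simp
  ultimately have ui: "?u \<bullet> v i \<noteq> 0" by linarith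
  then show "mirror i \<bullet> v i \<noteq> 0" unfolding mirror_def using u0 by simp
  show "?h = reflection (mirror i)"
  proof (rule linear_eqI[OF lin linear_reflection])
    fix j assume j: "j < DIM('a)"
    show "?h (v j) = reflection (mirror i) (v j)"
    proof (cases "j = i")
      case False
      then show ?thesis using fixed[OF j] nj[OF j] by (simp add: reflection_def)
    next
      case True
      have nn: "norm ?u * norm ?u = - 2 * (?u \<bullet> v i)" using uu by (simp add: dot_square_norm power2_eq_square)
      have n0: "norm ?u \<noteq> 0" using u0 by simp
      have "(2 * (mirror i \<bullet> v i)) *\<^sub>R mirror i = (2 * (?u \<bullet> v i) / (norm ?u * norm ?u)) *\<^sub>R ?u"
        unfolding mirror_def by (simp add: divide_inverse mult.assoc)
      also have "2 * (?u \<bullet> v i) / (norm ?u * norm ?u) = -1" unfolding nn using ui by simp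
      finally show ?thesis using True by (simp add: reflection_def)
    qed
  qed
qed

lemma mirror_indep:
  assumes ij: "i < DIM('a)" "j < DIM('a)" "i \<noteq> j" and "x *\<^sub>R mirror i + y *\<^sub>R mirror j = 0"
  shows "x = 0 \<and> y = 0"
proof -
  have "x * (mirror i \<bullet> v i) = 0" "y * (mirror j \<bullet> v j) = 0"
    using arg_cong[OF assms(4), of "\<lambda>z. z \<bullet> v i"] arg_cong[OF assms(4), of "\<lambda>z. z \<bullet> v j"]
      mirror(2)[OF ij(1), of j] mirror(2)[OF ij(2), of i] ij by (simp_all add: inner_add_left)
  then show ?thesis using mirror(3) ij by simp
qed

end

section \<open>Regular convex polytopes in dimension four\<close>

text \<open>All reflections are conjugate to the one in a coordinate hyperplane, which is diagonal.\<close>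
lemma det_reflection:
  fixes a :: "real^'n"
  assumes "norm a = 1" shows "det (matrix (reflection a)) = -1"
proof -
  let ?k = "undefined :: 'n"
  let ?e = "axis ?k 1 :: real^'n"
  obtain T where T: "orthogonal_transformation T" "T ?e = a"
    using orthogonal_transformation_exists_1[of ?e a] assms by (auto simp: norm_axis_1)
  have lin: "linear T" using T(1) orthogonal_transformation_linear by blast
  have "T (reflection ?e x) = reflection a (T x)" for x
  proof -
    have "a \<bullet> T x = ?e \<bullet> x" using T unfolding orthogonal_transformation_def by metis
    then show ?thesis unfolding reflection_def using T(2) by (simp add: linear_diff[OF lin] linear_scale[OF lin])
  qed
  then have "T \<circ> reflection ?e = reflection a \<circ> T" by auto
  then have "matrix T ** matrix (reflection ?e) = matrix (reflection a) ** matrix T"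
    using matrix_compose[OF linear_reflection[of ?e] lin] matrix_compose[OF lin linear_reflection[of a]] by simp
  then have "det (matrix T) * det (matrix (reflection ?e)) = det (matrix (reflection a)) * det (matrix T)"
    by (metis det_mul)
  moreover have "det (matrix T) \<noteq> 0"
    using det_orthogonal_matrix[of "matrix T"] T(1) orthogonal_transformation_matrix by fastforce
  ultimately have eq: "det (matrix (reflection a)) = det (matrix (reflection ?e))" by simp
  have entry: "matrix (reflection ?e) $ i $ j = (if i = j then if i = ?k then -1 else 1 else 0)" for i j :: 'n
  proof -
    have "?e \<bullet> axis j 1 = (if ?k = j then 1 else 0)" by (simp add: inner_axis_axis)
    then show ?thesis unfolding matrix_def reflection_def by (simp add: axis_def)
  qed
  then have "det (matrix (reflection ?e)) = (\<Prod>i\<in>UNIV. if i = ?k then -1 else 1)"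
    using det_diagonal[of "matrix (reflection ?e)"] by simp
  then show ?thesis using eq by (simp add: prod.delta)
qed

lemma orthogonal_of_commuting_reflections:
  fixes a b :: "'a::real_inner"
  assumes ab: "norm a = 1" "norm b = 1" and indep: "\<And>x y. x *\<^sub>R a + y *\<^sub>R b = 0 \<Longrightarrow> x = 0 \<and> y = 0"
    and comm: "reflection a \<circ> reflection b = reflection b \<circ> reflection a"
  shows "a \<bullet> b = 0"
proof -
  have aa: "a \<bullet> a = 1" "b \<bullet> b = 1" using ab by (simp_all add: dot_square_norm)
  have "reflection a (reflection b b) = reflection b (reflection a b)" using fun_cong[OF comm, of b] by simp
  then have "(4 * (a \<bullet> b)) *\<^sub>R a + (- 4 * (a \<bullet> b) * (a \<bullet> b)) *\<^sub>R b = 0"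
    unfolding reflection_def using aa by (simp add: algebra_simps inner_diff_right inner_commute scaleR_2 flip: scaleR_add_left)
  then show ?thesis using indep by fastforce
qed

lemma int_square_eq_prime_square:
  fixes p :: int assumes p: "prime p" and eq: "x * x = p * (y * y)"
  shows "x = 0 \<and> y = 0"
  using eq
proof (induction "nat (\<bar>x\<bar> + \<bar>y\<bar>)" arbitrary: x y rule: less_induct)
  case less
  have p1: "1 < p" using p prime_gt_1_int by blast
  have "p dvd x" using less.prems p by (metis dvd_triv_left prime_dvd_multD)
  then obtain a where a: "x = p * a" by auto
  have "p * (p * (a * a)) = p * (y * y)" using less.prems unfolding a by (simp only: ac_simps)
  then have pa: "p * (a * a) = y * y" using p1 by simp
  then have "p dvd y * y" by (metis dvd_triv_left)
  then have "p dvd y" using p by (metis prime_dvd_multD)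
  then obtain b where b: "y = p * b" by auto
  have "p * (a * a) = p * (p * (b * b))" using pa unfolding b by (simp only: ac_simps)
  then have e: "a * a = p * (b * b)" using p1 by simp
  show ?case
  proof (rule ccontr)
    assume n: "\<not> ?case"
    have le: "\<bar>z\<bar> \<le> \<bar>p * z\<bar>" "z \<noteq> 0 \<Longrightarrow> \<bar>z\<bar> < \<bar>p * z\<bar>" for z
      using p1 mult_right_mono[of 1 p "\<bar>z\<bar>"] mult_strict_right_mono[of 1 p "\<bar>z\<bar>"] by (simp_all add: abs_mult)
    have "a \<noteq> 0 \<or> b \<noteq> 0" using n unfolding a b by auto
    then have "\<bar>a\<bar> + \<bar>b\<bar> < \<bar>x\<bar> + \<bar>y\<bar>"
      using le(1)[of a] le(1)[of b] le(2)[of a] le(2)[of b] unfolding a b by linarith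
    then have "nat (\<bar>a\<bar> + \<bar>b\<bar>) < nat (\<bar>x\<bar> + \<bar>y\<bar>)" by linarith
    then show False using less.hyps[OF _ e] n a b by simp
  qed
qed

lemma irrational_sqrt_2:
  assumes t: "\<tau> * \<tau> = (2::real)" and z: "of_int x + of_int y * \<tau> = 0"
  shows "x = 0 \<and> y = 0"
proof -
  have h: "of_int x = - (of_int y * \<tau>)" using z by simp
  have "of_int x * of_int x = (of_int y * of_int y) * (\<tau> * \<tau>)" unfolding h by (simp add: algebra_simps)
  then have "of_int (x * x) = (of_int (2 * (y * y)) :: real)" unfolding t by simp
  then have "x * x = 2 * (y * y)" unfolding of_int_eq_iff .
  then show ?thesis using int_square_eq_prime_square[of 2] by simp
qed

lemma irrational_golden:
  assumes t: "\<tau> * \<tau> = \<tau> + (1::real)" and z: "of_int x + of_int y * \<tau> = 0"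
  shows "x = 0 \<and> y = 0"
proof -
  let ?s = "2 * \<tau> - 1"
  have s: "?s * ?s = 5" using t by (simp add: algebra_simps)
  have h: "of_int (2 * x + y) = - (of_int y * ?s)" using z by (simp add: algebra_simps)
  have "of_int (2 * x + y) * of_int (2 * x + y) = (of_int y * of_int y) * (?s * ?s)" unfolding h by (simp add: algebra_simps)
  then have "of_int ((2 * x + y) * (2 * x + y)) = (of_int (5 * (y * y)) :: real)" unfolding s by simp
  then have "(2 * x + y) * (2 * x + y) = 5 * (y * y)" unfolding of_int_eq_iff .
  then show ?thesis using int_square_eq_prime_square[of 5 "2 * x + y" y] by simp
qed

locale regular_flag4 = regular_flag S \<Phi> for S :: "(real^4) set" and \<Phi>
begin

abbreviation "AL \<equiv> aut_group L"

lemma dim4: "i \<le> 3 \<Longrightarrow> i < DIM(real^4)" by simp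

lemma string_group_L: "string_group AL \<rho>"
proof
  show "\<rho> i \<in> carrier AL" if "i \<le> 3" for i using rho(1)[OF dim4[OF that]] .
  show "\<rho> i \<otimes>\<^bsub>AL\<^esub> \<rho> i = \<one>\<^bsub>AL\<^esub>" if "i \<le> 3" for i using rho_sq[OF dim4[OF that]] .
  show "\<rho> i \<otimes>\<^bsub>AL\<^esub> \<rho> j = \<rho> j \<otimes>\<^bsub>AL\<^esub> \<rho> i" if "j \<le> 3" "i + 2 \<le> j" for i j
    using rho_comm[of i j] that by simp
qed

sublocale G: string_group AL \<rho>
  by (rule string_group_L)

lemma realized_full: assumes "x \<in> G.full" shows "realized x"
  using assms order_refl
proof (induction rule: G.W_induct)
  case one
  then show ?case by (rule realized_one(1))
next
  case (mult i y)
  then show ?case using realized_mult(1)[OF realized_rho[OF dim4]] by simp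
qed

lemma stab_fixes: assumes "x \<in> G.stab j" "j \<le> 3" shows "x (fa j) = fa j"
  using assms(1) Diff_subset
proof (induction rule: G.W_induct)
  case one
  have "fa j \<in> faces L" using fa(3)[of j] assms(2) by (simp add: face_lattice_def)
  then show ?case by (simp add: aut_one)
next
  case (mult i y)
  then have i: "i \<le> 3" "i \<noteq> j" by auto
  have "y \<in> auts L" using G.stab_closed[OF mult(2)] .
  then show ?case using aut_app[OF rho(1)[OF dim4[OF i(1)]] _ fa(3)[of j], of y] mult(3) rho_fix[OF dim4[OF i(1)], of j] i assms(2) by simp
qed

lemma linf_rotation:
  assumes x: "x \<in> G.even_part" shows "det (matrix (linf x)) = 1"
proof -
  have lin: "linear (linf y)" if "realized y" for y using linf_linear[OF that] orthogonal_transformation_linear by blast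
  have dm: "det (matrix (linf (y \<otimes>\<^bsub>AL\<^esub> z))) = det (matrix (linf y)) * det (matrix (linf z))"
    if "realized y" "realized z" for y z
    using matrix_compose[OF lin[OF that(2)] lin[OF that(1)]] realized_mult(2)[OF that] det_mul by metis
  have dr: "det (matrix (linf (\<rho> i))) = -1" if "i \<le> 3" for i
    using det_reflection mirror(1,4)[OF dim4[OF that]] by metis
  have pair: "realized (\<rho> i \<otimes>\<^bsub>AL\<^esub> \<rho> k) \<and> det (matrix (linf (\<rho> i \<otimes>\<^bsub>AL\<^esub> \<rho> k))) = 1" if "i \<le> 3" "k \<le> 3" for i k
    using realized_mult(1)[OF realized_rho realized_rho, OF dim4 dim4] dm[OF realized_rho realized_rho, OF dim4 dim4] dr that by simp
  have "realized x \<and> det (matrix (linf x)) = 1"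
    using x unfolding G.E_def
  proof induction
    case one
    then show ?case using realized_one det_I matrix_id by metis
  next
    case (incl h)
    then show ?case using pair by auto
  next
    case (inv h)
    then obtain i k where h: "h = \<rho> i \<otimes>\<^bsub>AL\<^esub> \<rho> k" "i \<le> 3" "k \<le> 3" by auto
    then have "inv\<^bsub>AL\<^esub> h = \<rho> k \<otimes>\<^bsub>AL\<^esub> \<rho> i" using A.inv_mult_group[of "\<rho> i" "\<rho> k"] by simp
    then show ?case using pair h by simp
  next
    case (eng y z)
    then show ?case using realized_mult(1) dm by simp
  qed
  then show ?thesis by blast
qed

text \<open>
  The determinant of the linear part separates \<open>\<rho> 0\<close> from the rotations; the other two conditions
  hold because automorphisms are determined by their action on the base flag.
\<close>
lemma coset_geometry_L: "coset_geometry AL \<rho>"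
proof (rule coset_geometry.intro[OF string_group_L], rule coset_geometry_axioms.intro)
  show "\<rho> 0 \<notin> G.even_part"
    using linf_rotation det_reflection[OF mirror(1)] mirror(4)[of 0] by force
  show "\<rho> i \<notin> G.stab i" if "i \<le> 3" for i
    using stab_fixes[OF _ that] rho_move[OF dim4[OF that]] by blast
  fix i x assume i: "i \<le> 3" and x: "\<And>j. \<lbrakk>j \<le> 3; j \<noteq> i\<rbrakk> \<Longrightarrow> x \<in> G.stab j"
  obtain j :: nat where j: "j \<le> 3" "j \<noteq> i"
  proof (cases "i = 0")
    case True
    then show ?thesis using that[of 1] by simp
  qed (use that[of 0] in simp)
  have "x \<in> auts L" using G.stab_closed[OF x[OF j]] .
  then show "x = \<one>\<^bsub>AL\<^esub> \<or> x = \<rho> i"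
    by (rule aut_fixing_all_but_one[OF _ dim4[OF i]]) (use stab_fixes[OF x] in auto)
qed

sublocale G: coset_geometry AL \<rho>
  by (rule coset_geometry_L)

lemma finite_AL: "finite (carrier AL)"
proof (rule finite_subset)
  have fin: "finite (faces L)" using finite_polytope_faces[OF poly] by (simp add: face_lattice_def)
  show "carrier AL \<subseteq> PiE (faces L) (\<lambda>_. faces L)"
    unfolding aut_group_def Bij_def by (auto simp: bij_betw_def PiE_def)
  show "finite (PiE (faces L) (\<lambda>_. faces L))" using fin by (simp add: finite_PiE)
qed

lemma finite_W: assumes "J \<subseteq> {0..3}" shows "finite (G.W J)"
  by (rule finite_subset[OF _ finite_AL]) (use G.W_closed assms in blast)

definition angle :: "nat \<Rightarrow> real" where
  "angle i = 2 * (mirror (i - 1) \<bullet> mirror i)"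

lemma angle_order:
  assumes i: "1 \<le> i" "i \<le> 3"
  shows "A.ord (G.s i) = 3 \<Longrightarrow> angle i * angle i = 1"
    and "A.ord (G.s i) = 4 \<Longrightarrow> angle i * angle i = 2"
    and "A.ord (G.s i) = 5 \<Longrightarrow> angle i * angle i = angle i + 1 \<or> angle i * angle i = - angle i + 1"
proof -
  have i': "i - 1 < DIM(real^4)" "i < DIM(real^4)" "i - 1 \<noteq> i" using i by auto
  let ?B = "reflection (mirror (i - 1)) \<circ> reflection (mirror i)"
  have real: "realized (G.s i)" and B: "linf (G.s i) = ?B"
    using realized_mult[OF realized_rho[OF i'(1)] realized_rho[OF i'(2)]] mirror(4)[OF i'(1)] mirror(4)[OF i'(2)]
    unfolding G.s_def by simp_all
  have pow: "realized (G.s i [^]\<^bsub>AL\<^esub> n) \<and> linf (G.s i [^]\<^bsub>AL\<^esub> n) = ?B ^^ n" for n :: nat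
  proof (induction n)
    case 0
    then show ?case using realized_one by simp
  next
    case (Suc n)
    note IH = conjunct1[OF Suc] conjunct2[OF Suc]
    show ?case unfolding A.nat_pow_Suc funpow_Suc_right
      using realized_mult[OF IH(1) real] unfolding IH(2) B by blast
  qed
  have sc: "G.s i \<in> carrier AL" using i(2) by simp
  have iff: "?B ^^ n = id \<longleftrightarrow> A.ord (G.s i) dvd n" for n
  proof -
    have "?B ^^ n = id \<longleftrightarrow> G.s i [^]\<^bsub>AL\<^esub> n = \<one>\<^bsub>AL\<^esub>"
      using pow[of n] realized_one linf_inj by metis
    then show ?thesis using A.pow_eq_id[OF sc] by simp
  qed
  note ma = mirror_angle[OF mirror(1)[OF i'(1)] mirror(1)[OF i'(2)] mirror_indep[OF i'], folded angle_def]
  show "A.ord (G.s i) = 3 \<Longrightarrow> angle i * angle i = 1" using ma(1) iff[of 3] by simp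
  show "A.ord (G.s i) = 4 \<Longrightarrow> angle i * angle i = 2" using ma(2) iff[of 4] iff[of 2] by simp
  show "A.ord (G.s i) = 5 \<Longrightarrow> angle i * angle i = angle i + 1 \<or> angle i * angle i = - angle i + 1" using ma(3) iff[of 5] by simp
qed

lemma mirrors_orthogonal:
  assumes "j \<le> 3" "i + 2 \<le> j" shows "mirror i \<bullet> mirror j = 0"
proof -
  have ij: "i < DIM(real^4)" "j < DIM(real^4)" "i \<noteq> j" using assms by auto
  note r = realized_rho[OF ij(1)] realized_rho[OF ij(2)]
  have "reflection (mirror i) \<circ> reflection (mirror j) = reflection (mirror j) \<circ> reflection (mirror i)"
    using rho_comm[OF ij(1,2) assms(2)] realized_mult(2)[OF r] realized_mult(2)[OF r(2,1)] mirror(4)[OF ij(1)] mirror(4)[OF ij(2)] by simp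
  then show ?thesis
    using orthogonal_of_commuting_reflections[OF mirror(1)[OF ij(1)] mirror(1)[OF ij(2)] mirror_indep[OF ij]] by simp
qed

end

section \<open>Root systems and orders of the groups\<close>

context regular_flag4
begin

text \<open>
  Reversing the string exchanges a polytope with its dual, so that \<open>{4,3,3}\<close> and \<open>{5,3,3}\<close> are
  computed with the matrices for \<open>{3,3,4}\<close> and \<open>{3,3,5}\<close>.
\<close>
definition dir :: "bool \<Rightarrow> nat \<Rightarrow> nat" where
  "dir rv i = (if rv then 3 - i else i)"

definition link :: "bool \<Rightarrow> nat \<Rightarrow> nat" where
  "link rv i = (if rv then 3 - i else Suc i)"

lemma dir_le: "i \<le> 3 \<Longrightarrow> dir rv i \<le> 3"
  unfolding dir_def by simp

lemma dir_eq_iff: "\<lbrakk>i \<le> 3; j \<le> 3\<rbrakk> \<Longrightarrow> dir rv i = dir rv j \<longleftrightarrow> i = j"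
  unfolding dir_def by auto

lemma dir_surj: assumes "i \<le> 3" obtains k where "k \<le> 3" "i = dir rv k"
  by (rule that[of "dir rv i"]) (use assms in \<open>auto simp: dir_def\<close>)

lemma dir_string_group: "string_group AL (\<lambda>i. \<rho> (dir rv i))"
proof (rule string_group.intro[OF group_aut_group], rule string_group_axioms.intro)
  show "\<rho> (dir rv i) \<in> carrier AL" if "i \<le> 3" for i using G.r_closed[OF dir_le[OF that]] .
  show "\<rho> (dir rv i) \<otimes>\<^bsub>AL\<^esub> \<rho> (dir rv i) = \<one>\<^bsub>AL\<^esub>" if "i \<le> 3" for i using G.r_sq[OF dir_le[OF that]] .
  show "\<rho> (dir rv i) \<otimes>\<^bsub>AL\<^esub> \<rho> (dir rv j) = \<rho> (dir rv j) \<otimes>\<^bsub>AL\<^esub> \<rho> (dir rv i)" if "j \<le> 3" "i + 2 \<le> j" for i j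
    using G.r_comm[of j i] G.r_comm[of "3 - i" "3 - j"] that unfolding dir_def by (cases rv) simp_all
qed

lemma dir_W: "string_group.W AL (\<lambda>i. \<rho> (dir rv i)) J = G.W (dir rv ` J)"
  unfolding string_group.W_def[OF dir_string_group] G.W_def by (simp add: image_image)

text \<open>
  The angles determine the inner products of the unit normals up to sign; as the diagram has no
  cycle, the signs can be corrected one after the other along the string.
\<close>
lemma roots:
  assumes links: "\<And>i. i < 3 \<Longrightarrow> angle (link rv i) * angle (link rv i) = cartan \<tau> bs i (Suc i) * cartan \<tau> bs i (Suc i)"
  obtains \<alpha> where "\<And>i. i \<le> 3 \<Longrightarrow> \<alpha> i = mirror (dir rv i) \<or> \<alpha> i = - mirror (dir rv i)"
    "\<And>i j. \<lbrakk>i \<le> 3; j \<le> 3\<rbrakk> \<Longrightarrow> 2 * (\<alpha> i \<bullet> \<alpha> j) = cartan \<tau> bs i j"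
proof -
  let ?m = "\<lambda>i. mirror (dir rv i)"
  have ang: "2 * (?m i \<bullet> ?m (Suc i)) = angle (link rv i)" if "i < 3" for i
    using that unfolding angle_def link_def dir_def by (cases rv) (simp_all add: inner_commute Suc_diff_Suc numeral_3_eq_3)
  have "\<exists>q. (q = 1 \<or> q = -1) \<and> 2 * (?m i \<bullet> ?m (Suc i)) = - q * cartan \<tau> bs i (Suc i)" if "i < 3" for i
  proof -
    have "angle (link rv i) = cartan \<tau> bs i (Suc i) \<or> angle (link rv i) = - cartan \<tau> bs i (Suc i)"
      using links[OF that] square_eq_iff by blast
    then show ?thesis unfolding ang[OF that] by (metis minus_minus mult_1 mult_minus_left)
  qed
  then have "\<forall>i. \<exists>q. i < 3 \<longrightarrow> (q = 1 \<or> q = -1) \<and> 2 * (?m i \<bullet> ?m (Suc i)) = - q * cartan \<tau> bs i (Suc i)" by blast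
  from choice[OF this] obtain q :: "nat \<Rightarrow> real" where q: "\<And>i. i < 3 \<Longrightarrow> q i = 1 \<or> q i = -1"
    "\<And>i. i < 3 \<Longrightarrow> 2 * (?m i \<bullet> ?m (Suc i)) = - q i * cartan \<tau> bs i (Suc i)" by blast
  define \<epsilon> where "\<epsilon> i = (\<Prod>k<i. q k)" for i :: nat
  have \<epsilon>: "\<epsilon> i = 1 \<or> \<epsilon> i = -1" if "i \<le> 3" for i
    using that
  proof (induction i)
    case (Suc i)
    then show ?case using q(1)[of i] unfolding \<epsilon>_def by auto
  qed (simp add: \<epsilon>_def)
  have qq: "q i * q i = 1" if "i < 3" for i using q(1)[OF that] by auto
  have \<epsilon>2: "\<epsilon> i * \<epsilon> i = 1" if "i \<le> 3" for i using \<epsilon>[OF that] by auto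
  define \<alpha> where "\<alpha> i = ((-1) ^ i * \<epsilon> i) *\<^sub>R ?m i" for i
  have sgn: "(-1::real) ^ i * \<epsilon> i = 1 \<or> (-1::real) ^ i * \<epsilon> i = -1" if "i \<le> 3" for i
    using \<epsilon>[OF that] by (cases "even i") auto
  have signs: "\<alpha> i = ?m i \<or> \<alpha> i = - ?m i" if "i \<le> 3" for i
    using sgn[OF that] unfolding \<alpha>_def by (elim disjE) simp_all
  have csym: "cartan \<tau> bs i j = cartan \<tau> bs j i" for i j by (cases bs) (simp add: insert_commute)
  have le: "2 * (\<alpha> i \<bullet> \<alpha> j) = cartan \<tau> bs i j" if ij: "i \<le> j" "j \<le> 3" for i j
  proof -
    consider "i = j" | "j = Suc i" | "i + 2 \<le> j" using ij by linarith
    then show ?thesis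
    proof cases
      case 1
      have "?m i \<bullet> ?m i = 1" using mirror(1)[OF dim4[OF dir_le[of i]]] ij by (simp add: dot_square_norm)
      moreover have "((-1) ^ i * \<epsilon> i) * ((-1) ^ i * \<epsilon> i) = 1" using sgn[of i] ij by auto
      ultimately show ?thesis using 1 unfolding \<alpha>_def by (cases bs) (simp add: mult.assoc[symmetric])
    next
      case 2
      have "2 * (\<alpha> i \<bullet> \<alpha> j) = ((-1) ^ i * (-1) ^ Suc i) * (\<epsilon> i * \<epsilon> i) * q i * (2 * (?m i \<bullet> ?m (Suc i)))"
        unfolding 2 \<alpha>_def \<epsilon>_def by simp
      also have "(-1::real) ^ i * (-1) ^ Suc i = -1" by (simp flip: power_mult_distrib)
      also have "-1 * (\<epsilon> i * \<epsilon> i) * q i * (2 * (?m i \<bullet> ?m (Suc i))) = (q i * q i) * cartan \<tau> bs i (Suc i)"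
        using \<epsilon>2[of i] q(2)[of i] ij 2 by simp
      finally show ?thesis using qq[of i] ij 2 by simp
    next
      case 3
      have "?m i \<bullet> ?m j = 0"
        using mirrors_orthogonal[of j i] mirrors_orthogonal[of "3 - i" "3 - j"] 3 ij
        unfolding dir_def by (cases rv) (simp_all add: inner_commute)
      moreover obtain b0 b1 b2 where "bs = (b0, b1, b2)" by (cases bs) auto
      ultimately show ?thesis using 3 unfolding \<alpha>_def by (simp add: doubleton_eq_iff)
    qed
  qed
  have "2 * (\<alpha> i \<bullet> \<alpha> j) = cartan \<tau> bs i j" if "i \<le> 3" "j \<le> 3" for i j
    using le[of i j] le[of j i] that csym[of i j] by (cases "i \<le> j") (simp_all add: inner_commute)
  then show ?thesis using that[of \<alpha>] signs by blast
qed

text \<open>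
  Coordinates with respect to the roots \<open>\<alpha> k\<close> are read off by the vectors \<open>d k\<close>, which up to scale
  form the dual basis.
\<close>
lemma refl_rep_exists:
  assumes links: "\<And>i. i < 3 \<Longrightarrow> angle (link rv i) * angle (link rv i) = cartan \<tau> bs i (Suc i) * cartan \<tau> bs i (Suc i)"
    and quadratic: "\<tau> * \<tau> = of_int u * \<tau> + of_int w"
    and irrational: "\<And>x y. of_int x + of_int y * \<tau> = 0 \<Longrightarrow> x = 0 \<and> y = 0"
  shows "\<exists>entry. refl_rep AL (\<lambda>i. \<rho> (dir rv i)) entry \<tau> u w bs"
proof -
  interpret R: string_group AL "\<lambda>i. \<rho> (dir rv i)" by (rule dir_string_group)
  obtain \<alpha> where sign: "\<And>i. i \<le> 3 \<Longrightarrow> \<alpha> i = mirror (dir rv i) \<or> \<alpha> i = - mirror (dir rv i)"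
    and gram: "\<And>i j. \<lbrakk>i \<le> 3; j \<le> 3\<rbrakk> \<Longrightarrow> 2 * (\<alpha> i \<bullet> \<alpha> j) = cartan \<tau> bs i j"
    using roots[OF links] by blast
  define d where "d i = v (dir rv i)" for i
  have refl: "linf (\<rho> (dir rv i)) = reflection (\<alpha> i)" if "i \<le> 3" for i
    using sign[OF that] mirror(4)[OF dim4[OF dir_le[OF that, of rv]]] by (auto simp: reflection_uminus)
  have dual: "d i \<bullet> \<alpha> j = 0 \<longleftrightarrow> i \<noteq> j" if "i \<le> 3" "j \<le> 3" for i j
    using sign[OF that(2)] mirror(2)[OF dim4[OF dir_le[OF that(2)]] dim4[OF dir_le[OF that(1)]], of rv rv]
      mirror(3)[OF dim4[OF dir_le[OF that(2), of rv]]] dir_eq_iff[OF that] unfolding d_def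
    by (auto simp: inner_commute)
  have expand: "x = (\<Sum>k\<le>3. ((d k \<bullet> x) / (d k \<bullet> \<alpha> k)) *\<^sub>R \<alpha> k)" for x
  proof -
    let ?y = "\<Sum>k\<le>3. ((d k \<bullet> x) / (d k \<bullet> \<alpha> k)) *\<^sub>R \<alpha> k"
    have "d i \<bullet> ?y = d i \<bullet> x" if i: "i \<le> 3" for i
    proof -
      have "d i \<bullet> ?y = (\<Sum>k\<le>3. ((d k \<bullet> x) / (d k \<bullet> \<alpha> k)) * (d i \<bullet> \<alpha> k))" by (simp add: inner_sum_right)
      also have "\<dots> = (\<Sum>k\<le>3. if k = i then d i \<bullet> x else 0)"
        by (rule sum.cong[OF HOL.refl]) (use dual i in auto)
      finally show ?thesis using i by simp
    qed
    then have eq: "d i \<bullet> (x - ?y) = 0" if "i \<le> 3" for i using that by (simp add: inner_diff_right)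
    have "(x - ?y) \<bullet> v i = 0" if i: "i < DIM(real^4)" for i
    proof -
      have i3: "i \<le> 3" using i by simp
      obtain k where "k \<le> 3" "i = dir rv k" using dir_surj[OF i3] by blast
      then show ?thesis using eq[of k] unfolding d_def by (simp add: inner_commute)
    qed
    then have "x - ?y = 0" by (rule orthogonal_v)
    then show ?thesis by simp
  qed
  define entry where "entry f i j = (d i \<bullet> linf f (\<alpha> j)) / (d i \<bullet> \<alpha> i)" for f i j
  have lin: "linear (linf f)" if "realized f" for f using linf_linear[OF that] orthogonal_transformation_linear by blast
  have rr: "realized (\<rho> (dir rv i))" if "i \<le> 3" for i using realized_rho[OF dim4[OF dir_le[OF that]]] .
  have rf: "realized f" if "f \<in> R.full" for f
  proof -
    have "dir rv ` {0..3} \<subseteq> {0..3}" by (auto simp: dir_def)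
    then show ?thesis using that realized_full G.W_mono[of "dir rv ` {0..3}" "{0..3}"] unfolding dir_W by blast
  qed
  have reflect: "reflection (\<alpha> s) x = x - (2 * (\<alpha> s \<bullet> x)) *\<^sub>R \<alpha> s" for s x unfolding reflection_def by simp
  have "refl_rep_axioms AL (\<lambda>i. \<rho> (dir rv i)) entry \<tau> u w bs"
  proof (rule refl_rep_axioms.intro)
    show "entry \<one>\<^bsub>AL\<^esub> i j = (if i = j then 1 else 0)" if "i \<le> 3" "j \<le> 3" for i j
      using dual[OF that] unfolding entry_def realized_one(2) by auto
    show "entry (g \<otimes>\<^bsub>AL\<^esub> \<rho> (dir rv s)) i j = entry g i j - cartan \<tau> bs s j * entry g i s"
      if "g \<in> R.full" "s \<le> 3" "i \<le> 3" "j \<le> 3" for g s i j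
    proof -
      note g = rf[OF that(1)]
      have "linf (g \<otimes>\<^bsub>AL\<^esub> \<rho> (dir rv s)) (\<alpha> j) = linf g (\<alpha> j) - cartan \<tau> bs s j *\<^sub>R linf g (\<alpha> s)"
        unfolding realized_mult(2)[OF g rr[OF that(2)]] refl[OF that(2)] comp_apply reflect gram[OF that(2,4)]
        by (simp add: linear_diff[OF lin[OF g]] linear_scale[OF lin[OF g]])
      then show ?thesis unfolding entry_def by (simp add: inner_diff_right diff_divide_distrib)
    qed
    show "entry (\<rho> (dir rv s) \<otimes>\<^bsub>AL\<^esub> g) i j =
        (if i = s then entry g s j - (\<Sum>k\<le>3. cartan \<tau> bs s k * entry g k j) else entry g i j)"
      if "g \<in> R.full" "s \<le> 3" "i \<le> 3" "j \<le> 3" for g s i j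
    proof -
      note g = rf[OF that(1)]
      let ?y = "linf g (\<alpha> j)"
      have "2 * (\<alpha> s \<bullet> ?y) = (\<Sum>k\<le>3. entry g k j * (2 * (\<alpha> s \<bullet> \<alpha> k)))"
        by (subst expand[of ?y]) (simp add: inner_sum_right entry_def sum_distrib_left algebra_simps)
      also have "\<dots> = (\<Sum>k\<le>3. cartan \<tau> bs s k * entry g k j)"
        by (rule sum.cong[OF HOL.refl]) (use gram[OF that(2)] in simp)
      finally have c: "2 * (\<alpha> s \<bullet> ?y) = (\<Sum>k\<le>3. cartan \<tau> bs s k * entry g k j)" .
      have "linf (\<rho> (dir rv s) \<otimes>\<^bsub>AL\<^esub> g) (\<alpha> j) = ?y - (\<Sum>k\<le>3. cartan \<tau> bs s k * entry g k j) *\<^sub>R \<alpha> s"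
        unfolding realized_mult(2)[OF rr[OF that(2)] g] refl[OF that(2)] comp_apply reflect c ..
      then have "entry (\<rho> (dir rv s) \<otimes>\<^bsub>AL\<^esub> g) i j = entry g i j - (\<Sum>k\<le>3. cartan \<tau> bs s k * entry g k j) * ((d i \<bullet> \<alpha> s) / (d i \<bullet> \<alpha> i))"
        unfolding entry_def by (simp add: inner_diff_right diff_divide_distrib)
      then show ?thesis using dual[OF that(3,2)] by auto
    qed
    show "g = h" if gh: "g \<in> R.full" "h \<in> R.full" "\<And>i j. \<lbrakk>i \<le> 3; j \<le> 3\<rbrakk> \<Longrightarrow> entry g i j = entry h i j" for g h
    proof (rule linf_inj[OF rf[OF gh(1)] rf[OF gh(2)]])
      have eq: "linf g (\<alpha> j) = linf h (\<alpha> j)" if "j \<le> 3" for j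
        using gh(3)[OF _ that] unfolding entry_def
        by (subst expand[of "linf g (\<alpha> j)"], subst expand[of "linf h (\<alpha> j)"]) (intro sum.cong HOL.refl, simp)
      show "linf g = linf h"
      proof
        fix x
        let ?k = "\<lambda>k. (d k \<bullet> x) / (d k \<bullet> \<alpha> k)"
        have "linf f x = (\<Sum>k\<le>3. ?k k *\<^sub>R linf f (\<alpha> k))" if "f \<in> R.full" for f
          using arg_cong[OF expand[of x], of "linf f"]
          by (simp add: linear_sum[OF lin[OF rf[OF that]]] linear_scale[OF lin[OF rf[OF that]]])
        then show "linf g x = linf h x" using gh(1,2) eq by simp
      qed
    qed
    show "\<tau> * \<tau> = of_int u * \<tau> + of_int w" by (rule quadratic)
    show "x = 0 \<and> y = 0" if "of_int x + of_int y * \<tau> = 0" for x y by (rule irrational[OF that])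
  qed
  then show ?thesis unfolding refl_rep_def using R.string_group_axioms by blast
qed

lemma dir_images: "dir rv ` {0..3} = {0..3}" "dir rv ` {1, 2} = {1, 2}"
    "dir rv ` {1..3} = (if rv then {0..2} else {1..3})"
proof -
  have "{0..3::nat} = {0, 1, 2, 3}" "{1..3::nat} = {1, 2, 3}" "{0..2::nat} = {0, 1, 2}" by auto
  then show "dir rv ` {0..3} = {0..3}" "dir rv ` {1, 2} = {1, 2}"
    "dir rv ` {1..3} = (if rv then {0..2} else {1..3})" by (auto simp: dir_def)
qed

text \<open>
  The enumeration of \<open>W {1..3}\<close> modulo \<open>W {1, 2}\<close> is by row 3 of the matrices. Left multiplication by
  elements of the facet stabiliser does not change that row, hence an element of both stabilisers has
  the row of the identity and lies in \<open>W {1, 2}\<close>.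
\<close>
lemma coset_counts:
  assumes links: "\<And>i. i < 3 \<Longrightarrow> angle (link rv i) * angle (link rv i) = cartan \<tau> bs i (Suc i) * cartan \<tau> bs i (Suc i)"
    and quadratic: "\<tau> * \<tau> = of_int u * \<tau> + of_int w"
    and irrational: "\<And>x y. of_int x + of_int y * \<tau> = 0 \<Longrightarrow> x = 0 \<and> y = 0"
    and check: "coset_check u w bs [1, 2, 3] 3 [1, 2] n" "coset_check u w bs [0, 1, 2, 3] 0 [1, 2, 3] m"
  shows "card G.even_part = m * (n * A.ord (G.s 2))"
    "card (G.E (if rv then {0..2} else {1..3})) = n * A.ord (G.s 2)"
    "G.stab 0 \<inter> G.stab 3 \<subseteq> G.W {1, 2}"
proof -
  let ?r = "\<lambda>i. \<rho> (dir rv i)"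
  obtain entry where rep: "refl_rep AL ?r entry \<tau> u w bs" using refl_rep_exists[OF links quadratic irrational] by blast
  interpret R: refl_rep AL ?r entry \<tau> u w bs by (rule rep)
  have sets: "{1..3::nat} = {1, 2, 3}" "{1..3} - {3::nat} = {1, 2}" "{0..3} - {0::nat} = {1..3}" "{0..3} - {3::nat} = {0..2}"
    "{0..3::nat} = {0, 1, 2, 3}" by auto
  have "set [1, 2, 3] = {1..3::nat}" "{1..3::nat} \<subseteq> {0..3}" "set [1, 2] = {1..3} - {3::nat}" "3 \<in> {1..3::nat}" by auto
  note c3 = R.coset_enumeration[OF this check(1)]
  have "set [0, 1, 2, 3] = {0..3::nat}" "{0..3::nat} \<subseteq> {0..3}" "set [1, 2, 3] = {0..3} - {0::nat}" "0 \<in> {0..3::nat}" by auto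
  note c0 = R.coset_enumeration[OF this check(2)]
  let ?K = "if rv then {0..2} else {1..3::nat}"
  have K: "?K \<subseteq> {0..3}" "?K \<noteq> {}" by auto
  have W3: "card (G.W ?K) = n * card (G.W {1, 2})"
    using c3(1) unfolding dir_W dir_images sets(2) .
  have W0: "card G.full = m * card (G.W ?K)"
    using c0(1) unfolding dir_W dir_images sets(3) .
  have "{1, 2} = {1..Suc (1::nat)}" "{1<..Suc (1::nat)} = {2}" by auto
  then have "card (G.E {1, 2}) = A.ord (G.s 2)"
    using G.E_interval[of 2 1] A.generate_pow_card[of "G.s 2"] by (simp add: numeral_2_eq_2)
  then have W12: "card (G.W {1, 2}) = 2 * A.ord (G.s 2)" using G.card_W[of "{1, 2}"] finite_W[of "{1, 2}"] by simp
  have E: "card (G.W ?K) = 2 * card (G.E ?K)" "card G.full = 2 * card G.even_part"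
    using G.card_W[OF K] G.card_W[of "{0..3}"] finite_W[OF K(1)] finite_W[of "{0..3}"] by simp_all
  show "card (G.E ?K) = n * A.ord (G.s 2)" using W3 W12 E by simp
  then show "card G.even_part = m * (n * A.ord (G.s 2))" using W0 E by simp
  have one: "\<one>\<^bsub>AL\<^esub> \<in> R.full" by (rule R.W_one)
  have "x \<in> G.W {1, 2}" if x: "x \<in> R.stab 0" "x \<in> R.stab 3" for x
  proof -
    have xc: "x \<in> carrier AL" using R.stab_closed[OF x(1)] .
    have "entry x 3 j = (if 3 = j then 1 else 0)" if "j \<le> 3" for j
      using R.entry_row_left[OF x(2) _ _ _ one that] R.entry_one[of 3 j] that xc by simp
    then have "x \<in> R.W ({1..3} - {3})" using c3(2)[of x] x(1) unfolding sets(3) by blast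
    then show ?thesis unfolding dir_W dir_images sets(2) .
  qed
  moreover have "R.stab 0 \<inter> R.stab 3 = G.stab 0 \<inter> G.stab 3"
  proof -
    have "dir rv ` {0..2} = (if rv then {1..3} else {0..2})" 
    proof -
      have "{0..2::nat} = {0, 1, 2}" by auto
      then show ?thesis unfolding sets(1) by (auto simp: dir_def)
    qed
    then show ?thesis unfolding dir_W sets(3,4) dir_images(3) by auto
  qed
  ultimately show "G.stab 0 \<inter> G.stab 3 \<subseteq> G.W {1, 2}" by blast
qed

lemma schlafli_iff:
  "schlafli_symbol 4 L \<Phi> = [p, q, t] \<longleftrightarrow> A.ord (G.s 1) = p \<and> A.ord (G.s 2) = q \<and> A.ord (G.s 3) = t"
proof -
  have "[1..<4] = [1, 2, 3::nat]" by (simp add: upt_rec)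
  then show ?thesis unfolding schlafli_symbol_def sigma_def G.s_def by simp
qed

lemma counts_crystallographic:
  assumes ord: "\<And>i. i < 3 \<Longrightarrow> A.ord (G.s (link rv i)) = (if [b0, b1, b2] ! i then 4 else 3)"
    and check: "coset_check 0 2 (b0, b1, b2) [1, 2, 3] 3 [1, 2] n" "coset_check 0 2 (b0, b1, b2) [0, 1, 2, 3] 0 [1, 2, 3] m"
  shows "card G.even_part = m * (n * A.ord (G.s 2))"
    "card (G.E (if rv then {0..2} else {1..3})) = n * A.ord (G.s 2)"
    "G.stab 0 \<inter> G.stab 3 \<subseteq> G.W {1, 2}"
proof -
  have link: "1 \<le> link rv i" "link rv i \<le> 3" if "i < 3" for i using that unfolding link_def by auto
  have car: "cartan \<tau> (b0, b1, b2) i (Suc i) = - bond_val \<tau> ([b0, b1, b2] ! i)" if "i < 3" for i \<tau>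
    using that by (auto simp: less_Suc_eq numeral_3_eq_3 doubleton_eq_iff)
  have "angle (link rv i) * angle (link rv i) = cartan (sqrt 2) (b0, b1, b2) i (Suc i) * cartan (sqrt 2) (b0, b1, b2) i (Suc i)"
    if i: "i < 3" for i
    unfolding car[OF i] using angle_order(1,2)[OF link[OF i]] ord[OF i] by (cases "[b0, b1, b2] ! i") simp_all
  note cc = coset_counts[OF this _ irrational_sqrt_2 check]
  show "card G.even_part = m * (n * A.ord (G.s 2))"
    "card (G.E (if rv then {0..2} else {1..3})) = n * A.ord (G.s 2)"
    "G.stab 0 \<inter> G.stab 3 \<subseteq> G.W {1, 2}" by (rule cc; simp)+
qed

text \<open>
  Order five leaves open whether \<open>\<tau>\<close> is the golden ratio or its conjugate. The enumeration uses only
  the equation \<open>\<tau>\<^sup>2 = \<tau> + 1\<close> and irrationality, so both cases give the same orders.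
\<close>
lemma counts_golden:
  assumes ord: "A.ord (G.s (link rv 0)) = 3" "A.ord (G.s (link rv 1)) = 3" "A.ord (G.s (link rv 2)) = 5"
    and check: "coset_check 1 1 (False, False, True) [1, 2, 3] 3 [1, 2] n" "coset_check 1 1 (False, False, True) [0, 1, 2, 3] 0 [1, 2, 3] m"
  shows "card G.even_part = m * (n * A.ord (G.s 2))"
    "card (G.E (if rv then {0..2} else {1..3})) = n * A.ord (G.s 2)"
    "G.stab 0 \<inter> G.stab 3 \<subseteq> G.W {1, 2}"
proof -
  have link: "1 \<le> link rv i" "link rv i \<le> 3" if "i < 3" for i using that unfolding link_def by auto
  let ?a = "angle (link rv 2)"
  have a: "?a * ?a = ?a + 1 \<or> ?a * ?a = - ?a + 1" using angle_order(3)[OF link[of 2]] ord(3) by simp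
  define \<tau> where "\<tau> = (if ?a * ?a = ?a + 1 then ?a else - ?a)"
  have \<tau>: "\<tau> * \<tau> = \<tau> + 1" "?a * ?a = \<tau> * \<tau>" using a unfolding \<tau>_def by auto
  have "angle (link rv i) * angle (link rv i) = cartan \<tau> (False, False, True) i (Suc i) * cartan \<tau> (False, False, True) i (Suc i)"
    if i: "i < 3" for i
  proof -
    consider "i = 0" | "i = 1" | "i = 2" using i by linarith
    then show ?thesis
      using angle_order(1)[OF link[of 0]] angle_order(1)[OF link[of 1]] ord \<tau>(2) by cases (simp_all add: doubleton_eq_iff numeral_2_eq_2)
  qed
  note cc = coset_counts[OF this _ irrational_golden[OF \<tau>(1)] check]
  show "card G.even_part = m * (n * A.ord (G.s 2))"
    "card (G.E (if rv then {0..2} else {1..3})) = n * A.ord (G.s 2)"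
    "G.stab 0 \<inter> G.stab 3 \<subseteq> G.W {1, 2}" by (rule cc; simp add: \<tau>)+
qed

end

section \<open>The six components\<close>

lemma (in group) pow_mod_ord:
  assumes x: "x \<in> carrier G" shows "x [^] ((m :: nat) mod ord x) = x [^] m"
proof -
  have "x [^] m = x [^] (ord x * (m div ord x) + m mod ord x)" by simp
  also have "\<dots> = (x [^] ord x) [^] (m div ord x) \<otimes> x [^] (m mod ord x)"
    using x by (simp only: nat_pow_mult[symmetric] nat_pow_pow)
  finally show ?thesis using x pow_ord_eq_1[OF x] by simp
qed

context mix_family
begin

lemma P_ord:
  assumes k: "k \<le> 3" shows "P.ord (P.s k) = (LCM t\<in>I. group.ord (A t) (sc t k))"
proof -
  have c: "P.s k \<in> carrier PG" by (rule P.s_closed[OF k])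
  have pow: "P.s k [^]\<^bsub>PG\<^esub> n = \<one>\<^bsub>PG\<^esub> \<longleftrightarrow> (\<forall>t \<in> I. sc t k [^]\<^bsub>A t\<^esub> n = \<one>\<^bsub>A t\<^esub>)" for n :: nat
  proof
    assume eq: "P.s k [^]\<^bsub>PG\<^esub> n = \<one>\<^bsub>PG\<^esub>"
    show "\<forall>t \<in> I. sc t k [^]\<^bsub>A t\<^esub> n = \<one>\<^bsub>A t\<^esub>"
    proof
      fix t assume t: "t \<in> I"
      show "sc t k [^]\<^bsub>A t\<^esub> n = \<one>\<^bsub>A t\<^esub>" using fun_cong[OF eq, of t] unfolding PG_pow[OF t c] P_s[OF t] using t by simp
    qed
  next
    assume eq: "\<forall>t \<in> I. sc t k [^]\<^bsub>A t\<^esub> n = \<one>\<^bsub>A t\<^esub>"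
    show "P.s k [^]\<^bsub>PG\<^esub> n = \<one>\<^bsub>PG\<^esub>"
    proof (rule PG_eqI[OF P.nat_pow_closed[OF c] P.one_closed])
      fix t assume t: "t \<in> I"
      show "(P.s k [^]\<^bsub>PG\<^esub> n) t = \<one>\<^bsub>PG\<^esub> t" unfolding PG_pow[OF t c] P_s[OF t] using eq t by simp
    qed
  qed
  have dvd: "P.ord (P.s k) dvd n \<longleftrightarrow> (LCM t\<in>I. group.ord (A t) (sc t k)) dvd n" for n
  proof -
    have "sc t k [^]\<^bsub>A t\<^esub> n = \<one>\<^bsub>A t\<^esub> \<longleftrightarrow> group.ord (A t) (sc t k) dvd n" if t: "t \<in> I" for t
      using group.pow_eq_id[OF comp_group[OF t] s_component_closed[OF t k]] .
    then show ?thesis using P.pow_eq_id[OF c, of n] pow[of n] by (simp add: Lcm_dvd_iff)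
  qed
  show ?thesis
  proof (rule dvd_antisym)
    show "P.ord (P.s k) dvd (LCM t\<in>I. group.ord (A t) (sc t k))" unfolding dvd by (rule dvd_refl)
    show "(LCM t\<in>I. group.ord (A t) (sc t k)) dvd P.ord (P.s k)" unfolding dvd[symmetric] by (rule dvd_refl)
  qed
qed

lemma even_power:
  assumes fin: "\<And>t. t \<in> I \<Longrightarrow> finite (carrier (A t))" and x: "x \<in> P.E {1, 2}"
  shows "\<exists>k :: nat. x = P.s 2 [^]\<^bsub>PG\<^esub> k"
proof -
  have "finite (carrier PG)" using fin finI by (simp add: finite_PiE)
  moreover have "P.s 2 \<in> carrier PG" by (rule P.s_closed) simp
  moreover have "{1..2} = {1, 2::nat}" "{1<..2} = {2::nat}" by auto
  ultimately show ?thesis using P.generate_pow_on_finite_carrier[of "P.s 2"] P.E_interval[of 2 1] x by auto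
qed

text \<open>
  The restrictions of the two tetrahedral groups to one component and to \<open>D\<close> both have order 12, so
  one component determines the others.
\<close>
lemma tetrahedral_determined:
  assumes D: "D \<subseteq> I" and a: "a \<le> 1" and t: "t \<in> D"
    and cubes: "\<And>t k. \<lbrakk>t \<in> D; k \<in> {Suc a, Suc (Suc a)}\<rbrakk> \<Longrightarrow> sc t k [^]\<^bsub>A t\<^esub> (3::nat) = \<one>\<^bsub>A t\<^esub>"
    and xy: "x \<in> P.E {a..a + 2}" "y \<in> P.E {a..a + 2}" "x t = y t" and u: "u \<in> D"
  shows "x u = y u"
proof -
  let ?V = "\<lambda>D. (\<lambda>x. restrict x D) ` P.E {a..a + 2}"
  have V: "card (?V D) = 12" using card_restrict_tetrahedral[OF D _ a cubes] t by blast
  have T: "card (?V {t}) = 12" by (rule card_restrict_tetrahedral[OF _ _ a]) (use D t cubes in auto)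
  have im: "(\<lambda>z. restrict z {t}) ` ?V D = ?V {t}" using t by (simp add: image_image Int_absorb1)
  have "finite (?V D)" by (rule card_ge_0_finite) (unfold V, simp)
  moreover have "card ((\<lambda>z. restrict z {t}) ` ?V D) = card (?V D)" unfolding im V T ..
  ultimately have inj: "inj_on (\<lambda>z. restrict z {t}) (?V D)" by (rule eq_card_imp_inj_on)
  have "restrict (restrict x D) {t} = restrict (restrict y D) {t}"
    using xy(3) by (auto simp: fun_eq_iff restrict_def)
  then have "restrict x D = restrict y D" using inj_onD[OF inj] xy by blast
  then have "restrict x D u = restrict y D u" by (rule fun_cong)
  then show ?thesis using u by simp
qed

end

definition schlafli_entry :: "nat \<Rightarrow> nat \<Rightarrow> nat" where
  "schlafli_entry t k =
    (if k = 1 then if t = 5 then 4 else if t = 6 then 5 else 3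
     else if k = 2 then if t = 4 then 4 else 3
     else if t = 2 then 4 else if t = 3 then 5 else 3)"

definition rotation_count :: "nat \<Rightarrow> nat" where
  "rotation_count t = (if t = 1 then 60 else if t = 4 then 576 else if t \<in> {2, 5} then 192 else 7200)"

definition facet_rotation_count :: "nat \<Rightarrow> nat" where
  "facet_rotation_count t = (if t = 6 then 60 else 24)"

definition vertex_rotation_count :: "nat \<Rightarrow> nat" where
  "vertex_rotation_count t = (if t = 3 then 60 else 24)"

locale six_family = mix_family I A \<rho> for I :: "nat set" and A :: "nat \<Rightarrow> 'b monoid" and \<rho> +
  assumes I6: "I \<subseteq> {1..6}"
    and finite_component: "t \<in> I \<Longrightarrow> finite (carrier (A t))"
    and ord_component: "\<lbrakk>t \<in> I; k \<in> {1, 2, 3}\<rbrakk> \<Longrightarrow> group.ord (A t) (sc t k) = schlafli_entry t k"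
    and card_rotations: "t \<in> I \<Longrightarrow> card (Ec t {0..3}) = rotation_count t"
    and card_facet: "\<lbrakk>t \<in> I; t \<in> {4, 5, 6}\<rbrakk> \<Longrightarrow> card (Ec t {0..2}) = facet_rotation_count t"
    and card_vertex: "\<lbrakk>t \<in> I; t \<in> {2, 3, 4}\<rbrakk> \<Longrightarrow> card (Ec t {1..3}) = vertex_rotation_count t"
    and component_stab_Int: "t \<in> I \<Longrightarrow> Wc t ({0..3} - {0}) \<inter> Wc t ({0..3} - {3}) \<subseteq> Wc t {1, 2}"
begin

lemma s_pow_eq:
  assumes t: "t \<in> I" and k: "k \<in> {1, 2, 3}" and mod: "m mod schlafli_entry t k = n mod schlafli_entry t k"
  shows "sc t k [^]\<^bsub>A t\<^esub> m = sc t k [^]\<^bsub>A t\<^esub> n"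
proof -
  interpret t: group "A t" by (rule comp_group[OF t])
  have k3: "k \<le> 3" using k by auto
  show ?thesis
    using t.pow_mod_ord[OF s_component_closed[OF t k3], of m] t.pow_mod_ord[OF s_component_closed[OF t k3], of n]
    unfolding ord_component[OF t k] mod by simp
qed

lemma s_cube: assumes "t \<in> I" "k \<in> {1, 2, 3}" "schlafli_entry t k = 3"
  shows "sc t k [^]\<^bsub>A t\<^esub> (3::nat) = \<one>\<^bsub>A t\<^esub>"
proof -
  interpret t: group "A t" by (rule comp_group[OF assms(1)])
  show ?thesis using s_pow_eq[of t k 3 0] assms by simp
qed

text \<open>
  A suitable exponent is congruent to 1 modulo the order in component \<open>t\<close> and divisible by the orders
  in the other components: 45 and 36 separate orders 4 and 5 from \<open>{3, 5}\<close> and \<open>{3, 4}\<close>, and 9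
  separates 4 from 3.
\<close>
lemma isolated_by_power:
  assumes t: "t \<in> I" and k: "k \<in> {1, 2, 3}" "k \<in> {a<..b}" "b \<le> 3"
    and m: "m mod schlafli_entry t k = 1"
    "\<And>u. \<lbrakk>u \<in> {1, 2, 3, 4, 5, 6}; u \<noteq> t\<rbrakk> \<Longrightarrow> m mod schlafli_entry u k = 0"
  shows "isolated a b t (sc t k)"
proof (rule isolated_power[OF t k(2,3), of m])
  interpret t: group "A t" by (rule comp_group[OF t])
  have k3: "k \<le> 3" using k by auto
  have "1 mod schlafli_entry t k = 1" unfolding schlafli_entry_def by simp
  then show "sc t k [^]\<^bsub>A t\<^esub> m = sc t k" using s_pow_eq[OF t k(1), of m 1] m(1) s_component_closed[OF t k3] by simp
  fix u assume u: "u \<in> I" "u \<noteq> t"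
  interpret u: group "A u" by (rule comp_group[OF u(1)])
  have "{1..6} = {1, 2, 3, 4, 5, 6::nat}" by auto
  then show "sc u k [^]\<^bsub>A u\<^esub> m = \<one>\<^bsub>A u\<^esub>" using s_pow_eq[OF u(1) k(1), of m 0] m(2)[OF _ u(2)] u(1) I6 by auto
qed

lemma isolated_first:
  assumes "t \<in> I" "t \<in> {5, 6}" "a = 0" "1 \<le> b" "b \<le> 3" shows "isolated a b t (sc t 1)"
proof (cases "t = 5")
  case True
  show ?thesis by (rule isolated_by_power[OF assms(1), of 1 a b 45]) (use assms True in \<open>auto simp: schlafli_entry_def\<close>)
next
  case False
  show ?thesis by (rule isolated_by_power[OF assms(1), of 1 a b 36]) (use assms False in \<open>auto simp: schlafli_entry_def\<close>)
qed

lemma isolated_third: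
  assumes "t \<in> I" "t \<in> {2, 3}" "a \<le> 2" shows "isolated a 3 t (sc t 3)"
proof (cases "t = 2")
  case True
  show ?thesis by (rule isolated_by_power[OF assms(1), of 3 a 3 45]) (use assms True in \<open>auto simp: schlafli_entry_def\<close>)
next
  case False
  show ?thesis by (rule isolated_by_power[OF assms(1), of 3 a 3 36]) (use assms False in \<open>auto simp: schlafli_entry_def\<close>)
qed

lemma isolated_middle:
  assumes "4 \<in> I" "a \<le> 1" "2 \<le> b" "b \<le> 3" shows "isolated a b 4 (sc 4 2)"
  by (rule isolated_by_power[OF assms(1), of 2 a b 9]) (use assms in \<open>auto simp: schlafli_entry_def\<close>)

lemma neighbour:
  assumes "t \<in> I" "isolated a b t (sc t i)" "i \<in> {a<..b}" "k \<in> {a<..b}" "b \<le> 3" "k = Suc i \<or> i = Suc k" "schlafli_entry t k = 3"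
  shows "isolated a b t (sc t k)"
proof -
  have "k \<in> {1, 2, 3}" using assms(4,5) by auto
  then show ?thesis using isolated_neighbour[OF assms(1,5,3,4,6,2) s_cube[OF assms(1) _ assms(7)]] by blast
qed

lemma isolated_facet:
  assumes t: "t \<in> I \<inter> {4, 5, 6}" and k: "k \<in> {0<..2}" shows "isolated 0 2 t (sc t k)"
proof -
  have k': "k = 1 \<or> k = 2" using k by auto
  have tI: "t \<in> I" using t by blast
  show ?thesis
  proof (cases "t = 4")
    case True
    have "isolated 0 2 t (sc t 2)" using isolated_middle[of 0 2] tI True by simp
    then show ?thesis using neighbour[OF tI, of 0 2 2 1] k' True by (auto simp: schlafli_entry_def)
  next
    case False
    then have "isolated 0 2 t (sc t 1)" using isolated_first[OF tI, of 0 2] t by simp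
    then show ?thesis using neighbour[OF tI, of 0 2 1 2] k' False by (auto simp: schlafli_entry_def)
  qed
qed

lemma isolated_vertex:
  assumes t: "t \<in> I \<inter> {2, 3, 4}" and k: "k \<in> {1<..3}" shows "isolated 1 3 t (sc t k)"
proof -
  have k': "k = 2 \<or> k = 3" using k by auto
  have tI: "t \<in> I" using t by blast
  show ?thesis
  proof (cases "t = 4")
    case True
    have "isolated 1 3 t (sc t 2)" using isolated_middle[of 1 3] tI True by simp
    then show ?thesis using neighbour[OF tI, of 1 3 2 3] k' True by (auto simp: schlafli_entry_def)
  next
    case False
    then have "isolated 1 3 t (sc t 3)" using isolated_third[OF tI, of 1] t by simp
    then show ?thesis using neighbour[OF tI, of 1 3 3 2] k' False by (auto simp: schlafli_entry_def)
  qed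
qed

lemma isolated_full:
  assumes t: "t \<in> I - {1}" and k: "k \<in> {0<..3}" shows "isolated 0 3 t (sc t k)"
proof -
  have k': "k = 1 \<or> k = 2 \<or> k = 3" using k by auto
  have tI: "t \<in> I" using t by blast
  have t6: "t = 2 \<or> t = 3 \<or> t = 4 \<or> t = 5 \<or> t = 6" using t I6 by (auto simp: subset_iff)
  consider "t = 4" | "t \<in> {5, 6}" | "t \<in> {2, 3}" using t6 by blast
  then show ?thesis
  proof cases
    case 1
    have 2: "isolated 0 3 t (sc t 2)" using isolated_middle[of 0 3] tI 1 by simp
    have "isolated 0 3 t (sc t 1)" by (rule neighbour[OF tI 2]) (auto simp: 1 schlafli_entry_def)
    moreover have "isolated 0 3 t (sc t 3)" by (rule neighbour[OF tI 2]) (auto simp: 1 schlafli_entry_def)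
    ultimately show ?thesis using 2 k' by blast
  next
    case 2
    have s1: "isolated 0 3 t (sc t 1)" using isolated_first[OF tI 2] by simp
    have s2: "isolated 0 3 t (sc t 2)" by (rule neighbour[OF tI s1]) (use 2 in \<open>auto simp: schlafli_entry_def\<close>)
    have "isolated 0 3 t (sc t 3)" by (rule neighbour[OF tI s2]) (use 2 in \<open>auto simp: schlafli_entry_def\<close>)
    then show ?thesis using s1 s2 k' by blast
  next
    case 3
    have s3: "isolated 0 3 t (sc t 3)" using isolated_third[OF tI 3] by simp
    have s2: "isolated 0 3 t (sc t 2)" by (rule neighbour[OF tI s3]) (use 3 in \<open>auto simp: schlafli_entry_def\<close>)
    have "isolated 0 3 t (sc t 1)" by (rule neighbour[OF tI s2]) (use 3 in \<open>auto simp: schlafli_entry_def\<close>)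
    then show ?thesis using s3 s2 k' by blast
  qed
qed

lemma facet_cubes: "\<lbrakk>t \<in> I \<inter> {1, 2, 3}; k \<in> {Suc 0, Suc (Suc 0)}\<rbrakk> \<Longrightarrow> sc t k [^]\<^bsub>A t\<^esub> (3::nat) = \<one>\<^bsub>A t\<^esub>"
  by (rule s_cube) (auto simp: schlafli_entry_def)

lemma vertex_cubes: "\<lbrakk>t \<in> I \<inter> {1, 5, 6}; k \<in> {Suc 1, Suc (Suc 1)}\<rbrakk> \<Longrightarrow> sc t k [^]\<^bsub>A t\<^esub> (3::nat) = \<one>\<^bsub>A t\<^esub>"
  by (rule s_cube) (auto simp: schlafli_entry_def)

lemma I_cases: assumes "t \<in> I" shows "t = 1 \<or> t = 2 \<or> t = 3 \<or> t = 4 \<or> t = 5 \<or> t = 6"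
proof -
  have "t \<in> {1..6}" using assms I6 by (rule rev_subsetD)
  then have "1 \<le> t" "t \<le> 6" by simp_all
  then show ?thesis by linarith
qed

lemma facet_rest: "I \<inter> {1, 2, 3} = I - I \<inter> {4, 5, 6}"
proof (rule Set.set_eqI)
  show "t \<in> I \<inter> {1, 2, 3} \<longleftrightarrow> t \<in> I - I \<inter> {4, 5, 6}" for t
    by (cases "t \<in> I", drule I_cases, elim disjE) simp_all
qed

lemma vertex_rest: "I \<inter> {1, 5, 6} = I - I \<inter> {2, 3, 4}"
proof (rule Set.set_eqI)
  show "t \<in> I \<inter> {1, 5, 6} \<longleftrightarrow> t \<in> I - I \<inter> {2, 3, 4}" for t
    by (cases "t \<in> I", drule I_cases, elim disjE) simp_all
qed

lemma full_rest: "I \<inter> {1} = I - (I - {1})"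
  by blast

lemma card_mix_rotations: "card P.even_part = (\<Prod>t\<in>I. rotation_count t)"
proof -
  have eq: "card P.even_part = (\<Prod>t\<in>I - {1}. card (Ec t {0..3})) * card ((\<lambda>x. restrict x (I \<inter> {1})) ` P.even_part)"
    by (rule E_decompose(2)[OF order_refl Diff_subset full_rest isolated_full])
  have p: "(\<Prod>t\<in>I - {1}. card (Ec t {0..3})) = (\<Prod>t\<in>I - {1}. rotation_count t)"
    by (rule prod.cong) (use card_rotations in auto)
  show ?thesis
  proof (cases "1 \<in> I")
    case True
    then have "I \<inter> {1} = {1}" by blast
    then have "card P.even_part = (\<Prod>t\<in>I - {1}. rotation_count t) * rotation_count 1"
      using eq p card_restrict_single[OF True order_refl] card_rotations[OF True] by simp
    then show ?thesis using prod.remove[OF finI True, of rotation_count] by (simp add: mult.commute)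
  next
    case False
    then have "I \<inter> {1} = {}" "I - {1} = I" by auto
    then show ?thesis using eq p card_restrict_empty by simp
  qed
qed

lemma card_mix_facet:
  "card (P.E {0..2}) = (\<Prod>t\<in>I \<inter> {4, 5, 6}. facet_rotation_count t) * (if I \<inter> {1, 2, 3} = {} then 1 else 12)"
proof -
  have "card (P.E {0..2}) = (\<Prod>t\<in>I \<inter> {4, 5, 6}. card (Ec t {0..2})) * card ((\<lambda>x. restrict x (I \<inter> {1, 2, 3})) ` P.E {0..2})"
    by (rule E_decompose(2)[OF _ Int_lower1 facet_rest isolated_facet]) simp
  moreover have "(\<Prod>t\<in>I \<inter> {4, 5, 6}. card (Ec t {0..2})) = (\<Prod>t\<in>I \<inter> {4, 5, 6}. facet_rotation_count t)"
    by (rule prod.cong) (use card_facet in auto)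
  moreover have "card ((\<lambda>x. restrict x (I \<inter> {1, 2, 3})) ` P.E {0..2}) = (if I \<inter> {1, 2, 3} = {} then 1 else 12)"
  proof (cases "I \<inter> {1, 2, 3} = {}")
    case True
    then show ?thesis using card_restrict_empty by simp
  next
    case False
    then show ?thesis using card_restrict_tetrahedral[OF Int_lower1 False _ facet_cubes] by (simp add: numeral_2_eq_2)
  qed
  ultimately show ?thesis by simp
qed

lemma card_mix_vertex:
  "card (P.E {1..3}) = (\<Prod>t\<in>I \<inter> {2, 3, 4}. vertex_rotation_count t) * (if I \<inter> {1, 5, 6} = {} then 1 else 12)"
proof -
  have "card (P.E {1..3}) = (\<Prod>t\<in>I \<inter> {2, 3, 4}. card (Ec t {1..3})) * card ((\<lambda>x. restrict x (I \<inter> {1, 5, 6})) ` P.E {1..3})"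
    by (rule E_decompose(2)[OF order_refl Int_lower1 vertex_rest isolated_vertex])
  moreover have "(\<Prod>t\<in>I \<inter> {2, 3, 4}. card (Ec t {1..3})) = (\<Prod>t\<in>I \<inter> {2, 3, 4}. vertex_rotation_count t)"
    by (rule prod.cong) (use card_vertex in auto)
  moreover have "card ((\<lambda>x. restrict x (I \<inter> {1, 5, 6})) ` P.E {1..3}) = (if I \<inter> {1, 5, 6} = {} then 1 else 12)"
  proof (cases "I \<inter> {1, 5, 6} = {}")
    case True
    then show ?thesis using card_restrict_empty by simp
  next
    case False
    then show ?thesis using card_restrict_tetrahedral[OF Int_lower1 False _ vertex_cubes] by (simp add: numeral_3_eq_3)
  qed
  ultimately show ?thesis by simp
qed

text \<open>
  Each component of \<open>x\<close> is a power of \<open>\<sigma>\<^sub>2\<close>. The exponent in component 1 serves for components 2 and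
  3 through the common tetrahedral facet, and for components 5 and 6 through the common tetrahedral
  vertex figure; only component 4, where \<open>\<sigma>\<^sub>2\<close> has order 4, has an exponent of its own.
\<close>
lemma stab_Int_even:
  assumes one: "1 \<in> I" and x: "x \<in> P.E {0..2}" "x \<in> P.E {1..3}"
  shows "x \<in> P.W {1, 2}"
proof -
  have sub: "{0..2} \<subseteq> {0..3::nat}" "{1..3} \<subseteq> {0..3::nat}" "{1, 2} \<subseteq> {0..3::nat}" by auto
  have xc: "x \<in> carrier PG" using P.E_closed[OF x(1) sub(1)] .
  have sP: "P.s 2 \<in> carrier PG" by (rule P.s_closed) simp
  have pow: "\<exists>k :: nat. x t = sc t 2 [^]\<^bsub>A t\<^esub> k" if t: "t \<in> I" for t
  proof -
    interpret t: coset_geometry "A t" "\<rho> t" by (rule comp[OF t])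
    have e: "x t \<in> Ec t {0..2}" "x t \<in> Ec t {1..3}" using component_E[OF _ t] x sub by blast+
    have s: "{0..3} - {3::nat} = {0..2}" "{0..3} - {0::nat} = {1..3}" by auto
    have "x t \<in> Wc t {1, 2}"
      using component_stab_Int[OF t] t.E_subset_W[OF sub(1)] t.E_subset_W[OF sub(2)] e unfolding s by blast
    moreover have "x t \<in> t.even_part" using e t.E_mono[OF sub(1)] by blast
    ultimately have "x t \<in> Ec t {1, 2}" using t.W_Int_even[OF sub(3)] by blast
    moreover have "{1..2} = {1, 2::nat}" "{1<..2} = {2::nat}" by auto
    ultimately have "x t \<in> generate (A t) {sc t 2}" using t.E_interval[of 2 1] by simp
    then show ?thesis using t.generate_pow_on_finite_carrier[OF finite_component[OF t], of "sc t 2"] by auto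
  qed
  have spow: "(P.s 2 [^]\<^bsub>PG\<^esub> m) t = sc t 2 [^]\<^bsub>A t\<^esub> m" if "t \<in> I" for t and m :: nat
    unfolding PG_pow[OF that sP] P_s[OF that] ..
  have sE: "P.s 2 [^]\<^bsub>PG\<^esub> m \<in> P.E {a..b}" if "a < 2" "2 \<le> b" "b \<le> 3" for m a b :: nat
  proof -
    have "P.s 2 \<in> P.E {a..b}" unfolding P.E_interval[OF that(3)] by (rule generate.incl) (use that in auto)
    then show ?thesis by (induction m) (simp_all add: P.E_mult del: mult_product_group one_product_group)
  qed
  obtain k :: nat where k: "x 1 = sc 1 2 [^]\<^bsub>A 1\<^esub> k" using pow[OF one] by blast
  obtain l :: nat where l: "4 \<in> I \<Longrightarrow> x 4 = sc 4 2 [^]\<^bsub>A 4\<^esub> l" using pow by blast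
  have same: "x t = sc t 2 [^]\<^bsub>A t\<^esub> k" if t: "t \<in> I" "t \<noteq> 4" for t
  proof -
    have eq1: "x 1 = (P.s 2 [^]\<^bsub>PG\<^esub> k) 1" unfolding spow[OF one] by (rule k)
    have "t \<in> I \<inter> {1, 2, 3} \<or> t \<in> I \<inter> {1, 5, 6}" using I_cases[OF t(1)] t by (elim disjE) simp_all
    then consider "t \<in> I \<inter> {1, 2, 3}" | "t \<in> I \<inter> {1, 5, 6}" by (elim disjE)
    then have "x t = (P.s 2 [^]\<^bsub>PG\<^esub> k) t"
    proof cases
      case 1
      show ?thesis
      proof (rule tetrahedral_determined[where D = "I \<inter> {1, 2, 3}" and a = 0 and t = 1 and x = x
            and y = "P.s 2 [^]\<^bsub>PG\<^esub> k" and u = t, OF Int_lower1 _ _ facet_cubes])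
        show "x 1 = (P.s 2 [^]\<^bsub>PG\<^esub> k) 1" by (rule eq1)
        show "t \<in> I \<inter> {1, 2, 3}" by (rule 1)
        show "1 \<in> I \<inter> {1, 2, 3}" using one by blast
        show "x \<in> P.E {0..0 + 2}" using x(1) by (simp only: add_0)
        show "P.s 2 [^]\<^bsub>PG\<^esub> k \<in> P.E {0..0 + 2}" by (rule sE) simp_all
      qed simp_all
    next
      case 2
      show ?thesis
      proof (rule tetrahedral_determined[where D = "I \<inter> {1, 5, 6}" and a = 1 and t = 1 and x = x
            and y = "P.s 2 [^]\<^bsub>PG\<^esub> k" and u = t, OF Int_lower1 _ _ vertex_cubes])
        show "x 1 = (P.s 2 [^]\<^bsub>PG\<^esub> k) 1" by (rule eq1)
        show "t \<in> I \<inter> {1, 5, 6}" by (rule 2)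
        show "1 \<in> I \<inter> {1, 5, 6}" using one by blast
        show "x \<in> P.E {1..1 + 2}" using x(2) by (simp add: numeral_3_eq_3)
        show "P.s 2 [^]\<^bsub>PG\<^esub> k \<in> P.E {1..1 + 2}" by (rule sE) simp_all
      qed simp_all
    qed
    then show ?thesis unfolding spow[OF t(1)] .
  qed
  \<comment> \<open>\<open>4 k + 9 l\<close> is congruent to \<open>k\<close> modulo 3 and to \<open>l\<close> modulo 4\<close>
  have "x = P.s 2 [^]\<^bsub>PG\<^esub> (4 * k + 9 * l)"
  proof (rule PG_eqI[OF xc P.nat_pow_closed[OF sP]])
    fix t assume t: "t \<in> I"
    show "x t = (P.s 2 [^]\<^bsub>PG\<^esub> (4 * k + 9 * l)) t"
    proof (cases "t = 4")
      case True
      have "l mod schlafli_entry t 2 = (4 * k + 9 * l) mod schlafli_entry t 2"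
        unfolding True schlafli_entry_def by simp presburger
      then show ?thesis unfolding spow[OF t] using s_pow_eq[OF t, of 2 l] l t True by simp
    next
      case False
      have "k mod schlafli_entry t 2 = (4 * k + 9 * l) mod schlafli_entry t 2"
        using False unfolding schlafli_entry_def by simp presburger
      then show ?thesis unfolding spow[OF t] same[OF t False] using s_pow_eq[OF t, of 2 k] by simp
    qed
  qed
  moreover have "P.s 2 [^]\<^bsub>PG\<^esub> (4 * k + 9 * l) \<in> P.E {1..2}" by (rule sE) simp_all
  moreover have "{1..2} = {1, 2::nat}" by auto
  ultimately show ?thesis using P.E_subset_W[OF sub(3)] by auto
qed

lemma stab_Int: assumes one: "1 \<in> I" shows "P.stab 0 \<inter> P.stab 3 \<subseteq> P.W {1, 2}"
proof
  fix x assume x: "x \<in> P.stab 0 \<inter> P.stab 3"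
  have s: "{0..3} - {3::nat} = {0..2}" "{0..3} - {0::nat} = {1..3}" by auto
  have sub: "{0..2} \<subseteq> {0..3::nat}" "{1..3} \<subseteq> {0..3::nat}" "{1, 2} \<subseteq> {0..3::nat}" by auto
  have ev: "y \<in> P.W {1, 2}" if "y \<in> P.stab 0" "y \<in> P.stab 3" "y \<in> P.even_part" for y
    using stab_Int_even[OF one, of y] P.W_Int_even[OF sub(1)] P.W_Int_even[OF sub(2)] that unfolding s by blast
  have r1: "rr 1 \<in> P.stab 0" "rr 1 \<in> P.stab 3" "rr 1 \<in> P.W {1, 2}" by (rule P.W_gen; simp)+
  have xc: "x \<in> carrier PG" using x P.stab_closed by blast
  have "x \<in> P.even_part \<or> rr 1 \<otimes>\<^bsub>PG\<^esub> x \<in> P.even_part"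
    using P.W_even_odd[of 1 "{0..3}" x] P.stab_full x by auto
  then show "x \<in> P.W {1, 2}"
  proof
    assume "x \<in> P.even_part"
    then show ?thesis using ev x by blast
  next
    assume "rr 1 \<otimes>\<^bsub>PG\<^esub> x \<in> P.even_part"
    then have "rr 1 \<otimes>\<^bsub>PG\<^esub> x \<in> P.W {1, 2}"
      using ev P.W_mult[OF r1(1)] P.W_mult[OF r1(2)] x by blast
    then have "rr 1 \<otimes>\<^bsub>PG\<^esub> (rr 1 \<otimes>\<^bsub>PG\<^esub> x) \<in> P.W {1, 2}" by (rule P.W_mult[OF r1(3)])
    moreover have "rr 1 \<otimes>\<^bsub>PG\<^esub> (rr 1 \<otimes>\<^bsub>PG\<^esub> x) = x" by (rule P.r_cancel[OF _ xc]) simp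
    ultimately show ?thesis by (simp only:)
  qed
qed

text \<open>
  The element \<open>x\<close> is \<open>\<beta>\<^sub>2\<close> restricted to the components with tetrahedral facets. In the facet
  stabiliser these components split off from the others, and in the vertex stabiliser each of them
  is a direct factor. As a power of \<open>\<beta>\<^sub>2\<close> its exponent would be both 0 and 1 modulo 3.
\<close>
lemma stab_Int_fails:
  assumes one: "1 \<notin> I" and p: "p \<in> I" "p \<in> {2, 3}" and q: "q \<in> I" "q \<in> {5, 6}"
  shows "\<not> P.stab 0 \<inter> P.stab 3 \<subseteq> P.W {1, 2}"
proof
  assume le: "P.stab 0 \<inter> P.stab 3 \<subseteq> P.W {1, 2}"
  have s: "{0..3} - {3::nat} = {0..2}" "{0..3} - {0::nat} = {1..3}" by auto
  have sub: "{0..2} \<subseteq> {0..3::nat}" "{1..3} \<subseteq> {0..3::nat}" "{1, 2} \<subseteq> {0..3::nat}" by auto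
  define x where "x = (\<lambda>t\<in>I. if t \<in> {2, 3} then sc t 2 else \<one>\<^bsub>A t\<^esub>)"
  have xt: "x t = (if t \<in> {2, 3} then sc t 2 else \<one>\<^bsub>A t\<^esub>)" if "t \<in> I" for t using that unfolding x_def by simp
  have xc: "x \<in> carrier PG"
  proof -
    have "x t \<in> carrier (A t)" if t: "t \<in> I" for t
    proof -
      interpret t: group "A t" by (rule comp_group[OF t])
      show ?thesis unfolding xt[OF t] using s_component_closed[OF t, of 2] by simp
    qed
    then show ?thesis unfolding x_def by auto
  qed
  have sP: "P.s 2 \<in> carrier PG" by (rule P.s_closed) simp
  have "x \<in> P.E {0..2}"
  proof (subst E_decompose(1)[OF _ _ facet_rest isolated_facet], goal_cases)
    case 5
    have "x t \<in> Ec t {0..2}" if t: "t \<in> I \<inter> {4, 5, 6}" for t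
    proof -
      have tI: "t \<in> I" using t by blast
      interpret t: coset_geometry "A t" "\<rho> t" by (rule comp[OF tI])
      show ?thesis using xt[OF tI] t t.E_one by auto
    qed
    moreover have "restrict x (I \<inter> {1, 2, 3}) = restrict (P.s 2) (I \<inter> {1, 2, 3})"
    proof
      fix t
      show "restrict x (I \<inter> {1, 2, 3}) t = restrict (P.s 2) (I \<inter> {1, 2, 3}) t"
        using one xt[of t] P_s[of t 2] by (auto simp: restrict_def)
    qed
    moreover have "P.s 2 \<in> P.E {0..2}" by (subst P.E_interval, simp, rule generate.incl) auto
    ultimately show ?case using xc by blast
  qed auto
  moreover have "x \<in> P.E {1..3}"
  proof (subst E_decompose(1)[OF _ _ vertex_rest isolated_vertex], goal_cases)
    case 5
    have "x t \<in> Ec t {1..3}" if t: "t \<in> I \<inter> {2, 3, 4}" for t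
    proof -
      have tI: "t \<in> I" using t by blast
      interpret t: coset_geometry "A t" "\<rho> t" by (rule comp[OF tI])
      have "sc t 2 \<in> Ec t {1..3}" by (subst t.E_interval, simp, rule generate.incl) auto
      then show ?thesis using xt[OF tI] t.E_one by auto
    qed
    moreover have "restrict x (I \<inter> {1, 5, 6}) = restrict \<one>\<^bsub>PG\<^esub> (I \<inter> {1, 5, 6})"
    proof
      fix t
      show "restrict x (I \<inter> {1, 5, 6}) t = restrict \<one>\<^bsub>PG\<^esub> (I \<inter> {1, 5, 6}) t"
        using one xt[of t] by (auto simp: restrict_def)
    qed
    ultimately show ?case using xc P.E_one by blast
  qed auto
  ultimately have "x \<in> P.W {1, 2}" "x \<in> P.even_part"
    using le P.E_subset_W[OF sub(1)] P.E_subset_W[OF sub(2)] P.E_mono[OF sub(1)] unfolding s by blast+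
  then have "x \<in> P.E {1, 2}" using P.W_Int_even[OF sub(3)] by blast
  then obtain k :: nat where k: "x = P.s 2 [^]\<^bsub>PG\<^esub> k" using even_power finite_component by blast
  have xk: "x t = sc t 2 [^]\<^bsub>A t\<^esub> k" if t: "t \<in> I" for t unfolding k PG_pow[OF t sP] P_s[OF t] ..
  interpret p: group "A p" by (rule comp_group[OF p(1)])
  interpret q: group "A q" by (rule comp_group[OF q(1)])
  have three: "schlafli_entry p 2 = 3" "schlafli_entry q 2 = 3" using p(2) q(2) unfolding schlafli_entry_def by auto
  have "sc q 2 [^]\<^bsub>A q\<^esub> k = \<one>\<^bsub>A q\<^esub>" using xk[OF q(1)] xt[OF q(1)] q(2) by auto
  then have "3 dvd k" using q.pow_eq_id[OF s_component_closed[OF q(1), of 2], of k] ord_component[OF q(1), of 2] three by simp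
  then have "sc p 2 [^]\<^bsub>A p\<^esub> k = \<one>\<^bsub>A p\<^esub>"
    using p.pow_eq_id[OF s_component_closed[OF p(1), of 2], of k] ord_component[OF p(1), of 2] three by simp
  then have "sc p 2 = \<one>\<^bsub>A p\<^esub>" using xk[OF p(1)] xt[OF p(1)] p(2) by auto
  then have "p.ord (sc p 2) = 1" using p.ord_eq_1[OF s_component_closed[OF p(1), of 2]] by simp
  then show False using ord_component[OF p(1), of 2] three by simp
qed

lemma finite_full: "finite P.full"
proof (rule finite_subset)
  show "P.full \<subseteq> carrier PG" using P.full_closed by blast
  show "finite (carrier PG)" using finite_component finI by (simp add: finite_PiE)
qed

lemma mix_counts:
  defines "R \<equiv> \<Prod>t\<in>I. rotation_count t"
  shows "face_count P.geometry 0 =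
      R div ((\<Prod>t\<in>I \<inter> {2, 3, 4}. vertex_rotation_count t) * (if I \<inter> {1, 5, 6} = {} then 1 else 12))"
    and "face_count P.geometry 1 = R div (2 * (LCM t\<in>I. schlafli_entry t 3))"
    and "face_count P.geometry 2 = R div (2 * (LCM t\<in>I. schlafli_entry t 1))"
    and "face_count P.geometry 3 =
      R div ((\<Prod>t\<in>I \<inter> {4, 5, 6}. facet_rotation_count t) * (if I \<inter> {1, 2, 3} = {} then 1 else 12))"
    and "card (flags P.geometry) = 2 * R"
    and "abstract_polytope 4 P.geometry \<longleftrightarrow> P.stab 0 \<inter> P.stab 3 \<subseteq> P.W {1, 2}"
proof -
  have s: "{0..3} - {3::nat} = {0..2}" "{0..3} - {0::nat} = {1..3}" by auto
  have fc: "face_count P.geometry j = R div card (P.E ({0..3} - {j}))" if "j \<le> 3" for j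
  proof -
    have "P.E ({0..3} - {j}) \<subseteq> P.full" using P.E_mono[of "{0..3} - {j}" "{0..3}"] P.even_full by auto
    then have "finite (P.E ({0..3} - {j}))" using finite_full finite_subset by blast
    then have "card (P.E ({0..3} - {j})) \<noteq> 0" using P.E_one by auto
    then show ?thesis
      using P.face_count_geometry[OF finite_full that] card_mix_rotations unfolding R_def by (metis nonzero_mult_div_cancel_right)
  qed
  have lcm: "P.ord (P.s k) = (LCM t\<in>I. schlafli_entry t k)" if "k \<in> {1, 2, 3}" for k
  proof -
    have "k \<le> 3" using that by auto
    then have "P.ord (P.s k) = (LCM t\<in>I. group.ord (A t) (sc t k))" by (rule P_ord)
    also have "\<dots> = (LCM t\<in>I. schlafli_entry t k)"
      by (rule arg_cong[where f = Lcm], rule image_cong[OF refl]) (rule ord_component[OF _ that])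
    finally show ?thesis .
  qed
  show "face_count P.geometry 0 =
      R div ((\<Prod>t\<in>I \<inter> {2, 3, 4}. vertex_rotation_count t) * (if I \<inter> {1, 5, 6} = {} then 1 else 12))"
    using fc[of 0] card_mix_vertex unfolding s by simp
  show "face_count P.geometry 1 = R div (2 * (LCM t\<in>I. schlafli_entry t 3))"
    using fc[of 1] P.card_E_023(1)[OF finite_full] lcm[of 3] by simp
  show "face_count P.geometry 2 = R div (2 * (LCM t\<in>I. schlafli_entry t 1))"
    using fc[of 2] P.card_E_023(2)[OF finite_full] lcm[of 1] by simp
  show "face_count P.geometry 3 =
      R div ((\<Prod>t\<in>I \<inter> {4, 5, 6}. facet_rotation_count t) * (if I \<inter> {1, 2, 3} = {} then 1 else 12))"
    using fc[of 3] card_mix_facet unfolding s by simp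
  show "card (flags P.geometry) = 2 * R" using P.card_flags_geometry[OF finite_full] card_mix_rotations unfolding R_def by simp
  show "abstract_polytope 4 P.geometry \<longleftrightarrow> P.stab 0 \<inter> P.stab 3 \<subseteq> P.W {1, 2}" by (rule P.geometry_polytope_iff)
qed

end

section \<open>The mix as a coset geometry\<close>

text \<open>
  The groups in the definition of the mix are nested subgroups with restricted carriers. As generated
  subgroups do not depend on the ambient group, all of them can be formed in the product of the
  full automorphism groups.
\<close>
lemma mix_eq_geometry:
  fixes Q :: "'i \<Rightarrow> 'a ranked_poset" and \<Phi> :: "'i \<Rightarrow> 'a set"
  assumes mf: "mix_family I (\<lambda>t. aut_group (Q t)) (\<lambda>t. rho (Q t) (\<Phi> t))"
  shows "mix 4 I Q \<Phi> =
    coset_geometry.geometry (product_group I (\<lambda>t. aut_group (Q t))) (mix_family.rr I (\<lambda>t. rho (Q t) (\<Phi> t)))"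
proof -
  interpret M: mix_family I "\<lambda>t. aut_group (Q t)" "\<lambda>t. rho (Q t) (\<Phi> t)" by (rule mf)
  define H where "H t = generate (aut_group (Q t)) (sigma (Q t) (\<Phi> t) ` {1..4 - 1})" for t
  let ?RP = "rotation_product 4 I Q \<Phi>"
  have RP: "?RP = M.PG\<lparr>carrier := PiE I H\<rparr>"
    unfolding rotation_product_def rotation_group_def product_group_def H_def by simp
  have sig: "sigma (Q t) (\<Phi> t) i = M.sc t i" if "t \<in> I" for t i
    unfolding sigma_def string_group.s_def[OF M.comp_string[OF that]] ..
  have H: "subgroup (H t) (aut_group (Q t))" if t: "t \<in> I" for t
  proof -
    interpret t: group "aut_group (Q t)" by (rule M.comp_group[OF t])
    show ?thesis unfolding H_def
      by (rule t.generate_is_subgroup) (auto simp: sig[OF t] intro!: M.s_component_closed[OF t])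
  qed
  have sub: "subgroup (PiE I H) M.PG"
    using PiE_subgroup_product_group[of I "\<lambda>t. aut_group (Q t)" H] M.comp_group H by blast
  have beta: "beta I Q \<Phi> i = M.P.s i" for i
  proof
    fix t
    show "beta I Q \<Phi> i t = M.P.s i t"
    proof (cases "t \<in> I")
      case True
      then show ?thesis using M.P_s[OF True, of i] sig[OF True] by (simp add: beta_def)
    next
      case False
      then show ?thesis by (simp add: beta_def M.P.s_def)
    qed
  qed
  have sH: "M.P.s ` {1..3} \<subseteq> PiE I H"
  proof (rule image_subsetI)
    fix i :: nat assume i: "i \<in> {1..3}"
    have "M.P.s i \<in> carrier M.PG" by (rule M.P.s_closed) (use i in simp)
    moreover have "M.P.s i t \<in> H t" if t: "t \<in> I" for t
      unfolding H_def M.P_s[OF t] sig[OF t, symmetric] by (rule generate.incl) (use i in simp)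
    ultimately show "M.P.s i \<in> PiE I H" by (auto simp: PiE_iff)
  qed
  have int: "{1..4 - 1} = {1..3::nat}" "{0<..3} = {1..3::nat}" by auto
  have "generate ?RP (beta I Q \<Phi> ` {1..4 - 1}) = M.P.even_part"
    unfolding RP beta int(1) M.P.generate_consistent[OF sH sub] M.P.E_interval[OF order_refl] int(2) ..
  then have mg: "mix_group 4 I Q \<Phi> = M.P.rotations" unfolding mix_group_def RP by simp
  have bp: "beta_prod 4 I Q \<Phi> i j = M.rr (i - 1) \<otimes>\<^bsub>M.PG\<^esub> M.rr j" if ij: "1 \<le> i" "i \<le> j" "j \<le> 3" for i j
  proof -
    have m: "monoid.mult ?RP = monoid.mult M.PG" "one ?RP = one M.PG" unfolding RP by simp_all
    have "foldr (\<lambda>k x. M.P.s k \<otimes>\<^bsub>M.PG\<^esub> x) [i..<Suc j] \<one>\<^bsub>M.PG\<^esub> = M.rr (i - 1) \<otimes>\<^bsub>M.PG\<^esub> M.rr j"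
      using ij(2,1)
    proof (induction i rule: inc_induct)
      case base
      have "M.P.s j \<otimes>\<^bsub>M.PG\<^esub> \<one>\<^bsub>M.PG\<^esub> = M.P.s j" by (rule M.P.r_one[OF M.P.s_closed[OF ij(3)]])
      then show ?case by (simp add: M.P.s_def del: mult_product_group one_product_group)
    next
      case (step n)
      have n: "n - 1 \<le> 3" "n \<le> 3" using step.hyps ij by auto
      have "[n..<Suc j] = n # [Suc n..<Suc j]" using step.hyps by (simp add: upt_rec)
      then have "foldr (\<lambda>k x. M.P.s k \<otimes>\<^bsub>M.PG\<^esub> x) [n..<Suc j] \<one>\<^bsub>M.PG\<^esub> = M.P.s n \<otimes>\<^bsub>M.PG\<^esub> (M.rr n \<otimes>\<^bsub>M.PG\<^esub> M.rr j)"
        using step.IH by (simp del: mult_product_group one_product_group upt_Suc)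
      also have "\<dots> = M.rr (n - 1) \<otimes>\<^bsub>M.PG\<^esub> (M.rr n \<otimes>\<^bsub>M.PG\<^esub> (M.rr n \<otimes>\<^bsub>M.PG\<^esub> M.rr j))"
        unfolding M.P.s_def by (rule M.P.m_assoc[OF M.P.r_closed[OF n(1)] M.P.r_closed[OF n(2)]
            M.P.m_closed[OF M.P.r_closed[OF n(2)] M.P.r_closed[OF ij(3)]]])
      also have "\<dots> = M.rr (n - 1) \<otimes>\<^bsub>M.PG\<^esub> M.rr j" unfolding M.P.r_cancel[OF n(2) M.P.r_closed[OF ij(3)]] ..
      finally show ?case .
    qed
    then show ?thesis unfolding beta_prod_def beta m .
  qed
  have ms: "mix_subgroup 4 I Q \<Phi> J = M.P.E J" if J: "J \<subseteq> {0..3}" for J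
  proof -
    let ?S = "{M.rr i \<otimes>\<^bsub>M.PG\<^esub> M.rr k | i k. i \<in> J \<and> k \<in> J \<and> i < k}"
    have "{beta_prod 4 I Q \<Phi> i j | i j. 1 \<le> i \<and> i \<le> j \<and> j \<le> 4 - 1 \<and> i - 1 \<in> J \<and> j \<in> J} = ?S" (is "?B = _")
    proof
      show "?B \<subseteq> ?S"
      proof
        fix x assume "x \<in> ?B"
        then obtain i j where ij: "x = beta_prod 4 I Q \<Phi> i j" "1 \<le> i" "i \<le> j" "j \<le> 3" "i - 1 \<in> J" "j \<in> J" by auto
        have "x = M.rr (i - 1) \<otimes>\<^bsub>M.PG\<^esub> M.rr j" "i - 1 < j" using bp[OF ij(2-4)] ij by simp_all
        then show "x \<in> ?S" using ij(5,6) by blast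
      qed
      show "?S \<subseteq> ?B"
      proof
        fix x assume "x \<in> ?S"
        then obtain i j where ij: "x = M.rr i \<otimes>\<^bsub>M.PG\<^esub> M.rr j" "i \<in> J" "j \<in> J" "i < j" by auto
        have j3: "j \<le> 3" using ij(3) J by auto
        have "x = beta_prod 4 I Q \<Phi> (Suc i) j" using bp[of "Suc i" j] ij(1,4) j3 by (simp only: Suc_leI diff_Suc_1)
        moreover have "1 \<le> Suc i" "Suc i \<le> j" "j \<le> 4 - 1" "Suc i - 1 \<in> J" using ij j3 by simp_all
        ultimately show "x \<in> ?B" using ij(3) by blast
      qed
    qed
    then have "mix_subgroup 4 I Q \<Phi> J = generate M.P.rotations ?S" unfolding mix_subgroup_def mg by (simp only:)
    also have "\<dots> = generate M.PG ?S"
    proof (rule M.P.generate_consistent)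
      show "?S \<subseteq> M.P.even_part" using M.P.E_gen[of _ "{0..3}"] J by blast
      show "subgroup M.P.even_part M.PG" by (rule M.P.E_subgroup) simp
    qed
    finally show ?thesis unfolding M.P.E_def .
  qed
  have "mix_subgroup 4 I Q \<Phi> ({0..4 - 1} - {j}) = M.P.E ({0..3} - {j})" for j
    using ms[of "{0..3} - {j}"] by simp
  then have "mix_faces 4 I Q \<Phi> = {Least_Face, Greatest_Face} \<union>
      {Face j C | j C. j < 4 \<and> C \<in> rcosets\<^bsub>M.P.rotations\<^esub> (M.P.E ({0..3} - {j}))}"
    unfolding mix_faces_def mg by (simp only:)
  then show ?thesis unfolding mix_def M.P.geometry_def Let_def by (simp only:)
qed

text \<open>
  The indices are the numbers of facets at a vertex and of vertices: 4 and 5 for the simplex, 8 and 8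
  for the cross polytope, 6 and 24 for the 24-cell, and below 20 and 120 for the 600-cell.
\<close>
lemma coset_checks_crystallographic:
  "coset_check 0 2 (False, False, False) [1, 2, 3] 3 [1, 2] 4"
  "coset_check 0 2 (False, False, False) [0, 1, 2, 3] 0 [1, 2, 3] 5"
  "coset_check 0 2 (False, False, True) [1, 2, 3] 3 [1, 2] 8"
  "coset_check 0 2 (False, False, True) [0, 1, 2, 3] 0 [1, 2, 3] 8"
  "coset_check 0 2 (False, True, False) [1, 2, 3] 3 [1, 2] 6"
  "coset_check 0 2 (False, True, False) [0, 1, 2, 3] 0 [1, 2, 3] 24"
  by code_simp+

lemma coset_checks_golden:
  "coset_check 1 1 (False, False, True) [1, 2, 3] 3 [1, 2] 20"
  "coset_check 1 1 (False, False, True) [0, 1, 2, 3] 0 [1, 2, 3] 120"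
  by code_simp+

definition component_data :: "nat \<Rightarrow> 'b monoid \<Rightarrow> (nat \<Rightarrow> 'b) \<Rightarrow> bool" where
  "component_data t G r \<longleftrightarrow> coset_geometry G r \<and> finite (carrier G) \<and>
     (\<forall>k \<in> {1, 2, 3}. group.ord G (string_group.s G r k) = schlafli_entry t k) \<and>
     card (string_group.E G r {0..3}) = rotation_count t \<and>
     (t \<in> {4, 5, 6} \<longrightarrow> card (string_group.E G r {0..2}) = facet_rotation_count t) \<and>
     (t \<in> {2, 3, 4} \<longrightarrow> card (string_group.E G r {1..3}) = vertex_rotation_count t) \<and>
     string_group.W G r ({0..3} - {0}) \<inter> string_group.W G r ({0..3} - {3}) \<subseteq> string_group.W G r {1, 2}"

lemma less_3_iff: "i < 3 \<longleftrightarrow> i = 0 \<or> i = 1 \<or> i = (2::nat)"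
  by linarith

context regular_flag4
begin

lemma component_data:
  assumes symbol: "schlafli_symbol 4 L \<Phi> = [schlafli_entry t 1, schlafli_entry t 2, schlafli_entry t 3]"
    and t: "t \<in> {1..6}"
  shows "component_data t AL \<rho>"
proof -
  have ords: "A.ord (G.s 1) = schlafli_entry t 1" "A.ord (G.s 2) = schlafli_entry t 2" "A.ord (G.s 3) = schlafli_entry t 3"
    using symbol unfolding schlafli_iff by blast+
  note o = ords[unfolded schlafli_entry_def]
  have link_ord: "A.ord (G.s (link rv i)) =
      schlafli_entry t (if rv then 3 - i else Suc i)" if "i < 3" for rv i
    using that ords unfolding less_3_iff link_def by (auto simp: numeral_2_eq_2 numeral_3_eq_3)
  have data: "card G.even_part = rotation_count t \<and>
      (t \<in> {4, 5, 6} \<longrightarrow> card (G.E {0..2}) = facet_rotation_count t) \<and>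
      (t \<in> {2, 3, 4} \<longrightarrow> card (G.E {1..3}) = vertex_rotation_count t) \<and> G.stab 0 \<inter> G.stab 3 \<subseteq> G.W {1, 2}"
  proof -
    have "1 \<le> t" "t \<le> 6" using t by auto
    then consider "t = 1" | "t = 2" | "t = 3" | "t = 4" | "t = 5" | "t = 6" by linarith
    then show ?thesis
    proof cases
      case 1
      have "A.ord (G.s (link False i)) = (if [False, False, False] ! i then 4 else 3)" if "i < 3" for i
        unfolding link_ord[OF that] using that unfolding less_3_iff 1 by (auto simp: schlafli_entry_def)
      note c = counts_crystallographic[OF this coset_checks_crystallographic(1,2)]
      show ?thesis using c o(2) 1 by (simp add: rotation_count_def)
    next
      case 2
      have "A.ord (G.s (link False i)) = (if [False, False, True] ! i then 4 else 3)" if "i < 3" for i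
        unfolding link_ord[OF that] using that unfolding less_3_iff 2 by (auto simp: schlafli_entry_def)
      note c = counts_crystallographic[OF this coset_checks_crystallographic(3,4)]
      show ?thesis using c o(2) 2 by (simp add: rotation_count_def vertex_rotation_count_def)
    next
      case 3
      have "A.ord (G.s (link False 0)) = 3" "A.ord (G.s (link False 1)) = 3" "A.ord (G.s (link False 2)) = 5"
        using link_ord[of 0 False] link_ord[of 1 False] link_ord[of 2 False] unfolding 3 by (simp_all add: schlafli_entry_def)
      note c = counts_golden[OF this coset_checks_golden]
      show ?thesis using c o(2) 3 by (simp add: rotation_count_def vertex_rotation_count_def)
    next
      case 4
      have "A.ord (G.s (link rv i)) = (if [False, True, False] ! i then 4 else 3)" if "i < 3" for rv i
        unfolding link_ord[OF that] using that unfolding less_3_iff 4 by (auto simp: schlafli_entry_def)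
      note c = counts_crystallographic[OF this coset_checks_crystallographic(5,6)]
      show ?thesis using c(1,3) c(2)[of False] c(2)[of True] o(2) 4
        by (simp add: rotation_count_def vertex_rotation_count_def facet_rotation_count_def)
    next
      case 5
      have "A.ord (G.s (link True i)) = (if [False, False, True] ! i then 4 else 3)" if "i < 3" for i
        unfolding link_ord[OF that] using that unfolding less_3_iff 5 by (auto simp: schlafli_entry_def)
      note c = counts_crystallographic[OF this coset_checks_crystallographic(3,4)]
      show ?thesis using c o(2) 5 by (simp add: rotation_count_def facet_rotation_count_def)
    next
      case 6
      have "A.ord (G.s (link True 0)) = 3" "A.ord (G.s (link True 1)) = 3" "A.ord (G.s (link True 2)) = 5"
        using link_ord[of 0 True] link_ord[of 1 True] link_ord[of 2 True] unfolding 6 by (simp_all add: schlafli_entry_def)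
      note c = counts_golden[OF this coset_checks_golden]
      show ?thesis using c o(2) 6 by (simp add: rotation_count_def facet_rotation_count_def)
    qed
  qed
  show ?thesis unfolding component_data_def using coset_geometry_L finite_AL data ords by blast
qed

end

definition mix_table :: "nat set \<Rightarrow> nat \<times> nat \<times> nat \<times> nat \<times> nat" where
  "mix_table I = (let R = \<Prod>t\<in>I. rotation_count t in
     (R div ((\<Prod>t\<in>I \<inter> {2, 3, 4}. vertex_rotation_count t) * (if I \<inter> {1, 5, 6} = {} then 1 else 12)),
      R div (2 * (LCM t\<in>I. schlafli_entry t 3)),
      R div (2 * (LCM t\<in>I. schlafli_entry t 1)),
      R div ((\<Prod>t\<in>I \<inter> {4, 5, 6}. facet_rotation_count t) * (if I \<inter> {1, 2, 3} = {} then 1 else 12)),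
      2 * R))"

lemma mix_values:
  fixes Q :: "nat \<Rightarrow> 'a ranked_poset" and \<Phi> :: "nat \<Rightarrow> 'a set"
  assumes data: "\<And>t. t \<in> {1..6} \<Longrightarrow> component_data t (aut_group (Q t)) (rho (Q t) (\<Phi> t))"
    and I: "I \<subseteq> {1..6}" "1 \<in> I \<or> I \<inter> {2, 3} \<noteq> {} \<and> I \<inter> {5, 6} \<noteq> {}"
    and v: "v = mix_table I" and p: "p \<longleftrightarrow> 1 \<in> I"
  shows "let P = mix 4 I Q \<Phi> in
    (face_count P 0, face_count P 1, face_count P 2, face_count P 3, card (flags P)) = v \<and> (abstract_polytope 4 P \<longleftrightarrow> p)"
proof -
  have d: "component_data t (aut_group (Q t)) (rho (Q t) (\<Phi> t))" if "t \<in> I" for t using data that I(1) by blast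
  have mf: "mix_family I (\<lambda>t. aut_group (Q t)) (\<lambda>t. rho (Q t) (\<Phi> t))"
    using d finite_subset[OF I(1)] I(2) unfolding component_data_def by (intro mix_family.intro) auto
  have "six_family I (\<lambda>t. aut_group (Q t)) (\<lambda>t. rho (Q t) (\<Phi> t))"
    by (rule six_family.intro[OF mf], rule six_family_axioms.intro)
      (use d I(1) in \<open>simp_all only: component_data_def\<close>)
  then interpret S: six_family I "\<lambda>t. aut_group (Q t)" "\<lambda>t. rho (Q t) (\<Phi> t)" .
  have "abstract_polytope 4 S.P.geometry \<longleftrightarrow> 1 \<in> I"
  proof (cases "1 \<in> I")
    case True
    then show ?thesis using S.mix_counts(6) S.stab_Int by blast
  next
    case False
    then obtain i j where "i \<in> I" "i \<in> {2, 3}" "j \<in> I" "j \<in> {5, 6}" using I(2) by blast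
    then show ?thesis using S.mix_counts(6) S.stab_Int_fails[OF False] False by blast
  qed
  then show ?thesis
    unfolding mix_eq_geometry[OF mf] Let_def v p mix_table_def S.mix_counts(1-5) by simp
qed

theorem mainTheorem9:
  fixes K :: "nat \<Rightarrow> (real^4) set" and \<Phi> :: "nat \<Rightarrow> (real^4) set set"
  assumes "\<And>r. r \<in> {1..6} \<Longrightarrow> regular_convex_polytope (K r)"
    and "\<And>r. r \<in> {1..6} \<Longrightarrow> \<Phi> r \<in> flags (face_lattice (K r))"
    and "schlafli_symbol 4 (face_lattice (K 1)) (\<Phi> 1) = [3, 3, 3]"
    and "schlafli_symbol 4 (face_lattice (K 2)) (\<Phi> 2) = [3, 3, 4]"
    and "schlafli_symbol 4 (face_lattice (K 3)) (\<Phi> 3) = [3, 3, 5]"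
    and "schlafli_symbol 4 (face_lattice (K 4)) (\<Phi> 4) = [3, 4, 3]"
    and "schlafli_symbol 4 (face_lattice (K 5)) (\<Phi> 5) = [4, 3, 3]"
    and "schlafli_symbol 4 (face_lattice (K 6)) (\<Phi> 6) = [5, 3, 3]"
  shows "\<forall>(I, v, polytopal) \<in> set
      [({1, 2, 3, 4}, (115200, 398131200, 7962624000, 165888000, 95551488000), True),
       ({1, 2, 3, 5}, (921600, 132710400, 663552000, 55296000, 31850496000), True),
       ({1, 2, 3, 6}, (34560000, 4976640000, 19906560000, 829440000, 1194393600000), True),
       ({1, 2, 4, 5}, (184320, 53084160, 53084160, 184320, 2548039680), True),
       ({1, 2, 4, 6}, (6912000, 1990656000, 1592524800, 2764800, 95551488000), True),
       ({1, 2, 5, 6}, (55296000, 663552000, 132710400, 921600, 31850496000), True),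
       ({1, 3, 4, 5}, (2764800, 1592524800, 1990656000, 6912000, 95551488000), True),
       ({1, 3, 4, 6}, (103680000, 59719680000, 59719680000, 103680000, 3583180800000), True),
       ({1, 3, 5, 6}, (829440000, 19906560000, 4976640000, 34560000, 1194393600000), True),
       ({1, 4, 5, 6}, (165888000, 7962624000, 398131200, 115200, 95551488000), True),
       ({2, 3, 4, 5}, (368640, 1274019840, 6370099200, 22118400, 305764761600), False),
       ({2, 3, 4, 6}, (13824000, 47775744000, 191102976000, 331776000, 11466178560000), False),
       ({2, 3, 5, 6}, (110592000, 15925248000, 15925248000, 110592000, 3822059520000), False),
       ({2, 4, 5, 6}, (22118400, 6370099200, 1274019840, 368640, 305764761600), False),
       ({3, 4, 5, 6}, (331776000, 191102976000, 47775744000, 13824000, 11466178560000), False),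
       ({1, 2, 3, 4, 5}, (22118400, 76441190400, 382205952000, 1327104000, 18345885696000), True),
       ({1, 2, 3, 4, 6}, (829440000, 2866544640000, 11466178560000, 19906560000, 687970713600000), True),
       ({1, 2, 3, 5, 6}, (6635520000, 955514880000, 955514880000, 6635520000, 229323571200000), True),
       ({1, 2, 4, 5, 6}, (1327104000, 382205952000, 76441190400, 22118400, 18345885696000), True),
       ({1, 3, 4, 5, 6}, (19906560000, 11466178560000, 2866544640000, 829440000, 687970713600000), True),
       ({2, 3, 4, 5, 6}, (2654208000, 9172942848000, 9172942848000, 2654208000, 2201506283520000), False),
       ({1, 2, 3, 4, 5, 6}, (159252480000, 550376570880000, 550376570880000, 159252480000, 132090377011200000), True)].
    let P = mix 4 I (\<lambda>r. face_lattice (K r)) \<Phi> in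
      (face_count P 0, face_count P 1, face_count P 2, face_count P 3, card (flags P)) = v \<and>
      (abstract_polytope 4 P \<longleftrightarrow> polytopal)"
proof -
  have "component_data t (aut_group (face_lattice (K t))) (rho (face_lattice (K t)) (\<Phi> t))" if t: "t \<in> {1..6}" for t
  proof -
    have "regular_flag4 (K t) (\<Phi> t)" by (intro regular_flag4.intro regular_flag.intro assms(1,2) t)
    moreover have "schlafli_symbol 4 (face_lattice (K t)) (\<Phi> t) = [schlafli_entry t 1, schlafli_entry t 2, schlafli_entry t 3]"
    proof -
      have "1 \<le> t" "t \<le> 6" using t by auto
      then consider "t = 1" | "t = 2" | "t = 3" | "t = 4" | "t = 5" | "t = 6" by linarith
      then show ?thesis using assms(3-8) by cases (simp_all add: schlafli_entry_def)
    qed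
    ultimately show ?thesis using regular_flag4.component_data t by blast
  qed
  note row = mix_values[of "\<lambda>t. face_lattice (K t)" \<Phi>, OF this]
  show ?thesis
    unfolding list.set ball_simps prod.case
    by (intro conjI TrueI row;
      simp add: mix_table_def rotation_count_def vertex_rotation_count_def facet_rotation_count_def
        schlafli_entry_def lcm_nat_def gcd_non_0_nat)
qed

end
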